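(* Let $B$ be a pointed Poisson Hopf algebra over $k$. Then $B^e$ is isomorphic as an algebra to a crossed product of $B$ with $\mathcal H(B)$: $$B^e\cong B\#_\sigma\mathcal H(B).$$ That is, there exist a $k$-linear map $\mathcal H(B)\otimes B\to B$, $z\otimes b\mapsto z\cdot b$, measuring $B$, and a convolution-invertible linear map $\sigma:\mathcal H(B)\otimes\mathcal H(B)\to B$, such that $B\#_\sigma\mathcal H(B)$ is an associative algebra with identity $1\#1$ and is isomorphic to $B^e$ as an algebra.
   Context: $k$ is a field. A Poisson algebra is a commutative $k$-algebra with a Lie bracket $\{\cdot,\cdot\}$ such that $\{a,bc\}=\{a,b\}c+b\{a,c\}$; the tensor square $A\otimes A$ of a Poisson algebra is Poisson with $\{a\otimes b,c\otimes d\}=ac\otimes\{b,d\}+\{a,c\}\otimes bd$. A Poisson Hopf algebra is a commutative Hopf algebra $B$ with a Poisson bracket such that $\Delta(\{a,b\})=\{\Delta(a),\Delta(b)\}$; it is pointed if it is pointed as a coalgebra (its coradical is spanned by group-like elements). Universal enveloping algebra: $B^e$ is the associative unital $k$-algebra generated by two copies $\{m_a:a\in B\}$ and $\{h_a:a\in B\}$ of the vector space $B$ (linear in $a$) subject to, for all $x,y\in B$, $$m_{xy}=m_xm_y,\quad h_{\{x,y\}}=h_xh_y-h_yh_x,\quad h_{xy}=m_yh_x+m_xh_y,\quad m_{\{x,y\}}=h_xm_y-m_yh_x,\quad m_1=1.$$ $B^e$ is a Hopf algebra with $\Delta(m_b)=m_{b_1}\otimes m_{b_2}$, $\epsilon(m_b)=\epsilon(b)$,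 $\Delta(h_b)=m_{b_1}\otimes h_{b_2}+h_{b_1}\otimes m_{b_2}$, $\epsilon(h_b)=0$ (Sweedler notation). The map $b\mapsto m_b$ is injective and identifies $B$ with a Hopf subalgebra of $B^e$. With $B^+=\ker\epsilon|_B$, one has $B^eB^+=B^+B^e$, a Hopf ideal of $B^e$, and $\mathcal H(B):=B^e/B^eB^+$ is the quotient Hopf algebra. Crossed product: for a Hopf algebra $H$ measuring an algebra $A$ (i.e. $z\cdot1=\epsilon(z)1$ and $z\cdot(ab)=(z_1\cdot a)(z_2\cdot b)$) and a convolution-invertible $\sigma\in\mathrm{Hom}_k(H\otimes H,A)$, $A\#_\sigma H$ is the vector space $A\otimes H$ with multiplication $(a\#z)(b\#y)=a(z_1\cdot b)\sigma(z_2,y_1)\#z_3y_2$. *)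

theory Defs
  imports "HOL-Algebra.Module" "HOL-Algebra.QuotRing" "HOL-Library.Poly_Mapping"
begin

section \<open>Vector spaces and algebras over a field\<close>

text \<open>
  The base field is a type \<open>'k\<close> of class \<^class>\<open>field\<close>; vector spaces and algebras over it are
  records of type \<open>('k, 'a) module\<close> with explicit carriers. For a mere vector space
  the fields \<^const>\<open>mult\<close> and \<^const>\<open>one\<close> are irrelevant.
\<close>

definition ground :: "('k::field, 'k) module" where
  "ground = \<lparr>carrier = UNIV, mult = (*), one = 1, zero = 0, add = (+), smult = (*)\<rparr>"

definition k_algebra :: "('k::field, 'a) module \<Rightarrow> bool" where
  "k_algebra A \<longleftrightarrow> ring A \<and> module (ground :: ('k, 'k) module) A \<and>
     (\<forall>c. \<forall>x\<in>carrier A. \<forall>y\<in>carrier A.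
        (c \<odot>\<^bsub>A\<^esub> x) \<otimes>\<^bsub>A\<^esub> y = c \<odot>\<^bsub>A\<^esub> (x \<otimes>\<^bsub>A\<^esub> y) \<and>
        x \<otimes>\<^bsub>A\<^esub> (c \<odot>\<^bsub>A\<^esub> y) = c \<odot>\<^bsub>A\<^esub> (x \<otimes>\<^bsub>A\<^esub> y))"

definition linear_map :: "('k::field, 'a) module \<Rightarrow> ('k, 'b) module \<Rightarrow> ('a \<Rightarrow> 'b) \<Rightarrow> bool" where
  "linear_map V W f \<longleftrightarrow> f \<in> carrier V \<rightarrow> carrier W \<and>
     (\<forall>x\<in>carrier V. \<forall>y\<in>carrier V. f (x \<oplus>\<^bsub>V\<^esub> y) = f x \<oplus>\<^bsub>W\<^esub> f y) \<and>
     (\<forall>c. \<forall>x\<in>carrier V. f (c \<odot>\<^bsub>V\<^esub> x) = c \<odot>\<^bsub>W\<^esub> f x)"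

definition bilinear_map ::
  "('k::field, 'a) module \<Rightarrow> ('k, 'b) module \<Rightarrow> ('k, 'c) module \<Rightarrow> ('a \<Rightarrow> 'b \<Rightarrow> 'c) \<Rightarrow> bool" where
  "bilinear_map U V W f \<longleftrightarrow>
     (\<forall>u\<in>carrier U. linear_map V W (f u)) \<and> (\<forall>v\<in>carrier V. linear_map U W (\<lambda>u. f u v))"

definition algebra_hom :: "('k::field, 'a) module \<Rightarrow> ('k, 'b) module \<Rightarrow> ('a \<Rightarrow> 'b) \<Rightarrow> bool" where
  "algebra_hom A B f \<longleftrightarrow> f \<in> ring_hom A B \<and> linear_map A B f"

definition algebra_isomorphic :: "('k::field, 'a) module \<Rightarrow> ('k, 'b) module \<Rightarrow> bool" where
  "algebra_isomorphic A B \<longleftrightarrow> (\<exists>f. f \<in> ring_iso A B \<and> linear_map A B f)"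

definition lin_span :: "('k::field, 'a) module \<Rightarrow> 'a set \<Rightarrow> 'a set" where
  "lin_span V S = \<Inter>{N. submodule N (ground :: ('k, 'k) module) V \<and> S \<subseteq> N}"

text \<open>
  The library's quotient ring \<open>A Quot N\<close> with scalar multiplication added. For a subspace \<open>N\<close> it is
  the quotient vector space, and for an ideal \<open>N\<close> the quotient algebra.
\<close>

definition quotient :: "('k::field, 'a) module \<Rightarrow> 'a set \<Rightarrow> ('k, 'a set) module" where
  "quotient A N =
     \<lparr>carrier = carrier (A Quot N), mult = mult (A Quot N), one = one (A Quot N),
      zero = zero (A Quot N), add = add (A Quot N),
      smult = (\<lambda>c X. \<Union>x\<in>X. N +>\<^bsub>A\<^esub> (c \<odot>\<^bsub>A\<^esub> x))\<rparr>"

text \<open>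
  \<open>k[G]\<close>: formal linear combinations of elements of \<open>G\<close>. For an arbitrary \<open>G\<close> this is the vector
  space with basis \<open>carrier G\<close>.
\<close>

definition monoid_algebra :: "('g, 'm) monoid_scheme \<Rightarrow> ('k::field, 'g \<Rightarrow>\<^sub>0 'k) module" where
  "monoid_algebra G =
     \<lparr>carrier = {x. Poly_Mapping.keys x \<subseteq> carrier G},
      mult = (\<lambda>x y. \<Sum>u\<in>Poly_Mapping.keys x. \<Sum>v\<in>Poly_Mapping.keys y.
                Poly_Mapping.single (u \<otimes>\<^bsub>G\<^esub> v) (Poly_Mapping.lookup x u * Poly_Mapping.lookup y v)),
      one = Poly_Mapping.single \<one>\<^bsub>G\<^esub> 1,
      zero = 0,
      add = (+),
      smult = (\<lambda>c. Poly_Mapping.map ((*) c))\<rparr>"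

definition linear_extension :: "('k::field, 'w) module \<Rightarrow> ('g \<Rightarrow> 'w) \<Rightarrow> ('g \<Rightarrow>\<^sub>0 'k) \<Rightarrow> 'w" where
  "linear_extension W f x = (\<Oplus>\<^bsub>W\<^esub>u\<in>Poly_Mapping.keys x. Poly_Mapping.lookup x u \<odot>\<^bsub>W\<^esub> f u)"


section \<open>Tensor products\<close>

text \<open>
  \<open>A \<otimes> B\<close> is the free vector space on \<open>carrier A \<times> carrier B\<close> modulo the bilinearity relations.
  Since the free vector space carries the multiplication of the monoid algebra of \<open>A \<times>\<times> B\<close>, the
  quotient carries \<open>(a \<otimes> b)(a' \<otimes> b') = aa' \<otimes> bb'\<close> whenever \<open>A\<close> and \<open>B\<close> are algebras.
\<close>

definition formal_tensors ::
  "('k::field, 'a) module \<Rightarrow> ('k, 'b) module \<Rightarrow> ('k, 'a \<times> 'b \<Rightarrow>\<^sub>0 'k) module" where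
  "formal_tensors A B = monoid_algebra (A \<times>\<times> B)"

definition bilinearity_relations ::
  "('k::field, 'a) module \<Rightarrow> ('k, 'b) module \<Rightarrow> ('a \<times> 'b \<Rightarrow>\<^sub>0 'k) set" where
  "bilinearity_relations A B = lin_span (formal_tensors A B)
     ({Poly_Mapping.single (a \<oplus>\<^bsub>A\<^esub> a', b) 1
         - Poly_Mapping.single (a, b) 1 - Poly_Mapping.single (a', b) 1 | a a' b.
         a \<in> carrier A \<and> a' \<in> carrier A \<and> b \<in> carrier B} \<union>
      {Poly_Mapping.single (a, b \<oplus>\<^bsub>B\<^esub> b') 1
         - Poly_Mapping.single (a, b) 1 - Poly_Mapping.single (a, b') 1 | a b b'.
         a \<in> carrier A \<and> b \<in> carrier B \<and> b' \<in> carrier B} \<union>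
      {Poly_Mapping.single (c \<odot>\<^bsub>A\<^esub> a, b) 1 - Poly_Mapping.single (a, b) c | c a b.
         a \<in> carrier A \<and> b \<in> carrier B} \<union>
      {Poly_Mapping.single (a, c \<odot>\<^bsub>B\<^esub> b) 1 - Poly_Mapping.single (a, b) c | c a b.
         a \<in> carrier A \<and> b \<in> carrier B})"

type_synonym ('k, 'a, 'b) tensors = "('a \<times> 'b \<Rightarrow>\<^sub>0 'k) set"

definition tensor ::
  "('k::field, 'a) module \<Rightarrow> ('k, 'b) module \<Rightarrow> ('k, ('k, 'a, 'b) tensors) module" where
  "tensor A B = quotient (formal_tensors A B) (bilinearity_relations A B)"

definition tens ::
  "('k::field, 'a) module \<Rightarrow> ('k, 'b) module \<Rightarrow> 'a \<Rightarrow> 'b \<Rightarrow> ('k, 'a, 'b) tensors" where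
  "tens A B a b =
     bilinearity_relations A B +>\<^bsub>formal_tensors A B\<^esub> Poly_Mapping.single (a, b) 1"

text \<open>
  For bilinear \<open>f\<close> with values in \<open>W\<close>, \<open>tensor_lift W f\<close> is the linear map with \<open>a \<otimes> b \<mapsto> f a b\<close>.
  Thus \<open>tensor_lift W f (\<Delta> c)\<close> is the Sweedler sum of \<open>f c\<^sub>1 c\<^sub>2\<close>.
\<close>

definition tensor_lift ::
  "('k::field, 'w) module \<Rightarrow> ('a \<Rightarrow> 'b \<Rightarrow> 'w) \<Rightarrow> ('k, 'a, 'b) tensors \<Rightarrow> 'w" where
  "tensor_lift W f t = the_elem (linear_extension W (\<lambda>(a, b). f a b) ` t)"


section \<open>Coalgebras and Hopf algebras\<close>

text \<open>Coassociativity is expressed in \<open>C \<otimes> (C \<otimes> C)\<close>.\<close>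

definition coalgebra ::
  "('k::field, 'c) module \<Rightarrow> ('c \<Rightarrow> ('k, 'c, 'c) tensors) \<Rightarrow> ('c \<Rightarrow> 'k) \<Rightarrow> bool" where
  "coalgebra C \<Delta> \<epsilon> \<longleftrightarrow>
     module (ground :: ('k, 'k) module) C \<and>
     linear_map C (tensor C C) \<Delta> \<and> linear_map C ground \<epsilon> \<and>
     (\<forall>c\<in>carrier C.
        tensor_lift (tensor C (tensor C C))
          (\<lambda>c\<^sub>1 c\<^sub>2. tensor_lift (tensor C (tensor C C))
             (\<lambda>c\<^sub>1\<^sub>1 c\<^sub>1\<^sub>2. tens C (tensor C C) c\<^sub>1\<^sub>1 (tens C C c\<^sub>1\<^sub>2 c\<^sub>2)) (\<Delta> c\<^sub>1)) (\<Delta> c)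
        = tensor_lift (tensor C (tensor C C))
          (\<lambda>c\<^sub>1 c\<^sub>2. tens C (tensor C C) c\<^sub>1 (\<Delta> c\<^sub>2)) (\<Delta> c)) \<and>
     (\<forall>c\<in>carrier C. tensor_lift C (\<lambda>c\<^sub>1 c\<^sub>2. \<epsilon> c\<^sub>1 \<odot>\<^bsub>C\<^esub> c\<^sub>2) (\<Delta> c) = c) \<and>
     (\<forall>c\<in>carrier C. tensor_lift C (\<lambda>c\<^sub>1 c\<^sub>2. \<epsilon> c\<^sub>2 \<odot>\<^bsub>C\<^esub> c\<^sub>1) (\<Delta> c) = c)"

definition tensor_comult ::
  "('k::field, 'c) module \<Rightarrow> ('c \<Rightarrow> ('k, 'c, 'c) tensors) \<Rightarrow>
   ('k, 'd) module \<Rightarrow> ('d \<Rightarrow> ('k, 'd, 'd) tensors) \<Rightarrow>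
   ('k, 'c, 'd) tensors \<Rightarrow> ('k, ('k, 'c, 'd) tensors, ('k, 'c, 'd) tensors) tensors" where
  "tensor_comult C \<Delta>\<^sub>C D \<Delta>\<^sub>D =
     (let CD = tensor C D; T = tensor CD CD in
      tensor_lift T (\<lambda>c d.
        tensor_lift T (\<lambda>c\<^sub>1 c\<^sub>2.
          tensor_lift T (\<lambda>d\<^sub>1 d\<^sub>2. tens CD CD (tens C D c\<^sub>1 d\<^sub>1) (tens C D c\<^sub>2 d\<^sub>2)) (\<Delta>\<^sub>D d)) (\<Delta>\<^sub>C c)))"

definition tensor_counit ::
  "('c \<Rightarrow> 'k::field) \<Rightarrow> ('d \<Rightarrow> 'k) \<Rightarrow> ('k, 'c, 'd) tensors \<Rightarrow> 'k" where
  "tensor_counit \<epsilon>\<^sub>C \<epsilon>\<^sub>D = tensor_lift ground (\<lambda>c d. \<epsilon>\<^sub>C c * \<epsilon>\<^sub>D d)"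

text \<open>The convolution product on \<open>Hom(C, A)\<close>, where \<open>\<Delta>\<close> is the comultiplication of \<open>C\<close>.\<close>

definition convolution ::
  "('c \<Rightarrow> ('k::field, 'c, 'c) tensors) \<Rightarrow> ('k, 'a) module \<Rightarrow>
   ('c \<Rightarrow> 'a) \<Rightarrow> ('c \<Rightarrow> 'a) \<Rightarrow> 'c \<Rightarrow> 'a" where
  "convolution \<Delta> A f g c = tensor_lift A (\<lambda>c\<^sub>1 c\<^sub>2. f c\<^sub>1 \<otimes>\<^bsub>A\<^esub> g c\<^sub>2) (\<Delta> c)"

definition convolution_invertible ::
  "('k::field, 'c) module \<Rightarrow> ('c \<Rightarrow> ('k, 'c, 'c) tensors) \<Rightarrow> ('c \<Rightarrow> 'k) \<Rightarrow>
   ('k, 'a) module \<Rightarrow> ('c \<Rightarrow> 'a) \<Rightarrow> bool" where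
  "convolution_invertible C \<Delta> \<epsilon> A f \<longleftrightarrow>
     linear_map C A f \<and>
     (\<exists>g. linear_map C A g \<and>
       (\<forall>c\<in>carrier C. convolution \<Delta> A f g c = \<epsilon> c \<odot>\<^bsub>A\<^esub> \<one>\<^bsub>A\<^esub> \<and>
                      convolution \<Delta> A g f c = \<epsilon> c \<odot>\<^bsub>A\<^esub> \<one>\<^bsub>A\<^esub>))"

definition bialgebra ::
  "('k::field, 'h) module \<Rightarrow> ('h \<Rightarrow> ('k, 'h, 'h) tensors) \<Rightarrow> ('h \<Rightarrow> 'k) \<Rightarrow> bool" where
  "bialgebra H \<Delta> \<epsilon> \<longleftrightarrow> k_algebra H \<and> coalgebra H \<Delta> \<epsilon> \<and>
     algebra_hom H (tensor H H) \<Delta> \<and> algebra_hom H ground \<epsilon>"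

text \<open>An antipode is a convolution inverse of the identity map.\<close>

definition hopf_algebra ::
  "('k::field, 'h) module \<Rightarrow> ('h \<Rightarrow> ('k, 'h, 'h) tensors) \<Rightarrow> ('h \<Rightarrow> 'k) \<Rightarrow> bool" where
  "hopf_algebra H \<Delta> \<epsilon> \<longleftrightarrow> bialgebra H \<Delta> \<epsilon> \<and> convolution_invertible H \<Delta> \<epsilon> H (\<lambda>x. x)"

definition subcoalgebra ::
  "('k::field, 'c) module \<Rightarrow> ('c \<Rightarrow> ('k, 'c, 'c) tensors) \<Rightarrow> 'c set \<Rightarrow> bool" where
  "subcoalgebra C \<Delta> D \<longleftrightarrow> submodule D (ground :: ('k, 'k) module) C \<and>
     \<Delta> ` D \<subseteq> lin_span (tensor C C) {tens C C d d' | d d'. d \<in> D \<and> d' \<in> D}"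

definition simple_subcoalgebra ::
  "('k::field, 'c) module \<Rightarrow> ('c \<Rightarrow> ('k, 'c, 'c) tensors) \<Rightarrow> 'c set \<Rightarrow> bool" where
  "simple_subcoalgebra C \<Delta> D \<longleftrightarrow> subcoalgebra C \<Delta> D \<and> D \<noteq> {\<zero>\<^bsub>C\<^esub>} \<and>
     (\<forall>D'. subcoalgebra C \<Delta> D' \<and> D' \<subseteq> D \<longrightarrow> D' = {\<zero>\<^bsub>C\<^esub>} \<or> D' = D)"

definition coradical ::
  "('k::field, 'c) module \<Rightarrow> ('c \<Rightarrow> ('k, 'c, 'c) tensors) \<Rightarrow> 'c set" where
  "coradical C \<Delta> = lin_span C (\<Union>{D. simple_subcoalgebra C \<Delta> D})"

definition group_likes ::
  "('k::field, 'c) module \<Rightarrow> ('c \<Rightarrow> ('k, 'c, 'c) tensors) \<Rightarrow> ('c \<Rightarrow> 'k) \<Rightarrow> 'c set" where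
  "group_likes C \<Delta> \<epsilon> = {g \<in> carrier C. \<Delta> g = tens C C g g \<and> \<epsilon> g = 1}"

definition pointed ::
  "('k::field, 'c) module \<Rightarrow> ('c \<Rightarrow> ('k, 'c, 'c) tensors) \<Rightarrow> ('c \<Rightarrow> 'k) \<Rightarrow> bool" where
  "pointed C \<Delta> \<epsilon> \<longleftrightarrow> coradical C \<Delta> = lin_span C (group_likes C \<Delta> \<epsilon>)"


section \<open>Poisson Hopf algebras\<close>

text \<open>The library locale \<^locale>\<open>algebra\<close> is that of commutative algebras.\<close>

definition poisson_algebra :: "('k::field, 'a) module \<Rightarrow> ('a \<Rightarrow> 'a \<Rightarrow> 'a) \<Rightarrow> bool" where
  "poisson_algebra A br \<longleftrightarrow>
     algebra (ground :: ('k, 'k) module) A \<and>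
     bilinear_map A A A br \<and>
     (\<forall>a\<in>carrier A. br a a = \<zero>\<^bsub>A\<^esub>) \<and>
     (\<forall>a\<in>carrier A. \<forall>b\<in>carrier A. \<forall>c\<in>carrier A.
        br a (br b c) \<oplus>\<^bsub>A\<^esub> br b (br c a) \<oplus>\<^bsub>A\<^esub> br c (br a b) = \<zero>\<^bsub>A\<^esub>) \<and>
     (\<forall>a\<in>carrier A. \<forall>b\<in>carrier A. \<forall>c\<in>carrier A.
        br a (b \<otimes>\<^bsub>A\<^esub> c) = br a b \<otimes>\<^bsub>A\<^esub> c \<oplus>\<^bsub>A\<^esub> b \<otimes>\<^bsub>A\<^esub> br a c)"

text \<open>The bracket of \<open>A \<otimes> A\<close>: \<open>{a \<otimes> b, c \<otimes> d} = ac \<otimes> {b, d} + {a, c} \<otimes> bd\<close>.\<close>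

definition tensor_bracket ::
  "('k::field, 'a) module \<Rightarrow> ('a \<Rightarrow> 'a \<Rightarrow> 'a) \<Rightarrow>
   ('k, 'a, 'a) tensors \<Rightarrow> ('k, 'a, 'a) tensors \<Rightarrow> ('k, 'a, 'a) tensors" where
  "tensor_bracket A br s t =
     tensor_lift (tensor A A) (\<lambda>a b.
       tensor_lift (tensor A A) (\<lambda>c d.
         tens A A (a \<otimes>\<^bsub>A\<^esub> c) (br b d) \<oplus>\<^bsub>tensor A A\<^esub> tens A A (br a c) (b \<otimes>\<^bsub>A\<^esub> d)) t) s"

definition poisson_hopf_algebra ::
  "('k::field, 'b) module \<Rightarrow> ('b \<Rightarrow> 'b \<Rightarrow> 'b) \<Rightarrow>
   ('b \<Rightarrow> ('k, 'b, 'b) tensors) \<Rightarrow> ('b \<Rightarrow> 'k) \<Rightarrow> bool" where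
  "poisson_hopf_algebra B br \<Delta> \<epsilon> \<longleftrightarrow> poisson_algebra B br \<and> hopf_algebra B \<Delta> \<epsilon> \<and>
     (\<forall>a\<in>carrier B. \<forall>b\<in>carrier B. \<Delta> (br a b) = tensor_bracket B br (\<Delta> a) (\<Delta> b))"


section \<open>The universal enveloping algebra of a Poisson algebra\<close>

datatype 'b gen = gen_m 'b | gen_h 'b

definition free_monoid :: "'g set \<Rightarrow> 'g list monoid" where
  "free_monoid X = \<lparr>carrier = lists X, mult = (@), one = []\<rparr>"

type_synonym ('k, 'b) noncomm_poly = "'b gen list \<Rightarrow>\<^sub>0 'k"

definition env_free :: "('k::field, 'b) module \<Rightarrow> ('k, ('k, 'b) noncomm_poly) module" where
  "env_free B = monoid_algebra (free_monoid (gen_m ` carrier B \<union> gen_h ` carrier B))"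

definition env_relations ::
  "('k::field, 'b) module \<Rightarrow> ('b \<Rightarrow> 'b \<Rightarrow> 'b) \<Rightarrow> ('k, 'b) noncomm_poly set" where
  "env_relations B br =
     (let C = carrier B;
          M = (\<lambda>x. Poly_Mapping.single [gen_m x] 1 :: ('k, 'b) noncomm_poly);
          H = (\<lambda>x. Poly_Mapping.single [gen_h x] 1 :: ('k, 'b) noncomm_poly);
          mul = mult (env_free B); sc = smult (env_free B) in
      {M (x \<oplus>\<^bsub>B\<^esub> y) - (M x + M y) | x y. x \<in> C \<and> y \<in> C} \<union>
      {M (c \<odot>\<^bsub>B\<^esub> x) - sc c (M x) | c x. x \<in> C} \<union>
      {H (x \<oplus>\<^bsub>B\<^esub> y) - (H x + H y) | x y. x \<in> C \<and> y \<in> C} \<union>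
      {H (c \<odot>\<^bsub>B\<^esub> x) - sc c (H x) | c x. x \<in> C} \<union>
      {M (x \<otimes>\<^bsub>B\<^esub> y) - mul (M x) (M y) | x y. x \<in> C \<and> y \<in> C} \<union>
      {H (br x y) - (mul (H x) (H y) - mul (H y) (H x)) | x y. x \<in> C \<and> y \<in> C} \<union>
      {H (x \<otimes>\<^bsub>B\<^esub> y) - (mul (M y) (H x) + mul (M x) (H y)) | x y. x \<in> C \<and> y \<in> C} \<union>
      {M (br x y) - (mul (H x) (M y) - mul (M y) (H x)) | x y. x \<in> C \<and> y \<in> C} \<union>
      {M \<one>\<^bsub>B\<^esub> - one (env_free B)})"

type_synonym ('k, 'b) env = "('k, 'b) noncomm_poly set"

definition env ::
  "('k::field, 'b) module \<Rightarrow> ('b \<Rightarrow> 'b \<Rightarrow> 'b) \<Rightarrow> ('k, ('k, 'b) env) module" where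
  "env B br = quotient (env_free B) (Idl\<^bsub>env_free B\<^esub> (env_relations B br))"

definition env_m ::
  "('k::field, 'b) module \<Rightarrow> ('b \<Rightarrow> 'b \<Rightarrow> 'b) \<Rightarrow> 'b \<Rightarrow> ('k, 'b) env" where
  "env_m B br x =
     Idl\<^bsub>env_free B\<^esub> (env_relations B br) +>\<^bsub>env_free B\<^esub> Poly_Mapping.single [gen_m x] 1"

definition env_h ::
  "('k::field, 'b) module \<Rightarrow> ('b \<Rightarrow> 'b \<Rightarrow> 'b) \<Rightarrow> 'b \<Rightarrow> ('k, 'b) env" where
  "env_h B br x =
     Idl\<^bsub>env_free B\<^esub> (env_relations B br) +>\<^bsub>env_free B\<^esub> Poly_Mapping.single [gen_h x] 1"

text \<open>
  For maps \<open>\<mu>, \<eta>\<close> from \<open>B\<close> to an algebra \<open>A\<close> that satisfy the defining relations,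
  \<open>env_lift A \<mu> \<eta>\<close> is the algebra homomorphism with \<open>m\<^sub>b \<mapsto> \<mu> b\<close> and \<open>h\<^sub>b \<mapsto> \<eta> b\<close>.
\<close>

definition env_lift ::
  "('k::field, 'a) module \<Rightarrow> ('b \<Rightarrow> 'a) \<Rightarrow> ('b \<Rightarrow> 'a) \<Rightarrow> ('k, 'b) env \<Rightarrow> 'a" where
  "env_lift A \<mu> \<eta> X =
     the_elem (linear_extension A
       (\<lambda>w. foldr (\<lambda>g a. case_gen \<mu> \<eta> g \<otimes>\<^bsub>A\<^esub> a) w \<one>\<^bsub>A\<^esub>) ` X)"

definition env_comult ::
  "('k::field, 'b) module \<Rightarrow> ('b \<Rightarrow> 'b \<Rightarrow> 'b) \<Rightarrow> ('b \<Rightarrow> ('k, 'b, 'b) tensors) \<Rightarrow>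
   ('k, 'b) env \<Rightarrow> ('k, ('k, 'b) env, ('k, 'b) env) tensors" where
  "env_comult B br \<Delta> =
     (let E = env B br; T = tensor E E; m = env_m B br; h = env_h B br in
      env_lift T
        (\<lambda>b. tensor_lift T (\<lambda>b\<^sub>1 b\<^sub>2. tens E E (m b\<^sub>1) (m b\<^sub>2)) (\<Delta> b))
        (\<lambda>b. tensor_lift T
           (\<lambda>b\<^sub>1 b\<^sub>2. tens E E (m b\<^sub>1) (h b\<^sub>2) \<oplus>\<^bsub>T\<^esub> tens E E (h b\<^sub>1) (m b\<^sub>2)) (\<Delta> b)))"

definition env_counit :: "('b \<Rightarrow> 'k::field) \<Rightarrow> ('k, 'b) env \<Rightarrow> 'k" where
  "env_counit \<epsilon> = env_lift ground \<epsilon> (\<lambda>_. 0)"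


section \<open>The quotient Hopf algebra of the enveloping algebra\<close>

definition env_aug_ideal ::
  "('k::field, 'b) module \<Rightarrow> ('b \<Rightarrow> 'b \<Rightarrow> 'b) \<Rightarrow> ('b \<Rightarrow> 'k) \<Rightarrow> ('k, 'b) env set" where
  "env_aug_ideal B br \<epsilon> =
     lin_span (env B br)
       {e \<otimes>\<^bsub>env B br\<^esub> env_m B br b | e b. e \<in> carrier (env B br) \<and> b \<in> carrier B \<and> \<epsilon> b = 0}"

type_synonym ('k, 'b) env_quot = "('k, 'b) env set"

definition env_quot ::
  "('k::field, 'b) module \<Rightarrow> ('b \<Rightarrow> 'b \<Rightarrow> 'b) \<Rightarrow> ('b \<Rightarrow> 'k) \<Rightarrow>
   ('k, ('k, 'b) env_quot) module" where
  "env_quot B br \<epsilon> = quotient (env B br) (env_aug_ideal B br \<epsilon>)"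

definition env_proj ::
  "('k::field, 'b) module \<Rightarrow> ('b \<Rightarrow> 'b \<Rightarrow> 'b) \<Rightarrow> ('b \<Rightarrow> 'k) \<Rightarrow>
   ('k, 'b) env \<Rightarrow> ('k, 'b) env_quot" where
  "env_proj B br \<epsilon> e = env_aug_ideal B br \<epsilon> +>\<^bsub>env B br\<^esub> e"

text \<open>The structure maps of the quotient are those induced by \<^const>\<open>env_comult\<close> and \<^const>\<open>env_counit\<close>.\<close>

definition env_quot_comult ::
  "('k::field, 'b) module \<Rightarrow> ('b \<Rightarrow> 'b \<Rightarrow> 'b) \<Rightarrow> ('b \<Rightarrow> ('k, 'b, 'b) tensors) \<Rightarrow> ('b \<Rightarrow> 'k) \<Rightarrow>
   ('k, 'b) env_quot \<Rightarrow> ('k, ('k, 'b) env_quot, ('k, 'b) env_quot) tensors" where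
  "env_quot_comult B br \<Delta> \<epsilon> X =
     (let Q = env_quot B br \<epsilon>; \<pi> = env_proj B br \<epsilon> in
      the_elem ((\<lambda>e. tensor_lift (tensor Q Q) (\<lambda>e\<^sub>1 e\<^sub>2. tens Q Q (\<pi> e\<^sub>1) (\<pi> e\<^sub>2))
                       (env_comult B br \<Delta> e)) ` X))"

definition env_quot_counit :: "('b \<Rightarrow> 'k::field) \<Rightarrow> ('k, 'b) env_quot \<Rightarrow> 'k" where
  "env_quot_counit \<epsilon> X = the_elem (env_counit \<epsilon> ` X)"


section \<open>Crossed products\<close>

definition measuring ::
  "('k::field, 'h) module \<Rightarrow> ('h \<Rightarrow> ('k, 'h, 'h) tensors) \<Rightarrow> ('h \<Rightarrow> 'k) \<Rightarrow> ('k, 'a) module \<Rightarrow>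
   (('k, 'h, 'a) tensors \<Rightarrow> 'a) \<Rightarrow> bool" where
  "measuring H \<Delta> \<epsilon> A act \<longleftrightarrow>
     linear_map (tensor H A) A act \<and>
     (\<forall>z\<in>carrier H. act (tens H A z \<one>\<^bsub>A\<^esub>) = \<epsilon> z \<odot>\<^bsub>A\<^esub> \<one>\<^bsub>A\<^esub>) \<and>
     (\<forall>z\<in>carrier H. \<forall>a\<in>carrier A. \<forall>b\<in>carrier A.
        act (tens H A z (a \<otimes>\<^bsub>A\<^esub> b)) =
        tensor_lift A (\<lambda>z\<^sub>1 z\<^sub>2. act (tens H A z\<^sub>1 a) \<otimes>\<^bsub>A\<^esub> act (tens H A z\<^sub>2 b)) (\<Delta> z))"

text \<open>
  \<open>(a # z)(b # y) = a (z\<^sub>1 \<cdot> b) \<sigma>(z\<^sub>2, y\<^sub>1) # z\<^sub>3 y\<^sub>2\<close>. The threefold Sweedler sum over \<open>z\<close> splits \<open>z\<close>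
  into \<open>z\<^sub>1\<close> and \<open>z'\<close>, and then \<open>z'\<close> into \<open>z\<^sub>2\<close> and \<open>z\<^sub>3\<close>.
\<close>

definition crossed_product ::
  "('k::field, 'a) module \<Rightarrow> ('k, 'h) module \<Rightarrow> ('h \<Rightarrow> ('k, 'h, 'h) tensors) \<Rightarrow>
   (('k, 'h, 'a) tensors \<Rightarrow> 'a) \<Rightarrow> (('k, 'h, 'h) tensors \<Rightarrow> 'a) \<Rightarrow>
   ('k, ('k, 'a, 'h) tensors) module" where
  "crossed_product A H \<Delta> act \<sigma> =
     (let T = tensor A H in
      T\<lparr>mult := (\<lambda>s t.
           tensor_lift T (\<lambda>a z. tensor_lift T (\<lambda>b y.
             tensor_lift T (\<lambda>z\<^sub>1 z'. tensor_lift T (\<lambda>z\<^sub>2 z\<^sub>3. tensor_lift T (\<lambda>y\<^sub>1 y\<^sub>2.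
               tens A H
                 (a \<otimes>\<^bsub>A\<^esub> act (tens H A z\<^sub>1 b) \<otimes>\<^bsub>A\<^esub> \<sigma> (tens H H z\<^sub>2 y\<^sub>1))
                 (z\<^sub>3 \<otimes>\<^bsub>H\<^esub> y\<^sub>2))
               (\<Delta> y)) (\<Delta> z')) (\<Delta> z)) t) s),
         one := tens A H \<one>\<^bsub>A\<^esub> \<one>\<^bsub>H\<^esub>\<rparr>)"

end

theory Submission
  imports Defs
begin

text \<open>
  The elements \<open>\<omega> b = S(b\<^sub>1) h(b\<^sub>2)\<close> of \<open>B\<^sup>e\<close> (the left invariant one-forms of a Poisson group)
  satisfy \<open>\<omega>(xy) = \<epsilon>(x) \<omega>(y) + \<epsilon>(y) \<omega>(x)\<close> and \<open>[\<omega> x, \<omega> y] = \<omega>{x, y}\<close>: multiplication by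
  \<open>x\<^sub>1 y\<^sub>1\<close> turns both into defining relations, because \<open>x\<^sub>1 \<omega>(x\<^sub>2) = h(x)\<close>, and it can be cancelled by
  convolution with the antipode. Hence \<open>m b \<mapsto> \<epsilon>(b)\<close>, \<open>h b \<mapsto> \<omega> b\<close> defines an algebra map \<open>\<gamma>\<close> from
  \<open>\<H>(B)\<close> to \<open>B\<^sup>e\<close>, a section of the projection \<open>\<pi>\<close>. Let \<open>B\<^sup>e\<close> act on \<open>B\<close> by \<open>m a \<cdot> b = ab\<close>,
  \<open>h a \<cdot> b = {a, b}\<close>, and let \<open>\<H>(B)\<close> act through \<open>\<gamma>\<close>. Since the images of the \<open>h b\<close> are primitive in
  \<open>\<H>(B)\<close>, induction on \<open>z\<close> gives \<open>\<gamma>(z) m(b) = m(z\<^sub>1 \<cdot> b) \<gamma>(z\<^sub>2)\<close>, so \<open>b # z \<mapsto> m(b) \<gamma>(z)\<close> is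
  multiplicative on the crossed product with the trivial cocycle \<open>\<sigma> = \<epsilon> \<otimes> \<epsilon>\<close>. Its inverse is
  \<open>e \<mapsto> (e\<^sub>1 \<cdot> 1) \<otimes> \<pi>(e\<^sub>2)\<close>.
\<close>

text \<open>For a group-like x, \<open>\<omega> x\<close> is x^(-1) h(x), a logarithmic
  differential. Being left invariant is what makes these elements close under commutators and obey a
  Leibniz rule with coefficients in k; so they span a copy of the generators of the quotient inside
  \<open>B^e\<close>, and the section of \<open>\<pi>\<close> comes out multiplicative instead of
  merely convolution invertible. A multiplicative section has no defect to record, which is why the
  cocycle is trivial. The shape of the proof is set by Sweedler sums. Such a sum is
  \<open>tensor_lift W f (\<Delta> x)\<close>, and it has its meaning only for bilinear
  \<open>f\<close>. Each manipulation therefore carries a bilinearity proof, and a few moves are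
  repeated throughout: replace the summand (\<open>tensor_lift_cong\<close>), apply a linear map
  under the sum (\<open>tensor_lift_linear\<close>), and collapse or regroup by the counit and
  coassociativity laws for arbitrary multilinear summands. Rule lists such as \<open>lin\<close> and
  \<open>BHlin\<close> discharge the linearity goals. Associativity of the crossed product is pulled
  back from \<open>B^e\<close> along the injective map \<open>\<Psi>\<close>, so identities between
  fivefold sums do not arise.\<close>

abbreviation vec_space :: "('k::field, 'a) module \<Rightarrow> bool" where
  "vec_space V \<equiv> module (ground :: ('k, 'k) module) V"

lemma ground_simps [simp]:
  "carrier ground = UNIV" "a \<otimes>\<^bsub>ground\<^esub> b = a * b" "\<one>\<^bsub>ground\<^esub> = 1"
  "\<zero>\<^bsub>ground\<^esub> = 0" "a \<oplus>\<^bsub>ground\<^esub> b = a + b" "a \<odot>\<^bsub>ground\<^esub> b = a * b"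
  by (simp_all add: ground_def)

lemma cring_ground: "cring (ground :: ('k::field, 'k) module)"
proof (rule cringI)
  show "abelian_group (ground :: ('k::field, 'k) module)"
    by (rule abelian_groupI) (auto simp: ac_simps intro: exI[of _ "- x" for x] left_minus)
  show "comm_monoid (ground :: ('k::field, 'k) module)"
    by (rule comm_monoidI) (auto simp: ac_simps)
qed (auto simp: ring_distribs)

lemma vec_spaceI:
  assumes "abelian_group V"
    and "\<And>c x. x \<in> carrier V \<Longrightarrow> c \<odot>\<^bsub>V\<^esub> x \<in> carrier V"
    and "\<And>c d x. x \<in> carrier V \<Longrightarrow> (c + d) \<odot>\<^bsub>V\<^esub> x = c \<odot>\<^bsub>V\<^esub> x \<oplus>\<^bsub>V\<^esub> d \<odot>\<^bsub>V\<^esub> x"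
    and "\<And>c x y. x \<in> carrier V \<Longrightarrow> y \<in> carrier V \<Longrightarrow>
      c \<odot>\<^bsub>V\<^esub> (x \<oplus>\<^bsub>V\<^esub> y) = c \<odot>\<^bsub>V\<^esub> x \<oplus>\<^bsub>V\<^esub> c \<odot>\<^bsub>V\<^esub> y"
    and "\<And>c d x. x \<in> carrier V \<Longrightarrow> (c * d) \<odot>\<^bsub>V\<^esub> x = c \<odot>\<^bsub>V\<^esub> (d \<odot>\<^bsub>V\<^esub> x)"
    and "\<And>x. x \<in> carrier V \<Longrightarrow> 1 \<odot>\<^bsub>V\<^esub> x = x"
  shows "vec_space V"
  using assms by (intro moduleI cring_ground) auto

lemma vec_space_ground [simp]: "vec_space (ground :: ('k::field, 'k) module)"
  using cring_ground
  by (intro vec_spaceI) (auto simp: ring_distribs dest: cring.axioms ring.is_abelian_group)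

lemma k_algebraI:
  assumes "ring A" "vec_space A"
    and "\<And>c x y. x \<in> carrier A \<Longrightarrow> y \<in> carrier A \<Longrightarrow> (c \<odot>\<^bsub>A\<^esub> x) \<otimes>\<^bsub>A\<^esub> y = c \<odot>\<^bsub>A\<^esub> (x \<otimes>\<^bsub>A\<^esub> y)"
    and "\<And>c x y. x \<in> carrier A \<Longrightarrow> y \<in> carrier A \<Longrightarrow> x \<otimes>\<^bsub>A\<^esub> (c \<odot>\<^bsub>A\<^esub> y) = c \<odot>\<^bsub>A\<^esub> (x \<otimes>\<^bsub>A\<^esub> y)"
  shows "k_algebra A"
  using assms by (simp add: k_algebra_def)

lemma k_algebraD:
  assumes "k_algebra A"
  shows "ring A" "vec_space A"
    and "\<And>c x y. x \<in> carrier A \<Longrightarrow> y \<in> carrier A \<Longrightarrow> (c \<odot>\<^bsub>A\<^esub> x) \<otimes>\<^bsub>A\<^esub> y = c \<odot>\<^bsub>A\<^esub> (x \<otimes>\<^bsub>A\<^esub> y)"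
    and "\<And>c x y. x \<in> carrier A \<Longrightarrow> y \<in> carrier A \<Longrightarrow> x \<otimes>\<^bsub>A\<^esub> (c \<odot>\<^bsub>A\<^esub> y) = c \<odot>\<^bsub>A\<^esub> (x \<otimes>\<^bsub>A\<^esub> y)"
  using assms by (simp_all add: k_algebra_def)

lemma k_algebra_ground [simp]: "k_algebra (ground :: ('k::field, 'k) module)"
  using cring_ground by (intro k_algebraI) (auto dest: cring.axioms)

section \<open>Linear maps\<close>

lemma linear_mapI:
  assumes "\<And>x. x \<in> carrier V \<Longrightarrow> f x \<in> carrier W"
    and "\<And>x y. x \<in> carrier V \<Longrightarrow> y \<in> carrier V \<Longrightarrow> f (x \<oplus>\<^bsub>V\<^esub> y) = f x \<oplus>\<^bsub>W\<^esub> f y"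
    and "\<And>c x. x \<in> carrier V \<Longrightarrow> f (c \<odot>\<^bsub>V\<^esub> x) = c \<odot>\<^bsub>W\<^esub> f x"
  shows "linear_map V W f"
  using assms by (auto simp: linear_map_def)

lemma linear_mapD:
  assumes "linear_map V W f"
  shows "\<And>x. x \<in> carrier V \<Longrightarrow> f x \<in> carrier W"
    and "\<And>x y. x \<in> carrier V \<Longrightarrow> y \<in> carrier V \<Longrightarrow> f (x \<oplus>\<^bsub>V\<^esub> y) = f x \<oplus>\<^bsub>W\<^esub> f y"
    and "\<And>c x. x \<in> carrier V \<Longrightarrow> f (c \<odot>\<^bsub>V\<^esub> x) = c \<odot>\<^bsub>W\<^esub> f x"
  using assms by (auto simp: linear_map_def)

lemma linear_map_zero:
  assumes "vec_space V" "vec_space W" "linear_map V W f"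
  shows "f \<zero>\<^bsub>V\<^esub> = \<zero>\<^bsub>W\<^esub>"
proof -
  interpret V: module ground V by fact
  interpret W: module ground W by fact
  have "f \<zero>\<^bsub>V\<^esub> = 0 \<odot>\<^bsub>W\<^esub> f \<zero>\<^bsub>V\<^esub>"
    using linear_mapD(3)[OF assms(3), of "\<zero>\<^bsub>V\<^esub>" 0] V.smult_l_null[of "\<zero>\<^bsub>V\<^esub>"] by simp
  also have "\<dots> = \<zero>\<^bsub>W\<^esub>" using W.smult_l_null linear_mapD(1)[OF assms(3)] by simp
  finally show ?thesis .
qed

lemma linear_map_uminus:
  assumes "vec_space V" "vec_space W" "linear_map V W f" "x \<in> carrier V"
  shows "f (\<ominus>\<^bsub>V\<^esub> x) = \<ominus>\<^bsub>W\<^esub> f x"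
proof -
  interpret V: module ground V by fact
  interpret W: module ground W by fact
  have "f (\<ominus>\<^bsub>V\<^esub> x) \<oplus>\<^bsub>W\<^esub> f x = f (\<ominus>\<^bsub>V\<^esub> x \<oplus>\<^bsub>V\<^esub> x)" using assms(4) by (simp add: linear_mapD[OF assms(3)])
  also have "\<dots> = \<zero>\<^bsub>W\<^esub>" using assms(4) by (simp add: V.M.l_neg linear_map_zero[OF assms(1-3)])
  finally show ?thesis using assms(4) W.M.minus_equality linear_mapD(1)[OF assms(3)] by simp
qed

lemma linear_map_minus:
  assumes "vec_space V" "vec_space W" "linear_map V W f" "x \<in> carrier V" "y \<in> carrier V"
  shows "f (x \<ominus>\<^bsub>V\<^esub> y) = f x \<ominus>\<^bsub>W\<^esub> f y"
proof -
  interpret V: module ground V by fact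
  show ?thesis using assms(4,5)
    by (simp add: a_minus_def linear_mapD(2)[OF assms(3)] linear_map_uminus[OF assms(1-3)])
qed

lemma minus_eq_zeroD:
  assumes "abelian_group G" "x \<in> carrier G" "y \<in> carrier G" "x \<ominus>\<^bsub>G\<^esub> y = \<zero>\<^bsub>G\<^esub>"
  shows "x = y"
proof -
  interpret abelian_group G by fact
  show ?thesis using assms(2-4)
    by (metis a_minus_def minus_equality minus_minus a_inv_closed)
qed

lemma linear_map_id: "linear_map V V (\<lambda>x. x)"
  by (auto simp: linear_map_def)

lemma linear_map_compose:
  "linear_map W X g \<Longrightarrow> linear_map V W f \<Longrightarrow> linear_map V X (\<lambda>x. g (f x))"
  by (rule linear_mapI) (simp_all add: linear_mapD)

text \<open>Functions are total, but linearity looks only at the carrier, so a map may be replaced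
  by one that agrees there. The agreement has to reach sums and multiples, which lie in the carrier
  because \<open>V\<close> is a vector space.\<close>

lemma linear_map_cong:
  assumes "vec_space V" "\<And>x. x \<in> carrier V \<Longrightarrow> f x = g x"
  shows "linear_map V W f \<longleftrightarrow> linear_map V W g"
proof -
  interpret V: module ground V by fact
  show ?thesis using assms(2) by (auto simp: linear_map_def Pi_def)
qed

lemma linear_map_const_zero: "vec_space W \<Longrightarrow> linear_map V W (\<lambda>x. \<zero>\<^bsub>W\<^esub>)"
proof -
  assume "vec_space W"
  then interpret W: module ground W .
  show ?thesis using W.smult_r_null by (auto simp: linear_map_def)
qed

lemma linear_map_plus:
  assumes "vec_space W" "linear_map V W f" "linear_map V W g"
  shows "linear_map V W (\<lambda>x. f x \<oplus>\<^bsub>W\<^esub> g x)"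
proof -
  interpret W: module ground W by fact
  show ?thesis using linear_mapD[OF assms(2)] linear_mapD[OF assms(3)]
    by (auto intro!: linear_mapI simp: W.smult_r_distr W.M.a_ac)
qed

lemma linear_map_smult:
  assumes "vec_space W" "linear_map V W f"
  shows "linear_map V W (\<lambda>x. c \<odot>\<^bsub>W\<^esub> f x)"
proof -
  interpret W: module ground W by fact
  have *: "c \<odot>\<^bsub>W\<^esub> (d \<odot>\<^bsub>W\<^esub> x) = d \<odot>\<^bsub>W\<^esub> (c \<odot>\<^bsub>W\<^esub> x)" if "x \<in> carrier W" for d x
    using that W.smult_assoc1[of c d x] W.smult_assoc1[of d c x] by (simp add: mult.commute)
  show ?thesis using linear_mapD[OF assms(2)]
    by (auto intro!: linear_mapI simp: W.smult_r_distr *)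
qed

lemma linear_map_uminus_fun:
  assumes "vec_space W" "linear_map V W f"
  shows "linear_map V W (\<lambda>x. \<ominus>\<^bsub>W\<^esub> f x)"
proof -
  interpret W: module ground W by fact
  show ?thesis using linear_mapD[OF assms(2)] W.smult_r_minus
    by (auto intro!: linear_mapI simp: W.M.minus_add W.M.a_ac)
qed

lemma linear_map_scalar:
  assumes "vec_space W" "linear_map V ground f" "w \<in> carrier W"
  shows "linear_map V W (\<lambda>x. f x \<odot>\<^bsub>W\<^esub> w)"
proof -
  interpret W: module ground W by fact
  show ?thesis using linear_mapD[OF assms(2)] assms(3) W.smult_l_distr[OF _ _ assms(3)] W.smult_assoc1[OF _ _ assms(3)]
    by (auto intro!: linear_mapI)
qed

lemma linear_map_ground_mult_left:
  "linear_map V ground f \<Longrightarrow> linear_map V ground (\<lambda>x. c * f x)"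
  using linear_map_smult[of ground V f c] by simp

lemma linear_map_ground_mult_right:
  "linear_map V ground f \<Longrightarrow> linear_map V ground (\<lambda>x. f x * c)"
  using linear_map_smult[of ground V f c] by (simp add: mult.commute)

lemma linear_map_mult_left:
  assumes "k_algebra A" "linear_map V A f" "a \<in> carrier A"
  shows "linear_map V A (\<lambda>x. a \<otimes>\<^bsub>A\<^esub> f x)"
proof -
  note A = k_algebraD[OF assms(1)]
  interpret A: ring A by (rule A)
  show ?thesis using linear_mapD[OF assms(2)] assms(3)
    by (auto intro!: linear_mapI simp: A A.r_distr)
qed

lemma linear_map_mult_right:
  assumes "k_algebra A" "linear_map V A f" "a \<in> carrier A"
  shows "linear_map V A (\<lambda>x. f x \<otimes>\<^bsub>A\<^esub> a)"
proof -
  note A = k_algebraD[OF assms(1)]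
  interpret A: ring A by (rule A)
  show ?thesis using linear_mapD[OF assms(2)] assms(3)
    by (auto intro!: linear_mapI simp: A A.l_distr)
qed

section \<open>Bilinear maps\<close>

lemma bilinear_mapI:
  assumes "\<And>u. u \<in> carrier U \<Longrightarrow> linear_map V W (f u)"
    and "\<And>v. v \<in> carrier V \<Longrightarrow> linear_map U W (\<lambda>u. f u v)"
  shows "bilinear_map U V W f"
  using assms by (auto simp: bilinear_map_def)

lemma bilinear_map_cong:
  assumes U: "vec_space U" and V: "vec_space V"
    and eq: "\<And>u v. u \<in> carrier U \<Longrightarrow> v \<in> carrier V \<Longrightarrow> f u v = g u v"
  shows "bilinear_map U V W f \<longleftrightarrow> bilinear_map U V W g"
  using linear_map_cong[OF V, of "f u" "g u" W for u] linear_map_cong[OF U, of "\<lambda>u. f u v" "\<lambda>u. g u v" W for v] eq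
  by (auto simp: bilinear_map_def)

lemma bilinear_map_left: "bilinear_map U V W f \<Longrightarrow> v \<in> carrier V \<Longrightarrow> linear_map U W (\<lambda>u. f u v)"
  by (simp add: bilinear_map_def)

lemma bilinear_map_right: "bilinear_map U V W f \<Longrightarrow> u \<in> carrier U \<Longrightarrow> linear_map V W (\<lambda>v. f u v)"
  by (simp add: bilinear_map_def)

lemma bilinear_map_closed:
  "bilinear_map U V W f \<Longrightarrow> u \<in> carrier U \<Longrightarrow> v \<in> carrier V \<Longrightarrow> f u v \<in> carrier W"
  by (auto simp: bilinear_map_def dest: linear_mapD)

lemma linear_map_bilinear_left:
  "bilinear_map U V W f \<Longrightarrow> linear_map X U g \<Longrightarrow> v \<in> carrier V \<Longrightarrow> linear_map X W (\<lambda>x. f (g x) v)"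
  by (rule linear_map_compose[OF bilinear_map_left])

lemma linear_map_bilinear_right:
  "bilinear_map U V W f \<Longrightarrow> linear_map X V g \<Longrightarrow> u \<in> carrier U \<Longrightarrow> linear_map X W (\<lambda>x. f u (g x))"
  by (rule linear_map_compose[OF bilinear_map_right])

section \<open>Subspaces and quotients\<close>

lemma submodule_kernel:
  assumes "vec_space V" "vec_space W" "linear_map V W f"
  shows "submodule {x \<in> carrier V. f x = \<zero>\<^bsub>W\<^esub>} ground V"
proof -
  interpret V: module ground V by fact
  interpret W: module ground W by fact
  show ?thesis
    using assms(3) W.smult_r_null
    by (intro V.submoduleI)
       (auto simp: linear_mapD linear_map_zero[OF assms] linear_map_uminus[OF assms])
qed

lemma lin_span_superset: "S \<subseteq> lin_span V S"
  by (auto simp: lin_span_def)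

lemma lin_span_minimal: "submodule N ground V \<Longrightarrow> S \<subseteq> N \<Longrightarrow> lin_span V S \<subseteq> N"
  by (auto simp: lin_span_def)

text \<open>\<open>S \<subseteq> carrier V\<close> puts the whole space into the family that is
  intersected; otherwise the family could be empty and its intersection everything.\<close>

lemma submodule_lin_span:
  assumes "vec_space V" "S \<subseteq> carrier V"
  shows "submodule (lin_span V S) ground V"
proof -
  interpret V: module ground V by fact
  show ?thesis
  proof (rule V.submoduleI)
    show "lin_span V S \<subseteq> carrier V"
      using V.carrier_is_submodule assms(2) by (auto simp: lin_span_def)
    show "\<zero>\<^bsub>V\<^esub> \<in> lin_span V S"
      unfolding lin_span_def using submodule.axioms(1)[THEN subgroup.one_closed] by fastforce
  qed (auto simp: lin_span_def V.submoduleE)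
qed

lemma vec_space_abelian: "vec_space V \<Longrightarrow> abelian_group V"
  by (simp add: module_def)

lemma abelian_subgroup_submodule:
  assumes "vec_space V" "submodule N ground V"
  shows "abelian_subgroup N V"
  using assms vec_space_abelian[OF assms(1)]
  by (intro abelian_subgroupI3 additive_subgroupI) (auto dest: submodule.axioms)

context
  fixes V :: "('k::field, 'a) module" and N
  assumes V: "vec_space V" and N: "submodule N (ground :: ('k, 'k) module) V"
begin

interpretation V: module ground V by (rule V)
interpretation N: abelian_subgroup N V by (rule abelian_subgroup_submodule[OF V N])

lemma quotient_carrier: "carrier (quotient V N) = (\<lambda>x. N +>\<^bsub>V\<^esub> x) ` carrier V"
  by (auto simp: quotient_def FactRing_simps)

lemma quotient_add:
  "x \<in> carrier V \<Longrightarrow> y \<in> carrier V \<Longrightarrow>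
    (N +>\<^bsub>V\<^esub> x) \<oplus>\<^bsub>quotient V N\<^esub> (N +>\<^bsub>V\<^esub> y) = N +>\<^bsub>V\<^esub> (x \<oplus>\<^bsub>V\<^esub> y)"
  by (simp add: quotient_def FactRing_def N.a_rcos_sum)

lemma coset_eq_iff:
  assumes "x \<in> carrier V" "y \<in> carrier V"
  shows "N +>\<^bsub>V\<^esub> x = N +>\<^bsub>V\<^esub> y \<longleftrightarrow> x \<ominus>\<^bsub>V\<^esub> y \<in> N"
  using assms N.a_rcos_module[of y x] N.a_rcos_self[of x] N.a_repr_independence'[of x y]
  by (auto simp: a_minus_def)

lemma coset_memE:
  assumes "y \<in> N +>\<^bsub>V\<^esub> x" "x \<in> carrier V"
  obtains n where "n \<in> N" "n \<in> carrier V" "y = n \<oplus>\<^bsub>V\<^esub> x"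
  using assms N.a_subset by (auto simp: a_r_coset_def')

text \<open>Scalar multiplication of the quotient is a union over all representatives. Two
  representatives differ by some n in \<open>N\<close>, and c n is again in \<open>N\<close>, so all
  cosets in the union coincide.\<close>

lemma quotient_smult:
  assumes "x \<in> carrier V"
  shows "c \<odot>\<^bsub>quotient V N\<^esub> (N +>\<^bsub>V\<^esub> x) = N +>\<^bsub>V\<^esub> (c \<odot>\<^bsub>V\<^esub> x)"
proof -
  have *: "N +>\<^bsub>V\<^esub> (c \<odot>\<^bsub>V\<^esub> y) = N +>\<^bsub>V\<^esub> (c \<odot>\<^bsub>V\<^esub> x)" if y: "y \<in> N +>\<^bsub>V\<^esub> x" for y
  proof -
    obtain n where n: "n \<in> N" "n \<in> carrier V" "y = n \<oplus>\<^bsub>V\<^esub> x" using coset_memE[OF y assms] .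
    then have cn: "c \<odot>\<^bsub>V\<^esub> n \<in> N" using V.submoduleE(4)[OF N] by simp
    have "N +>\<^bsub>V\<^esub> (c \<odot>\<^bsub>V\<^esub> y) = N +>\<^bsub>V\<^esub> (c \<odot>\<^bsub>V\<^esub> n \<oplus>\<^bsub>V\<^esub> c \<odot>\<^bsub>V\<^esub> x)"
      using n assms by (simp add: V.smult_r_distr)
    also have "\<dots> = N +>\<^bsub>V\<^esub> (c \<odot>\<^bsub>V\<^esub> x)"
      using n assms cn by (subst coset_eq_iff) (auto simp: a_minus_def V.M.a_assoc V.M.r_neg)
    finally show ?thesis .
  qed
  have "(\<lambda>y. N +>\<^bsub>V\<^esub> (c \<odot>\<^bsub>V\<^esub> y)) ` (N +>\<^bsub>V\<^esub> x) =
      (\<lambda>_. N +>\<^bsub>V\<^esub> (c \<odot>\<^bsub>V\<^esub> x)) ` (N +>\<^bsub>V\<^esub> x)"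
    by (rule image_cong[OF refl]) (rule *)
  moreover have "N +>\<^bsub>V\<^esub> x \<noteq> {}"
    using N.a_rcos_self[OF assms] by blast
  ultimately show ?thesis
    by (simp add: quotient_def)
qed

lemma coset_zero: "N +>\<^bsub>V\<^esub> \<zero>\<^bsub>V\<^esub> = \<zero>\<^bsub>quotient V N\<^esub>"
  by (simp add: quotient_def FactRing_def N.a_subset V.M.a_coset_add_zero)

lemma vec_space_quotient: "vec_space (quotient V N)"
proof (rule vec_spaceI)
  show "abelian_group (quotient V N)"
  proof (rule abelian_groupI)
    fix X assume "X \<in> carrier (quotient V N)"
    then obtain x where x: "x \<in> carrier V" "X = N +>\<^bsub>V\<^esub> x" by (auto simp: quotient_carrier)
    show "\<exists>Y\<in>carrier (quotient V N). Y \<oplus>\<^bsub>quotient V N\<^esub> X = \<zero>\<^bsub>quotient V N\<^esub>"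
      using x by (intro bexI[of _ "N +>\<^bsub>V\<^esub> (\<ominus>\<^bsub>V\<^esub> x)"])
        (auto simp: quotient_carrier quotient_add V.M.l_neg coset_zero)
  qed (auto simp: quotient_carrier quotient_add V.M.a_ac simp flip: coset_zero)
qed (auto simp: quotient_carrier quotient_add quotient_smult V.smult_r_distr
   V.smult_l_distr[simplified] V.smult_assoc1[simplified] V.smult_one[simplified])

lemma linear_map_coset: "linear_map V (quotient V N) (\<lambda>x. N +>\<^bsub>V\<^esub> x)"
  by (rule linear_mapI) (auto simp: quotient_carrier quotient_add quotient_smult)

lemma coset_eq_zero: "n \<in> N \<Longrightarrow> N +>\<^bsub>V\<^esub> n = \<zero>\<^bsub>quotient V N\<^esub>"
  using coset_eq_iff[of n "\<zero>\<^bsub>V\<^esub>"] N.a_Hcarr[of n] by (simp add: coset_zero a_minus_def)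

lemma coset_eq_zeroD: "n \<in> carrier V \<Longrightarrow> N +>\<^bsub>V\<^esub> n = \<zero>\<^bsub>quotient V N\<^esub> \<Longrightarrow> n \<in> N"
  using N.a_rcos_self[of n] by (simp add: quotient_def FactRing_def)

text \<open>A linear map that kills \<open>N\<close> is constant on each coset, so the image of a
  coset is a singleton and \<open>the_elem\<close> reads off the value. All induced maps of the
  development (\<open>tensor_lift\<close>, \<open>env_lift\<close>, the structure maps of the
  quotient, the section \<open>\<gamma>\<close>) are evaluated through this fact.\<close>

lemma the_elem_image_coset:
  assumes W: "vec_space W" and f: "linear_map V W f" and ker: "\<And>n. n \<in> N \<Longrightarrow> f n = \<zero>\<^bsub>W\<^esub>"
    and x: "x \<in> carrier V"
  shows "the_elem (f ` (N +>\<^bsub>V\<^esub> x)) = f x"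
proof -
  interpret W: module ground W by (rule W)
  have *: "f y = f x" if y: "y \<in> N +>\<^bsub>V\<^esub> x" for y
  proof -
    obtain n where "n \<in> N" "n \<in> carrier V" "y = n \<oplus>\<^bsub>V\<^esub> x" using coset_memE[OF y x] .
    then show ?thesis using x by (simp add: linear_mapD[OF f] ker)
  qed
  have "f ` (N +>\<^bsub>V\<^esub> x) = (\<lambda>_. f x) ` (N +>\<^bsub>V\<^esub> x)"
    by (rule image_cong[OF refl]) (rule *)
  moreover have "N +>\<^bsub>V\<^esub> x \<noteq> {}"
    using N.a_rcos_self[OF x] by blast
  ultimately show ?thesis by (simp add: image_constant_conv)
qed

lemma linear_map_the_elem:
  assumes W: "vec_space W" and f: "linear_map V W f" and ker: "\<And>n. n \<in> N \<Longrightarrow> f n = \<zero>\<^bsub>W\<^esub>"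
  shows "linear_map (quotient V N) W (\<lambda>X. the_elem (f ` X))"
  by (rule linear_mapI)
    (auto simp: quotient_carrier quotient_add quotient_smult the_elem_image_coset[OF W f ker] linear_mapD[OF f])

end

text \<open>Closure under scalars follows from closure under left multiplication, since c x = (c 1)
  x.\<close>

lemma submodule_ideal:
  assumes "k_algebra A" "ideal I A"
  shows "submodule I ground A"
proof -
  note A = k_algebraD[OF assms(1)]
  interpret A: module ground A by (rule A)
  interpret R: ring A by (rule A)
  interpret I: ideal I A by fact
  have *: "c \<odot>\<^bsub>A\<^esub> x \<in> I" if "x \<in> I" for c x
    using A(3)[of "\<one>\<^bsub>A\<^esub>" x c] that I.I_l_closed[of x "c \<odot>\<^bsub>A\<^esub> \<one>\<^bsub>A\<^esub>"] I.a_subset by auto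
  show ?thesis
    by (intro A.submoduleI) (auto simp: I.a_subset *)
qed

section \<open>Quotient algebras\<close>

context
  fixes A :: "('k::field, 'a) module" and I
  assumes A: "k_algebra A" and I: "ideal I A"
begin

interpretation A: ring A using A by (rule k_algebraD)
interpretation I: ideal I A by (rule I)

lemmas quotient_algebra_simps =
  quotient_carrier[OF k_algebraD(2)[OF A] submodule_ideal[OF A I]]
  quotient_add[OF k_algebraD(2)[OF A] submodule_ideal[OF A I]]
  quotient_smult[OF k_algebraD(2)[OF A] submodule_ideal[OF A I]]

lemma quotient_mult:
  "x \<in> carrier A \<Longrightarrow> y \<in> carrier A \<Longrightarrow>
    (I +>\<^bsub>A\<^esub> x) \<otimes>\<^bsub>quotient A I\<^esub> (I +>\<^bsub>A\<^esub> y) = I +>\<^bsub>A\<^esub> (x \<otimes>\<^bsub>A\<^esub> y)"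
  by (simp add: quotient_def FactRing_def I.rcoset_mult_add)

lemma quotient_one: "\<one>\<^bsub>quotient A I\<^esub> = I +>\<^bsub>A\<^esub> \<one>\<^bsub>A\<^esub>"
  by (simp add: quotient_def FactRing_def)

lemma k_algebra_quotient: "k_algebra (quotient A I)"
proof (rule k_algebraI)
  interpret Q: module ground "quotient A I"
    by (rule vec_space_quotient[OF k_algebraD(2)[OF A] submodule_ideal[OF A I]])
  interpret V: module ground A by (rule k_algebraD(2)[OF A])
  show "vec_space (quotient A I)" by unfold_locales
  show "ring (quotient A I)"
  proof (rule ringI)
    show "abelian_group (quotient A I)" by unfold_locales
    show "Group.monoid (quotient A I)"
      by (rule monoidI) (auto simp: quotient_algebra_simps quotient_mult quotient_one A.m_assoc)
    fix x y z assume "x \<in> carrier (quotient A I)" "y \<in> carrier (quotient A I)" "z \<in> carrier (quotient A I)"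
    then obtain x' y' z' where *: "x' \<in> carrier A" "y' \<in> carrier A" "z' \<in> carrier A"
      "x = I +>\<^bsub>A\<^esub> x'" "y = I +>\<^bsub>A\<^esub> y'" "z = I +>\<^bsub>A\<^esub> z'"
      by (auto simp: quotient_algebra_simps)
    show "(x \<oplus>\<^bsub>quotient A I\<^esub> y) \<otimes>\<^bsub>quotient A I\<^esub> z = x \<otimes>\<^bsub>quotient A I\<^esub> z \<oplus>\<^bsub>quotient A I\<^esub> y \<otimes>\<^bsub>quotient A I\<^esub> z"
      "z \<otimes>\<^bsub>quotient A I\<^esub> (x \<oplus>\<^bsub>quotient A I\<^esub> y) = z \<otimes>\<^bsub>quotient A I\<^esub> x \<oplus>\<^bsub>quotient A I\<^esub> z \<otimes>\<^bsub>quotient A I\<^esub> y"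
      using * by (simp_all add: quotient_algebra_simps quotient_mult A.l_distr A.r_distr)
  qed
next
  interpret V: module ground A by (rule k_algebraD(2)[OF A])
  fix c x y assume "x \<in> carrier (quotient A I)" "y \<in> carrier (quotient A I)"
  then obtain x' y' where *: "x' \<in> carrier A" "y' \<in> carrier A"
      "x = I +>\<^bsub>A\<^esub> x'" "y = I +>\<^bsub>A\<^esub> y'"
    by (auto simp: quotient_algebra_simps)
  have "c \<odot>\<^bsub>A\<^esub> x' \<in> carrier A" "c \<odot>\<^bsub>A\<^esub> y' \<in> carrier A"
    using * V.smult_closed by simp_all
  then show "(c \<odot>\<^bsub>quotient A I\<^esub> x) \<otimes>\<^bsub>quotient A I\<^esub> y = c \<odot>\<^bsub>quotient A I\<^esub> (x \<otimes>\<^bsub>quotient A I\<^esub> y)"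
    "x \<otimes>\<^bsub>quotient A I\<^esub> (c \<odot>\<^bsub>quotient A I\<^esub> y) = c \<odot>\<^bsub>quotient A I\<^esub> (x \<otimes>\<^bsub>quotient A I\<^esub> y)"
    using * by (simp_all add: quotient_algebra_simps quotient_mult k_algebraD(3,4)[OF A])
qed

end

section \<open>Monoid algebras\<close>

lemma monoid_algebra_simps:
  "carrier (monoid_algebra G) = {x. Poly_Mapping.keys x \<subseteq> carrier G}"
  "\<one>\<^bsub>monoid_algebra G\<^esub> = Poly_Mapping.single \<one>\<^bsub>G\<^esub> 1"
  "\<zero>\<^bsub>monoid_algebra G\<^esub> = 0"
  "x \<oplus>\<^bsub>monoid_algebra G\<^esub> y = x + y"
  "c \<odot>\<^bsub>monoid_algebra G\<^esub> x = Poly_Mapping.map ((*) c) x"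
  by (simp_all add: monoid_algebra_def)

lemma lookup_map_mult [simp]: "Poly_Mapping.lookup (Poly_Mapping.map ((*) (c :: 'k :: field)) x) u = c * Poly_Mapping.lookup x u"
  by (simp add: Poly_Mapping.map.rep_eq when_def)

lemma keys_map_mult: "Poly_Mapping.keys (Poly_Mapping.map ((*) (c :: 'k :: field)) x) \<subseteq> Poly_Mapping.keys x"
  by (auto simp: in_keys_iff)

lemma map_mult_single: "Poly_Mapping.map ((*) (c :: 'k :: field)) (Poly_Mapping.single u d) = Poly_Mapping.single u (c * d)"
  by (rule poly_mapping_eqI) (simp add: lookup_single when_def)

lemma map_mult_add: "Poly_Mapping.map ((*) (c :: 'k :: field)) (x + y) = Poly_Mapping.map ((*) c) x + Poly_Mapping.map ((*) c) y"
  by (rule poly_mapping_eqI) (simp add: lookup_add algebra_simps)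

lemma map_mult_zero: "Poly_Mapping.map ((*) (c :: 'k :: field)) 0 = 0"
  by (rule poly_mapping_eqI) simp

lemma vec_space_monoid_algebra: "vec_space (monoid_algebra G :: ('k::field, 'g \<Rightarrow>\<^sub>0 'k) module)"
proof (rule vec_spaceI)
  show "abelian_group (monoid_algebra G :: ('k::field, 'g \<Rightarrow>\<^sub>0 'k) module)"
  proof (rule abelian_groupI)
    fix x y :: "'g \<Rightarrow>\<^sub>0 'k"
    assume x: "x \<in> carrier (monoid_algebra G)" and y: "y \<in> carrier (monoid_algebra G)"
    show "\<exists>y\<in>carrier (monoid_algebra G). y \<oplus>\<^bsub>monoid_algebra G\<^esub> x = \<zero>\<^bsub>monoid_algebra G\<^esub>"
      using x by (intro bexI[of _ "- x"]) (auto simp: monoid_algebra_simps in_keys_iff subset_iff)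
    show "x \<oplus>\<^bsub>monoid_algebra G\<^esub> y \<in> carrier (monoid_algebra G)"
      using x y keys_add[of x y] by (auto simp: monoid_algebra_simps)
  qed (simp_all add: monoid_algebra_simps ac_simps)
next
  fix c and x :: "'g \<Rightarrow>\<^sub>0 'k" assume "x \<in> carrier (monoid_algebra G)"
  then show "c \<odot>\<^bsub>monoid_algebra G\<^esub> x \<in> carrier (monoid_algebra G)"
    using keys_map_mult[of c x] by (auto simp: monoid_algebra_simps)
qed (simp_all add: monoid_algebra_simps poly_mapping_eq_iff fun_eq_iff lookup_add algebra_simps)

lemma single_closed: "u \<in> carrier G \<Longrightarrow> Poly_Mapping.single u c \<in> carrier (monoid_algebra G)"
  by (simp add: monoid_algebra_simps)

lemma monoid_algebra_diff_closed:
  "x \<in> carrier (monoid_algebra G) \<Longrightarrow> y \<in> carrier (monoid_algebra G) \<Longrightarrow> x - y \<in> carrier (monoid_algebra G)"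
  by (auto simp: monoid_algebra_simps in_keys_iff lookup_minus subset_iff) metis

text \<open>Induction on the support. The coefficient stays inside \<open>single\<close>, so there
  is no separate case for scalar multiples.\<close>

lemma monoid_algebra_induct [consumes 1, case_names zero single add]:
  assumes "x \<in> carrier (monoid_algebra G)"
    and zero: "P 0"
    and single: "\<And>u c. u \<in> carrier G \<Longrightarrow> P (Poly_Mapping.single u c)"
    and add: "\<And>x y. x \<in> carrier (monoid_algebra G) \<Longrightarrow> y \<in> carrier (monoid_algebra G) \<Longrightarrow>
      P x \<Longrightarrow> P y \<Longrightarrow> P (x + y)"
  shows "P x"
proof -
  have "x \<in> carrier (monoid_algebra G) \<longrightarrow> P x"
  proof (induction x rule: update_induct)
    case const then show ?case by (simp add: zero)
  next
    case (update f a b)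
    have eq: "Poly_Mapping.update a b f = f + Poly_Mapping.single a b"
      using update(1) by (intro poly_mapping_eqI)
        (auto simp: lookup_update lookup_add lookup_single in_keys_iff when_def)
    show ?case
    proof
      assume *: "Poly_Mapping.update a b f \<in> carrier (monoid_algebra G)"
      have "Poly_Mapping.keys (Poly_Mapping.update a b f) = insert a (Poly_Mapping.keys f)"
        using update(2) by (auto simp: in_keys_iff lookup_update split: if_splits)
      with * have "a \<in> carrier G" "f \<in> carrier (monoid_algebra G)"
        by (auto simp: monoid_algebra_simps)
      then show "P (Poly_Mapping.update a b f)"
        unfolding eq using update(3) by (intro add single single_closed) auto
    qed
  qed
  then show ?thesis using assms(1) by simp
qed

text \<open>Terms outside the support contribute zero. Enlarging the index set allows elements with
  different supports to be summed over a common one.\<close>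

lemma linear_extension_superset:
  fixes W :: "('k::field, 'w) module"
  assumes "vec_space W" "\<And>u. u \<in> carrier G \<Longrightarrow> f u \<in> carrier W"
    and "finite S" "S \<subseteq> carrier G" "Poly_Mapping.keys x \<subseteq> S"
  shows "linear_extension W f x = (\<Oplus>\<^bsub>W\<^esub>u\<in>S. Poly_Mapping.lookup x u \<odot>\<^bsub>W\<^esub> f u)"
proof -
  interpret W: module ground W by fact
  show ?thesis unfolding linear_extension_def
    using assms W.smult_closed W.smult_l_null
    by (intro W.M.add.finprod_mono_neutral_cong_left) (auto simp: in_keys_iff Pi_def)
qed

lemma linear_extension_single:
  assumes "vec_space W" "f u \<in> carrier W"
  shows "linear_extension W f (Poly_Mapping.single u c) = c \<odot>\<^bsub>W\<^esub> f u"
proof -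
  interpret W: module ground W by fact
  show ?thesis using assms(2) W.smult_closed[of c "f u"] W.smult_l_null[of "f u"]
    by (cases "c = 0") (auto simp: linear_extension_def)
qed

lemma linear_map_linear_extension:
  fixes W :: "('k::field, 'w) module" and G :: "('g, 'm) monoid_scheme"
  assumes "vec_space W" "\<And>u. u \<in> carrier G \<Longrightarrow> f u \<in> carrier W"
  shows "linear_map (monoid_algebra G) W (linear_extension W f)"
proof (rule linear_mapI)
  interpret W: module ground W by fact
  note sup = linear_extension_superset[of W G f, OF assms]
  fix x :: "'g \<Rightarrow>\<^sub>0 'k" assume x: "x \<in> carrier (monoid_algebra G)"
  show "linear_extension W f x \<in> carrier W"
    unfolding linear_extension_def using x assms(2) W.smult_closed
    by (intro W.M.finsum_closed) (auto simp: monoid_algebra_simps)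
  {
    fix y :: "'g \<Rightarrow>\<^sub>0 'k" assume y: "y \<in> carrier (monoid_algebra G)"
    \<comment> \<open>Cancellation can make the support of x + y smaller than this union, so all
      three sums are brought to the union.\<close>
    let ?S = "Poly_Mapping.keys x \<union> Poly_Mapping.keys y"
    have S: "finite ?S" "?S \<subseteq> carrier G" using x y by (auto simp: monoid_algebra_simps)
    have "linear_extension W f (x + y) = (\<Oplus>\<^bsub>W\<^esub>u\<in>?S. Poly_Mapping.lookup (x + y) u \<odot>\<^bsub>W\<^esub> f u)"
      using S keys_add[of x y] by (intro sup) auto
    also have "\<dots> = (\<Oplus>\<^bsub>W\<^esub>u\<in>?S. Poly_Mapping.lookup x u \<odot>\<^bsub>W\<^esub> f u \<oplus>\<^bsub>W\<^esub> Poly_Mapping.lookup y u \<odot>\<^bsub>W\<^esub> f u)"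
      using S assms(2) W.smult_closed W.smult_l_distr
      by (intro W.M.finsum_cong') (auto simp: lookup_add subset_iff)
    also have "\<dots> = linear_extension W f x \<oplus>\<^bsub>W\<^esub> linear_extension W f y"
      using S assms(2) W.smult_closed sup[OF _ S, of x] sup[OF _ S, of y]
      by (subst W.M.finsum_addf) (auto simp: subset_iff Pi_def)
    finally show "linear_extension W f (x \<oplus>\<^bsub>monoid_algebra G\<^esub> y) = linear_extension W f x \<oplus>\<^bsub>W\<^esub> linear_extension W f y"
      by (simp add: monoid_algebra_simps)
  }
  fix c
  have "linear_extension W f (c \<odot>\<^bsub>monoid_algebra G\<^esub> x) =
      (\<Oplus>\<^bsub>W\<^esub>u\<in>Poly_Mapping.keys x. Poly_Mapping.lookup (c \<odot>\<^bsub>monoid_algebra G\<^esub> x) u \<odot>\<^bsub>W\<^esub> f u)"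
    using x keys_map_mult[of c x] by (intro sup) (auto simp: monoid_algebra_simps)
  also have "\<dots> = (\<Oplus>\<^bsub>W\<^esub>u\<in>Poly_Mapping.keys x. c \<odot>\<^bsub>W\<^esub> (Poly_Mapping.lookup x u \<odot>\<^bsub>W\<^esub> f u))"
    using x assms(2) W.smult_closed W.smult_assoc1
    by (intro W.M.finsum_cong') (auto simp: monoid_algebra_simps subset_iff)
  also have "\<dots> = c \<odot>\<^bsub>W\<^esub> linear_extension W f x"
    unfolding linear_extension_def using x assms(2) W.smult_closed
    by (subst W.finsum_smult_ldistr) (auto simp: monoid_algebra_simps subset_iff)
  finally show "linear_extension W f (c \<odot>\<^bsub>monoid_algebra G\<^esub> x) = c \<odot>\<^bsub>W\<^esub> linear_extension W f x" .
qed

lemma monoid_algebra_mult: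
  "x \<otimes>\<^bsub>monoid_algebra G\<^esub> y = (\<Sum>u\<in>Poly_Mapping.keys x. \<Sum>v\<in>Poly_Mapping.keys y.
     Poly_Mapping.single (u \<otimes>\<^bsub>G\<^esub> v) (Poly_Mapping.lookup x u * Poly_Mapping.lookup y v))"
  by (simp add: monoid_algebra_def)

lemma monoid_algebra_mult_add_left:
  "(x + x') \<otimes>\<^bsub>monoid_algebra G\<^esub> y = x \<otimes>\<^bsub>monoid_algebra G\<^esub> y + x' \<otimes>\<^bsub>monoid_algebra G\<^esub> y"
  unfolding monoid_algebra_mult
  by (rule setsum_keys_plus_distrib) (simp_all add: ring_distribs single_add sum.distrib)

lemma monoid_algebra_mult_add_right:
  "x \<otimes>\<^bsub>monoid_algebra G\<^esub> (y + y') = x \<otimes>\<^bsub>monoid_algebra G\<^esub> y + x \<otimes>\<^bsub>monoid_algebra G\<^esub> y'"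
  unfolding monoid_algebra_mult sum.distrib[symmetric]
  by (rule sum.cong[OF refl], rule setsum_keys_plus_distrib) (simp_all add: ring_distribs single_add)

lemma monoid_algebra_mult_single:
  "Poly_Mapping.single u c \<otimes>\<^bsub>monoid_algebra G\<^esub> Poly_Mapping.single v d = Poly_Mapping.single (u \<otimes>\<^bsub>G\<^esub> v) (c * d)"
  by (simp add: monoid_algebra_mult)

lemma monoid_algebra_mult_zero:
  "0 \<otimes>\<^bsub>monoid_algebra G\<^esub> x = 0" "x \<otimes>\<^bsub>monoid_algebra G\<^esub> 0 = 0"
  by (simp_all add: monoid_algebra_mult)

text \<open>Every axiom is additive in each argument and so reduces to \<open>single\<close>, where
  it becomes a law of the monoid \<open>G\<close>.\<close>

lemma k_algebra_monoid_algebra: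
  assumes "Group.monoid G"
  shows "k_algebra (monoid_algebra G :: ('k::field, 'g \<Rightarrow>\<^sub>0 'k) module)"
proof -
  interpret G: Group.monoid G by fact
  define A where "A = (monoid_algebra G :: ('k, 'g \<Rightarrow>\<^sub>0 'k) module)"
  interpret A: module ground A unfolding A_def by (rule vec_space_monoid_algebra)
  note simps = monoid_algebra_mult_single monoid_algebra_mult_add_left monoid_algebra_mult_add_right
    monoid_algebra_mult_zero monoid_algebra_simps(2-5)
  have plus: "x + y \<in> carrier (monoid_algebra G)"
    if "x \<in> carrier (monoid_algebra G)" "y \<in> carrier (monoid_algebra G)" for x y :: "'g \<Rightarrow>\<^sub>0 'k"
    using that keys_add[of x y] by (auto simp: monoid_algebra_simps)
  have zero: "(0 :: 'g \<Rightarrow>\<^sub>0 'k) \<in> carrier (monoid_algebra G)" by (simp add: monoid_algebra_simps)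
  have closed: "x \<otimes>\<^bsub>A\<^esub> y \<in> carrier A" if x: "x \<in> carrier A" and y: "y \<in> carrier A" for x y
    unfolding A_def using x[unfolded A_def]
  proof (induction rule: monoid_algebra_induct)
    case (single u c)
    show ?case using y[unfolded A_def]
      by (induction rule: monoid_algebra_induct) (use single in \<open>auto simp: simps zero intro: plus single_closed\<close>)
  qed (auto simp: simps zero intro: plus)
  have one_l: "\<one>\<^bsub>A\<^esub> \<otimes>\<^bsub>A\<^esub> x = x" "x \<otimes>\<^bsub>A\<^esub> \<one>\<^bsub>A\<^esub> = x" if x: "x \<in> carrier A" for x
    unfolding A_def using x[unfolded A_def] by (induction rule: monoid_algebra_induct) (auto simp: simps)
  have assoc: "x \<otimes>\<^bsub>A\<^esub> y \<otimes>\<^bsub>A\<^esub> z = x \<otimes>\<^bsub>A\<^esub> (y \<otimes>\<^bsub>A\<^esub> z)"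
    if x: "x \<in> carrier A" and y: "y \<in> carrier A" and z: "z \<in> carrier A" for x y z
    unfolding A_def using x[unfolded A_def]
  proof (induction rule: monoid_algebra_induct)
    case (single u c)
    show ?case using y[unfolded A_def]
    proof (induction rule: monoid_algebra_induct)
      case (single v d)
      show ?case using z[unfolded A_def]
        by (induction rule: monoid_algebra_induct)
          (use single \<open>u \<in> carrier G\<close> in \<open>auto simp: simps G.m_assoc mult.assoc\<close>)
    qed (auto simp: simps)
  qed (auto simp: simps)
  have smult_l: "(c \<odot>\<^bsub>A\<^esub> x) \<otimes>\<^bsub>A\<^esub> y = c \<odot>\<^bsub>A\<^esub> (x \<otimes>\<^bsub>A\<^esub> y)"
    and smult_r: "x \<otimes>\<^bsub>A\<^esub> (c \<odot>\<^bsub>A\<^esub> y) = c \<odot>\<^bsub>A\<^esub> (x \<otimes>\<^bsub>A\<^esub> y)"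
    if x: "x \<in> carrier A" and y: "y \<in> carrier A" for c x y
  proof -
    have "(c \<odot>\<^bsub>A\<^esub> x) \<otimes>\<^bsub>A\<^esub> y = c \<odot>\<^bsub>A\<^esub> (x \<otimes>\<^bsub>A\<^esub> y) \<and> x \<otimes>\<^bsub>A\<^esub> (c \<odot>\<^bsub>A\<^esub> y) = c \<odot>\<^bsub>A\<^esub> (x \<otimes>\<^bsub>A\<^esub> y)"
      unfolding A_def using x[unfolded A_def]
    proof (induction rule: monoid_algebra_induct)
      case (single u d)
      show ?case using y[unfolded A_def]
        by (induction rule: monoid_algebra_induct)
          (auto simp: simps map_mult_single map_mult_add map_mult_zero mult.assoc mult.left_commute)
    qed (auto simp: simps map_mult_add map_mult_zero)
    then show "(c \<odot>\<^bsub>A\<^esub> x) \<otimes>\<^bsub>A\<^esub> y = c \<odot>\<^bsub>A\<^esub> (x \<otimes>\<^bsub>A\<^esub> y)" "x \<otimes>\<^bsub>A\<^esub> (c \<odot>\<^bsub>A\<^esub> y) = c \<odot>\<^bsub>A\<^esub> (x \<otimes>\<^bsub>A\<^esub> y)"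
      by auto
  qed
  have "k_algebra A"
  proof (rule k_algebraI)
    show "ring A"
    proof (rule ringI)
      show "abelian_group A" by unfold_locales
      show "Group.monoid A"
        using closed assoc one_l by (intro monoidI) (auto simp: A_def simps intro: single_closed)
    qed (auto simp: A_def simps)
    show "vec_space A" by unfold_locales
  qed (auto simp: smult_l smult_r)
  then show ?thesis by (simp add: A_def)
qed

section \<open>Tensor products\<close>

lemma vec_space_formal_tensors: "vec_space (formal_tensors A B)"
  unfolding formal_tensors_def by (rule vec_space_monoid_algebra)

lemma single_formal_tensors:
  "a \<in> carrier A \<Longrightarrow> b \<in> carrier B \<Longrightarrow> Poly_Mapping.single (a, b) c \<in> carrier (formal_tensors A B)"
  unfolding formal_tensors_def by (rule single_closed) simp

lemma formal_tensors_diff_closed: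
  "x \<in> carrier (formal_tensors A B) \<Longrightarrow> y \<in> carrier (formal_tensors A B) \<Longrightarrow> x - y \<in> carrier (formal_tensors A B)"
  unfolding formal_tensors_def by (rule monoid_algebra_diff_closed)

text \<open>Relations are written with the subtraction of the polynomial type, whereas linearity
  speaks of the operations of the record. The two meet in (x - y) + y = x.\<close>

lemma linear_map_formal_diff:
  assumes W: "vec_space W" and f: "linear_map (monoid_algebra G) W f"
    and x: "x \<in> carrier (monoid_algebra G)" and y: "y \<in> carrier (monoid_algebra G)"
    and eq: "f x = f y"
  shows "f (x - y) = \<zero>\<^bsub>W\<^esub>"
proof -
  interpret W: module ground W by (rule W)
  have "f ((x - y) \<oplus>\<^bsub>monoid_algebra G\<^esub> y) = f (x - y) \<oplus>\<^bsub>W\<^esub> f y"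
    by (intro linear_mapD[OF f] monoid_algebra_diff_closed x y)
  then have "f y = f (x - y) \<oplus>\<^bsub>W\<^esub> f y" by (simp add: monoid_algebra_simps eq)
  then show ?thesis
    using linear_mapD(1)[OF f y] linear_mapD(1)[OF f monoid_algebra_diff_closed[OF x y]]
      W.M.add.l_cancel_one'[of "f y" "f (x - y)"] W.M.add.r_cancel_one'[of "f y" "f (x - y)"] by simp
qed

context
  fixes A :: "('k::field, 'a) module" and B :: "('k, 'b) module"
  assumes A: "vec_space A" and B: "vec_space B"
begin

interpretation A: module ground A by (rule A)
interpretation B: module ground B by (rule B)
interpretation F: module ground "formal_tensors A B" by (rule vec_space_formal_tensors)

lemma bilinearity_relations_submodule: "submodule (bilinearity_relations A B) ground (formal_tensors A B)"
  unfolding bilinearity_relations_def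
  using A.smult_closed B.smult_closed
  by (intro submodule_lin_span vec_space_formal_tensors)
    (auto intro!: formal_tensors_diff_closed single_formal_tensors)

text \<open>The kernel of \<open>f\<close> is a subspace containing the four generating families,
  hence their span. The map \<open>f\<close> is an arbitrary linear map on formal tensors, because
  besides linear extensions it is also applied to multiplication by a fixed element followed by
  projection.\<close>

lemma bilinearity_relations_kernel:
  assumes W: "vec_space W" and f: "linear_map (formal_tensors A B) W f"
    and bil: "bilinear_map A B W (\<lambda>a b. f (Poly_Mapping.single (a, b) 1))"
    and n: "n \<in> bilinearity_relations A B"
  shows "f n = \<zero>\<^bsub>W\<^esub>"
proof -
  interpret W: module ground W by (rule W)
  note f' = f[unfolded formal_tensors_def]
  note l = linear_mapD[OF bilinear_map_left[OF bil]]
  note r = linear_mapD[OF bilinear_map_right[OF bil]]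
  have s: "f (Poly_Mapping.single (a, b) c) = c \<odot>\<^bsub>W\<^esub> f (Poly_Mapping.single (a, b) 1)"
    if "a \<in> carrier A" "b \<in> carrier B" for a b c
    using linear_mapD(3)[OF f single_formal_tensors[OF that], of c 1]
    by (simp add: formal_tensors_def monoid_algebra_simps map_mult_single)
  have p: "f (x + y) = f x \<oplus>\<^bsub>W\<^esub> f y"
    if "x \<in> carrier (formal_tensors A B)" "y \<in> carrier (formal_tensors A B)" for x y
    using linear_mapD(2)[OF f that] by (simp add: formal_tensors_def monoid_algebra_simps)
  have e: "f (x - y) = \<zero>\<^bsub>W\<^esub>"
    if "x \<in> carrier (formal_tensors A B)" "y \<in> carrier (formal_tensors A B)" "f x = f y" for x y
    using that unfolding formal_tensors_def by (rule linear_map_formal_diff[OF W f'])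
  have d: "f (x - y - z) = \<zero>\<^bsub>W\<^esub>"
    if "x \<in> carrier (formal_tensors A B)" "y \<in> carrier (formal_tensors A B)" "z \<in> carrier (formal_tensors A B)"
      "f x = f y \<oplus>\<^bsub>W\<^esub> f z" for x y z
  proof -
    have "y + z \<in> carrier (formal_tensors A B)"
      using F.M.a_closed[OF that(2,3)] by (simp add: formal_tensors_def monoid_algebra_simps)
    then have "f (x - (y + z)) = \<zero>\<^bsub>W\<^esub>"
      using that by (intro e) (auto simp: p)
    then show ?thesis by (simp add: diff_diff_eq)
  qed
  have "bilinearity_relations A B \<subseteq> {x \<in> carrier (formal_tensors A B). f x = \<zero>\<^bsub>W\<^esub>}"
    unfolding bilinearity_relations_def
  proof (intro lin_span_minimal submodule_kernel vec_space_formal_tensors W f Un_least subsetI, goal_cases)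
    case (1 x) then show ?case
      by (auto intro!: formal_tensors_diff_closed single_formal_tensors d simp: l)
  next
    case (2 x) then show ?case
      by (auto intro!: formal_tensors_diff_closed single_formal_tensors d simp: r)
  next
    case (3 x) then show ?case using A.smult_closed
      by (auto intro!: formal_tensors_diff_closed single_formal_tensors e simp: l s[symmetric])
  next
    case (4 x) then show ?case using B.smult_closed
      by (auto intro!: formal_tensors_diff_closed single_formal_tensors e simp: r s[symmetric])
  qed
  then show ?thesis using n by blast
qed

end

context
  fixes A :: "('k::field, 'a) module" and B :: "('k, 'b) module"
  assumes A: "vec_space A" and B: "vec_space B"
begin

interpretation A: module ground A by (rule A)
interpretation B: module ground B by (rule B)
interpretation F: module ground "formal_tensors A B" by (rule vec_space_formal_tensors)

lemma vec_space_tensor: "vec_space (tensor A B)"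
  unfolding tensor_def
  by (rule vec_space_quotient[OF vec_space_formal_tensors bilinearity_relations_submodule[OF A B]])

lemma linear_map_tensor_coset:
  "linear_map (formal_tensors A B) (tensor A B) (\<lambda>x. bilinearity_relations A B +>\<^bsub>formal_tensors A B\<^esub> x)"
  unfolding tensor_def
  by (rule linear_map_coset[OF vec_space_formal_tensors bilinearity_relations_submodule[OF A B]])

interpretation T: module ground "tensor A B" by (rule vec_space_tensor)

lemma tens_closed: "a \<in> carrier A \<Longrightarrow> b \<in> carrier B \<Longrightarrow> tens A B a b \<in> carrier (tensor A B)"
  unfolding tens_def by (rule linear_mapD[OF linear_map_tensor_coset single_formal_tensors])

lemma coset_single:
  assumes "a \<in> carrier A" "b \<in> carrier B"
  shows "bilinearity_relations A B +>\<^bsub>formal_tensors A B\<^esub> Poly_Mapping.single (a, b) c = c \<odot>\<^bsub>tensor A B\<^esub> tens A B a b"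
  using linear_mapD(3)[OF linear_map_tensor_coset single_formal_tensors[OF assms], of c 1]
  by (simp add: formal_tensors_def monoid_algebra_simps map_mult_single tens_def)

lemma coset_relation:
  assumes "x - y \<in> bilinearity_relations A B" "x \<in> carrier (formal_tensors A B)" "y \<in> carrier (formal_tensors A B)"
  shows "bilinearity_relations A B +>\<^bsub>formal_tensors A B\<^esub> x = bilinearity_relations A B +>\<^bsub>formal_tensors A B\<^esub> y"
proof -
  let ?c = "\<lambda>x. bilinearity_relations A B +>\<^bsub>formal_tensors A B\<^esub> x"
  have xy: "x - y \<in> carrier (formal_tensors A B)" by (rule formal_tensors_diff_closed[OF assms(2,3)])
  have "?c ((x - y) \<oplus>\<^bsub>formal_tensors A B\<^esub> y) = ?c (x - y) \<oplus>\<^bsub>tensor A B\<^esub> ?c y"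
    by (intro linear_mapD(2)[OF linear_map_tensor_coset] xy assms)
  also have "?c (x - y) = \<zero>\<^bsub>tensor A B\<^esub>"
    unfolding tensor_def
    by (rule coset_eq_zero[OF vec_space_formal_tensors bilinearity_relations_submodule[OF A B] assms(1)])
  also have "(x - y) \<oplus>\<^bsub>formal_tensors A B\<^esub> y = x" by (simp add: formal_tensors_def monoid_algebra_simps)
  finally show ?thesis using linear_mapD(1)[OF linear_map_tensor_coset assms(3)] by simp
qed

lemma coset_relation3:
  assumes "x - y - z \<in> bilinearity_relations A B" "x \<in> carrier (formal_tensors A B)"
    "y \<in> carrier (formal_tensors A B)" "z \<in> carrier (formal_tensors A B)"
  shows "bilinearity_relations A B +>\<^bsub>formal_tensors A B\<^esub> x =
    (bilinearity_relations A B +>\<^bsub>formal_tensors A B\<^esub> y) \<oplus>\<^bsub>tensor A B\<^esub> (bilinearity_relations A B +>\<^bsub>formal_tensors A B\<^esub> z)"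
proof -
  have eq: "y \<oplus>\<^bsub>formal_tensors A B\<^esub> z = y + z" by (simp add: formal_tensors_def monoid_algebra_simps)
  have "y + z \<in> carrier (formal_tensors A B)" using F.M.a_closed[OF assms(3,4)] by (simp add: eq)
  then have "bilinearity_relations A B +>\<^bsub>formal_tensors A B\<^esub> x = bilinearity_relations A B +>\<^bsub>formal_tensors A B\<^esub> (y + z)"
    using assms by (intro coset_relation) (auto simp: diff_diff_eq)
  then show ?thesis
    using linear_mapD(2)[OF linear_map_tensor_coset assms(3,4)] by (simp add: eq)
qed

lemma bilinear_map_tens: "bilinear_map A B (tensor A B) (tens A B)"
proof (intro bilinear_mapI linear_mapI tens_closed)
  note sup = subsetD[OF lin_span_superset]
  fix a assume a: "a \<in> carrier A"
  fix b assume b: "b \<in> carrier B"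
  {
    fix a' assume a': "a' \<in> carrier A"
    show "tens A B (a \<oplus>\<^bsub>A\<^esub> a') b = tens A B a b \<oplus>\<^bsub>tensor A B\<^esub> tens A B a' b"
      unfolding tens_def
      by (rule coset_relation3, unfold bilinearity_relations_def, rule sup)
        (use a a' b in \<open>auto intro!: single_formal_tensors\<close>)
  next
    fix b' assume b': "b' \<in> carrier B"
    show "tens A B a (b \<oplus>\<^bsub>B\<^esub> b') = tens A B a b \<oplus>\<^bsub>tensor A B\<^esub> tens A B a b'"
      unfolding tens_def
      by (rule coset_relation3, unfold bilinearity_relations_def, rule sup)
        (use a b b' in \<open>auto intro!: single_formal_tensors\<close>)
  next
    fix c
    show "tens A B (c \<odot>\<^bsub>A\<^esub> a) b = c \<odot>\<^bsub>tensor A B\<^esub> tens A B a b"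
      unfolding coset_single[OF a b, symmetric] unfolding tens_def
      by (rule coset_relation, unfold bilinearity_relations_def, rule sup)
        (use a b A.smult_closed in \<open>auto intro!: single_formal_tensors\<close>)
    show "tens A B a (c \<odot>\<^bsub>B\<^esub> b) = c \<odot>\<^bsub>tensor A B\<^esub> tens A B a b"
      unfolding coset_single[OF a b, symmetric] unfolding tens_def
      by (rule coset_relation, unfold bilinearity_relations_def, rule sup)
        (use a b B.smult_closed in \<open>auto intro!: single_formal_tensors\<close>)
  }
qed

text \<open>Pure tensors and sums suffice: a scalar is absorbed into the first factor, and zero is
  the pure tensor of two zeros.\<close>

lemma tensor_induct [consumes 1, case_names tens add]:
  assumes t: "t \<in> carrier (tensor A B)"
    and tens: "\<And>a b. a \<in> carrier A \<Longrightarrow> b \<in> carrier B \<Longrightarrow> P (tens A B a b)"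
    and add: "\<And>s t. s \<in> carrier (tensor A B) \<Longrightarrow> t \<in> carrier (tensor A B) \<Longrightarrow> P s \<Longrightarrow> P t \<Longrightarrow>
      P (s \<oplus>\<^bsub>tensor A B\<^esub> t)"
  shows "P t"
proof -
  let ?c = "\<lambda>x. bilinearity_relations A B +>\<^bsub>formal_tensors A B\<^esub> x"
  note bl = linear_mapD(3)[OF bilinear_map_left[OF bilinear_map_tens]]
  have "P (?c x)" if x: "x \<in> carrier (formal_tensors A B)" for x
    using x[unfolded formal_tensors_def]
  proof (induction rule: monoid_algebra_induct)
    case zero
    have "?c 0 = \<zero>\<^bsub>tensor A B\<^esub>"
      using linear_map_zero[OF vec_space_formal_tensors vec_space_tensor linear_map_tensor_coset]
      by (simp add: formal_tensors_def monoid_algebra_simps)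
    also have "\<dots> = tens A B (0 \<odot>\<^bsub>A\<^esub> \<zero>\<^bsub>A\<^esub>) \<zero>\<^bsub>B\<^esub>"
      using bl[of "\<zero>\<^bsub>B\<^esub>" "\<zero>\<^bsub>A\<^esub>" 0] T.smult_l_null[OF tens_closed[of "\<zero>\<^bsub>A\<^esub>" "\<zero>\<^bsub>B\<^esub>"]] by simp
    finally show ?case using A.smult_closed[of 0 "\<zero>\<^bsub>A\<^esub>"] by (simp add: tens)
  next
    case (single u c)
    obtain a b where u: "u = (a, b)" "a \<in> carrier A" "b \<in> carrier B"
      using single by (cases u) auto
    have "?c (Poly_Mapping.single u c) = tens A B (c \<odot>\<^bsub>A\<^esub> a) b"
      using u bl[of b a c] by (simp add: coset_single)
    then show ?case using u A.smult_closed[of c a] by (simp add: tens)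
  next
    case (add x y)
    have x: "x \<in> carrier (formal_tensors A B)" and y: "y \<in> carrier (formal_tensors A B)"
      using add by (simp_all add: formal_tensors_def)
    have "P (?c x \<oplus>\<^bsub>tensor A B\<^esub> ?c y)"
      by (intro assms(3) add linear_mapD(1)[OF linear_map_tensor_coset] x y)
    also have "?c x \<oplus>\<^bsub>tensor A B\<^esub> ?c y = ?c (x + y)"
      using linear_mapD(2)[OF linear_map_tensor_coset x y]
      by (simp add: formal_tensors_def monoid_algebra_simps)
    finally show ?case .
  qed
  moreover obtain x where "x \<in> carrier (formal_tensors A B)" "t = ?c x"
    using t quotient_carrier[OF vec_space_formal_tensors bilinearity_relations_submodule[OF A B]]
    by (auto simp: tensor_def)
  ultimately show ?thesis by simp
qed

lemma tensor_hom_eq: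
  assumes "linear_map (tensor A B) W f" "linear_map (tensor A B) W g"
    and "\<And>a b. a \<in> carrier A \<Longrightarrow> b \<in> carrier B \<Longrightarrow> f (tens A B a b) = g (tens A B a b)"
    and "t \<in> carrier (tensor A B)"
  shows "f t = g t"
  using assms(4)
  by (induction rule: tensor_induct) (simp_all add: assms(3) linear_mapD[OF assms(1)] linear_mapD[OF assms(2)])

context
  fixes W :: "('k, 'w) module" and f
  assumes W: "vec_space W" and f: "bilinear_map A B W f"
begin

interpretation W: module ground W by (rule W)

lemma linear_extension_bilinear:
  "linear_map (formal_tensors A B) W (linear_extension W (\<lambda>(a, b). f a b))"
  unfolding formal_tensors_def
  by (rule linear_map_linear_extension[OF W])
    (auto simp: intro: bilinear_map_closed[OF f])

lemma linear_extension_bilinear_single: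
  "a \<in> carrier A \<Longrightarrow> b \<in> carrier B \<Longrightarrow>
    linear_extension W (\<lambda>(a, b). f a b) (Poly_Mapping.single (a, b) 1) = f a b"
  using W.smult_one[OF bilinear_map_closed[OF f, of a b]] bilinear_map_closed[OF f, of a b]
  by (subst linear_extension_single[OF W]) auto

lemma linear_extension_bilinear_kernel:
  assumes n: "n \<in> bilinearity_relations A B"
  shows "linear_extension W (\<lambda>(a, b). f a b) n = \<zero>\<^bsub>W\<^esub>"
proof (rule bilinearity_relations_kernel[OF A B W linear_extension_bilinear _ n])
  have "linear_map B W (\<lambda>b. linear_extension W (\<lambda>(a, b). f a b) (Poly_Mapping.single (a, b) 1))"
    if a: "a \<in> carrier A" for a
    by (rule iffD1[OF linear_map_cong[OF B] bilinear_map_right[OF f a]])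
      (simp add: linear_extension_bilinear_single a)
  moreover have "linear_map A W (\<lambda>a. linear_extension W (\<lambda>(a, b). f a b) (Poly_Mapping.single (a, b) 1))"
    if b: "b \<in> carrier B" for b
    by (rule iffD1[OF linear_map_cong[OF A] bilinear_map_left[OF f b]])
      (simp add: linear_extension_bilinear_single b)
  ultimately show "bilinear_map A B W
      (\<lambda>a b. linear_extension W (\<lambda>(a, b). f a b) (Poly_Mapping.single (a, b) 1))"
    by (rule bilinear_mapI)
qed

lemma linear_map_tensor_lift: "linear_map (tensor A B) W (tensor_lift W f)"
  unfolding tensor_lift_def[abs_def] tensor_def
  by (rule linear_map_the_elem[OF vec_space_formal_tensors bilinearity_relations_submodule[OF A B]
       W linear_extension_bilinear linear_extension_bilinear_kernel])

lemma tensor_lift_tens: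
  assumes "a \<in> carrier A" "b \<in> carrier B"
  shows "tensor_lift W f (tens A B a b) = f a b"
proof -
  have "tensor_lift W f (tens A B a b) = linear_extension W (\<lambda>(a, b). f a b) (Poly_Mapping.single (a, b) 1)"
    unfolding tensor_lift_def[abs_def] tens_def
    by (rule the_elem_image_coset[OF vec_space_formal_tensors bilinearity_relations_submodule[OF A B]
         W linear_extension_bilinear linear_extension_bilinear_kernel single_formal_tensors[OF assms]])
  then show ?thesis using assms by (simp add: linear_extension_bilinear_single)
qed

lemma tensor_lift_closed: "t \<in> carrier (tensor A B) \<Longrightarrow> tensor_lift W f t \<in> carrier W"
  by (rule linear_mapD[OF linear_map_tensor_lift])

lemma tensor_lift_add:
  "s \<in> carrier (tensor A B) \<Longrightarrow> t \<in> carrier (tensor A B) \<Longrightarrow>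
    tensor_lift W f (s \<oplus>\<^bsub>tensor A B\<^esub> t) = tensor_lift W f s \<oplus>\<^bsub>W\<^esub> tensor_lift W f t"
  by (rule linear_mapD[OF linear_map_tensor_lift])

end

text \<open>This is rewriting under a Sweedler sum, where the equation holds only for arguments in
  the carriers. Bilinearity is asked of one summand and inherited by the other; uses preceded by
  \<open>sym\<close> choose the side whose bilinearity is easier to see.\<close>

lemma tensor_lift_cong:
  assumes W: "vec_space W" and f: "bilinear_map A B W f"
    and eq: "\<And>a b. a \<in> carrier A \<Longrightarrow> b \<in> carrier B \<Longrightarrow> f a b = g a b"
    and t: "t \<in> carrier (tensor A B)"
  shows "tensor_lift W f t = tensor_lift W g t"
proof -
  have "linear_map B W (g a)" if a: "a \<in> carrier A" for a
    by (rule iffD1[OF linear_map_cong[OF B] bilinear_map_right[OF f a]]) (simp add: eq a)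
  moreover have "linear_map A W (\<lambda>a. g a b)" if b: "b \<in> carrier B" for b
    by (rule iffD1[OF linear_map_cong[OF A] bilinear_map_left[OF f b]]) (simp add: eq b)
  ultimately have g: "bilinear_map A B W g" by (rule bilinear_mapI)
  show ?thesis
    by (rule tensor_hom_eq[OF linear_map_tensor_lift[OF W f] linear_map_tensor_lift[OF W g] _ t])
      (simp add: tensor_lift_tens[OF W f] tensor_lift_tens[OF W g] eq)
qed

lemma bilinear_map_compose:
  "linear_map W X L \<Longrightarrow> bilinear_map A B W f \<Longrightarrow> bilinear_map A B X (\<lambda>a b. L (f a b))"
  by (rule bilinear_mapI; rule linear_map_compose[of W X L]) (auto simp: bilinear_map_def)

lemma tensor_lift_linear:
  assumes W: "vec_space W" and X: "vec_space X" and f: "bilinear_map A B W f"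
    and L: "linear_map W X L" and t: "t \<in> carrier (tensor A B)"
  shows "L (tensor_lift W f t) = tensor_lift X (\<lambda>a b. L (f a b)) t"
  by (rule tensor_hom_eq[OF linear_map_compose[OF L linear_map_tensor_lift[OF W f]]
        linear_map_tensor_lift[OF X bilinear_map_compose[OF L f]] _ t])
    (simp add: tensor_lift_tens[OF W f] tensor_lift_tens[OF X bilinear_map_compose[OF L f]])

lemma tensor_lift_add_fun:
  assumes W: "vec_space W" and f: "bilinear_map A B W f" and g: "bilinear_map A B W g"
    and t: "t \<in> carrier (tensor A B)"
  shows "tensor_lift W (\<lambda>a b. f a b \<oplus>\<^bsub>W\<^esub> g a b) t = tensor_lift W f t \<oplus>\<^bsub>W\<^esub> tensor_lift W g t"
proof -
  have fg: "bilinear_map A B W (\<lambda>a b. f a b \<oplus>\<^bsub>W\<^esub> g a b)"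
    by (intro bilinear_mapI linear_map_plus W) (use f g in \<open>auto simp: bilinear_map_def\<close>)
  show ?thesis
    by (rule tensor_hom_eq[OF linear_map_tensor_lift[OF W fg]
        linear_map_plus[OF W linear_map_tensor_lift[OF W f] linear_map_tensor_lift[OF W g]] _ t])
      (simp add: tensor_lift_tens[OF W f] tensor_lift_tens[OF W g] tensor_lift_tens[OF W fg])
qed

text \<open>Here the tensor is fixed and the summand varies, so the universal property does not
  apply directly. Induction on the tensor does: on pure tensors the map is \<open>F x a b\<close>,
  and sums of tensors give pointwise sums of linear maps.\<close>

lemma linear_map_tensor_lift_fun:
  assumes W: "vec_space W" and t: "t \<in> carrier (tensor A B)"
    and bil: "\<And>x. x \<in> carrier X \<Longrightarrow> bilinear_map A B W (F x)"
    and lin: "\<And>a b. a \<in> carrier A \<Longrightarrow> b \<in> carrier B \<Longrightarrow> linear_map X W (\<lambda>x. F x a b)"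
    and X: "vec_space X"
  shows "linear_map X W (\<lambda>x. tensor_lift W (F x) t)"
  using t
proof (induction rule: tensor_induct)
  case (tens a b)
  show ?case
    by (rule iffD1[OF linear_map_cong[OF X] lin[OF tens]]) (simp add: tensor_lift_tens[OF W bil] tens)
next
  case (add s t)
  show ?case
    by (rule iffD1[OF linear_map_cong[OF X] linear_map_plus[OF W add(3,4)]])
      (simp add: tensor_lift_add[OF W bil] add)
qed

end

lemma linear_map_tens_left:
  assumes "vec_space A" "vec_space B" "linear_map X A f" "b \<in> carrier B"
  shows "linear_map X (tensor A B) (\<lambda>x. tens A B (f x) b)"
  by (rule linear_map_bilinear_left[OF bilinear_map_tens[OF assms(1,2)] assms(3,4)])

lemma linear_map_tens_right:
  assumes "vec_space A" "vec_space B" "linear_map X B f" "a \<in> carrier A"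
  shows "linear_map X (tensor A B) (\<lambda>x. tens A B a (f x))"
  by (rule linear_map_bilinear_right[OF bilinear_map_tens[OF assms(1,2)] assms(3,4)])

text \<open>Fubini for independent Sweedler sums. With t fixed both sides are linear in s, and on a
  pure tensor s both reduce to the same sum over t.\<close>

lemma tensor_lift_swap:
  assumes A: "vec_space A" and B: "vec_space B" and C: "vec_space C" and D: "vec_space D" and W: "vec_space W"
    and AB: "\<And>c d. c \<in> carrier C \<Longrightarrow> d \<in> carrier D \<Longrightarrow> bilinear_map A B W (\<lambda>a b. F a b c d)"
    and CD: "\<And>a b. a \<in> carrier A \<Longrightarrow> b \<in> carrier B \<Longrightarrow> bilinear_map C D W (\<lambda>c d. F a b c d)"
    and s: "s \<in> carrier (tensor A B)" and t: "t \<in> carrier (tensor C D)"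
  shows "tensor_lift W (\<lambda>a b. tensor_lift W (\<lambda>c d. F a b c d) t) s =
    tensor_lift W (\<lambda>c d. tensor_lift W (\<lambda>a b. F a b c d) s) t"
proof -
  have bl: "bilinear_map A B W (\<lambda>a b. tensor_lift W (\<lambda>c d. F a b c d) t)"
    by (intro bilinear_mapI linear_map_tensor_lift_fun[OF C D W t] CD A B
        bilinear_map_left[OF AB] bilinear_map_right[OF AB])
  have br: "bilinear_map C D W (\<lambda>c d. tensor_lift W (\<lambda>a b. F a b c d) s)" if "s \<in> carrier (tensor A B)" for s
    by (intro bilinear_mapI linear_map_tensor_lift_fun[OF A B W that] AB C D
        bilinear_map_left[OF CD] bilinear_map_right[OF CD])
  have "linear_map (tensor A B) W (\<lambda>s. tensor_lift W (\<lambda>c d. tensor_lift W (\<lambda>a b. F a b c d) s) t)"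
    by (intro linear_map_tensor_lift_fun[OF C D W t] br linear_map_tensor_lift[OF A B W] AB
        vec_space_tensor A B)
  then show ?thesis
  proof (rule tensor_hom_eq[OF A B linear_map_tensor_lift[OF A B W bl] _ _ s])
    fix a b assume ab: "a \<in> carrier A" "b \<in> carrier B"
    have "tensor_lift W (\<lambda>c d. tensor_lift W (\<lambda>a b. F a b c d) (tens A B a b)) t =
        tensor_lift W (\<lambda>c d. F a b c d) t"
      by (rule tensor_lift_cong[OF C D W br[OF tens_closed[OF A B ab]] _ t])
        (simp add: tensor_lift_tens[OF A B W AB] ab)
    then show "tensor_lift W (\<lambda>a b. tensor_lift W (F a b) t) (tens A B a b) =
        tensor_lift W (\<lambda>c d. tensor_lift W (\<lambda>a b. F a b c d) (tens A B a b)) t"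
      by (simp add: tensor_lift_tens[OF A B W bl ab])
  qed
qed

section \<open>Tensor products of algebras\<close>

context
  fixes A :: "('k::field, 'a) module" and B :: "('k, 'b) module"
  assumes A: "k_algebra A" and B: "k_algebra B"
begin

interpretation A: ring A by (rule k_algebraD[OF A])
interpretation B: ring B by (rule k_algebraD[OF B])

lemma k_algebra_formal_tensors: "k_algebra (formal_tensors A B)"
  unfolding formal_tensors_def
  by (intro k_algebra_monoid_algebra DirProd_monoid A.is_monoid B.is_monoid)

interpretation F: ring "formal_tensors A B" by (rule k_algebraD[OF k_algebra_formal_tensors])

text \<open>The relations are given only as a linear span. Multiplying by a basis element and then
  projecting to the tensor product is bilinear in the other factor, so it kills every relation;
  membership is therefore tested as vanishing in the quotient space.\<close>

lemma bilinearity_relations_ideal: "ideal (bilinearity_relations A B) (formal_tensors A B)"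
proof (rule idealI)
  note A' = k_algebraD(2)[OF A] and B' = k_algebraD(2)[OF B]
  interpret N: abelian_subgroup "bilinearity_relations A B" "formal_tensors A B"
    by (rule abelian_subgroup_submodule[OF vec_space_formal_tensors bilinearity_relations_submodule[OF A' B']])
  show "subgroup (bilinearity_relations A B) (add_monoid (formal_tensors A B))"
    by (rule N.a_subgroup)
  show "ring (formal_tensors A B)" by unfold_locales
  let ?c = "\<lambda>x. bilinearity_relations A B +>\<^bsub>formal_tensors A B\<^esub> x"
  note T = vec_space_tensor[OF A' B']
  note c = linear_map_tensor_coset[OF A' B']
  fix n x assume n: "n \<in> bilinearity_relations A B" and x: "x \<in> carrier (formal_tensors A B)"
  have "?c (x \<otimes>\<^bsub>formal_tensors A B\<^esub> n) = \<zero>\<^bsub>tensor A B\<^esub> \<and> ?c (n \<otimes>\<^bsub>formal_tensors A B\<^esub> x) = \<zero>\<^bsub>tensor A B\<^esub>"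
    using x[unfolded formal_tensors_def]
  proof (induction rule: monoid_algebra_induct)
    case zero
    then show ?case
      using linear_map_zero[OF vec_space_formal_tensors T c]
      by (simp add: formal_tensors_def monoid_algebra_mult_zero monoid_algebra_simps)
  next
    case (single u d)
    obtain a b where u: "u = (a, b)" and a: "a \<in> carrier A" and b: "b \<in> carrier B"
      using single by (cases u) auto
    have s: "Poly_Mapping.single u d \<in> carrier (formal_tensors A B)"
      unfolding u by (rule single_formal_tensors[OF a b])
    have mult: "Poly_Mapping.single u d \<otimes>\<^bsub>formal_tensors A B\<^esub> Poly_Mapping.single (a', b') 1 =
        Poly_Mapping.single (a \<otimes>\<^bsub>A\<^esub> a', b \<otimes>\<^bsub>B\<^esub> b') d"
      "Poly_Mapping.single (a', b') 1 \<otimes>\<^bsub>formal_tensors A B\<^esub> Poly_Mapping.single u d =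
        Poly_Mapping.single (a' \<otimes>\<^bsub>A\<^esub> a, b' \<otimes>\<^bsub>B\<^esub> b) d" for a' b'
      by (simp_all add: formal_tensors_def monoid_algebra_mult_single u)
    have "?c (Poly_Mapping.single u d \<otimes>\<^bsub>formal_tensors A B\<^esub> n) = \<zero>\<^bsub>tensor A B\<^esub>"
    proof (rule bilinearity_relations_kernel[OF A' B' T _ _ n])
      show "linear_map (formal_tensors A B) (tensor A B) (\<lambda>n. ?c (Poly_Mapping.single u d \<otimes>\<^bsub>formal_tensors A B\<^esub> n))"
        by (rule linear_map_compose[OF c linear_map_mult_left[OF k_algebra_formal_tensors linear_map_id s]])
      have "bilinear_map A B (tensor A B) (\<lambda>a' b'. d \<odot>\<^bsub>tensor A B\<^esub> tens A B (a \<otimes>\<^bsub>A\<^esub> a') (b \<otimes>\<^bsub>B\<^esub> b'))"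
        by (intro bilinear_mapI linear_map_smult linear_map_tens_left linear_map_tens_right
          linear_map_mult_left linear_map_id T A B A' B' A.m_closed B.m_closed a b)
      then show "bilinear_map A B (tensor A B) (\<lambda>a' b'. ?c (Poly_Mapping.single u d \<otimes>\<^bsub>formal_tensors A B\<^esub> Poly_Mapping.single (a', b') 1))"
        unfolding mult
        by (rule iffD1[OF bilinear_map_cong[OF A' B'], rotated]) (simp add: coset_single[OF A' B'] a b)
    qed
    moreover have "?c (n \<otimes>\<^bsub>formal_tensors A B\<^esub> Poly_Mapping.single u d) = \<zero>\<^bsub>tensor A B\<^esub>"
    proof (rule bilinearity_relations_kernel[OF A' B' T _ _ n])
      show "linear_map (formal_tensors A B) (tensor A B) (\<lambda>n. ?c (n \<otimes>\<^bsub>formal_tensors A B\<^esub> Poly_Mapping.single u d))"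
        by (rule linear_map_compose[OF c linear_map_mult_right[OF k_algebra_formal_tensors linear_map_id s]])
      have "bilinear_map A B (tensor A B) (\<lambda>a' b'. d \<odot>\<^bsub>tensor A B\<^esub> tens A B (a' \<otimes>\<^bsub>A\<^esub> a) (b' \<otimes>\<^bsub>B\<^esub> b))"
        by (intro bilinear_mapI linear_map_smult linear_map_tens_left linear_map_tens_right
          linear_map_mult_right linear_map_id T A B A' B' A.m_closed B.m_closed a b)
      then show "bilinear_map A B (tensor A B) (\<lambda>a' b'. ?c (Poly_Mapping.single (a', b') 1 \<otimes>\<^bsub>formal_tensors A B\<^esub> Poly_Mapping.single u d))"
        unfolding mult
        by (rule iffD1[OF bilinear_map_cong[OF A' B'], rotated]) (simp add: coset_single[OF A' B'] a b)
    qed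
    ultimately show ?case by blast
  next
    case (add x y)
    interpret T: module ground "tensor A B" by (rule T)
    have xy: "x \<in> carrier (formal_tensors A B)" "y \<in> carrier (formal_tensors A B)"
      using add by (simp_all add: formal_tensors_def)
    have "x + y = x \<oplus>\<^bsub>formal_tensors A B\<^esub> y" by (simp add: formal_tensors_def monoid_algebra_simps)
    then show ?case using add xy n N.a_Hcarr[OF n]
      by (simp add: F.l_distr F.r_distr linear_mapD(2)[OF c])
  qed
  then show "x \<otimes>\<^bsub>formal_tensors A B\<^esub> n \<in> bilinearity_relations A B" "n \<otimes>\<^bsub>formal_tensors A B\<^esub> x \<in> bilinearity_relations A B"
    using coset_eq_zeroD[OF vec_space_formal_tensors bilinearity_relations_submodule[OF A' B']]
      N.a_Hcarr[OF n] x by (auto simp: tensor_def)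
qed

lemma k_algebra_tensor: "k_algebra (tensor A B)"
  unfolding tensor_def
  by (rule k_algebra_quotient[OF k_algebra_formal_tensors bilinearity_relations_ideal])

lemma tens_mult:
  assumes "a \<in> carrier A" "b \<in> carrier B" "a' \<in> carrier A" "b' \<in> carrier B"
  shows "tens A B a b \<otimes>\<^bsub>tensor A B\<^esub> tens A B a' b' = tens A B (a \<otimes>\<^bsub>A\<^esub> a') (b \<otimes>\<^bsub>B\<^esub> b')"
  using quotient_mult[OF k_algebra_formal_tensors bilinearity_relations_ideal
      single_formal_tensors[OF assms(1,2), of 1] single_formal_tensors[OF assms(3,4), of 1]]
  unfolding tens_def tensor_def
  by (simp only: formal_tensors_def monoid_algebra_mult_single mult_DirProd mult_1)

lemma tens_one: "tens A B \<one>\<^bsub>A\<^esub> \<one>\<^bsub>B\<^esub> = \<one>\<^bsub>tensor A B\<^esub>"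
  unfolding tens_def tensor_def quotient_one[OF k_algebra_formal_tensors bilinearity_relations_ideal]
  by (simp only: formal_tensors_def monoid_algebra_simps one_DirProd)

end

section \<open>The enveloping algebra\<close>

lemma algebra_homI:
  assumes "linear_map A A' f"
    and "\<And>x y. x \<in> carrier A \<Longrightarrow> y \<in> carrier A \<Longrightarrow> f (x \<otimes>\<^bsub>A\<^esub> y) = f x \<otimes>\<^bsub>A'\<^esub> f y"
    and "f \<one>\<^bsub>A\<^esub> = \<one>\<^bsub>A'\<^esub>"
  shows "algebra_hom A A' f"
  using assms by (auto simp: algebra_hom_def intro!: ring_hom_memI dest: linear_mapD)

lemma algebra_homD:
  assumes "algebra_hom A A' f"
  shows "linear_map A A' f"
    and "\<And>x y. x \<in> carrier A \<Longrightarrow> y \<in> carrier A \<Longrightarrow> f (x \<otimes>\<^bsub>A\<^esub> y) = f x \<otimes>\<^bsub>A'\<^esub> f y"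
    and "f \<one>\<^bsub>A\<^esub> = \<one>\<^bsub>A'\<^esub>"
  using assms by (auto simp: algebra_hom_def ring_hom_mult ring_hom_one)

lemma algebra_hom_kernel_ideal:
  assumes A: "k_algebra A" and A': "k_algebra A'" and f: "algebra_hom A A' f"
  shows "ideal {x \<in> carrier A. f x = \<zero>\<^bsub>A'\<^esub>} A"
proof -
  have "ring_hom_ring A A' f"
    using f by (intro ring_hom_ringI2 k_algebraD[OF A] k_algebraD[OF A']) (simp add: algebra_hom_def)
  then have "ideal (a_kernel A A' f) A" by (rule ring_hom_ring.kernel_is_ideal)
  then show ?thesis by (simp add: a_kernel_def')
qed

lemma linear_map_monoid_algebra_diff:
  assumes W: "vec_space W" and f: "linear_map (monoid_algebra G) W f"
    and x: "x \<in> carrier (monoid_algebra G)" and y: "y \<in> carrier (monoid_algebra G)"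
  shows "f (x - y) = f x \<ominus>\<^bsub>W\<^esub> f y"
proof -
  interpret W: module ground W by (rule W)
  have xy: "x - y \<in> carrier (monoid_algebra G)" by (rule monoid_algebra_diff_closed[OF x y])
  have "f ((x - y) \<oplus>\<^bsub>monoid_algebra G\<^esub> y) = f (x - y) \<oplus>\<^bsub>W\<^esub> f y"
    by (rule linear_mapD(2)[OF f xy y])
  then have "f x = f (x - y) \<oplus>\<^bsub>W\<^esub> f y" by (simp add: monoid_algebra_simps)
  then show ?thesis
    using linear_mapD(1)[OF f xy] linear_mapD(1)[OF f y]
    by (simp add: a_minus_def W.M.a_assoc W.M.r_neg)
qed

lemma algebra_hom_linear_extension:
  fixes G :: "('g, 'm) monoid_scheme" and A :: "('k::field, 'a) module"
  assumes G: "Group.monoid G" and A: "k_algebra A"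
    and closed: "\<And>u. u \<in> carrier G \<Longrightarrow> f u \<in> carrier A"
    and mult: "\<And>u v. u \<in> carrier G \<Longrightarrow> v \<in> carrier G \<Longrightarrow> f (u \<otimes>\<^bsub>G\<^esub> v) = f u \<otimes>\<^bsub>A\<^esub> f v"
    and one: "f \<one>\<^bsub>G\<^esub> = \<one>\<^bsub>A\<^esub>"
  shows "algebra_hom (monoid_algebra G) A (linear_extension A f)"
proof -
  interpret A: ring A by (rule k_algebraD[OF A])
  interpret AV: module ground A by (rule k_algebraD[OF A])
  have lin: "linear_map (monoid_algebra G) A (linear_extension A f)"
    by (rule linear_map_linear_extension[OF k_algebraD(2)[OF A] closed])
  note LE = linear_mapD[OF lin, unfolded monoid_algebra_simps(4)]
  have LE_zero: "linear_extension A f 0 = \<zero>\<^bsub>A\<^esub>"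
    by (simp add: linear_extension_def)
  have LE_single: "linear_extension A f (Poly_Mapping.single u c) = c \<odot>\<^bsub>A\<^esub> f u" if "f u \<in> carrier A" for u c
    by (rule linear_extension_single[where f = f, OF k_algebraD(2)[OF A] that])
  show ?thesis
  proof (rule algebra_homI[OF lin])
    show "linear_extension A f \<one>\<^bsub>monoid_algebra G\<^esub> = \<one>\<^bsub>A\<^esub>"
      using AV.smult_one[of "\<one>\<^bsub>A\<^esub>"] by (simp add: LE_single one monoid_algebra_simps)
    fix x y :: "'g \<Rightarrow>\<^sub>0 'k"
    assume x: "x \<in> carrier (monoid_algebra G)" and y: "y \<in> carrier (monoid_algebra G)"
    have smult: "(c \<odot>\<^bsub>A\<^esub> a) \<otimes>\<^bsub>A\<^esub> (d \<odot>\<^bsub>A\<^esub> b) = (c * d) \<odot>\<^bsub>A\<^esub> (a \<otimes>\<^bsub>A\<^esub> b)"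
      if "a \<in> carrier A" "b \<in> carrier A" for a b c d
      using that AV.smult_closed[of d b] AV.smult_assoc1[of d c "a \<otimes>\<^bsub>A\<^esub> b"]
      by (simp add: k_algebraD(3,4)[OF A] mult.commute)
    note simps = LE_zero LE_single monoid_algebra_mult_zero monoid_algebra_mult_single
      monoid_algebra_mult_add_left monoid_algebra_mult_add_right
    have mult_closed: "x \<otimes>\<^bsub>monoid_algebra G\<^esub> y \<in> carrier (monoid_algebra G)"
      if "x \<in> carrier (monoid_algebra G)" "y \<in> carrier (monoid_algebra G)" for x y :: "'g \<Rightarrow>\<^sub>0 'k"
      using that monoid.m_closed[OF ring.is_monoid[OF k_algebraD(1)[OF k_algebra_monoid_algebra[OF G]]]] by blast
    have sx: "linear_extension A f (Poly_Mapping.single u c \<otimes>\<^bsub>monoid_algebra G\<^esub> y) =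
        linear_extension A f (Poly_Mapping.single u c) \<otimes>\<^bsub>A\<^esub> linear_extension A f y"
      if u: "u \<in> carrier G" for u c
      using y
    proof (induction rule: monoid_algebra_induct)
      case zero
      then show ?case using closed[OF u] AV.smult_closed[of c "f u"] by (simp add: simps)
    next
      case (single v d)
      then show ?case using u by (simp add: simps closed mult smult)
    next
      case (add v w)
      then show ?case
        using LE(1)[OF single_closed[OF u]] LE(1) mult_closed[OF single_closed[OF u]]
        by (simp add: simps LE(2) A.r_distr del: LE_single)
    qed
    show "linear_extension A f (x \<otimes>\<^bsub>monoid_algebra G\<^esub> y) = linear_extension A f x \<otimes>\<^bsub>A\<^esub> linear_extension A f y"
      using x
    proof (induction rule: monoid_algebra_induct)
      case zero
      then show ?case using LE(1)[OF y] by (simp add: simps)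
    next
      case (single u c)
      then show ?case by (rule sx)
    next
      case (add v w)
      then show ?case using LE(1) y mult_closed by (simp add: simps LE(2) A.l_distr)
    qed
  qed
qed

lemma minus_eq_zero_iff:
  assumes "abelian_group G" "x \<in> carrier G" "y \<in> carrier G"
  shows "x \<ominus>\<^bsub>G\<^esub> y = \<zero>\<^bsub>G\<^esub> \<longleftrightarrow> x = y"
  using minus_eq_zeroD[OF assms] abelian_group.r_neg[OF assms(1,3)] by (auto simp: a_minus_def)

text \<open>Turns commutator relations into equations between sums, which can be handled by
  associativity and commutativity without additive inverses.\<close>

lemma eq_minus_iff:
  assumes "abelian_group G" "x \<in> carrier G" "y \<in> carrier G" "z \<in> carrier G"
  shows "x = y \<ominus>\<^bsub>G\<^esub> z \<longleftrightarrow> y = x \<oplus>\<^bsub>G\<^esub> z"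
proof -
  interpret abelian_group G by fact
  show ?thesis using assms(2-4)
    by (auto simp: a_minus_def a_assoc r_neg l_neg)
qed

lemma monoid_free_monoid: "Group.monoid (free_monoid X)"
  by (rule monoidI) (auto simp: free_monoid_def)

lemma free_monoid_simps:
  "carrier (free_monoid X) = lists X" "u \<otimes>\<^bsub>free_monoid X\<^esub> v = u @ v" "\<one>\<^bsub>free_monoid X\<^esub> = []"
  by (simp_all add: free_monoid_def)

lemma k_algebra_env_free: "k_algebra (env_free B)"
  unfolding env_free_def by (rule k_algebra_monoid_algebra[OF monoid_free_monoid])

section \<open>Poisson algebras and the defining relations of the enveloping algebra\<close>

locale poisson =
  fixes B :: "('k::field, 'b) module" and br :: "'b \<Rightarrow> 'b \<Rightarrow> 'b"
  assumes poisson: "poisson_algebra B br"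
begin

lemma k_algebra_B: "k_algebra B"
proof -
  interpret algebra "ground :: ('k, 'k) module" B using poisson by (simp add: poisson_algebra_def)
  have "x \<otimes>\<^bsub>B\<^esub> (c \<odot>\<^bsub>B\<^esub> y) = c \<odot>\<^bsub>B\<^esub> (x \<otimes>\<^bsub>B\<^esub> y)" if "x \<in> carrier B" "y \<in> carrier B" for c x y
    using that smult_assoc2[of c y x] m_comm by simp
  then show ?thesis
    using smult_assoc2 by (intro k_algebraI) (auto intro: module_axioms ring_axioms)
qed

lemma cring_B: "cring B"
  using poisson by (auto simp: poisson_algebra_def intro: algebra.M_cring)

lemma vec_space_B: "vec_space B"
  by (rule k_algebraD[OF k_algebra_B])

sublocale B: cring B by (rule cring_B)
sublocale BV: module ground B by (rule vec_space_B)

lemma smult_closed_B [simp, intro]: "x \<in> carrier B \<Longrightarrow> c \<odot>\<^bsub>B\<^esub> x \<in> carrier B"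
  by (rule BV.smult_closed) simp_all

lemma bilinear_br: "bilinear_map B B B br"
  using poisson by (simp add: poisson_algebra_def)

lemma br_closed [simp, intro]: "x \<in> carrier B \<Longrightarrow> y \<in> carrier B \<Longrightarrow> br x y \<in> carrier B"
  by (rule bilinear_map_closed[OF bilinear_br])

lemmas br_right = linear_mapD(2,3)[OF bilinear_map_right[OF bilinear_br]]
lemmas br_left = linear_mapD(2,3)[OF bilinear_map_left[OF bilinear_br]]

lemma br_self: "x \<in> carrier B \<Longrightarrow> br x x = \<zero>\<^bsub>B\<^esub>"
  using poisson by (simp add: poisson_algebra_def)

text \<open>Polarization of {x + y, x + y} = 0.\<close>

lemma br_antisym_add:
  assumes "x \<in> carrier B" "y \<in> carrier B"
  shows "br x y \<oplus>\<^bsub>B\<^esub> br y x = \<zero>\<^bsub>B\<^esub>"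
  using br_self[of "x \<oplus>\<^bsub>B\<^esub> y"] assms
  by (simp add: br_left br_right br_self[OF assms(1)] br_self[OF assms(2)] B.a_comm)

lemma br_antisym:
  assumes "x \<in> carrier B" "y \<in> carrier B"
  shows "br y x = \<ominus>\<^bsub>B\<^esub> br x y"
  using br_antisym_add[OF assms(2,1)] assms B.minus_equality[of "br y x" "br x y"] by simp

lemma br_jacobi:
  "a \<in> carrier B \<Longrightarrow> b \<in> carrier B \<Longrightarrow> c \<in> carrier B \<Longrightarrow>
    br a (br b c) \<oplus>\<^bsub>B\<^esub> br b (br c a) \<oplus>\<^bsub>B\<^esub> br c (br a b) = \<zero>\<^bsub>B\<^esub>"
  using poisson by (simp add: poisson_algebra_def)

lemma br_mult_right:
  "a \<in> carrier B \<Longrightarrow> b \<in> carrier B \<Longrightarrow> c \<in> carrier B \<Longrightarrow>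
    br a (b \<otimes>\<^bsub>B\<^esub> c) = br a b \<otimes>\<^bsub>B\<^esub> c \<oplus>\<^bsub>B\<^esub> b \<otimes>\<^bsub>B\<^esub> br a c"
  using poisson by (simp add: poisson_algebra_def)

lemma br_mult_left:
  assumes "a \<in> carrier B" "b \<in> carrier B" "c \<in> carrier B"
  shows "br (a \<otimes>\<^bsub>B\<^esub> b) c = br a c \<otimes>\<^bsub>B\<^esub> b \<oplus>\<^bsub>B\<^esub> a \<otimes>\<^bsub>B\<^esub> br b c"
  using assms by (simp add: br_antisym[of c] br_mult_right B.l_minus B.r_minus B.minus_add)

lemma br_one: assumes "x \<in> carrier B" shows "br x \<one>\<^bsub>B\<^esub> = \<zero>\<^bsub>B\<^esub>"
proof -
  have "br x \<one>\<^bsub>B\<^esub> = br x \<one>\<^bsub>B\<^esub> \<oplus>\<^bsub>B\<^esub> br x \<one>\<^bsub>B\<^esub>"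
    using br_mult_right[of x "\<one>\<^bsub>B\<^esub>" "\<one>\<^bsub>B\<^esub>"] assms by simp
  then show ?thesis using assms B.add.l_cancel_one'[of "br x \<one>\<^bsub>B\<^esub>" "br x \<one>\<^bsub>B\<^esub>"] by simp
qed

abbreviation E where "E \<equiv> env B br"
abbreviation m where "m \<equiv> env_m B br"
abbreviation h where "h \<equiv> env_h B br"
abbreviation relation_ideal where "relation_ideal \<equiv> Idl\<^bsub>env_free B\<^esub> (env_relations B br)"

lemma gen_closed:
  "x \<in> carrier B \<Longrightarrow> Poly_Mapping.single [gen_m x] c \<in> carrier (env_free B)"
  "x \<in> carrier B \<Longrightarrow> Poly_Mapping.single [gen_h x] c \<in> carrier (env_free B)"
  unfolding env_free_def by (auto intro!: single_closed simp: free_monoid_simps)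

interpretation F: ring "env_free B" by (rule k_algebraD[OF k_algebra_env_free])

lemma env_free_diff_closed:
  "x \<in> carrier (env_free B) \<Longrightarrow> y \<in> carrier (env_free B) \<Longrightarrow> x - y \<in> carrier (env_free B)"
  unfolding env_free_def by (rule monoid_algebra_diff_closed)

lemma env_free_plus: "x + y = x \<oplus>\<^bsub>env_free B\<^esub> y"
  by (simp add: env_free_def monoid_algebra_simps)

lemma env_relations_closed: "env_relations B br \<subseteq> carrier (env_free B)"
proof -
  interpret V: module ground "env_free B" by (rule k_algebraD[OF k_algebra_env_free])
  show ?thesis
    unfolding env_relations_def Let_def env_free_plus using V.smult_closed
    by (auto intro!: env_free_diff_closed gen_closed F.a_closed F.m_closed F.one_closed)
qed

lemma relation_ideal: "ideal relation_ideal (env_free B)"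
  by (rule F.genideal_ideal[OF env_relations_closed])

lemma k_algebra_E: "k_algebra E"
  unfolding env_def by (rule k_algebra_quotient[OF k_algebra_env_free relation_ideal])

lemma vec_space_E: "vec_space E"
  by (rule k_algebraD[OF k_algebra_E])

sublocale E: ring E by (rule k_algebraD[OF k_algebra_E])
sublocale EV: module ground E by (rule vec_space_E)

lemma smult_closed_E [simp, intro]: "x \<in> carrier E \<Longrightarrow> c \<odot>\<^bsub>E\<^esub> x \<in> carrier E"
  by (rule EV.smult_closed) simp_all

lemma algebra_hom_env_coset: "algebra_hom (env_free B) E (\<lambda>x. relation_ideal +>\<^bsub>env_free B\<^esub> x)"
  unfolding env_def
  by (intro algebra_homI linear_map_coset k_algebraD[OF k_algebra_env_free]
      submodule_ideal[OF k_algebra_env_free relation_ideal])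
    (simp_all add: quotient_mult[OF k_algebra_env_free relation_ideal] quotient_one[OF k_algebra_env_free relation_ideal])

lemma m_closed [simp, intro]: "x \<in> carrier B \<Longrightarrow> m x \<in> carrier E"
  unfolding env_m_def by (intro linear_mapD(1)[OF algebra_homD(1)[OF algebra_hom_env_coset]] gen_closed)

lemma h_closed [simp, intro]: "x \<in> carrier B \<Longrightarrow> h x \<in> carrier E"
  unfolding env_h_def by (intro linear_mapD(1)[OF algebra_homD(1)[OF algebra_hom_env_coset]] gen_closed)

text \<open>The relations with the addition of polynomials replaced by that of the record, to which
  the rules for algebra homomorphisms apply. \<open>env_relations_cases\<close> is the matching
  elimination rule.\<close>

lemma env_relationsI:
  fixes c :: 'k
  assumes x: "x \<in> carrier B"
  defines "M \<equiv> \<lambda>x. Poly_Mapping.single [gen_m x] 1 :: ('k, 'b) noncomm_poly"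
    and "H \<equiv> \<lambda>x. Poly_Mapping.single [gen_h x] 1 :: ('k, 'b) noncomm_poly"
  shows "M (c \<odot>\<^bsub>B\<^esub> x) - c \<odot>\<^bsub>env_free B\<^esub> M x \<in> env_relations B br"
    and "H (c \<odot>\<^bsub>B\<^esub> x) - c \<odot>\<^bsub>env_free B\<^esub> H x \<in> env_relations B br"
    and "M \<one>\<^bsub>B\<^esub> - \<one>\<^bsub>env_free B\<^esub> \<in> env_relations B br"
    and "y \<in> carrier B \<Longrightarrow> M (x \<oplus>\<^bsub>B\<^esub> y) - (M x \<oplus>\<^bsub>env_free B\<^esub> M y) \<in> env_relations B br"
    and "y \<in> carrier B \<Longrightarrow> H (x \<oplus>\<^bsub>B\<^esub> y) - (H x \<oplus>\<^bsub>env_free B\<^esub> H y) \<in> env_relations B br"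
    and "y \<in> carrier B \<Longrightarrow> M (x \<otimes>\<^bsub>B\<^esub> y) - M x \<otimes>\<^bsub>env_free B\<^esub> M y \<in> env_relations B br"
    and "y \<in> carrier B \<Longrightarrow> H (x \<otimes>\<^bsub>B\<^esub> y) - (M y \<otimes>\<^bsub>env_free B\<^esub> H x \<oplus>\<^bsub>env_free B\<^esub> M x \<otimes>\<^bsub>env_free B\<^esub> H y) \<in> env_relations B br"
    and "y \<in> carrier B \<Longrightarrow> H (br x y) - (H x \<otimes>\<^bsub>env_free B\<^esub> H y - H y \<otimes>\<^bsub>env_free B\<^esub> H x) \<in> env_relations B br"
    and "y \<in> carrier B \<Longrightarrow> M (br x y) - (H x \<otimes>\<^bsub>env_free B\<^esub> M y - M y \<otimes>\<^bsub>env_free B\<^esub> H x) \<in> env_relations B br"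
  unfolding env_relations_def Let_def env_free_plus[symmetric] M_def H_def Un_iff mem_Collect_eq
  using x by blast+

lemma env_relations_cases [consumes 1, case_names m_add m_smult h_add h_smult m_mult h_br h_mult m_br m_one]:
  fixes P :: "('k, 'b) noncomm_poly \<Rightarrow> bool"
  defines "M \<equiv> \<lambda>x. Poly_Mapping.single [gen_m x] 1 :: ('k, 'b) noncomm_poly"
    and "H \<equiv> \<lambda>x. Poly_Mapping.single [gen_h x] 1 :: ('k, 'b) noncomm_poly"
  assumes n: "n \<in> env_relations B br"
    and rel: "\<And>x y. x \<in> carrier B \<Longrightarrow> y \<in> carrier B \<Longrightarrow> P (M (x \<oplus>\<^bsub>B\<^esub> y) - (M x \<oplus>\<^bsub>env_free B\<^esub> M y))"
    "\<And>c x. x \<in> carrier B \<Longrightarrow> P (M (c \<odot>\<^bsub>B\<^esub> x) - c \<odot>\<^bsub>env_free B\<^esub> M x)"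
    "\<And>x y. x \<in> carrier B \<Longrightarrow> y \<in> carrier B \<Longrightarrow> P (H (x \<oplus>\<^bsub>B\<^esub> y) - (H x \<oplus>\<^bsub>env_free B\<^esub> H y))"
    "\<And>c x. x \<in> carrier B \<Longrightarrow> P (H (c \<odot>\<^bsub>B\<^esub> x) - c \<odot>\<^bsub>env_free B\<^esub> H x)"
    "\<And>x y. x \<in> carrier B \<Longrightarrow> y \<in> carrier B \<Longrightarrow> P (M (x \<otimes>\<^bsub>B\<^esub> y) - M x \<otimes>\<^bsub>env_free B\<^esub> M y)"
    "\<And>x y. x \<in> carrier B \<Longrightarrow> y \<in> carrier B \<Longrightarrow> P (H (br x y) - (H x \<otimes>\<^bsub>env_free B\<^esub> H y - H y \<otimes>\<^bsub>env_free B\<^esub> H x))"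
    "\<And>x y. x \<in> carrier B \<Longrightarrow> y \<in> carrier B \<Longrightarrow> P (H (x \<otimes>\<^bsub>B\<^esub> y) - (M y \<otimes>\<^bsub>env_free B\<^esub> H x \<oplus>\<^bsub>env_free B\<^esub> M x \<otimes>\<^bsub>env_free B\<^esub> H y))"
    "\<And>x y. x \<in> carrier B \<Longrightarrow> y \<in> carrier B \<Longrightarrow> P (M (br x y) - (H x \<otimes>\<^bsub>env_free B\<^esub> M y - M y \<otimes>\<^bsub>env_free B\<^esub> H x))"
    "P (M \<one>\<^bsub>B\<^esub> - \<one>\<^bsub>env_free B\<^esub>)"
  shows "P n"
proof -
  note rel = rel[unfolded M_def H_def]
  show ?thesis
    using n unfolding env_relations_def Let_def Un_iff mem_Collect_eq singleton_iff env_free_plus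
    by (elim disjE exE conjE) (simp_all only: rel)
qed

lemma env_relation_eq:
  assumes "x - y \<in> env_relations B br" "x \<in> carrier (env_free B)" "y \<in> carrier (env_free B)"
  shows "relation_ideal +>\<^bsub>env_free B\<^esub> x = relation_ideal +>\<^bsub>env_free B\<^esub> y"
proof -
  let ?c = "\<lambda>x. relation_ideal +>\<^bsub>env_free B\<^esub> x"
  note c = algebra_homD(1)[OF algebra_hom_env_coset]
  have "x - y \<in> relation_ideal" using F.genideal_self[OF env_relations_closed] assms(1) by blast
  then have "?c (x - y) = \<zero>\<^bsub>E\<^esub>"
    unfolding env_def
    by (rule coset_eq_zero[OF k_algebraD(2)[OF k_algebra_env_free] submodule_ideal[OF k_algebra_env_free relation_ideal]])
  also have "?c (x - y) = ?c x \<ominus>\<^bsub>E\<^esub> ?c y"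
    using linear_map_monoid_algebra_diff[OF vec_space_E, of _ "\<lambda>x. ?c x" x y] c assms(2,3)
    unfolding env_free_def by blast
  finally show ?thesis
    using linear_mapD(1)[OF c] assms(2,3) E.is_abelian_group by (auto simp: minus_eq_zero_iff)
qed

text \<open>The two commutator relations are put in the form "left product = correction + product in
  the opposite order", so that they can be used to move an \<open>h\<close> to the right of another
  generator.\<close>

lemma
  assumes x: "x \<in> carrier B" and y: "y \<in> carrier B"
  shows m_add: "m (x \<oplus>\<^bsub>B\<^esub> y) = m x \<oplus>\<^bsub>E\<^esub> m y"
    and h_add: "h (x \<oplus>\<^bsub>B\<^esub> y) = h x \<oplus>\<^bsub>E\<^esub> h y"
    and m_mult: "m (x \<otimes>\<^bsub>B\<^esub> y) = m x \<otimes>\<^bsub>E\<^esub> m y"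
    and h_mult: "h (x \<otimes>\<^bsub>B\<^esub> y) = m y \<otimes>\<^bsub>E\<^esub> h x \<oplus>\<^bsub>E\<^esub> m x \<otimes>\<^bsub>E\<^esub> h y"
    and h_h: "h x \<otimes>\<^bsub>E\<^esub> h y = h (br x y) \<oplus>\<^bsub>E\<^esub> h y \<otimes>\<^bsub>E\<^esub> h x"
    and h_m: "h x \<otimes>\<^bsub>E\<^esub> m y = m (br x y) \<oplus>\<^bsub>E\<^esub> m y \<otimes>\<^bsub>E\<^esub> h x"
proof -
  let ?c = "\<lambda>x. relation_ideal +>\<^bsub>env_free B\<^esub> x"
  let ?M = "\<lambda>x. Poly_Mapping.single [gen_m x] 1 :: ('k, 'b) noncomm_poly"
  let ?H = "\<lambda>x. Poly_Mapping.single [gen_h x] 1 :: ('k, 'b) noncomm_poly"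
  note hom = algebra_homD[OF algebra_hom_env_coset]
  note lin = linear_mapD[OF hom(1)]
  interpret V: module ground "env_free B" by (rule k_algebraD[OF k_algebra_env_free])
  have sc: "c \<odot>\<^bsub>env_free B\<^esub> x \<in> carrier (env_free B)" if "x \<in> carrier (env_free B)" for c x
    using that by (intro V.smult_closed) auto
  have c_diff: "?c (x - y) = ?c x \<ominus>\<^bsub>E\<^esub> ?c y"
    if "x \<in> carrier (env_free B)" "y \<in> carrier (env_free B)" for x y
    using linear_map_monoid_algebra_diff[OF vec_space_E, of _ "\<lambda>x. ?c x" x y] hom(1) that
    unfolding env_free_def by blast
  note cl = x y gen_closed env_free_diff_closed F.a_closed F.m_closed F.one_closed sc
  have gen: "?c (?M x) = m x" "?c (?H x) = h x" for x by (simp_all add: env_m_def env_h_def)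
  have comm: "a = b \<ominus>\<^bsub>E\<^esub> d \<Longrightarrow> b = a \<oplus>\<^bsub>E\<^esub> d" if "a \<in> carrier E" "b \<in> carrier E" "d \<in> carrier E" for a b d
    using eq_minus_iff[OF E.is_abelian_group that] by simp
  have "?c (?M (x \<oplus>\<^bsub>B\<^esub> y)) = ?c (?M x \<oplus>\<^bsub>env_free B\<^esub> ?M y)"
    by (intro env_relation_eq[OF env_relationsI(4)[OF x y]] cl B.a_closed B.m_closed br_closed smult_closed_B)
  then show "m (x \<oplus>\<^bsub>B\<^esub> y) = m x \<oplus>\<^bsub>E\<^esub> m y" by (simp add: lin cl gen)
  have "?c (?H (x \<oplus>\<^bsub>B\<^esub> y)) = ?c (?H x \<oplus>\<^bsub>env_free B\<^esub> ?H y)"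
    by (intro env_relation_eq[OF env_relationsI(5)[OF x y]] cl B.a_closed B.m_closed br_closed smult_closed_B)
  then show "h (x \<oplus>\<^bsub>B\<^esub> y) = h x \<oplus>\<^bsub>E\<^esub> h y" by (simp add: lin cl gen)
  have "?c (?M (x \<otimes>\<^bsub>B\<^esub> y)) = ?c (?M x \<otimes>\<^bsub>env_free B\<^esub> ?M y)"
    by (intro env_relation_eq[OF env_relationsI(6)[OF x y]] cl B.a_closed B.m_closed br_closed smult_closed_B)
  then show "m (x \<otimes>\<^bsub>B\<^esub> y) = m x \<otimes>\<^bsub>E\<^esub> m y" by (simp add: hom(2) cl gen)
  have "?c (?H (x \<otimes>\<^bsub>B\<^esub> y)) = ?c (?M y \<otimes>\<^bsub>env_free B\<^esub> ?H x \<oplus>\<^bsub>env_free B\<^esub> ?M x \<otimes>\<^bsub>env_free B\<^esub> ?H y)"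
    by (intro env_relation_eq[OF env_relationsI(7)[OF x y]] cl B.a_closed B.m_closed br_closed smult_closed_B)
  then show "h (x \<otimes>\<^bsub>B\<^esub> y) = m y \<otimes>\<^bsub>E\<^esub> h x \<oplus>\<^bsub>E\<^esub> m x \<otimes>\<^bsub>E\<^esub> h y" by (simp add: hom(2) lin cl gen)
  have "?c (?H (br x y)) = ?c (?H x \<otimes>\<^bsub>env_free B\<^esub> ?H y - ?H y \<otimes>\<^bsub>env_free B\<^esub> ?H x)"
    by (intro env_relation_eq[OF env_relationsI(8)[OF x y]] cl B.a_closed B.m_closed br_closed smult_closed_B)
  then show "h x \<otimes>\<^bsub>E\<^esub> h y = h (br x y) \<oplus>\<^bsub>E\<^esub> h y \<otimes>\<^bsub>E\<^esub> h x"
    using x y by (intro comm) (simp_all add: hom(2) c_diff cl gen)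
  have "?c (?M (br x y)) = ?c (?H x \<otimes>\<^bsub>env_free B\<^esub> ?M y - ?M y \<otimes>\<^bsub>env_free B\<^esub> ?H x)"
    by (intro env_relation_eq[OF env_relationsI(9)[OF x y]] cl B.a_closed B.m_closed br_closed smult_closed_B)
  then show "h x \<otimes>\<^bsub>E\<^esub> m y = m (br x y) \<oplus>\<^bsub>E\<^esub> m y \<otimes>\<^bsub>E\<^esub> h x"
    using x y by (intro comm) (simp_all add: hom(2) c_diff cl gen)
qed

lemma
  assumes x: "x \<in> carrier B"
  shows m_smult: "m (c \<odot>\<^bsub>B\<^esub> x) = c \<odot>\<^bsub>E\<^esub> m x"
    and h_smult: "h (c \<odot>\<^bsub>B\<^esub> x) = c \<odot>\<^bsub>E\<^esub> h x"
proof -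
  let ?c = "\<lambda>x. relation_ideal +>\<^bsub>env_free B\<^esub> x"
  let ?M = "\<lambda>x. Poly_Mapping.single [gen_m x] 1 :: ('k, 'b) noncomm_poly"
  let ?H = "\<lambda>x. Poly_Mapping.single [gen_h x] 1 :: ('k, 'b) noncomm_poly"
  note hom = algebra_homD[OF algebra_hom_env_coset]
  note lin = linear_mapD[OF hom(1)]
  interpret V: module ground "env_free B" by (rule k_algebraD[OF k_algebra_env_free])
  have sc: "c \<odot>\<^bsub>env_free B\<^esub> x \<in> carrier (env_free B)" if "x \<in> carrier (env_free B)" for c x
    using that by (intro V.smult_closed) auto
  note cl = x gen_closed env_free_diff_closed F.a_closed F.m_closed F.one_closed sc
  have gen: "?c (?M x) = m x" "?c (?H x) = h x" for x by (simp_all add: env_m_def env_h_def)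
  have "?c (?M (c \<odot>\<^bsub>B\<^esub> x)) = ?c (c \<odot>\<^bsub>env_free B\<^esub> ?M x)"
    by (intro env_relation_eq[OF env_relationsI(1)[OF x]] cl B.a_closed B.m_closed br_closed smult_closed_B)
  then show "m (c \<odot>\<^bsub>B\<^esub> x) = c \<odot>\<^bsub>E\<^esub> m x" by (simp add: lin cl gen)
  have "?c (?H (c \<odot>\<^bsub>B\<^esub> x)) = ?c (c \<odot>\<^bsub>env_free B\<^esub> ?H x)"
    by (intro env_relation_eq[OF env_relationsI(2)[OF x]] cl B.a_closed B.m_closed br_closed smult_closed_B)
  then show "h (c \<odot>\<^bsub>B\<^esub> x) = c \<odot>\<^bsub>E\<^esub> h x" by (simp add: lin cl gen)
qed

lemma m_one: "m \<one>\<^bsub>B\<^esub> = \<one>\<^bsub>E\<^esub>"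
proof -
  have "relation_ideal +>\<^bsub>env_free B\<^esub> Poly_Mapping.single [gen_m \<one>\<^bsub>B\<^esub>] 1 = relation_ideal +>\<^bsub>env_free B\<^esub> \<one>\<^bsub>env_free B\<^esub>"
    by (rule env_relation_eq[OF env_relationsI(3)]) (auto simp: gen_closed F.one_closed)
  then show ?thesis by (simp add: algebra_homD(3)[OF algebra_hom_env_coset] env_m_def)
qed

lemma linear_m: "linear_map B E m"
  by (rule linear_mapI) (auto simp: m_add m_smult)

lemma linear_h: "linear_map B E h"
  by (rule linear_mapI) (auto simp: h_add h_smult)

lemma m_comm: "x \<in> carrier B \<Longrightarrow> y \<in> carrier B \<Longrightarrow> m x \<otimes>\<^bsub>E\<^esub> m y = m y \<otimes>\<^bsub>E\<^esub> m x"
  by (simp add: B.m_comm flip: m_mult)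

text \<open>Words in the generators span, and a word is built by multiplying from the left. Scalars
  need no case of their own, since c e = m(c 1) e; zero arises in the same way.\<close>

lemma env_induct [consumes 1, case_names one m h add]:
  assumes e: "e \<in> carrier E"
    and one: "P \<one>\<^bsub>E\<^esub>"
    and m: "\<And>b e. b \<in> carrier B \<Longrightarrow> e \<in> carrier E \<Longrightarrow> P e \<Longrightarrow> P (m b \<otimes>\<^bsub>E\<^esub> e)"
    and h: "\<And>b e. b \<in> carrier B \<Longrightarrow> e \<in> carrier E \<Longrightarrow> P e \<Longrightarrow> P (h b \<otimes>\<^bsub>E\<^esub> e)"
    and add: "\<And>d e. d \<in> carrier E \<Longrightarrow> e \<in> carrier E \<Longrightarrow> P d \<Longrightarrow> P e \<Longrightarrow> P (d \<oplus>\<^bsub>E\<^esub> e)"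
  shows "P e"
proof -
  let ?c = "\<lambda>x. relation_ideal +>\<^bsub>env_free B\<^esub> x"
  let ?X = "gen_m ` carrier B \<union> gen_h ` carrier B"
  note hom = algebra_homD[OF algebra_hom_env_coset]
  note lin = linear_mapD[OF hom(1)]
  have words: "P (?c (Poly_Mapping.single w 1)) \<and> Poly_Mapping.single w (1::'k) \<in> carrier (env_free B)"
    if "w \<in> lists ?X" for w
    using that
  proof (induction w)
    case Nil
    have "Poly_Mapping.single [] (1::'k) = \<one>\<^bsub>env_free B\<^esub>"
      by (simp add: env_free_def monoid_algebra_simps free_monoid_simps)
    then show ?case using one hom(3) by simp
  next
    case (Cons g w)
    have s: "Poly_Mapping.single (g # w) (1::'k) = Poly_Mapping.single [g] 1 \<otimes>\<^bsub>env_free B\<^esub> Poly_Mapping.single w 1"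
      by (simp add: env_free_def monoid_algebra_mult_single free_monoid_simps)
    have g: "Poly_Mapping.single [g] (1::'k) \<in> carrier (env_free B)"
      using Cons by (auto simp: gen_closed)
    have w: "Poly_Mapping.single w (1::'k) \<in> carrier (env_free B)" "P (?c (Poly_Mapping.single w 1))"
      using Cons by auto
    have "P (?c (Poly_Mapping.single [g] 1) \<otimes>\<^bsub>E\<^esub> ?c (Poly_Mapping.single w 1))"
      using Cons(1) w lin(1)[OF w(1)]
      by (auto intro: m[unfolded env_m_def] h[unfolded env_h_def])
    then show ?case using g w by (simp add: s hom(2))
  qed
  have P_smult: "P (c \<odot>\<^bsub>E\<^esub> e)" if "e \<in> carrier E" "P e" for c e
  proof -
    have "c \<odot>\<^bsub>E\<^esub> e = m (c \<odot>\<^bsub>B\<^esub> \<one>\<^bsub>B\<^esub>) \<otimes>\<^bsub>E\<^esub> e"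
      using that by (simp add: m_smult m_one k_algebraD(3)[OF k_algebra_E])
    then show ?thesis using m[of "c \<odot>\<^bsub>B\<^esub> \<one>\<^bsub>B\<^esub>" e] that by simp
  qed
  have "P (?c x)" if x: "x \<in> carrier (env_free B)" for x
    using x[unfolded env_free_def]
  proof (induction rule: monoid_algebra_induct)
    case zero
    have "?c 0 = \<zero>\<^bsub>E\<^esub>"
      using linear_map_zero[OF k_algebraD(2)[OF k_algebra_env_free] vec_space_E hom(1)]
      by (simp add: env_free_def monoid_algebra_simps)
    then show ?case using P_smult[OF E.one_closed one, of 0] EV.smult_l_null[of "\<one>\<^bsub>E\<^esub>"] by simp
  next
    case (single w c)
    then have "w \<in> lists ?X" by (simp add: free_monoid_simps)
    note w = words[OF this]
    have "Poly_Mapping.single w c = c \<odot>\<^bsub>env_free B\<^esub> Poly_Mapping.single w 1"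
      by (simp add: env_free_def monoid_algebra_simps map_mult_single)
    then show ?case using w P_smult lin(1,3) by auto
  next
    case (add x y)
    then have "x \<in> carrier (env_free B)" "y \<in> carrier (env_free B)" by (simp_all add: env_free_def)
    then show ?case using add assms(5) lin(1,2) by (simp add: env_free_plus)
  qed
  moreover obtain x where "x \<in> carrier (env_free B)" "e = ?c x"
    using e quotient_carrier[OF k_algebraD(2)[OF k_algebra_env_free] submodule_ideal[OF k_algebra_env_free relation_ideal]]
    by (auto simp: env_def)
  ultimately show ?thesis by simp
qed

section \<open>The universal property of the enveloping algebra\<close>

context
  fixes A :: "('k, 'a) module" and \<mu> \<eta>
  assumes A: "k_algebra A" and \<mu>: "linear_map B A \<mu>" and \<eta>: "linear_map B A \<eta>"
    and \<mu>_one: "\<mu> \<one>\<^bsub>B\<^esub> = \<one>\<^bsub>A\<^esub>"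
    and \<mu>_mult: "\<And>x y. x \<in> carrier B \<Longrightarrow> y \<in> carrier B \<Longrightarrow> \<mu> (x \<otimes>\<^bsub>B\<^esub> y) = \<mu> x \<otimes>\<^bsub>A\<^esub> \<mu> y"
    and \<eta>_mult: "\<And>x y. x \<in> carrier B \<Longrightarrow> y \<in> carrier B \<Longrightarrow>
      \<eta> (x \<otimes>\<^bsub>B\<^esub> y) = \<mu> y \<otimes>\<^bsub>A\<^esub> \<eta> x \<oplus>\<^bsub>A\<^esub> \<mu> x \<otimes>\<^bsub>A\<^esub> \<eta> y"
    and \<eta>_br: "\<And>x y. x \<in> carrier B \<Longrightarrow> y \<in> carrier B \<Longrightarrow>
      \<eta> x \<otimes>\<^bsub>A\<^esub> \<eta> y = \<eta> (br x y) \<oplus>\<^bsub>A\<^esub> \<eta> y \<otimes>\<^bsub>A\<^esub> \<eta> x"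
    and \<mu>_br: "\<And>x y. x \<in> carrier B \<Longrightarrow> y \<in> carrier B \<Longrightarrow>
      \<eta> x \<otimes>\<^bsub>A\<^esub> \<mu> y = \<mu> (br x y) \<oplus>\<^bsub>A\<^esub> \<mu> y \<otimes>\<^bsub>A\<^esub> \<eta> x"
begin

interpretation A: ring A by (rule k_algebraD[OF A])
interpretation AV: module ground A by (rule k_algebraD[OF A])

lemma algebra_hom_words:
  "algebra_hom (env_free B) A (linear_extension A (\<lambda>w. foldr (\<lambda>g a. case_gen \<mu> \<eta> g \<otimes>\<^bsub>A\<^esub> a) w \<one>\<^bsub>A\<^esub>))"
    (is "algebra_hom _ _ (linear_extension A ?ev)")
proof -
  let ?X = "gen_m ` carrier B \<union> gen_h ` carrier B"
  have ev_closed: "?ev w \<in> carrier A" if "w \<in> lists ?X" for w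
    using that by (induction w) (auto simp: linear_mapD(1)[OF \<mu>] linear_mapD(1)[OF \<eta>])
  have "?ev (w @ v) = ?ev w \<otimes>\<^bsub>A\<^esub> ?ev v" if w: "w \<in> lists ?X" and v: "v \<in> lists ?X" for w v
    using w
  proof (induction w)
    case Nil
    then show ?case using ev_closed[OF v] by simp
  next
    case (Cons g w)
    have "case_gen \<mu> \<eta> g \<in> carrier A" using Cons(1) by (auto simp: linear_mapD(1)[OF \<mu>] linear_mapD(1)[OF \<eta>])
    moreover have "?ev w \<in> carrier A" using Cons(2) by (rule ev_closed)
    ultimately show ?case using Cons(3) ev_closed[OF v] by (simp add: A.m_assoc)
  qed
  with ev_closed show ?thesis
    unfolding env_free_def
    by (intro algebra_hom_linear_extension[OF monoid_free_monoid A]) (simp_all add: free_monoid_simps)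
qed

lemma words_gen:
  assumes "x \<in> carrier B"
  shows "linear_extension A (\<lambda>w. foldr (\<lambda>g a. case_gen \<mu> \<eta> g \<otimes>\<^bsub>A\<^esub> a) w \<one>\<^bsub>A\<^esub>) (Poly_Mapping.single [gen_m x] 1) = \<mu> x"
    and "linear_extension A (\<lambda>w. foldr (\<lambda>g a. case_gen \<mu> \<eta> g \<otimes>\<^bsub>A\<^esub> a) w \<one>\<^bsub>A\<^esub>) (Poly_Mapping.single [gen_h x] 1) = \<eta> x"
  using assms AV.smult_one[of "\<mu> x"] AV.smult_one[of "\<eta> x"] linear_mapD(1)[OF \<mu>] linear_mapD(1)[OF \<eta>]
  by (simp_all add: linear_extension_single[OF k_algebraD(2)[OF A]])

text \<open>The kernel of an algebra homomorphism is an ideal, so it contains the generated ideal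
  once it contains the generators. The additive and scalar relations come from linearity of
  \<open>\<mu>\<close> and \<open>\<eta>\<close>, the others from the assumed identities.\<close>

lemma words_ideal:
  assumes "n \<in> relation_ideal"
  shows "linear_extension A (\<lambda>w. foldr (\<lambda>g a. case_gen \<mu> \<eta> g \<otimes>\<^bsub>A\<^esub> a) w \<one>\<^bsub>A\<^esub>) n = \<zero>\<^bsub>A\<^esub>"
proof -
  define \<phi> where "\<phi> = linear_extension A (\<lambda>w. foldr (\<lambda>g a. case_gen \<mu> \<eta> g \<otimes>\<^bsub>A\<^esub> a) w \<one>\<^bsub>A\<^esub>)"
  have hom: "algebra_hom (env_free B) A \<phi>" unfolding \<phi>_def by (rule algebra_hom_words)
  note lin = linear_mapD[OF algebra_homD(1)[OF hom]]
  note gen = words_gen[folded \<phi>_def]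
  interpret V: module ground "env_free B" by (rule k_algebraD[OF k_algebra_env_free])
  have sc: "c \<odot>\<^bsub>env_free B\<^esub> x \<in> carrier (env_free B)" if "x \<in> carrier (env_free B)" for c x
    using that by (intro V.smult_closed) auto
  have diff: "\<phi> (x - y) = \<phi> x \<ominus>\<^bsub>A\<^esub> \<phi> y"
    if "x \<in> carrier (env_free B)" "y \<in> carrier (env_free B)" for x y
    using linear_map_monoid_algebra_diff[OF k_algebraD(2)[OF A], of _ \<phi> x y] algebra_homD(1)[OF hom] that
    unfolding env_free_def by blast
  have zero: "x \<ominus>\<^bsub>A\<^esub> x = \<zero>\<^bsub>A\<^esub>" if "x \<in> carrier A" for x
    using that by (simp add: a_minus_def A.r_neg)
  have comm: "(x \<oplus>\<^bsub>A\<^esub> y) \<ominus>\<^bsub>A\<^esub> y = x" if "x \<in> carrier A" "y \<in> carrier A" for x y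
    using that by (simp add: a_minus_def A.a_assoc A.r_neg)
  note simps = diff gen lin algebra_homD(2,3)[OF hom] gen_closed sc F.a_closed F.m_closed F.one_closed
    env_free_diff_closed linear_mapD[OF \<mu>] linear_mapD[OF \<eta>] \<mu>_one \<mu>_mult \<eta>_mult zero comm
  have "\<phi> n = \<zero>\<^bsub>A\<^esub>" if "n \<in> env_relations B br" for n
    using that
  proof (induction rule: env_relations_cases)
    case (h_br x y)
    then show ?case using \<eta>_br[of x y] by (simp add: simps)
  next
    case (m_br x y)
    then show ?case using \<mu>_br[of x y] by (simp add: simps)
  qed (simp_all add: simps)
  then have "env_relations B br \<subseteq> {x \<in> carrier (env_free B). \<phi> x = \<zero>\<^bsub>A\<^esub>}"
    using env_relations_closed by blast
  then have "relation_ideal \<subseteq> {x \<in> carrier (env_free B). \<phi> x = \<zero>\<^bsub>A\<^esub>}"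
    by (rule F.genideal_minimal[OF algebra_hom_kernel_ideal[OF k_algebra_env_free A hom]])
  then show ?thesis using assms unfolding \<phi>_def by blast
qed

lemma env_lift_coset:
  assumes "x \<in> carrier (env_free B)"
  shows "env_lift A \<mu> \<eta> (relation_ideal +>\<^bsub>env_free B\<^esub> x) =
    linear_extension A (\<lambda>w. foldr (\<lambda>g a. case_gen \<mu> \<eta> g \<otimes>\<^bsub>A\<^esub> a) w \<one>\<^bsub>A\<^esub>) x"
  unfolding env_lift_def
  by (rule the_elem_image_coset[OF k_algebraD(2)[OF k_algebra_env_free]
      submodule_ideal[OF k_algebra_env_free relation_ideal] k_algebraD(2)[OF A]
      algebra_homD(1)[OF algebra_hom_words] words_ideal assms])

lemma env_lift_m: "x \<in> carrier B \<Longrightarrow> env_lift A \<mu> \<eta> (m x) = \<mu> x"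
  unfolding env_m_def by (simp add: env_lift_coset gen_closed words_gen)

lemma env_lift_h: "x \<in> carrier B \<Longrightarrow> env_lift A \<mu> \<eta> (h x) = \<eta> x"
  unfolding env_h_def by (simp add: env_lift_coset gen_closed words_gen)

lemma algebra_hom_env_lift: "algebra_hom E A (env_lift A \<mu> \<eta>)"
proof (rule algebra_homI)
  note hom = algebra_homD[OF algebra_hom_words]
  note proj = algebra_homD[OF algebra_hom_env_coset]
  show "linear_map E A (env_lift A \<mu> \<eta>)"
    unfolding env_def env_lift_def[abs_def]
    by (rule linear_map_the_elem[OF k_algebraD(2)[OF k_algebra_env_free]
      submodule_ideal[OF k_algebra_env_free relation_ideal] k_algebraD(2)[OF A]
      hom(1) words_ideal])
  show "env_lift A \<mu> \<eta> \<one>\<^bsub>E\<^esub> = \<one>\<^bsub>A\<^esub>"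
    unfolding proj(3)[symmetric] by (simp only: env_lift_coset[OF F.one_closed] hom(3))
  fix x y assume "x \<in> carrier E" "y \<in> carrier E"
  then obtain x' y' where *: "x' \<in> carrier (env_free B)" "y' \<in> carrier (env_free B)"
    "x = relation_ideal +>\<^bsub>env_free B\<^esub> x'" "y = relation_ideal +>\<^bsub>env_free B\<^esub> y'"
    using quotient_carrier[OF k_algebraD(2)[OF k_algebra_env_free] submodule_ideal[OF k_algebra_env_free relation_ideal]]
    by (auto simp: env_def)
  show "env_lift A \<mu> \<eta> (x \<otimes>\<^bsub>E\<^esub> y) = env_lift A \<mu> \<eta> x \<otimes>\<^bsub>A\<^esub> env_lift A \<mu> \<eta> y"
      unfolding *(3,4) proj(2)[OF *(1,2), symmetric]
    by (simp only: env_lift_coset[OF *(1)] env_lift_coset[OF *(2)] env_lift_coset[OF F.m_closed[OF *(1,2)]] hom(2)[OF *(1,2)])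
qed

end

end

section \<open>Sweedler calculus\<close>

lemma bilinear_map_tensor_lift_fun:
  assumes "vec_space A" "vec_space B" "vec_space W" "vec_space X" "vec_space Y"
    and "t \<in> carrier (tensor A B)"
    and "\<And>x y. x \<in> carrier X \<Longrightarrow> y \<in> carrier Y \<Longrightarrow> bilinear_map A B W (F x y)"
    and "\<And>a b. a \<in> carrier A \<Longrightarrow> b \<in> carrier B \<Longrightarrow> bilinear_map X Y W (\<lambda>x y. F x y a b)"
  shows "bilinear_map X Y W (\<lambda>x y. tensor_lift W (F x y) t)"
proof (rule bilinear_mapI)
  fix x assume x: "x \<in> carrier X"
  show "linear_map Y W (\<lambda>y. tensor_lift W (F x y) t)"
    by (rule linear_map_tensor_lift_fun[OF assms(1-3,6) assms(7)[OF x] bilinear_map_right[OF assms(8) x] assms(5)])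
next
  fix y assume y: "y \<in> carrier Y"
  show "linear_map X W (\<lambda>x. tensor_lift W (F x y) t)"
    by (rule linear_map_tensor_lift_fun[OF assms(1-3,6) assms(7)[OF _ y] bilinear_map_left[OF assms(8) y] assms(4)])
qed

text \<open>Operations defined on pure tensors of both arguments, such as
  \<open>tensor_bracket\<close> and the product of \<open>crossed_product\<close>, are nested lifts
  of this shape.\<close>

lemma bilinear_map_tensor_lift2:
  assumes A: "vec_space A" and B: "vec_space B" and C: "vec_space C" and D: "vec_space D" and W: "vec_space W"
    and F1: "\<And>a b. a \<in> carrier A \<Longrightarrow> b \<in> carrier B \<Longrightarrow> bilinear_map C D W (F a b)"
    and F2: "\<And>c d. c \<in> carrier C \<Longrightarrow> d \<in> carrier D \<Longrightarrow> bilinear_map A B W (\<lambda>a b. F a b c d)"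
  shows "bilinear_map (tensor A B) (tensor C D) W (\<lambda>s t. tensor_lift W (\<lambda>a b. tensor_lift W (F a b) t) s)"
proof -
  have F3: "bilinear_map A B W (\<lambda>a b. tensor_lift W (F a b) t)" if "t \<in> carrier (tensor C D)" for t
    by (rule bilinear_map_tensor_lift_fun[OF C D W A B that F1 F2])
  show ?thesis
    by (intro bilinear_mapI linear_map_tensor_lift_fun[OF A B W] F3 linear_map_tensor_lift[OF C D W] F1
        linear_map_tensor_lift[OF A B W] vec_space_tensor[OF C D])
qed

lemma tensor_lift2_tens:
  assumes A: "vec_space A" and B: "vec_space B" and C: "vec_space C" and D: "vec_space D" and W: "vec_space W"
    and F1: "\<And>a b. a \<in> carrier A \<Longrightarrow> b \<in> carrier B \<Longrightarrow> bilinear_map C D W (F a b)"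
    and F2: "\<And>c d. c \<in> carrier C \<Longrightarrow> d \<in> carrier D \<Longrightarrow> bilinear_map A B W (\<lambda>a b. F a b c d)"
    and ab: "a \<in> carrier A" "b \<in> carrier B" and cd: "c \<in> carrier C" "d \<in> carrier D"
  shows "tensor_lift W (\<lambda>a b. tensor_lift W (F a b) (tens C D c d)) (tens A B a b) = F a b c d"
proof -
  have F3: "bilinear_map A B W (\<lambda>a b. tensor_lift W (F a b) (tens C D c d))"
    by (rule bilinear_map_tensor_lift_fun[OF C D W A B tens_closed[OF C D cd] F1 F2])
  show ?thesis
    by (simp only: tensor_lift_tens[OF A B W F3 ab] tensor_lift_tens[OF C D W F1[OF ab] cd])
qed

text \<open>With s = \<Delta> x and t = \<Delta> y this is the Sweedler rule that the components of
  x y are x1 y1 and x2 y2.\<close>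

lemma tensor_lift_mult:
  assumes A: "k_algebra A" and B: "k_algebra B" and W: "vec_space W" and f: "bilinear_map A B W f"
    and s: "s \<in> carrier (tensor A B)" and t: "t \<in> carrier (tensor A B)"
  shows "tensor_lift W f (s \<otimes>\<^bsub>tensor A B\<^esub> t) =
    tensor_lift W (\<lambda>a b. tensor_lift W (\<lambda>c d. f (a \<otimes>\<^bsub>A\<^esub> c) (b \<otimes>\<^bsub>B\<^esub> d)) t) s"
proof -
  note AV = k_algebraD(2)[OF A] and BV = k_algebraD(2)[OF B]
  interpret A: ring A by (rule k_algebraD[OF A])
  interpret B: ring B by (rule k_algebraD[OF B])
  interpret T: ring "tensor A B" by (rule k_algebraD[OF k_algebra_tensor[OF A B]])
  have b1: "bilinear_map A B W (\<lambda>c d. f (a \<otimes>\<^bsub>A\<^esub> c) (b \<otimes>\<^bsub>B\<^esub> d))"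
    if "a \<in> carrier A" "b \<in> carrier B" for a b
    using that by (intro bilinear_mapI linear_map_bilinear_left[OF f] linear_map_bilinear_right[OF f]
        linear_map_mult_left linear_map_id A B) auto
  have b2: "bilinear_map A B W (\<lambda>a b. f (a \<otimes>\<^bsub>A\<^esub> c) (b \<otimes>\<^bsub>B\<^esub> d))"
    if "c \<in> carrier A" "d \<in> carrier B" for c d
    using that by (intro bilinear_mapI linear_map_bilinear_left[OF f] linear_map_bilinear_right[OF f]
        linear_map_mult_right linear_map_id A B) auto
  have b3: "bilinear_map A B W (\<lambda>a b. tensor_lift W (\<lambda>c d. f (a \<otimes>\<^bsub>A\<^esub> c) (b \<otimes>\<^bsub>B\<^esub> d)) t)"
    by (rule bilinear_map_tensor_lift_fun[OF AV BV W AV BV t b1 b2])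
  have lin: "linear_map (tensor A B) W (tensor_lift W f)" by (rule linear_map_tensor_lift[OF AV BV W f])
  show ?thesis
  proof (rule tensor_hom_eq[OF AV BV _ linear_map_tensor_lift[OF AV BV W b3] _ s])
    show "linear_map (tensor A B) W (\<lambda>s. tensor_lift W f (s \<otimes>\<^bsub>tensor A B\<^esub> t))"
      by (rule linear_map_compose[OF lin linear_map_mult_right[OF k_algebra_tensor[OF A B] linear_map_id t]])
    fix a b assume ab: "a \<in> carrier A" "b \<in> carrier B"
    have "tensor_lift W f (tens A B a b \<otimes>\<^bsub>tensor A B\<^esub> t) =
        tensor_lift W (\<lambda>c d. f (a \<otimes>\<^bsub>A\<^esub> c) (b \<otimes>\<^bsub>B\<^esub> d)) t"
    proof (rule tensor_hom_eq[OF AV BV _ linear_map_tensor_lift[OF AV BV W b1[OF ab]] _ t])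
      show "linear_map (tensor A B) W (\<lambda>t. tensor_lift W f (tens A B a b \<otimes>\<^bsub>tensor A B\<^esub> t))"
        by (rule linear_map_compose[OF lin linear_map_mult_left[OF k_algebra_tensor[OF A B] linear_map_id tens_closed[OF AV BV ab]]])
      fix c d assume cd: "c \<in> carrier A" "d \<in> carrier B"
      show "tensor_lift W f (tens A B a b \<otimes>\<^bsub>tensor A B\<^esub> tens A B c d) =
          tensor_lift W (\<lambda>c d. f (a \<otimes>\<^bsub>A\<^esub> c) (b \<otimes>\<^bsub>B\<^esub> d)) (tens A B c d)"
        by (simp add: tens_mult[OF A B] ab cd tensor_lift_tens[OF AV BV W f] tensor_lift_tens[OF AV BV W b1[OF ab]])
    qed
    then show "tensor_lift W f (tens A B a b \<otimes>\<^bsub>tensor A B\<^esub> t) =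
        tensor_lift W (\<lambda>a b. tensor_lift W (\<lambda>c d. f (a \<otimes>\<^bsub>A\<^esub> c) (b \<otimes>\<^bsub>B\<^esub> d)) t) (tens A B a b)"
      by (simp add: tensor_lift_tens[OF AV BV W b3] ab)
  qed
qed

lemma bilinear_map_mult:
  "k_algebra A \<Longrightarrow> linear_map U A f \<Longrightarrow> linear_map V A g \<Longrightarrow> bilinear_map U V A (\<lambda>u v. f u \<otimes>\<^bsub>A\<^esub> g v)"
  by (intro bilinear_mapI linear_map_mult_left linear_map_mult_right) (auto dest: linear_mapD)

section \<open>Coalgebras and the convolution algebra\<close>

locale coalg =
  fixes C :: "('k::field, 'c) module" and \<Delta> :: "'c \<Rightarrow> ('k, 'c, 'c) tensors" and \<epsilon> :: "'c \<Rightarrow> 'k"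
  assumes coalgebra: "coalgebra C \<Delta> \<epsilon>"
begin

lemma vec_space_C: "vec_space C"
  using coalgebra by (simp add: coalgebra_def)

lemma linear_comult: "linear_map C (tensor C C) \<Delta>"
  using coalgebra by (simp add: coalgebra_def)

lemma linear_counit: "linear_map C ground \<epsilon>"
  using coalgebra by (simp add: coalgebra_def)

lemma comult_closed [simp, intro]: "c \<in> carrier C \<Longrightarrow> \<Delta> c \<in> carrier (tensor C C)"
  by (rule linear_mapD[OF linear_comult])

lemma counit_left: "c \<in> carrier C \<Longrightarrow> tensor_lift C (\<lambda>c1 c2. \<epsilon> c1 \<odot>\<^bsub>C\<^esub> c2) (\<Delta> c) = c"
  using coalgebra by (simp add: coalgebra_def)

lemma counit_right: "c \<in> carrier C \<Longrightarrow> tensor_lift C (\<lambda>c1 c2. \<epsilon> c2 \<odot>\<^bsub>C\<^esub> c1) (\<Delta> c) = c"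
  using coalgebra by (simp add: coalgebra_def)

text \<open>The image of the counit law under \<open>f\<close>. In this form it removes one
  summation index from any Sweedler sum that contains a counit.\<close>

lemma counit_left_lift:
  assumes W: "vec_space W" and f: "linear_map C W f" and c: "c \<in> carrier C"
  shows "tensor_lift W (\<lambda>c1 c2. \<epsilon> c1 \<odot>\<^bsub>W\<^esub> f c2) (\<Delta> c) = f c"
proof -
  have b: "bilinear_map C C C (\<lambda>c1 c2. \<epsilon> c1 \<odot>\<^bsub>C\<^esub> c2)"
    by (intro bilinear_mapI linear_map_smult linear_map_scalar linear_counit vec_space_C linear_map_id)
  have "f (tensor_lift C (\<lambda>c1 c2. \<epsilon> c1 \<odot>\<^bsub>C\<^esub> c2) (\<Delta> c)) = tensor_lift W (\<lambda>c1 c2. f (\<epsilon> c1 \<odot>\<^bsub>C\<^esub> c2)) (\<Delta> c)"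
    by (rule tensor_lift_linear[OF vec_space_C vec_space_C vec_space_C W b f comult_closed[OF c]])
  also have "\<dots> = tensor_lift W (\<lambda>c1 c2. \<epsilon> c1 \<odot>\<^bsub>W\<^esub> f c2) (\<Delta> c)"
    by (rule tensor_lift_cong[OF vec_space_C vec_space_C W bilinear_map_compose[OF vec_space_C vec_space_C f b]])
      (simp_all add: linear_mapD(3)[OF f] c comult_closed)
  finally show ?thesis by (simp add: counit_left c)
qed

lemma counit_right_lift:
  assumes W: "vec_space W" and f: "linear_map C W f" and c: "c \<in> carrier C"
  shows "tensor_lift W (\<lambda>c1 c2. \<epsilon> c2 \<odot>\<^bsub>W\<^esub> f c1) (\<Delta> c) = f c"
proof -
  have b: "bilinear_map C C C (\<lambda>c1 c2. \<epsilon> c2 \<odot>\<^bsub>C\<^esub> c1)"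
    by (intro bilinear_mapI linear_map_smult linear_map_scalar linear_counit vec_space_C linear_map_id)
  have "f (tensor_lift C (\<lambda>c1 c2. \<epsilon> c2 \<odot>\<^bsub>C\<^esub> c1) (\<Delta> c)) = tensor_lift W (\<lambda>c1 c2. f (\<epsilon> c2 \<odot>\<^bsub>C\<^esub> c1)) (\<Delta> c)"
    by (rule tensor_lift_linear[OF vec_space_C vec_space_C vec_space_C W b f comult_closed[OF c]])
  also have "\<dots> = tensor_lift W (\<lambda>c1 c2. \<epsilon> c2 \<odot>\<^bsub>W\<^esub> f c1) (\<Delta> c)"
    by (rule tensor_lift_cong[OF vec_space_C vec_space_C W bilinear_map_compose[OF vec_space_C vec_space_C f b]])
      (simp_all add: linear_mapD(3)[OF f] c comult_closed)
  finally show ?thesis by (simp add: counit_right c)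
qed

text \<open>The axiom is an equation in C \<otimes> (C \<otimes> C). A trilinear \<open>F\<close>
  factors through that space as a linear map \<open>L\<close>, and applying \<open>L\<close> to both
  sides gives the rule for arbitrary summands.\<close>

lemma coassoc_lift:
  assumes W: "vec_space W"
    and F1: "\<And>b c. b \<in> carrier C \<Longrightarrow> c \<in> carrier C \<Longrightarrow> linear_map C W (\<lambda>a. F a b c)"
    and F2: "\<And>a c. a \<in> carrier C \<Longrightarrow> c \<in> carrier C \<Longrightarrow> linear_map C W (\<lambda>b. F a b c)"
    and F3: "\<And>a b. a \<in> carrier C \<Longrightarrow> b \<in> carrier C \<Longrightarrow> linear_map C W (\<lambda>c. F a b c)"
    and c: "c \<in> carrier C"
  shows "tensor_lift W (\<lambda>c1 c2. tensor_lift W (\<lambda>c11 c12. F c11 c12 c2) (\<Delta> c1)) (\<Delta> c) =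
    tensor_lift W (\<lambda>c1 c2. tensor_lift W (\<lambda>c21 c22. F c1 c21 c22) (\<Delta> c2)) (\<Delta> c)"
proof -
  note C = vec_space_C
  note CC = vec_space_tensor[OF C C]
  note CCC = vec_space_tensor[OF C CC]
  let ?T = "tensor C (tensor C C)"
  have b0: "bilinear_map C C W (F a)" if "a \<in> carrier C" for a
    using that by (intro bilinear_mapI F2 F3)
  have b1: "bilinear_map C (tensor C C) W (\<lambda>a t. tensor_lift W (F a) t)"
    by (intro bilinear_mapI linear_map_tensor_lift[OF C C W] linear_map_tensor_lift_fun[OF C C W] b0 F1 C)
  define L where "L = tensor_lift W (\<lambda>a t. tensor_lift W (F a) t)"
  have L: "linear_map ?T W L" unfolding L_def by (rule linear_map_tensor_lift[OF C CC W b1])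
  have L_tens: "L (tens C (tensor C C) a t) = tensor_lift W (F a) t"
    if "a \<in> carrier C" "t \<in> carrier (tensor C C)" for a t
    unfolding L_def by (rule tensor_lift_tens[OF C CC W b1 that])
  have b2: "bilinear_map C C ?T (\<lambda>c11 c12. tens C (tensor C C) c11 (tens C C c12 c2))" if "c2 \<in> carrier C" for c2
    using that by (intro bilinear_mapI linear_map_tens_left linear_map_tens_right linear_map_id tens_closed C CC)
  have b2': "linear_map C ?T (\<lambda>c2. tens C (tensor C C) a (tens C C b c2))" if "a \<in> carrier C" "b \<in> carrier C" for a b
    using that by (intro linear_map_tens_left linear_map_tens_right linear_map_id tens_closed C CC)
  have b3: "bilinear_map C C ?T (\<lambda>c1 c2. tensor_lift ?T (\<lambda>c11 c12. tens C (tensor C C) c11 (tens C C c12 c2)) (\<Delta> c1))"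
    by (intro bilinear_mapI linear_map_tensor_lift_fun[OF C C CCC] b2 b2' C comult_closed
        linear_map_compose[OF linear_map_tensor_lift[OF C C CCC] linear_comult])
  have b4: "bilinear_map C C ?T (\<lambda>c1 c2. tens C (tensor C C) c1 (\<Delta> c2))"
    by (intro bilinear_mapI linear_map_tens_left linear_map_tens_right linear_map_id linear_comult comult_closed C CC)
  have L1: "L (tensor_lift ?T (\<lambda>c11 c12. tens C (tensor C C) c11 (tens C C c12 c2)) (\<Delta> c1)) =
      tensor_lift W (\<lambda>c11 c12. F c11 c12 c2) (\<Delta> c1)" if "c1 \<in> carrier C" "c2 \<in> carrier C" for c1 c2
    unfolding tensor_lift_linear[OF C C CCC W b2[OF that(2)] L comult_closed[OF that(1)]]
    by (rule tensor_lift_cong[OF C C W bilinear_map_compose[OF C C L b2[OF that(2)]]])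
      (simp_all add: that L_tens tens_closed[OF C C] tensor_lift_tens[OF C C W b0])
  have "tensor_lift W (\<lambda>c1 c2. tensor_lift W (\<lambda>c11 c12. F c11 c12 c2) (\<Delta> c1)) (\<Delta> c) =
    L (tensor_lift ?T (\<lambda>c1 c2. tensor_lift ?T (\<lambda>c11 c12. tens C (tensor C C) c11 (tens C C c12 c2)) (\<Delta> c1)) (\<Delta> c))"
    unfolding tensor_lift_linear[OF C C CCC W b3 L comult_closed[OF c]]
    by (rule sym, rule tensor_lift_cong[OF C C W bilinear_map_compose[OF C C L b3]])
      (simp_all add: L1 comult_closed c)
  also have "tensor_lift ?T (\<lambda>c1 c2. tensor_lift ?T (\<lambda>c11 c12. tens C (tensor C C) c11 (tens C C c12 c2)) (\<Delta> c1)) (\<Delta> c) =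
      tensor_lift ?T (\<lambda>c1 c2. tens C (tensor C C) c1 (\<Delta> c2)) (\<Delta> c)"
    using coalgebra c by (simp add: coalgebra_def)
  also have "L \<dots> = tensor_lift W (\<lambda>c1 c2. tensor_lift W (\<lambda>c21 c22. F c1 c21 c22) (\<Delta> c2)) (\<Delta> c)"
    unfolding tensor_lift_linear[OF C C CCC W b4 L comult_closed[OF c]]
    by (rule tensor_lift_cong[OF C C W bilinear_map_compose[OF C C L b4]])
      (simp_all add: L_tens comult_closed c)
  finally show ?thesis .
qed

lemma linear_convolution:
  assumes A: "k_algebra A" and f: "linear_map C A f" and g: "linear_map C A g"
  shows "linear_map C A (convolution \<Delta> A f g)"
  unfolding convolution_def
  by (rule linear_map_compose[OF linear_map_tensor_lift[OF vec_space_C vec_space_C k_algebraD(2)[OF A]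
        bilinear_map_mult[OF A f g]] linear_comult])

text \<open>Both sides are Sweedler sums of the trilinear expression f(c1) g(c2) h(c3), bracketed
  differently; coassociativity identifies them.\<close>

lemma convolution_assoc:
  assumes A: "k_algebra A" and f: "linear_map C A f" and g: "linear_map C A g" and h: "linear_map C A h"
    and c: "c \<in> carrier C"
  shows "convolution \<Delta> A (convolution \<Delta> A f g) h c = convolution \<Delta> A f (convolution \<Delta> A g h) c"
proof -
  interpret A: ring A by (rule k_algebraD[OF A])
  note C = vec_space_C
  note AV = k_algebraD(2)[OF A]
  note cl = linear_mapD(1)[OF f] linear_mapD(1)[OF g] linear_mapD(1)[OF h]
  have 1: "convolution \<Delta> A f g c1 \<otimes>\<^bsub>A\<^esub> h c2 =
      tensor_lift A (\<lambda>c11 c12. f c11 \<otimes>\<^bsub>A\<^esub> g c12 \<otimes>\<^bsub>A\<^esub> h c2) (\<Delta> c1)"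
    if "c1 \<in> carrier C" "c2 \<in> carrier C" for c1 c2
    unfolding convolution_def using that
    by (intro tensor_lift_linear[OF C C AV AV, where L = "\<lambda>x. x \<otimes>\<^bsub>A\<^esub> h c2"] bilinear_map_mult A f g
        linear_map_mult_right linear_map_id cl comult_closed)
  have b: "bilinear_map C C A (\<lambda>c21 c22. f c1 \<otimes>\<^bsub>A\<^esub> (g c21 \<otimes>\<^bsub>A\<^esub> h c22))"
    if "c1 \<in> carrier C" for c1
    using that by (intro bilinear_mapI linear_map_mult_left linear_map_mult_right A f g h) (auto simp: cl)
  have 2: "f c1 \<otimes>\<^bsub>A\<^esub> convolution \<Delta> A g h c2 =
      tensor_lift A (\<lambda>c21 c22. f c1 \<otimes>\<^bsub>A\<^esub> g c21 \<otimes>\<^bsub>A\<^esub> h c22) (\<Delta> c2)"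
    if "c1 \<in> carrier C" "c2 \<in> carrier C" for c1 c2
  proof -
    have "f c1 \<otimes>\<^bsub>A\<^esub> convolution \<Delta> A g h c2 =
      tensor_lift A (\<lambda>c21 c22. f c1 \<otimes>\<^bsub>A\<^esub> (g c21 \<otimes>\<^bsub>A\<^esub> h c22)) (\<Delta> c2)"
      unfolding convolution_def using that
      by (intro tensor_lift_linear[OF C C AV AV, where L = "\<lambda>x. f c1 \<otimes>\<^bsub>A\<^esub> x"] bilinear_map_mult A g h
        linear_map_mult_left linear_map_id cl comult_closed)
    also have "\<dots> = tensor_lift A (\<lambda>c21 c22. f c1 \<otimes>\<^bsub>A\<^esub> g c21 \<otimes>\<^bsub>A\<^esub> h c22) (\<Delta> c2)"
      by (rule tensor_lift_cong[OF C C AV b]) (simp_all add: that cl A.m_assoc comult_closed)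
    finally show ?thesis .
  qed
  have "convolution \<Delta> A (convolution \<Delta> A f g) h c =
      tensor_lift A (\<lambda>c1 c2. tensor_lift A (\<lambda>c11 c12. f c11 \<otimes>\<^bsub>A\<^esub> g c12 \<otimes>\<^bsub>A\<^esub> h c2) (\<Delta> c1)) (\<Delta> c)"
    unfolding convolution_def[of \<Delta> A "convolution \<Delta> A f g" h c]
    by (rule tensor_lift_cong[OF C C AV bilinear_map_mult[OF A linear_convolution[OF A f g] h]])
      (simp_all add: 1 comult_closed c)
  also have "\<dots> = tensor_lift A (\<lambda>c1 c2. tensor_lift A (\<lambda>c21 c22. f c1 \<otimes>\<^bsub>A\<^esub> g c21 \<otimes>\<^bsub>A\<^esub> h c22) (\<Delta> c2)) (\<Delta> c)"
    by (rule coassoc_lift[OF AV _ _ _ c])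
      (intro linear_map_mult_left linear_map_mult_right A f g h A.m_closed cl; assumption)+
  also have "\<dots> = convolution \<Delta> A f (convolution \<Delta> A g h) c"
    unfolding convolution_def[of \<Delta> A f "convolution \<Delta> A g h" c]
    by (rule sym, rule tensor_lift_cong[OF C C AV bilinear_map_mult[OF A f linear_convolution[OF A g h]]])
      (simp_all add: 2 comult_closed c)
  finally show ?thesis .
qed

lemma convolution_unit_left:
  assumes A: "k_algebra A" and f: "linear_map C A f" and c: "c \<in> carrier C"
  shows "convolution \<Delta> A (\<lambda>c. \<epsilon> c \<odot>\<^bsub>A\<^esub> \<one>\<^bsub>A\<^esub>) f c = f c"
proof -
  interpret A: ring A by (rule k_algebraD[OF A])
  note C = vec_space_C
  note AV = k_algebraD(2)[OF A]
  have "convolution \<Delta> A (\<lambda>c. \<epsilon> c \<odot>\<^bsub>A\<^esub> \<one>\<^bsub>A\<^esub>) f c = tensor_lift A (\<lambda>c1 c2. \<epsilon> c1 \<odot>\<^bsub>A\<^esub> f c2) (\<Delta> c)"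
    unfolding convolution_def
    by (rule tensor_lift_cong[OF C C AV bilinear_map_mult[OF A linear_map_scalar[OF AV linear_counit A.one_closed] f]])
      (simp_all add: k_algebraD(3)[OF A] linear_mapD(1)[OF f] comult_closed c)
  then show ?thesis by (simp add: counit_left_lift[OF AV f c])
qed

lemma convolution_cong:
  assumes A: "k_algebra A" and f: "linear_map C A f" and g: "linear_map C A g" and c: "c \<in> carrier C"
    and "\<And>c. c \<in> carrier C \<Longrightarrow> f c = f' c" "\<And>c. c \<in> carrier C \<Longrightarrow> g c = g' c"
  shows "convolution \<Delta> A f g c = convolution \<Delta> A f' g' c"
  unfolding convolution_def
  by (rule tensor_lift_cong[OF vec_space_C vec_space_C k_algebraD(2)[OF A] bilinear_map_mult[OF A f g]])
    (simp_all add: assms(5,6) comult_closed c)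

end

section \<open>The left invariant elements of the enveloping algebra\<close>

locale poisson_hopf = poisson B br for B :: "('k::field, 'b) module" and br +
  fixes \<Delta> :: "'b \<Rightarrow> ('k, 'b, 'b) tensors" and \<epsilon> :: "'b \<Rightarrow> 'k"
  assumes poisson_hopf: "poisson_hopf_algebra B br \<Delta> \<epsilon>"
begin

lemma hopf: "hopf_algebra B \<Delta> \<epsilon>"
  using poisson_hopf by (simp add: poisson_hopf_algebra_def)

lemma bialgebra: "bialgebra B \<Delta> \<epsilon>"
  using hopf by (simp add: hopf_algebra_def)

sublocale C: coalg B \<Delta> \<epsilon>
  using bialgebra by unfold_locales (simp add: bialgebra_def)

lemma algebra_hom_comult: "algebra_hom B (tensor B B) \<Delta>"
  using bialgebra by (simp add: bialgebra_def)

lemma algebra_hom_counit: "algebra_hom B ground \<epsilon>"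
  using bialgebra by (simp add: bialgebra_def)

lemma counit_mult: "x \<in> carrier B \<Longrightarrow> y \<in> carrier B \<Longrightarrow> \<epsilon> (x \<otimes>\<^bsub>B\<^esub> y) = \<epsilon> x * \<epsilon> y"
  using algebra_homD(2)[OF algebra_hom_counit] by simp

lemma counit_one: "\<epsilon> \<one>\<^bsub>B\<^esub> = 1"
  using algebra_homD(3)[OF algebra_hom_counit] by simp

lemma comult_br: "x \<in> carrier B \<Longrightarrow> y \<in> carrier B \<Longrightarrow> \<Delta> (br x y) = tensor_bracket B br (\<Delta> x) (\<Delta> y)"
  using poisson_hopf by (simp add: poisson_hopf_algebra_def)

text \<open>The antipode. Being a Hopf algebra asserts only the existence of a convolution inverse
  of the identity, so one is chosen.\<close>

definition S where
  "S = (SOME S. linear_map B B S \<and> (\<forall>c\<in>carrier B. convolution \<Delta> B (\<lambda>x. x) S c = \<epsilon> c \<odot>\<^bsub>B\<^esub> \<one>\<^bsub>B\<^esub> \<and>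
                      convolution \<Delta> B S (\<lambda>x. x) c = \<epsilon> c \<odot>\<^bsub>B\<^esub> \<one>\<^bsub>B\<^esub>))"

lemma S: "linear_map B B S"
    "\<And>c. c \<in> carrier B \<Longrightarrow> tensor_lift B (\<lambda>x y. x \<otimes>\<^bsub>B\<^esub> S y) (\<Delta> c) = \<epsilon> c \<odot>\<^bsub>B\<^esub> \<one>\<^bsub>B\<^esub>"
    "\<And>c. c \<in> carrier B \<Longrightarrow> tensor_lift B (\<lambda>x y. S x \<otimes>\<^bsub>B\<^esub> y) (\<Delta> c) = \<epsilon> c \<odot>\<^bsub>B\<^esub> \<one>\<^bsub>B\<^esub>"
proof -
  have "\<exists>S. linear_map B B S \<and> (\<forall>c\<in>carrier B. convolution \<Delta> B (\<lambda>x. x) S c = \<epsilon> c \<odot>\<^bsub>B\<^esub> \<one>\<^bsub>B\<^esub> \<and>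
                      convolution \<Delta> B S (\<lambda>x. x) c = \<epsilon> c \<odot>\<^bsub>B\<^esub> \<one>\<^bsub>B\<^esub>)"
    using hopf by (simp add: hopf_algebra_def convolution_invertible_def)
  from someI_ex[OF this] show "linear_map B B S"
    "\<And>c. c \<in> carrier B \<Longrightarrow> tensor_lift B (\<lambda>x y. x \<otimes>\<^bsub>B\<^esub> S y) (\<Delta> c) = \<epsilon> c \<odot>\<^bsub>B\<^esub> \<one>\<^bsub>B\<^esub>"
    "\<And>c. c \<in> carrier B \<Longrightarrow> tensor_lift B (\<lambda>x y. S x \<otimes>\<^bsub>B\<^esub> y) (\<Delta> c) = \<epsilon> c \<odot>\<^bsub>B\<^esub> \<one>\<^bsub>B\<^esub>"
    by (simp_all add: S_def convolution_def)
qed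

lemma S_closed [simp, intro]: "x \<in> carrier B \<Longrightarrow> S x \<in> carrier B"
  by (rule linear_mapD[OF S(1)])

lemmas lin =
  linear_map_id
  linear_map_plus[OF vec_space_E] linear_map_plus[OF vec_space_B]
  linear_map_smult[OF vec_space_E] linear_map_smult[OF vec_space_B]
  linear_map_mult_left[OF k_algebra_E] linear_map_mult_right[OF k_algebra_E]
  linear_map_mult_left[OF k_algebra_B] linear_map_mult_right[OF k_algebra_B]
  linear_map_scalar[OF vec_space_E] linear_map_scalar[OF vec_space_B]
  linear_map_compose[OF linear_m] linear_map_compose[OF linear_h] linear_map_compose[OF S(1)]
  linear_map_compose[OF C.linear_counit] linear_map_compose[OF C.linear_comult]
  linear_map_bilinear_left[OF bilinear_br] linear_map_bilinear_right[OF bilinear_br]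
  bilinear_mapI

lemmas lift_cong_E = tensor_lift_cong[OF vec_space_B vec_space_B vec_space_E]
lemmas lift_linear_BE = tensor_lift_linear[OF vec_space_B vec_space_B vec_space_B vec_space_E]
lemmas lift_linear_EE = tensor_lift_linear[OF vec_space_B vec_space_B vec_space_E vec_space_E]
lemmas lift_add_E = tensor_lift_add_fun[OF vec_space_B vec_space_B vec_space_E]
lemmas lift_fun_E = linear_map_tensor_lift_fun[OF vec_space_B vec_space_B vec_space_E]

lemma lift_closed_E [simp]:
  "bilinear_map B B E f \<Longrightarrow> t \<in> carrier (tensor B B) \<Longrightarrow> tensor_lift E f t \<in> carrier E"
  by (rule tensor_lift_closed[OF vec_space_B vec_space_B vec_space_E])

lemma bilinear_mult: "linear_map B E f \<Longrightarrow> linear_map B E g \<Longrightarrow> bilinear_map B B E (\<lambda>x y. f x \<otimes>\<^bsub>E\<^esub> g y)"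
  by (rule bilinear_map_mult[OF k_algebra_E])

lemmas bilinear_m_mult = bilinear_mult[OF linear_m]

text \<open>\<open>m\<close> is an algebra homomorphism, hence carries the convolution inverse of
  the identity of \<open>B\<close> to one of \<open>m\<close>.\<close>

lemma conv_mS_m: "x \<in> carrier B \<Longrightarrow> convolution \<Delta> E (\<lambda>x. m (S x)) m x = \<epsilon> x \<odot>\<^bsub>E\<^esub> \<one>\<^bsub>E\<^esub>"
proof -
  assume x: "x \<in> carrier B"
  have "m (tensor_lift B (\<lambda>x y. S x \<otimes>\<^bsub>B\<^esub> y) (\<Delta> x)) = tensor_lift E (\<lambda>x y. m (S x \<otimes>\<^bsub>B\<^esub> y)) (\<Delta> x)"
    by (rule lift_linear_BE[OF _ linear_m]) (auto intro!: lin x)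
  also have "\<dots> = convolution \<Delta> E (\<lambda>x. m (S x)) m x"
    unfolding convolution_def by (rule lift_cong_E) (auto intro!: lin x simp: m_mult)
  finally show ?thesis by (simp add: S(3) x m_smult m_one)
qed

lemma conv_m_mS: "x \<in> carrier B \<Longrightarrow> convolution \<Delta> E m (\<lambda>x. m (S x)) x = \<epsilon> x \<odot>\<^bsub>E\<^esub> \<one>\<^bsub>E\<^esub>"
proof -
  assume x: "x \<in> carrier B"
  have "m (tensor_lift B (\<lambda>x y. x \<otimes>\<^bsub>B\<^esub> S y) (\<Delta> x)) = tensor_lift E (\<lambda>x y. m (x \<otimes>\<^bsub>B\<^esub> S y)) (\<Delta> x)"
    by (rule lift_linear_BE[OF _ linear_m]) (auto intro!: lin x)
  also have "\<dots> = convolution \<Delta> E m (\<lambda>x. m (S x)) x"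
    unfolding convolution_def by (rule lift_cong_E) (auto intro!: lin x simp: m_mult)
  finally show ?thesis by (simp add: S(2) x m_smult m_one)
qed

definition \<omega> where "\<omega> = convolution \<Delta> E (\<lambda>x. m (S x)) h"

lemma linear_mS: "linear_map B E (\<lambda>x. m (S x))"
  by (intro lin)

lemma linear_counit_one: "linear_map B E (\<lambda>x. \<epsilon> x \<odot>\<^bsub>E\<^esub> \<one>\<^bsub>E\<^esub>)"
  by (intro lin E.one_closed)

lemma linear_\<omega>: "linear_map B E \<omega>"
  unfolding \<omega>_def by (rule C.linear_convolution[OF k_algebra_E linear_mS linear_h])

lemma \<omega>_closed [simp, intro]: "x \<in> carrier B \<Longrightarrow> \<omega> x \<in> carrier E"
  by (rule linear_mapD[OF linear_\<omega>])

lemma conv_m_\<omega>: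
  assumes x: "x \<in> carrier B"
  shows "convolution \<Delta> E m \<omega> x = h x"
proof -
  have "convolution \<Delta> E m \<omega> x = convolution \<Delta> E (convolution \<Delta> E m (\<lambda>x. m (S x))) h x"
    unfolding \<omega>_def by (rule C.convolution_assoc[OF k_algebra_E linear_m linear_mS linear_h x, symmetric])
  also have "\<dots> = convolution \<Delta> E (\<lambda>x. \<epsilon> x \<odot>\<^bsub>E\<^esub> \<one>\<^bsub>E\<^esub>) h x"
    by (rule C.convolution_cong[OF k_algebra_E C.linear_convolution[OF k_algebra_E linear_m linear_mS] linear_h x])
      (simp_all add: conv_m_mS)
  also have "\<dots> = h x" by (rule C.convolution_unit_left[OF k_algebra_E linear_h x])
  finally show ?thesis .
qed

lemma conv_mS_conv_m:
  assumes F: "linear_map B E F" and x: "x \<in> carrier B"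
  shows "convolution \<Delta> E (\<lambda>x. m (S x)) (convolution \<Delta> E m F) x = F x"
proof -
  have "convolution \<Delta> E (\<lambda>x. m (S x)) (convolution \<Delta> E m F) x = convolution \<Delta> E (convolution \<Delta> E (\<lambda>x. m (S x)) m) F x"
    by (rule C.convolution_assoc[OF k_algebra_E linear_mS linear_m F x, symmetric])
  also have "\<dots> = convolution \<Delta> E (\<lambda>x. \<epsilon> x \<odot>\<^bsub>E\<^esub> \<one>\<^bsub>E\<^esub>) F x"
    by (rule C.convolution_cong[OF k_algebra_E C.linear_convolution[OF k_algebra_E linear_mS linear_m] F x])
      (simp_all add: conv_mS_m)
  also have "\<dots> = F x" by (rule C.convolution_unit_left[OF k_algebra_E F x])
  finally show ?thesis .
qed

lemma conv_m_cancel: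
  assumes F: "linear_map B E F" and G: "linear_map B E G"
    and eq: "\<And>x. x \<in> carrier B \<Longrightarrow> convolution \<Delta> E m F x = convolution \<Delta> E m G x"
    and x: "x \<in> carrier B"
  shows "F x = G x"
proof -
  have "convolution \<Delta> E (\<lambda>x. m (S x)) (convolution \<Delta> E m F) x = convolution \<Delta> E (\<lambda>x. m (S x)) (convolution \<Delta> E m G) x"
    by (rule C.convolution_cong[OF k_algebra_E linear_mS C.linear_convolution[OF k_algebra_E linear_m F] x])
      (simp_all add: eq)
  then show ?thesis by (simp add: conv_mS_conv_m F G x)
qed

lemma linear_conv_m_fun:
  assumes F: "bilinear_map B B E F" and y: "y \<in> carrier B"
  shows "linear_map B E (\<lambda>x. convolution \<Delta> E m (F x) y)"
  unfolding convolution_def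
  by (intro lift_fun_E vec_space_B C.comult_closed y bilinear_m_mult bilinear_map_right[OF F]
      linear_map_mult_left[OF k_algebra_E] bilinear_map_left[OF F] m_closed)

text \<open>The factor m(x1) is cancelled first, with y fixed; what remains is a convolution in y
  alone, from which m(y1) is cancelled.\<close>

lemma conv_m_cancel2:
  assumes F: "bilinear_map B B E F" and G: "bilinear_map B B E G"
    and eq: "\<And>x y. x \<in> carrier B \<Longrightarrow> y \<in> carrier B \<Longrightarrow>
      convolution \<Delta> E m (\<lambda>x. convolution \<Delta> E m (F x) y) x = convolution \<Delta> E m (\<lambda>x. convolution \<Delta> E m (G x) y) x"
    and x: "x \<in> carrier B" and y: "y \<in> carrier B"
  shows "F x y = G x y"
proof (rule conv_m_cancel[OF bilinear_map_right[OF F x] bilinear_map_right[OF G x] _ y])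
  fix y assume y: "y \<in> carrier B"
  show "convolution \<Delta> E m (F x) y = convolution \<Delta> E m (G x) y"
    by (rule conv_m_cancel[OF linear_conv_m_fun[OF F y] linear_conv_m_fun[OF G y] eq[OF _ y] x])
qed

lemma conv_m_add:
  "linear_map B E F \<Longrightarrow> linear_map B E G \<Longrightarrow> x \<in> carrier B \<Longrightarrow>
    convolution \<Delta> E m (\<lambda>x. F x \<oplus>\<^bsub>E\<^esub> G x) x = convolution \<Delta> E m F x \<oplus>\<^bsub>E\<^esub> convolution \<Delta> E m G x"
proof -
  assume F: "linear_map B E F" and G: "linear_map B E G" and x: "x \<in> carrier B"
  have "convolution \<Delta> E m (\<lambda>x. F x \<oplus>\<^bsub>E\<^esub> G x) x =
      tensor_lift E (\<lambda>x y. m x \<otimes>\<^bsub>E\<^esub> F y \<oplus>\<^bsub>E\<^esub> m x \<otimes>\<^bsub>E\<^esub> G y) (\<Delta> x)"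
    unfolding convolution_def
    by (rule lift_cong_E[OF bilinear_m_mult[OF linear_map_plus[OF vec_space_E F G]]])
      (simp_all add: E.r_distr linear_mapD(1)[OF F] linear_mapD(1)[OF G] C.comult_closed x)
  then show ?thesis
    unfolding convolution_def
    by (simp add: lift_add_E bilinear_m_mult F G C.comult_closed x)
qed

lemma conv_m_counit:
  assumes e: "e \<in> carrier E" and x: "x \<in> carrier B"
  shows "convolution \<Delta> E m (\<lambda>x. \<epsilon> x \<odot>\<^bsub>E\<^esub> e) x = m x \<otimes>\<^bsub>E\<^esub> e"
proof -
  have "convolution \<Delta> E m (\<lambda>x. \<epsilon> x \<odot>\<^bsub>E\<^esub> e) x = tensor_lift E (\<lambda>x y. \<epsilon> y \<odot>\<^bsub>E\<^esub> (m x \<otimes>\<^bsub>E\<^esub> e)) (\<Delta> x)"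
    unfolding convolution_def
    by (rule lift_cong_E) (use e x in \<open>auto intro!: lin simp: k_algebraD(4)[OF k_algebra_E]\<close>)
  also have "\<dots> = m x \<otimes>\<^bsub>E\<^esub> e"
    by (rule C.counit_right_lift[OF vec_space_E _ x]) (intro lin e)
  finally show ?thesis .
qed

lemma conv_m_mult_right:
  assumes F: "linear_map B E F" and e: "e \<in> carrier E" and x: "x \<in> carrier B"
  shows "convolution \<Delta> E m (\<lambda>x. F x \<otimes>\<^bsub>E\<^esub> e) x = convolution \<Delta> E m F x \<otimes>\<^bsub>E\<^esub> e"
proof -
  have "convolution \<Delta> E m F x \<otimes>\<^bsub>E\<^esub> e = tensor_lift E (\<lambda>x y. m x \<otimes>\<^bsub>E\<^esub> F y \<otimes>\<^bsub>E\<^esub> e) (\<Delta> x)"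
    unfolding convolution_def
    by (rule lift_linear_EE[where L = "\<lambda>x. x \<otimes>\<^bsub>E\<^esub> e"]) (intro bilinear_m_mult F lin e C.comult_closed x)+
  also have "\<dots> = convolution \<Delta> E m (\<lambda>x. F x \<otimes>\<^bsub>E\<^esub> e) x"
    unfolding convolution_def
    by (rule lift_cong_E)
      (use e x in \<open>auto intro!: lin linear_map_compose[OF F] simp: E.m_assoc linear_mapD(1)[OF F]\<close>)
  finally show ?thesis by simp
qed

text \<open>Unlike multiplication on the right, this has to carry m(y) past m(x1), which is where
  commutativity of \<open>B\<close> enters.\<close>

lemma conv_m_mult_left:
  assumes F: "linear_map B E F" and y: "y \<in> carrier B" and x: "x \<in> carrier B"
  shows "convolution \<Delta> E m (\<lambda>x. m y \<otimes>\<^bsub>E\<^esub> F x) x = m y \<otimes>\<^bsub>E\<^esub> convolution \<Delta> E m F x"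
proof -
  have "m y \<otimes>\<^bsub>E\<^esub> convolution \<Delta> E m F x = tensor_lift E (\<lambda>x x'. m y \<otimes>\<^bsub>E\<^esub> (m x \<otimes>\<^bsub>E\<^esub> F x')) (\<Delta> x)"
    unfolding convolution_def
    by (rule lift_linear_EE[where L = "\<lambda>x. m y \<otimes>\<^bsub>E\<^esub> x"]) (intro bilinear_m_mult F lin m_closed y C.comult_closed x)+
  also have "\<dots> = convolution \<Delta> E m (\<lambda>x. m y \<otimes>\<^bsub>E\<^esub> F x) x"
    unfolding convolution_def
  proof (rule lift_cong_E)
    fix a b assume ab: "a \<in> carrier B" "b \<in> carrier B"
    then show "m y \<otimes>\<^bsub>E\<^esub> (m a \<otimes>\<^bsub>E\<^esub> F b) = m a \<otimes>\<^bsub>E\<^esub> (m y \<otimes>\<^bsub>E\<^esub> F b)"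
      using y linear_mapD(1)[OF F] by (simp add: m_comm[of y a] flip: E.m_assoc)
  qed (use y x in \<open>auto intro!: lin linear_map_compose[OF F] simp: linear_mapD(1)[OF F]\<close>)
  finally show ?thesis by simp
qed

text \<open>Merging m(x1) m(y1) into m(x1 y1) gives the shape in which the components of \<Delta>(x
  y) and of \<Delta>{x, y} appear.\<close>

lemma conv_m_conv_m:
  assumes F: "bilinear_map B B E F" and x: "x \<in> carrier B" and y: "y \<in> carrier B"
  shows "convolution \<Delta> E m (\<lambda>x. convolution \<Delta> E m (F x) y) x =
    tensor_lift E (\<lambda>x1 x2. tensor_lift E (\<lambda>y1 y2. m (x1 \<otimes>\<^bsub>B\<^esub> y1) \<otimes>\<^bsub>E\<^esub> F x2 y2) (\<Delta> y)) (\<Delta> x)"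
  unfolding convolution_def[of \<Delta> E m _ x]
proof (rule lift_cong_E[OF bilinear_m_mult[OF linear_conv_m_fun[OF F y]]])
  fix x1 x2 assume xs: "x1 \<in> carrier B" "x2 \<in> carrier B"
  note Fx = bilinear_map_right[OF F xs(2)]
  have "m x1 \<otimes>\<^bsub>E\<^esub> convolution \<Delta> E m (F x2) y = tensor_lift E (\<lambda>y1 y2. m x1 \<otimes>\<^bsub>E\<^esub> (m y1 \<otimes>\<^bsub>E\<^esub> F x2 y2)) (\<Delta> y)"
    unfolding convolution_def
    by (rule lift_linear_EE[where L = "\<lambda>x. m x1 \<otimes>\<^bsub>E\<^esub> x"]) (intro bilinear_m_mult Fx lin m_closed xs C.comult_closed y)+
  also have "\<dots> = tensor_lift E (\<lambda>y1 y2. m (x1 \<otimes>\<^bsub>B\<^esub> y1) \<otimes>\<^bsub>E\<^esub> F x2 y2) (\<Delta> y)"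
    by (rule lift_cong_E)
      (use xs y in \<open>auto intro!: lin linear_map_compose[OF Fx] simp: linear_mapD(1)[OF Fx] m_mult E.m_assoc\<close>)
  finally show "m x1 \<otimes>\<^bsub>E\<^esub> convolution \<Delta> E m (F x2) y = \<dots>" .
qed (rule C.comult_closed[OF x])

lemma bilinear_\<omega>_mult: "bilinear_map B B E (\<lambda>x y. \<omega> (x \<otimes>\<^bsub>B\<^esub> y))"
  by (intro lin linear_map_compose[OF linear_\<omega>])

lemma bilinear_\<omega>_br: "bilinear_map B B E (\<lambda>x y. \<omega> (br x y))"
  by (intro lin linear_map_compose[OF linear_\<omega>])

text \<open>After convolution with \<open>m\<close> in both variables, the left side is the sum of
  m(x1 y1) \<omega>(x2 y2), that is h(x y), because \<Delta> is multiplicative. The right side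
  collapses by counit laws to m(x) h(y) + m(y) h(x), which is the defining relation for h(x
  y).\<close>

lemma \<omega>_mult:
  assumes x: "x \<in> carrier B" and y: "y \<in> carrier B"
  shows "\<omega> (x \<otimes>\<^bsub>B\<^esub> y) = \<epsilon> x \<odot>\<^bsub>E\<^esub> \<omega> y \<oplus>\<^bsub>E\<^esub> \<epsilon> y \<odot>\<^bsub>E\<^esub> \<omega> x"
proof (rule conv_m_cancel2[OF bilinear_\<omega>_mult _ _ x y])
  show "bilinear_map B B E (\<lambda>x y. \<epsilon> x \<odot>\<^bsub>E\<^esub> \<omega> y \<oplus>\<^bsub>E\<^esub> \<epsilon> y \<odot>\<^bsub>E\<^esub> \<omega> x)"
    by (intro lin linear_map_compose[OF linear_\<omega>] \<omega>_closed)
next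
  fix x y assume x: "x \<in> carrier B" and y: "y \<in> carrier B"
  have "convolution \<Delta> E m (\<lambda>x. convolution \<Delta> E m (\<lambda>y. \<omega> (x \<otimes>\<^bsub>B\<^esub> y)) y) x =
      tensor_lift E (\<lambda>x1 x2. tensor_lift E (\<lambda>y1 y2. m (x1 \<otimes>\<^bsub>B\<^esub> y1) \<otimes>\<^bsub>E\<^esub> \<omega> (x2 \<otimes>\<^bsub>B\<^esub> y2)) (\<Delta> y)) (\<Delta> x)"
    by (rule conv_m_conv_m[OF bilinear_\<omega>_mult x y])
  also have "\<dots> = tensor_lift E (\<lambda>a b. m a \<otimes>\<^bsub>E\<^esub> \<omega> b) (\<Delta> x \<otimes>\<^bsub>tensor B B\<^esub> \<Delta> y)"
    by (rule tensor_lift_mult[OF k_algebra_B k_algebra_B vec_space_E bilinear_m_mult[OF linear_\<omega>]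
        C.comult_closed[OF x] C.comult_closed[OF y], symmetric])
  also have "\<dots> = convolution \<Delta> E m \<omega> (x \<otimes>\<^bsub>B\<^esub> y)"
    by (simp add: convolution_def algebra_homD(2)[OF algebra_hom_comult] x y)
  also have "\<dots> = m x \<otimes>\<^bsub>E\<^esub> h y \<oplus>\<^bsub>E\<^esub> m y \<otimes>\<^bsub>E\<^esub> h x"
    using x y by (simp add: conv_m_\<omega> h_mult E.a_comm)
  finally have L: "convolution \<Delta> E m (\<lambda>x. convolution \<Delta> E m (\<lambda>y. \<omega> (x \<otimes>\<^bsub>B\<^esub> y)) y) x = \<dots>" .
  \<comment> \<open>The inner convolution in y: the first term turns \<omega>(y) into h(y), while in
    the second the counit of y leaves m(y) in front of \<omega>(x').\<close>
  have "convolution \<Delta> E m (\<lambda>y. \<epsilon> x' \<odot>\<^bsub>E\<^esub> \<omega> y \<oplus>\<^bsub>E\<^esub> \<epsilon> y \<odot>\<^bsub>E\<^esub> \<omega> x') y = \<epsilon> x' \<odot>\<^bsub>E\<^esub> h y \<oplus>\<^bsub>E\<^esub> m y \<otimes>\<^bsub>E\<^esub> \<omega> x'"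
    if x': "x' \<in> carrier B" for x'
  proof -
    have "convolution \<Delta> E m (\<lambda>y. \<epsilon> x' \<odot>\<^bsub>E\<^esub> \<omega> y) y = convolution \<Delta> E m (\<lambda>y. \<omega> (\<epsilon> x' \<odot>\<^bsub>B\<^esub> y)) y"
      by (rule C.convolution_cong[OF k_algebra_E linear_m _ y])
        (auto intro!: lin linear_\<omega> simp: linear_mapD(3)[OF linear_\<omega>])
    also have "\<dots> = \<epsilon> x' \<odot>\<^bsub>E\<^esub> convolution \<Delta> E m \<omega> y"
    proof -
      have "\<epsilon> x' \<odot>\<^bsub>E\<^esub> convolution \<Delta> E m \<omega> y = tensor_lift E (\<lambda>y1 y2. \<epsilon> x' \<odot>\<^bsub>E\<^esub> (m y1 \<otimes>\<^bsub>E\<^esub> \<omega> y2)) (\<Delta> y)"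
        unfolding convolution_def
        by (rule lift_linear_EE[where L = "\<lambda>x. \<epsilon> x' \<odot>\<^bsub>E\<^esub> x"]) (intro bilinear_m_mult linear_\<omega> lin C.comult_closed y)+
      also have "\<dots> = convolution \<Delta> E m (\<lambda>y. \<omega> (\<epsilon> x' \<odot>\<^bsub>B\<^esub> y)) y"
        unfolding convolution_def
        by (rule lift_cong_E)
          (use y in \<open>auto intro!: lin linear_map_compose[OF linear_\<omega>] simp: linear_mapD(3)[OF linear_\<omega>] k_algebraD(4)[OF k_algebra_E]\<close>)
      finally show ?thesis by simp
    qed
    finally show ?thesis
      using x' y by (subst conv_m_add) (auto intro!: lin linear_\<omega> simp: conv_m_\<omega> conv_m_counit)
  qed
  then have "convolution \<Delta> E m (\<lambda>x. convolution \<Delta> E m (\<lambda>y. \<epsilon> x \<odot>\<^bsub>E\<^esub> \<omega> y \<oplus>\<^bsub>E\<^esub> \<epsilon> y \<odot>\<^bsub>E\<^esub> \<omega> x) y) x =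
      convolution \<Delta> E m (\<lambda>x. \<epsilon> x \<odot>\<^bsub>E\<^esub> h y \<oplus>\<^bsub>E\<^esub> m y \<otimes>\<^bsub>E\<^esub> \<omega> x) x"
    by (intro C.convolution_cong[OF k_algebra_E linear_m _ x] linear_conv_m_fun[OF _ y] lin
        linear_map_compose[OF linear_\<omega>] \<omega>_closed) auto
  also have "\<dots> = m x \<otimes>\<^bsub>E\<^esub> h y \<oplus>\<^bsub>E\<^esub> m y \<otimes>\<^bsub>E\<^esub> h x"
    using x y by (subst conv_m_add)
      (auto intro!: lin linear_\<omega> simp: conv_m_counit conv_m_mult_left[OF linear_\<omega>] conv_m_\<omega>)
  finally show "convolution \<Delta> E m (\<lambda>x. convolution \<Delta> E m (\<lambda>y. \<omega> (x \<otimes>\<^bsub>B\<^esub> y)) y) x =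
      convolution \<Delta> E m (\<lambda>x. convolution \<Delta> E m (\<lambda>y. \<epsilon> x \<odot>\<^bsub>E\<^esub> \<omega> y \<oplus>\<^bsub>E\<^esub> \<epsilon> y \<odot>\<^bsub>E\<^esub> \<omega> x) y) x"
    using L by simp
qed

end

section \<open>The bracket under the comultiplication\<close>

context poisson
begin

lemma bilinear_bracket_summand:
  shows "a \<in> carrier B \<Longrightarrow> b \<in> carrier B \<Longrightarrow> bilinear_map B B (tensor B B)
      (\<lambda>c d. tens B B (a \<otimes>\<^bsub>B\<^esub> c) (br b d) \<oplus>\<^bsub>tensor B B\<^esub> tens B B (br a c) (b \<otimes>\<^bsub>B\<^esub> d))"
    and "c \<in> carrier B \<Longrightarrow> d \<in> carrier B \<Longrightarrow> bilinear_map B B (tensor B B)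
      (\<lambda>a b. tens B B (a \<otimes>\<^bsub>B\<^esub> c) (br b d) \<oplus>\<^bsub>tensor B B\<^esub> tens B B (br a c) (b \<otimes>\<^bsub>B\<^esub> d))"
proof -
  note V = vec_space_B
  note lin = linear_map_id linear_map_plus[OF vec_space_tensor[OF V V]]
    linear_map_tens_left[OF V V] linear_map_tens_right[OF V V]
    linear_map_mult_left[OF k_algebra_B] linear_map_mult_right[OF k_algebra_B]
    linear_map_bilinear_left[OF bilinear_br] linear_map_bilinear_right[OF bilinear_br] bilinear_mapI
  show "bilinear_map B B (tensor B B)
      (\<lambda>c d. tens B B (a \<otimes>\<^bsub>B\<^esub> c) (br b d) \<oplus>\<^bsub>tensor B B\<^esub> tens B B (br a c) (b \<otimes>\<^bsub>B\<^esub> d))"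
    if "a \<in> carrier B" "b \<in> carrier B"
    using that by (intro lin br_closed B.m_closed)
  show "bilinear_map B B (tensor B B)
      (\<lambda>a b. tens B B (a \<otimes>\<^bsub>B\<^esub> c) (br b d) \<oplus>\<^bsub>tensor B B\<^esub> tens B B (br a c) (b \<otimes>\<^bsub>B\<^esub> d))"
    if "c \<in> carrier B" "d \<in> carrier B"
    using that by (intro lin br_closed B.m_closed)
qed

lemma tensor_lift_bracket:
  assumes W: "vec_space W" and g: "bilinear_map B B W g"
    and s: "s \<in> carrier (tensor B B)" and t: "t \<in> carrier (tensor B B)"
  shows "tensor_lift W g (tensor_bracket B br s t) =
    tensor_lift W (\<lambda>a b. tensor_lift W (\<lambda>c d.
      g (a \<otimes>\<^bsub>B\<^esub> c) (br b d) \<oplus>\<^bsub>W\<^esub> g (br a c) (b \<otimes>\<^bsub>B\<^esub> d)) t) s"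
proof -
  note V = vec_space_B
  note T = vec_space_tensor[OF V V]
  note F1 = bilinear_bracket_summand(1) and F2 = bilinear_bracket_summand(2)
  let ?F = "\<lambda>a b c d. tens B B (a \<otimes>\<^bsub>B\<^esub> c) (br b d) \<oplus>\<^bsub>tensor B B\<^esub> tens B B (br a c) (b \<otimes>\<^bsub>B\<^esub> d)"
  have F3: "bilinear_map B B (tensor B B) (\<lambda>a b. tensor_lift (tensor B B) (?F a b) t)"
    by (rule bilinear_map_tensor_lift_fun[OF V V T V V t F1 F2])
  have L: "linear_map (tensor B B) W (tensor_lift W g)"
    by (rule linear_map_tensor_lift[OF V V W g])
  have inner: "tensor_lift W g (tensor_lift (tensor B B) (?F a b) t) =
      tensor_lift W (\<lambda>c d. g (a \<otimes>\<^bsub>B\<^esub> c) (br b d) \<oplus>\<^bsub>W\<^esub> g (br a c) (b \<otimes>\<^bsub>B\<^esub> d)) t"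
    if ab: "a \<in> carrier B" "b \<in> carrier B" for a b
    unfolding tensor_lift_linear[OF V V T W F1[OF ab] L t]
    by (rule tensor_lift_cong[OF V V W bilinear_map_compose[OF V V L F1[OF ab]] _ t])
      (use ab in \<open>simp add: linear_mapD(2)[OF L] tens_closed[OF V V] tensor_lift_tens[OF V V W g]\<close>)
  show ?thesis
    unfolding tensor_bracket_def tensor_lift_linear[OF V V T W F3 L s]
    by (rule tensor_lift_cong[OF V V W bilinear_map_compose[OF V V L F3] _ s]) (simp add: inner)
qed

end

context poisson_hopf
begin

text \<open>Sweedler form of the compatibility axiom: \<Delta>{x, y} has one half x1 y1 \<otimes>
  {x2, y2} and one half {x1, y1} \<otimes> x2 y2.\<close>

lemma comult_br_lift:
  assumes W: "vec_space W" and g: "bilinear_map B B W g" and x: "x \<in> carrier B" and y: "y \<in> carrier B"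
  shows "tensor_lift W g (\<Delta> (br x y)) =
    tensor_lift W (\<lambda>x1 x2. tensor_lift W (\<lambda>y1 y2.
      g (x1 \<otimes>\<^bsub>B\<^esub> y1) (br x2 y2) \<oplus>\<^bsub>W\<^esub> g (br x1 y1) (x2 \<otimes>\<^bsub>B\<^esub> y2)) (\<Delta> y)) (\<Delta> x)"
  unfolding comult_br[OF x y]
  by (rule tensor_lift_bracket[OF W g C.comult_closed[OF x] C.comult_closed[OF y]])

lemma tensor_lift_add2:
  assumes W: "vec_space W"
    and F1: "\<And>a b. a \<in> carrier B \<Longrightarrow> b \<in> carrier B \<Longrightarrow> bilinear_map B B W (F a b)"
    and F2: "\<And>c d. c \<in> carrier B \<Longrightarrow> d \<in> carrier B \<Longrightarrow> bilinear_map B B W (\<lambda>a b. F a b c d)"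
    and G1: "\<And>a b. a \<in> carrier B \<Longrightarrow> b \<in> carrier B \<Longrightarrow> bilinear_map B B W (G a b)"
    and G2: "\<And>c d. c \<in> carrier B \<Longrightarrow> d \<in> carrier B \<Longrightarrow> bilinear_map B B W (\<lambda>a b. G a b c d)"
    and s: "s \<in> carrier (tensor B B)" and t: "t \<in> carrier (tensor B B)"
  shows "tensor_lift W (\<lambda>a b. tensor_lift W (\<lambda>c d. F a b c d \<oplus>\<^bsub>W\<^esub> G a b c d) t) s =
    tensor_lift W (\<lambda>a b. tensor_lift W (F a b) t) s \<oplus>\<^bsub>W\<^esub> tensor_lift W (\<lambda>a b. tensor_lift W (G a b) t) s"
proof -
  note V = vec_space_B
  have F: "bilinear_map B B W (\<lambda>a b. tensor_lift W (F a b) t)"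
    by (rule bilinear_map_tensor_lift_fun[OF V V W V V t F1 F2])
  have G: "bilinear_map B B W (\<lambda>a b. tensor_lift W (G a b) t)"
    by (rule bilinear_map_tensor_lift_fun[OF V V W V V t G1 G2])
  have FG: "bilinear_map B B W (\<lambda>a b. tensor_lift W (F a b) t \<oplus>\<^bsub>W\<^esub> tensor_lift W (G a b) t)"
    by (intro bilinear_mapI linear_map_plus[OF W] bilinear_map_left[OF F] bilinear_map_right[OF F]
      bilinear_map_left[OF G] bilinear_map_right[OF G])
  have "tensor_lift W (\<lambda>a b. tensor_lift W (\<lambda>c d. F a b c d \<oplus>\<^bsub>W\<^esub> G a b c d) t) s =
      tensor_lift W (\<lambda>a b. tensor_lift W (F a b) t \<oplus>\<^bsub>W\<^esub> tensor_lift W (G a b) t) s"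
    by (rule sym, rule tensor_lift_cong[OF V V W FG _ s]) (simp add: tensor_lift_add_fun[OF V V W F1 G1 t])
  then show ?thesis by (simp add: tensor_lift_add_fun[OF V V W F G s])
qed

text \<open>Applying \<epsilon> \<otimes> \<epsilon> to \<Delta>{x, y} gives \<epsilon>{x, y} on the
  one hand, and on the other the same scalar once from each half of the bracket of B \<otimes> B. So
  a = a + a, which forces a = 0 in every characteristic.\<close>

lemma counit_br:
  assumes x: "x \<in> carrier B" and y: "y \<in> carrier B"
  shows "\<epsilon> (br x y) = 0"
proof -
  note V = vec_space_B and K = vec_space_ground
  let ?tl = "tensor_lift (ground :: ('k, 'k) module)"
  note glin = bilinear_mapI linear_map_ground_mult_left linear_map_ground_mult_right
    linear_map_compose[OF C.linear_counit]
    linear_map_bilinear_left[OF bilinear_br] linear_map_bilinear_right[OF bilinear_br]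
    linear_map_mult_left[OF k_algebra_B] linear_map_mult_right[OF k_algebra_B] linear_map_id
  have g: "bilinear_map B B ground (\<lambda>a b. \<epsilon> a * \<epsilon> b)" by (intro glin)
  have lift: "?tl (\<lambda>a b. \<epsilon> a * \<epsilon> b) (\<Delta> z) = \<epsilon> z" if "z \<in> carrier B" for z
    using C.counit_left_lift[OF K C.linear_counit that] by simp
  have l: "?tl (\<lambda>x1 x2. ?tl (\<lambda>y1 y2. \<epsilon> (x1 \<otimes>\<^bsub>B\<^esub> y1) * \<epsilon> (br x2 y2)) (\<Delta> y)) (\<Delta> x) = \<epsilon> (br x y)"
  proof -
    have "?tl (\<lambda>y1 y2. \<epsilon> (x1 \<otimes>\<^bsub>B\<^esub> y1) * \<epsilon> (br x2 y2)) (\<Delta> y) = \<epsilon> x1 * \<epsilon> (br x2 y)"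
      if xs: "x1 \<in> carrier B" "x2 \<in> carrier B" for x1 x2
    proof -
      have f: "linear_map B ground (\<lambda>y2. \<epsilon> x1 * \<epsilon> (br x2 y2))" using xs by (intro glin)
      have "?tl (\<lambda>y1 y2. \<epsilon> (x1 \<otimes>\<^bsub>B\<^esub> y1) * \<epsilon> (br x2 y2)) (\<Delta> y) = ?tl (\<lambda>y1 y2. \<epsilon> y1 * (\<epsilon> x1 * \<epsilon> (br x2 y2))) (\<Delta> y)"
        by (rule tensor_lift_cong[OF V V K]) (use xs y in \<open>auto intro!: glin simp: counit_mult\<close>)
      then show ?thesis using C.counit_left_lift[OF K f y] by simp
    qed
    then have "?tl (\<lambda>x1 x2. ?tl (\<lambda>y1 y2. \<epsilon> (x1 \<otimes>\<^bsub>B\<^esub> y1) * \<epsilon> (br x2 y2)) (\<Delta> y)) (\<Delta> x) = ?tl (\<lambda>x1 x2. \<epsilon> x1 * \<epsilon> (br x2 y)) (\<Delta> x)"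
      by (intro tensor_lift_cong[OF V V K, symmetric]) (use x y in \<open>auto intro!: glin\<close>)
    moreover have "linear_map B ground (\<lambda>x. \<epsilon> (br x y))" using y by (intro glin)
    ultimately show ?thesis using C.counit_left_lift[OF K _ x, of "\<lambda>x. \<epsilon> (br x y)"] by simp
  qed
  have r: "?tl (\<lambda>x1 x2. ?tl (\<lambda>y1 y2. \<epsilon> (br x1 y1) * \<epsilon> (x2 \<otimes>\<^bsub>B\<^esub> y2)) (\<Delta> y)) (\<Delta> x) = \<epsilon> (br x y)"
  proof -
    have "?tl (\<lambda>y1 y2. \<epsilon> (br x1 y1) * \<epsilon> (x2 \<otimes>\<^bsub>B\<^esub> y2)) (\<Delta> y) = \<epsilon> x2 * \<epsilon> (br x1 y)"
      if xs: "x1 \<in> carrier B" "x2 \<in> carrier B" for x1 x2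
    proof -
      have f: "linear_map B ground (\<lambda>y1. \<epsilon> x2 * \<epsilon> (br x1 y1))" using xs by (intro glin)
      have "?tl (\<lambda>y1 y2. \<epsilon> (br x1 y1) * \<epsilon> (x2 \<otimes>\<^bsub>B\<^esub> y2)) (\<Delta> y) = ?tl (\<lambda>y1 y2. \<epsilon> y2 * (\<epsilon> x2 * \<epsilon> (br x1 y1))) (\<Delta> y)"
        by (rule tensor_lift_cong[OF V V K]) (use xs y in \<open>auto intro!: glin simp: counit_mult\<close>)
      then show ?thesis using C.counit_right_lift[OF K f y] by simp
    qed
    then have "?tl (\<lambda>x1 x2. ?tl (\<lambda>y1 y2. \<epsilon> (br x1 y1) * \<epsilon> (x2 \<otimes>\<^bsub>B\<^esub> y2)) (\<Delta> y)) (\<Delta> x) = ?tl (\<lambda>x1 x2. \<epsilon> x2 * \<epsilon> (br x1 y)) (\<Delta> x)"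
      by (intro tensor_lift_cong[OF V V K, symmetric]) (use x y in \<open>auto intro!: glin\<close>)
    moreover have "linear_map B ground (\<lambda>x. \<epsilon> (br x y))" using y by (intro glin)
    ultimately show ?thesis using C.counit_right_lift[OF K _ x, of "\<lambda>x. \<epsilon> (br x y)"] by simp
  qed
  have "\<epsilon> (br x y) = ?tl (\<lambda>x1 x2. ?tl (\<lambda>y1 y2. \<epsilon> (x1 \<otimes>\<^bsub>B\<^esub> y1) * \<epsilon> (br x2 y2) \<oplus>\<^bsub>ground\<^esub> \<epsilon> (br x1 y1) * \<epsilon> (x2 \<otimes>\<^bsub>B\<^esub> y2)) (\<Delta> y)) (\<Delta> x)"
    unfolding comult_br_lift[OF K g x y, symmetric] by (simp add: lift x y)
  also have "\<dots> = \<epsilon> (br x y) \<oplus>\<^bsub>ground\<^esub> \<epsilon> (br x y)"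
    by (subst tensor_lift_add2[OF K]) (use x y l r in \<open>auto intro!: glin\<close>)
  finally show ?thesis by (simp only: ground_simps add_cancel_right_right)
qed

text \<open>The correction that appears when h(x) is moved past the first factor of the sum of m(y1)
  \<omega>(y2), which is h(y).\<close>

definition bracket_sum where
  "bracket_sum x y = tensor_lift E (\<lambda>y1 y2. m (br x y1) \<otimes>\<^bsub>E\<^esub> \<omega> y2) (\<Delta> y)"

lemmas lin\<omega> = lin linear_map_compose[OF linear_\<omega>]

lemma bracket_sum_closed [simp]: "x \<in> carrier B \<Longrightarrow> y \<in> carrier B \<Longrightarrow> bracket_sum x y \<in> carrier E"
  unfolding bracket_sum_def by (intro lift_closed_E lin\<omega> C.comult_closed m_closed \<omega>_closed br_closed)

text \<open>Antisymmetry of the bracket inside the Sweedler sum: the summands cancel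
  pairwise.\<close>

lemma bracket_sum_flip:
  assumes x: "x \<in> carrier B" and y: "y \<in> carrier B"
  shows "tensor_lift E (\<lambda>x1 x2. m (br x1 y) \<otimes>\<^bsub>E\<^esub> \<omega> x2) (\<Delta> x) \<oplus>\<^bsub>E\<^esub> bracket_sum y x = \<zero>\<^bsub>E\<^esub>"
proof -
  have b1: "bilinear_map B B E (\<lambda>x1 x2. m (br x1 y) \<otimes>\<^bsub>E\<^esub> \<omega> x2)"
    and b2: "bilinear_map B B E (\<lambda>x1 x2. m (br y x1) \<otimes>\<^bsub>E\<^esub> \<omega> x2)"
    by (insert y) (intro lin\<omega> m_closed \<omega>_closed br_closed; assumption)+
  have "tensor_lift E (\<lambda>x1 x2. m (br x1 y) \<otimes>\<^bsub>E\<^esub> \<omega> x2) (\<Delta> x) \<oplus>\<^bsub>E\<^esub> bracket_sum y x =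
      tensor_lift E (\<lambda>x1 x2. m (br x1 y) \<otimes>\<^bsub>E\<^esub> \<omega> x2 \<oplus>\<^bsub>E\<^esub> m (br y x1) \<otimes>\<^bsub>E\<^esub> \<omega> x2) (\<Delta> x)"
    unfolding bracket_sum_def by (rule lift_add_E[OF b1 b2 C.comult_closed[OF x], symmetric])
  also have "\<dots> = tensor_lift E (\<lambda>x1 x2. \<zero>\<^bsub>E\<^esub>) (\<Delta> x)"
  proof (rule lift_cong_E)
    show "bilinear_map B B E (\<lambda>x1 x2. m (br x1 y) \<otimes>\<^bsub>E\<^esub> \<omega> x2 \<oplus>\<^bsub>E\<^esub> m (br y x1) \<otimes>\<^bsub>E\<^esub> \<omega> x2)"
      using y by (intro lin\<omega> m_closed \<omega>_closed br_closed)
    fix a b assume ab: "a \<in> carrier B" "b \<in> carrier B"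
    have "m (br a y) \<otimes>\<^bsub>E\<^esub> \<omega> b \<oplus>\<^bsub>E\<^esub> m (br y a) \<otimes>\<^bsub>E\<^esub> \<omega> b = m (br a y \<oplus>\<^bsub>B\<^esub> br y a) \<otimes>\<^bsub>E\<^esub> \<omega> b"
      using ab y by (simp add: E.l_distr m_add)
    then show "m (br a y) \<otimes>\<^bsub>E\<^esub> \<omega> b \<oplus>\<^bsub>E\<^esub> m (br y a) \<otimes>\<^bsub>E\<^esub> \<omega> b = \<zero>\<^bsub>E\<^esub>"
      using ab y by (simp add: br_antisym_add linear_map_zero[OF vec_space_B vec_space_E linear_m])
  qed (rule C.comult_closed[OF x])
  \<comment> \<open>The sum of zeros equals twice itself, hence vanishes.\<close>
  also have "\<dots> = \<zero>\<^bsub>E\<^esub>"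
  proof -
    have b: "bilinear_map B B E (\<lambda>x1 x2. \<zero>\<^bsub>E\<^esub>)"
      by (intro bilinear_mapI linear_map_const_zero vec_space_E)
    have "tensor_lift E (\<lambda>x1 x2. \<zero>\<^bsub>E\<^esub> \<oplus>\<^bsub>E\<^esub> \<zero>\<^bsub>E\<^esub>) (\<Delta> x) = tensor_lift E (\<lambda>x1 x2. \<zero>\<^bsub>E\<^esub>) (\<Delta> x) \<oplus>\<^bsub>E\<^esub> tensor_lift E (\<lambda>x1 x2. \<zero>\<^bsub>E\<^esub>) (\<Delta> x)"
      by (rule lift_add_E[OF b b C.comult_closed[OF x]])
    then show ?thesis using lift_closed_E[OF b C.comult_closed[OF x]]
      E.add.l_cancel_one'[of "tensor_lift E (\<lambda>x1 x2. \<zero>\<^bsub>E\<^esub>) (\<Delta> x)" "tensor_lift E (\<lambda>x1 x2. \<zero>\<^bsub>E\<^esub>) (\<Delta> x)"] by simp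
  qed
  finally show ?thesis .
qed

text \<open>Start from h{x, y} as the sum of m(a) \<omega>(b) over \<Delta>{x, y}. The half x1 y1
  \<otimes> {x2, y2} is the double convolution of \<omega>{x, y}. In the half {x1, y1} \<otimes> x2
  y2 the Leibniz rule for \<omega>(x2 y2) leaves a counit in each term, and the two collapsed sums
  are the corrections.\<close>

lemma h_br_sum:
  assumes x: "x \<in> carrier B" and y: "y \<in> carrier B"
  shows "h (br x y) = convolution \<Delta> E m (\<lambda>x. convolution \<Delta> E m (\<lambda>y. \<omega> (br x y)) y) x \<oplus>\<^bsub>E\<^esub>
    (bracket_sum x y \<oplus>\<^bsub>E\<^esub> tensor_lift E (\<lambda>x1 x2. m (br x1 y) \<otimes>\<^bsub>E\<^esub> \<omega> x2) (\<Delta> x))"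
proof -
  note cl = m_closed \<omega>_closed br_closed B.m_closed E.m_closed smult_closed_E C.comult_closed x y
  let ?F = "\<lambda>x1 x2 y1 y2. m (br x1 y1) \<otimes>\<^bsub>E\<^esub> \<omega> (x2 \<otimes>\<^bsub>B\<^esub> y2)"
  have second: "tensor_lift E (\<lambda>x1 x2. tensor_lift E (?F x1 x2) (\<Delta> y)) (\<Delta> x) =
      bracket_sum x y \<oplus>\<^bsub>E\<^esub> tensor_lift E (\<lambda>x1 x2. m (br x1 y) \<otimes>\<^bsub>E\<^esub> \<omega> x2) (\<Delta> x)"
  proof -
    have lbs: "linear_map B E (\<lambda>x. bracket_sum x y)"
      unfolding bracket_sum_def by (intro lift_fun_E lin\<omega> vec_space_B cl; assumption?)
    have lb: "linear_map B E (\<lambda>y1. m (br x1 y1) \<otimes>\<^bsub>E\<^esub> \<omega> x2)" if "x1 \<in> carrier B" "x2 \<in> carrier B" for x1 x2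
      using that by (intro lin\<omega> cl)
    have inner: "tensor_lift E (?F x1 x2) (\<Delta> y) = \<epsilon> x2 \<odot>\<^bsub>E\<^esub> bracket_sum x1 y \<oplus>\<^bsub>E\<^esub> m (br x1 y) \<otimes>\<^bsub>E\<^esub> \<omega> x2"
      if xs: "x1 \<in> carrier B" "x2 \<in> carrier B" for x1 x2
    proof -
      have b1: "bilinear_map B B E (\<lambda>y1 y2. \<epsilon> x2 \<odot>\<^bsub>E\<^esub> (m (br x1 y1) \<otimes>\<^bsub>E\<^esub> \<omega> y2))"
        and b2: "bilinear_map B B E (\<lambda>y1 y2. \<epsilon> y2 \<odot>\<^bsub>E\<^esub> (m (br x1 y1) \<otimes>\<^bsub>E\<^esub> \<omega> x2))"
        and b3: "bilinear_map B B E (\<lambda>y1 y2. m (br x1 y1) \<otimes>\<^bsub>E\<^esub> \<omega> y2)"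
        and b4: "bilinear_map B B E (?F x1 x2)"
        by (insert xs) (intro lin\<omega> cl; assumption?)+
      \<comment> \<open>In the first term the counit falls on x2 and waits for the outer sum; in the
        second it falls on y2 and collapses the sum over y at once.\<close>
      have "tensor_lift E (?F x1 x2) (\<Delta> y) =
          tensor_lift E (\<lambda>y1 y2. \<epsilon> x2 \<odot>\<^bsub>E\<^esub> (m (br x1 y1) \<otimes>\<^bsub>E\<^esub> \<omega> y2) \<oplus>\<^bsub>E\<^esub> \<epsilon> y2 \<odot>\<^bsub>E\<^esub> (m (br x1 y1) \<otimes>\<^bsub>E\<^esub> \<omega> x2)) (\<Delta> y)"
        by (rule lift_cong_E[OF b4])
          (use xs y in \<open>auto simp: \<omega>_mult E.r_distr k_algebraD(4)[OF k_algebra_E]\<close>)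
      also have "\<dots> = tensor_lift E (\<lambda>y1 y2. \<epsilon> x2 \<odot>\<^bsub>E\<^esub> (m (br x1 y1) \<otimes>\<^bsub>E\<^esub> \<omega> y2)) (\<Delta> y) \<oplus>\<^bsub>E\<^esub>
          tensor_lift E (\<lambda>y1 y2. \<epsilon> y2 \<odot>\<^bsub>E\<^esub> (m (br x1 y1) \<otimes>\<^bsub>E\<^esub> \<omega> x2)) (\<Delta> y)"
        by (rule lift_add_E[OF b1 b2 C.comult_closed[OF y]])
      also have "tensor_lift E (\<lambda>y1 y2. \<epsilon> x2 \<odot>\<^bsub>E\<^esub> (m (br x1 y1) \<otimes>\<^bsub>E\<^esub> \<omega> y2)) (\<Delta> y) = \<epsilon> x2 \<odot>\<^bsub>E\<^esub> bracket_sum x1 y"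
        unfolding bracket_sum_def
        by (rule lift_linear_EE[where L = "\<lambda>e. \<epsilon> x2 \<odot>\<^bsub>E\<^esub> e", OF b3 _ C.comult_closed[OF y], symmetric]) (intro lin)
      also have "tensor_lift E (\<lambda>y1 y2. \<epsilon> y2 \<odot>\<^bsub>E\<^esub> (m (br x1 y1) \<otimes>\<^bsub>E\<^esub> \<omega> x2)) (\<Delta> y) = m (br x1 y) \<otimes>\<^bsub>E\<^esub> \<omega> x2"
        by (rule C.counit_right_lift[OF vec_space_E lb[OF xs] y])
      finally show ?thesis .
    qed
    have b5: "bilinear_map B B E (\<lambda>x1 x2. \<epsilon> x2 \<odot>\<^bsub>E\<^esub> bracket_sum x1 y)"
      and b6: "bilinear_map B B E (\<lambda>x1 x2. m (br x1 y) \<otimes>\<^bsub>E\<^esub> \<omega> x2)"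
      and b7: "bilinear_map B B E (\<lambda>x1 x2. \<epsilon> x2 \<odot>\<^bsub>E\<^esub> bracket_sum x1 y \<oplus>\<^bsub>E\<^esub> m (br x1 y) \<otimes>\<^bsub>E\<^esub> \<omega> x2)"
      by - (intro lin\<omega> lbs bracket_sum_closed cl; assumption?)+
    have "tensor_lift E (\<lambda>x1 x2. tensor_lift E (?F x1 x2) (\<Delta> y)) (\<Delta> x) =
        tensor_lift E (\<lambda>x1 x2. \<epsilon> x2 \<odot>\<^bsub>E\<^esub> bracket_sum x1 y \<oplus>\<^bsub>E\<^esub> m (br x1 y) \<otimes>\<^bsub>E\<^esub> \<omega> x2) (\<Delta> x)"
      by (rule sym, rule lift_cong_E[OF b7 _ C.comult_closed[OF x]]) (simp add: inner)
    also have "\<dots> = tensor_lift E (\<lambda>x1 x2. \<epsilon> x2 \<odot>\<^bsub>E\<^esub> bracket_sum x1 y) (\<Delta> x) \<oplus>\<^bsub>E\<^esub>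
        tensor_lift E (\<lambda>x1 x2. m (br x1 y) \<otimes>\<^bsub>E\<^esub> \<omega> x2) (\<Delta> x)"
      by (rule lift_add_E[OF b5 b6 C.comult_closed[OF x]])
    also have "tensor_lift E (\<lambda>x1 x2. \<epsilon> x2 \<odot>\<^bsub>E\<^esub> bracket_sum x1 y) (\<Delta> x) = bracket_sum x y"
      by (rule C.counit_right_lift[OF vec_space_E lbs x])
    finally show ?thesis .
  qed
  have "h (br x y) = tensor_lift E (\<lambda>a b. m a \<otimes>\<^bsub>E\<^esub> \<omega> b) (\<Delta> (br x y))"
    using conv_m_\<omega>[OF br_closed[OF x y]] by (simp add: convolution_def)
  also have "\<dots> = tensor_lift E (\<lambda>x1 x2. tensor_lift E (\<lambda>y1 y2.
      m (x1 \<otimes>\<^bsub>B\<^esub> y1) \<otimes>\<^bsub>E\<^esub> \<omega> (br x2 y2) \<oplus>\<^bsub>E\<^esub> ?F x1 x2 y1 y2) (\<Delta> y)) (\<Delta> x)"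
    by (rule comult_br_lift[OF vec_space_E bilinear_m_mult[OF linear_\<omega>] x y])
  also have "\<dots> = tensor_lift E (\<lambda>x1 x2. tensor_lift E (\<lambda>y1 y2. m (x1 \<otimes>\<^bsub>B\<^esub> y1) \<otimes>\<^bsub>E\<^esub> \<omega> (br x2 y2)) (\<Delta> y)) (\<Delta> x) \<oplus>\<^bsub>E\<^esub>
      tensor_lift E (\<lambda>x1 x2. tensor_lift E (?F x1 x2) (\<Delta> y)) (\<Delta> x)"
    by (rule tensor_lift_add2[OF vec_space_E]) (intro lin\<omega> cl; assumption?)+
  finally show ?thesis
    unfolding conv_m_conv_m[OF bilinear_\<omega>_br x y] second .
qed

text \<open>The inner convolution turns \<omega>(y) into h(y), which then stands between m(x1) and
  \<omega>(x2). Pulling h(y) out to the left costs m{y, x1}, and these terms make up the added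
  correction.\<close>

lemma conv_m_\<omega>\<omega>:
  assumes x: "x \<in> carrier B" and y: "y \<in> carrier B"
  shows "convolution \<Delta> E m (\<lambda>x. convolution \<Delta> E m (\<lambda>y. \<omega> y \<otimes>\<^bsub>E\<^esub> \<omega> x) y) x \<oplus>\<^bsub>E\<^esub> bracket_sum y x = h y \<otimes>\<^bsub>E\<^esub> h x"
proof -
  note cl = m_closed \<omega>_closed h_closed br_closed B.m_closed E.m_closed smult_closed_E C.comult_closed x y
  have b: "bilinear_map B B E (\<lambda>x y. \<omega> y \<otimes>\<^bsub>E\<^esub> \<omega> x)" by (intro lin\<omega> cl)
  have lh: "linear_map B E (\<lambda>x. h y \<otimes>\<^bsub>E\<^esub> \<omega> x)" by (intro lin\<omega> cl)
  have b1: "bilinear_map B B E (\<lambda>x1 x2. m x1 \<otimes>\<^bsub>E\<^esub> (h y \<otimes>\<^bsub>E\<^esub> \<omega> x2))"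
    and b2: "bilinear_map B B E (\<lambda>x1 x2. m (br y x1) \<otimes>\<^bsub>E\<^esub> \<omega> x2)"
    and b3: "bilinear_map B B E (\<lambda>x1 x2. h y \<otimes>\<^bsub>E\<^esub> (m x1 \<otimes>\<^bsub>E\<^esub> \<omega> x2))"
    by - (intro lin\<omega> cl; assumption?)+
  have "convolution \<Delta> E m (\<lambda>x. convolution \<Delta> E m (\<lambda>y. \<omega> y \<otimes>\<^bsub>E\<^esub> \<omega> x) y) x = convolution \<Delta> E m (\<lambda>x. h y \<otimes>\<^bsub>E\<^esub> \<omega> x) x"
    by (rule C.convolution_cong[OF k_algebra_E linear_m linear_conv_m_fun[OF b y] x])
      (simp_all add: conv_m_mult_right[OF linear_\<omega>] conv_m_\<omega> y)
  then have "convolution \<Delta> E m (\<lambda>x. convolution \<Delta> E m (\<lambda>y. \<omega> y \<otimes>\<^bsub>E\<^esub> \<omega> x) y) x \<oplus>\<^bsub>E\<^esub> bracket_sum y x =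
      tensor_lift E (\<lambda>x1 x2. m x1 \<otimes>\<^bsub>E\<^esub> (h y \<otimes>\<^bsub>E\<^esub> \<omega> x2) \<oplus>\<^bsub>E\<^esub> m (br y x1) \<otimes>\<^bsub>E\<^esub> \<omega> x2) (\<Delta> x)"
    unfolding lift_add_E[OF b1 b2 C.comult_closed[OF x]] by (simp add: convolution_def bracket_sum_def)
  also have "\<dots> = tensor_lift E (\<lambda>x1 x2. h y \<otimes>\<^bsub>E\<^esub> (m x1 \<otimes>\<^bsub>E\<^esub> \<omega> x2)) (\<Delta> x)"
  proof (rule lift_cong_E[OF b3 _ C.comult_closed[OF x], symmetric])
    fix a c assume ac: "a \<in> carrier B" "c \<in> carrier B"
    have "h y \<otimes>\<^bsub>E\<^esub> (m a \<otimes>\<^bsub>E\<^esub> \<omega> c) = (m (br y a) \<oplus>\<^bsub>E\<^esub> m a \<otimes>\<^bsub>E\<^esub> h y) \<otimes>\<^bsub>E\<^esub> \<omega> c"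
      using ac y by (simp add: h_m flip: E.m_assoc)
    then show "h y \<otimes>\<^bsub>E\<^esub> (m a \<otimes>\<^bsub>E\<^esub> \<omega> c) = m a \<otimes>\<^bsub>E\<^esub> (h y \<otimes>\<^bsub>E\<^esub> \<omega> c) \<oplus>\<^bsub>E\<^esub> m (br y a) \<otimes>\<^bsub>E\<^esub> \<omega> c"
      using ac y by (simp add: E.l_distr E.m_assoc E.a_comm)
  qed
  also have "\<dots> = h y \<otimes>\<^bsub>E\<^esub> convolution \<Delta> E m \<omega> x"
    unfolding convolution_def
    by (rule lift_linear_EE[where L = "\<lambda>e. h y \<otimes>\<^bsub>E\<^esub> e", symmetric]) (intro lin\<omega> cl bilinear_m_mult linear_\<omega>; assumption?)+
  finally show ?thesis by (simp add: conv_m_\<omega> x)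
qed

text \<open>This is \<open>conv_m_\<omega>\<omega>\<close> with x and y exchanged. The two double
  convolutions agree because the Sweedler sums can be interchanged and x1 y1 = y1 x1.\<close>

lemma conv_m_\<omega>\<omega>_swap:
  assumes x: "x \<in> carrier B" and y: "y \<in> carrier B"
  shows "convolution \<Delta> E m (\<lambda>x. convolution \<Delta> E m (\<lambda>y. \<omega> x \<otimes>\<^bsub>E\<^esub> \<omega> y) y) x \<oplus>\<^bsub>E\<^esub> bracket_sum x y = h x \<otimes>\<^bsub>E\<^esub> h y"
proof -
  note cl = m_closed \<omega>_closed h_closed br_closed B.m_closed E.m_closed smult_closed_E C.comult_closed x y
  have b: "bilinear_map B B E (\<lambda>x y. \<omega> x \<otimes>\<^bsub>E\<^esub> \<omega> y)" "bilinear_map B B E (\<lambda>y x. \<omega> x \<otimes>\<^bsub>E\<^esub> \<omega> y)"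
    by - (intro lin\<omega> cl; assumption?)+
  have c: "bilinear_map B B E (\<lambda>x1 x2. m (x1 \<otimes>\<^bsub>B\<^esub> y1) \<otimes>\<^bsub>E\<^esub> (\<omega> x2 \<otimes>\<^bsub>E\<^esub> \<omega> y2))"
    "bilinear_map B B E (\<lambda>x1 x2. m (y1 \<otimes>\<^bsub>B\<^esub> x1) \<otimes>\<^bsub>E\<^esub> (\<omega> x2 \<otimes>\<^bsub>E\<^esub> \<omega> y2))"
    "bilinear_map B B E (\<lambda>x1 x2. m (y1 \<otimes>\<^bsub>B\<^esub> x1) \<otimes>\<^bsub>E\<^esub> (\<omega> y2 \<otimes>\<^bsub>E\<^esub> \<omega> x2))"
    if "y1 \<in> carrier B" "y2 \<in> carrier B" for y1 y2
    by (insert that) (intro lin\<omega> cl; assumption?)+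
  have "convolution \<Delta> E m (\<lambda>x. convolution \<Delta> E m (\<lambda>y. \<omega> x \<otimes>\<^bsub>E\<^esub> \<omega> y) y) x =
      tensor_lift E (\<lambda>x1 x2. tensor_lift E (\<lambda>y1 y2. m (x1 \<otimes>\<^bsub>B\<^esub> y1) \<otimes>\<^bsub>E\<^esub> (\<omega> x2 \<otimes>\<^bsub>E\<^esub> \<omega> y2)) (\<Delta> y)) (\<Delta> x)"
    by (rule conv_m_conv_m[OF b(1) x y])
  also have "\<dots> = tensor_lift E (\<lambda>y1 y2. tensor_lift E (\<lambda>x1 x2. m (x1 \<otimes>\<^bsub>B\<^esub> y1) \<otimes>\<^bsub>E\<^esub> (\<omega> x2 \<otimes>\<^bsub>E\<^esub> \<omega> y2)) (\<Delta> x)) (\<Delta> y)"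
    by (rule tensor_lift_swap[OF vec_space_B vec_space_B vec_space_B vec_space_B vec_space_E]) (intro lin\<omega> cl; assumption?)+
  also have "\<dots> = tensor_lift E (\<lambda>y1 y2. tensor_lift E (\<lambda>x1 x2. m (y1 \<otimes>\<^bsub>B\<^esub> x1) \<otimes>\<^bsub>E\<^esub> (\<omega> x2 \<otimes>\<^bsub>E\<^esub> \<omega> y2)) (\<Delta> x)) (\<Delta> y)"
  proof (rule lift_cong_E)
    show "bilinear_map B B E (\<lambda>y1 y2. tensor_lift E (\<lambda>x1 x2. m (x1 \<otimes>\<^bsub>B\<^esub> y1) \<otimes>\<^bsub>E\<^esub> (\<omega> x2 \<otimes>\<^bsub>E\<^esub> \<omega> y2)) (\<Delta> x))"
      by (rule bilinear_map_tensor_lift_fun[OF vec_space_B vec_space_B vec_space_E vec_space_B vec_space_B])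
        (intro lin\<omega> cl; assumption?)+
    fix a d assume "a \<in> carrier B" "d \<in> carrier B"
    then show "tensor_lift E (\<lambda>x1 x2. m (x1 \<otimes>\<^bsub>B\<^esub> a) \<otimes>\<^bsub>E\<^esub> (\<omega> x2 \<otimes>\<^bsub>E\<^esub> \<omega> d)) (\<Delta> x) = tensor_lift E (\<lambda>x1 x2. m (a \<otimes>\<^bsub>B\<^esub> x1) \<otimes>\<^bsub>E\<^esub> (\<omega> x2 \<otimes>\<^bsub>E\<^esub> \<omega> d)) (\<Delta> x)"
      by (intro lift_cong_E c C.comult_closed x) (simp_all add: B.m_comm)
  qed (rule C.comult_closed[OF y])
  also have "\<dots> = convolution \<Delta> E m (\<lambda>y. convolution \<Delta> E m (\<lambda>x. \<omega> x \<otimes>\<^bsub>E\<^esub> \<omega> y) x) y"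
    by (rule conv_m_conv_m[OF b(2) y x, symmetric])
  finally show ?thesis by (simp add: conv_m_\<omega>\<omega>[OF y x])
qed

lemma \<omega>_br:
  assumes x: "x \<in> carrier B" and y: "y \<in> carrier B"
  shows "\<omega> x \<otimes>\<^bsub>E\<^esub> \<omega> y = \<omega> (br x y) \<oplus>\<^bsub>E\<^esub> \<omega> y \<otimes>\<^bsub>E\<^esub> \<omega> x"
proof (rule conv_m_cancel2[OF _ _ _ x y])
  note cl = m_closed \<omega>_closed h_closed br_closed B.m_closed E.m_closed smult_closed_E C.comult_closed
  show b1: "bilinear_map B B E (\<lambda>x y. \<omega> x \<otimes>\<^bsub>E\<^esub> \<omega> y)"
    and b2: "bilinear_map B B E (\<lambda>x y. \<omega> (br x y) \<oplus>\<^bsub>E\<^esub> \<omega> y \<otimes>\<^bsub>E\<^esub> \<omega> x)"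
    by - (intro lin\<omega> cl; assumption?)+
  have b3: "bilinear_map B B E (\<lambda>x y. \<omega> y \<otimes>\<^bsub>E\<^esub> \<omega> x)" by (intro lin\<omega> cl; assumption?)+
  fix x y assume x: "x \<in> carrier B" and y: "y \<in> carrier B"
  let ?cc = "\<lambda>F. convolution \<Delta> E m (\<lambda>x. convolution \<Delta> E m (F x) y) x"
  have cc_closed: "?cc F \<in> carrier E" if "bilinear_map B B E F" for F
    by (rule linear_mapD(1)[OF C.linear_convolution[OF k_algebra_E linear_m linear_conv_m_fun[OF that y]] x])
  have "?cc (\<lambda>x y. \<omega> (br x y) \<oplus>\<^bsub>E\<^esub> \<omega> y \<otimes>\<^bsub>E\<^esub> \<omega> x) =
      convolution \<Delta> E m (\<lambda>x. convolution \<Delta> E m (\<lambda>y. \<omega> (br x y)) y \<oplus>\<^bsub>E\<^esub> convolution \<Delta> E m (\<lambda>y. \<omega> y \<otimes>\<^bsub>E\<^esub> \<omega> x) y) x"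
    by (rule C.convolution_cong[OF k_algebra_E linear_m linear_conv_m_fun[OF b2 y] x])
      (simp_all add: conv_m_add[OF bilinear_map_right[OF bilinear_\<omega>_br] bilinear_map_right[OF b3]] y)
  also have "\<dots> = ?cc (\<lambda>x y. \<omega> (br x y)) \<oplus>\<^bsub>E\<^esub> ?cc (\<lambda>x y. \<omega> y \<otimes>\<^bsub>E\<^esub> \<omega> x)"
    by (rule conv_m_add[OF linear_conv_m_fun[OF bilinear_\<omega>_br y] linear_conv_m_fun[OF b3 y] x])
  finally have sum: "?cc (\<lambda>x y. \<omega> (br x y) \<oplus>\<^bsub>E\<^esub> \<omega> y \<otimes>\<^bsub>E\<^esub> \<omega> x) = \<dots>" .
  \<comment> \<open>From here on the argument takes place in an abelian group: p + u and r + v are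
    the two products of h(x) and h(y), q + u + w is h{x, y}, and w + v = 0. The commutator relation
    for \<open>h\<close> then leaves p = q + r.\<close>
  define p where "p = ?cc (\<lambda>x y. \<omega> x \<otimes>\<^bsub>E\<^esub> \<omega> y)"
  define q where "q = ?cc (\<lambda>x y. \<omega> (br x y))"
  define r where "r = ?cc (\<lambda>x y. \<omega> y \<otimes>\<^bsub>E\<^esub> \<omega> x)"
  define u where "u = bracket_sum x y"
  define v where "v = bracket_sum y x"
  define w where "w = tensor_lift E (\<lambda>x1 x2. m (br x1 y) \<otimes>\<^bsub>E\<^esub> \<omega> x2) (\<Delta> x)"
  have closed: "p \<in> carrier E" "q \<in> carrier E" "r \<in> carrier E" "u \<in> carrier E" "v \<in> carrier E" "w \<in> carrier E"
    unfolding p_def q_def r_def u_def v_def w_def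
    by - (intro cc_closed b1 b3 bilinear_\<omega>_br bracket_sum_closed x y lift_closed_E lin\<omega> cl; assumption?)+
  have 1: "p \<oplus>\<^bsub>E\<^esub> u = h x \<otimes>\<^bsub>E\<^esub> h y" "r \<oplus>\<^bsub>E\<^esub> v = h y \<otimes>\<^bsub>E\<^esub> h x" "h (br x y) = q \<oplus>\<^bsub>E\<^esub> (u \<oplus>\<^bsub>E\<^esub> w)" "w \<oplus>\<^bsub>E\<^esub> v = \<zero>\<^bsub>E\<^esub>"
    unfolding p_def q_def r_def u_def v_def w_def
    by (rule conv_m_\<omega>\<omega>_swap[OF x y] conv_m_\<omega>\<omega>[OF x y] h_br_sum[OF x y] bracket_sum_flip[OF x y])+
  have "p \<oplus>\<^bsub>E\<^esub> u = (q \<oplus>\<^bsub>E\<^esub> (u \<oplus>\<^bsub>E\<^esub> w)) \<oplus>\<^bsub>E\<^esub> (r \<oplus>\<^bsub>E\<^esub> v)"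
    using h_h[OF x y] by (simp only: 1)
  also have "\<dots> = ((q \<oplus>\<^bsub>E\<^esub> r) \<oplus>\<^bsub>E\<^esub> (w \<oplus>\<^bsub>E\<^esub> v)) \<oplus>\<^bsub>E\<^esub> u"
    using closed by (simp add: E.a_ac)
  also have "\<dots> = (q \<oplus>\<^bsub>E\<^esub> r) \<oplus>\<^bsub>E\<^esub> u"
    using closed by (simp add: 1)
  finally have "p = q \<oplus>\<^bsub>E\<^esub> r" using closed by simp
  then show "?cc (\<lambda>x y. \<omega> x \<otimes>\<^bsub>E\<^esub> \<omega> y) = ?cc (\<lambda>x y. \<omega> (br x y) \<oplus>\<^bsub>E\<^esub> \<omega> y \<otimes>\<^bsub>E\<^esub> \<omega> x)"
    unfolding sum p_def q_def r_def .
qed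

text \<open>The dressing vector field of Poisson group theory: the left invariant one-form S(x1)
  d(x2), turned into a derivation of \<open>B\<close> by the Poisson bracket.\<close>

definition dressing where
  "dressing x c = tensor_lift B (\<lambda>x1 x2. S x1 \<otimes>\<^bsub>B\<^esub> br x2 c) (\<Delta> x)"

text \<open>In S(x1) h(x2) only the factor h(x2) fails to commute with m(c); its correction m{x2,
  c}, multiplied by m(S x1), sums to the dressing of c.\<close>

lemma \<omega>_m:
  assumes x: "x \<in> carrier B" and c: "c \<in> carrier B"
  shows "\<omega> x \<otimes>\<^bsub>E\<^esub> m c = m (dressing x c) \<oplus>\<^bsub>E\<^esub> m c \<otimes>\<^bsub>E\<^esub> \<omega> x"
proof -
  note cl = m_closed S_closed h_closed br_closed B.m_closed E.m_closed C.comult_closed x c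
  have b0: "bilinear_map B B B (\<lambda>x1 x2. S x1 \<otimes>\<^bsub>B\<^esub> br x2 c)"
    and b1: "bilinear_map B B E (\<lambda>x1 x2. m (S x1) \<otimes>\<^bsub>E\<^esub> h x2)"
    and b2: "bilinear_map B B E (\<lambda>x1 x2. m (S x1) \<otimes>\<^bsub>E\<^esub> h x2 \<otimes>\<^bsub>E\<^esub> m c)"
    and b3: "bilinear_map B B E (\<lambda>x1 x2. m (S x1 \<otimes>\<^bsub>B\<^esub> br x2 c))"
    and b4: "bilinear_map B B E (\<lambda>x1 x2. m c \<otimes>\<^bsub>E\<^esub> (m (S x1) \<otimes>\<^bsub>E\<^esub> h x2))"
    by - (intro lin cl; assumption?)+
  have "\<omega> x \<otimes>\<^bsub>E\<^esub> m c = tensor_lift E (\<lambda>x1 x2. m (S x1) \<otimes>\<^bsub>E\<^esub> h x2 \<otimes>\<^bsub>E\<^esub> m c) (\<Delta> x)"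
    unfolding \<omega>_def convolution_def
    by (rule lift_linear_EE[where L = "\<lambda>e. e \<otimes>\<^bsub>E\<^esub> m c", OF b1]) (intro lin cl)+
  also have "\<dots> = tensor_lift E (\<lambda>x1 x2. m (S x1 \<otimes>\<^bsub>B\<^esub> br x2 c) \<oplus>\<^bsub>E\<^esub> m c \<otimes>\<^bsub>E\<^esub> (m (S x1) \<otimes>\<^bsub>E\<^esub> h x2)) (\<Delta> x)"
  proof (rule lift_cong_E[OF b2])
    fix a b assume ab: "a \<in> carrier B" "b \<in> carrier B"
    have "m (S a) \<otimes>\<^bsub>E\<^esub> h b \<otimes>\<^bsub>E\<^esub> m c = m (S a) \<otimes>\<^bsub>E\<^esub> (m (br b c) \<oplus>\<^bsub>E\<^esub> m c \<otimes>\<^bsub>E\<^esub> h b)"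
      using ab c by (simp add: E.m_assoc h_m)
    also have "\<dots> = m (S a) \<otimes>\<^bsub>E\<^esub> m (br b c) \<oplus>\<^bsub>E\<^esub> m (S a) \<otimes>\<^bsub>E\<^esub> m c \<otimes>\<^bsub>E\<^esub> h b"
      using ab c by (simp add: E.m_assoc E.r_distr)
    also have "\<dots> = m (S a \<otimes>\<^bsub>B\<^esub> br b c) \<oplus>\<^bsub>E\<^esub> m c \<otimes>\<^bsub>E\<^esub> (m (S a) \<otimes>\<^bsub>E\<^esub> h b)"
      using ab c by (simp add: m_mult m_comm[of "S a" c] E.m_assoc)
    finally show "m (S a) \<otimes>\<^bsub>E\<^esub> h b \<otimes>\<^bsub>E\<^esub> m c = \<dots>" .
  qed (rule C.comult_closed[OF x])
  also have "\<dots> = tensor_lift E (\<lambda>x1 x2. m (S x1 \<otimes>\<^bsub>B\<^esub> br x2 c)) (\<Delta> x) \<oplus>\<^bsub>E\<^esub> tensor_lift E (\<lambda>x1 x2. m c \<otimes>\<^bsub>E\<^esub> (m (S x1) \<otimes>\<^bsub>E\<^esub> h x2)) (\<Delta> x)"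
    by (rule lift_add_E[OF b3 b4 C.comult_closed[OF x]])
  also have "tensor_lift E (\<lambda>x1 x2. m (S x1 \<otimes>\<^bsub>B\<^esub> br x2 c)) (\<Delta> x) = m (dressing x c)"
    unfolding dressing_def by (rule lift_linear_BE[OF b0 linear_m C.comult_closed[OF x], symmetric])
  also have "tensor_lift E (\<lambda>x1 x2. m c \<otimes>\<^bsub>E\<^esub> (m (S x1) \<otimes>\<^bsub>E\<^esub> h x2)) (\<Delta> x) = m c \<otimes>\<^bsub>E\<^esub> \<omega> x"
    unfolding \<omega>_def convolution_def
    by (rule lift_linear_EE[where L = "\<lambda>e. m c \<otimes>\<^bsub>E\<^esub> e", OF b1, symmetric]) (intro lin cl)+
  finally show ?thesis .
qed

end

section \<open>The action of the enveloping algebra and its Hopf structure\<close>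

text \<open>Elements are extensional, and all operations are restricted, so that equality in the
  algebra is equality on the carrier of \<open>V\<close>.\<close>

definition endomorphisms :: "('k::field, 'a) module \<Rightarrow> ('k, 'a \<Rightarrow> 'a) module" where
  "endomorphisms V =
     \<lparr>carrier = {f. linear_map V V f \<and> f \<in> extensional (carrier V)},
      mult = (\<lambda>f g. restrict (\<lambda>x. f (g x)) (carrier V)), one = restrict (\<lambda>x. x) (carrier V),
      zero = restrict (\<lambda>x. \<zero>\<^bsub>V\<^esub>) (carrier V),
      add = (\<lambda>f g. restrict (\<lambda>x. f x \<oplus>\<^bsub>V\<^esub> g x) (carrier V)),
      smult = (\<lambda>c f. restrict (\<lambda>x. c \<odot>\<^bsub>V\<^esub> f x) (carrier V))\<rparr>"

lemma endomorphisms_simps: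
  "carrier (endomorphisms V) = {f. linear_map V V f \<and> f \<in> extensional (carrier V)}"
  "f \<otimes>\<^bsub>endomorphisms V\<^esub> g = restrict (\<lambda>x. f (g x)) (carrier V)"
  "\<one>\<^bsub>endomorphisms V\<^esub> = restrict (\<lambda>x. x) (carrier V)"
  "\<zero>\<^bsub>endomorphisms V\<^esub> = restrict (\<lambda>x. \<zero>\<^bsub>V\<^esub>) (carrier V)"
  "f \<oplus>\<^bsub>endomorphisms V\<^esub> g = restrict (\<lambda>x. f x \<oplus>\<^bsub>V\<^esub> g x) (carrier V)"
  "c \<odot>\<^bsub>endomorphisms V\<^esub> f = restrict (\<lambda>x. c \<odot>\<^bsub>V\<^esub> f x) (carrier V)"
  by (simp_all add: endomorphisms_def)

lemma linear_map_restrict: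
  assumes "vec_space V" shows "linear_map V W (restrict f (carrier V)) \<longleftrightarrow> linear_map V W f"
  by (rule linear_map_cong[OF assms]) simp

lemma k_algebra_endomorphisms:
  assumes V: "vec_space V"
  shows "k_algebra (endomorphisms V)"
proof -
  interpret V: module ground V by (rule V)
  have closedI: "restrict f (carrier V) \<in> carrier (endomorphisms V)" if "linear_map V V f" for f
    using that by (simp add: endomorphisms_simps linear_map_restrict[OF V])
  have lin: "linear_map V V f" if "f \<in> carrier (endomorphisms V)" for f
    using that by (simp add: endomorphisms_simps)
  have cl: "f x \<in> carrier V" if "f \<in> carrier (endomorphisms V)" "x \<in> carrier V" for f x
    using linear_mapD(1)[OF lin[OF that(1)] that(2)] .
  have eqI: "f = g" if "f \<in> carrier (endomorphisms V)" "g \<in> carrier (endomorphisms V)" "\<And>x. x \<in> carrier V \<Longrightarrow> f x = g x" for f g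
    using that by (intro extensionalityI[of f "carrier V" g]) (auto simp: endomorphisms_simps)
  have sm: "c \<odot>\<^bsub>V\<^esub> x \<in> carrier V" if "x \<in> carrier V" for c x using that V.smult_closed by simp
  have mc: "f \<otimes>\<^bsub>endomorphisms V\<^esub> g \<in> carrier (endomorphisms V)"
    if "f \<in> carrier (endomorphisms V)" "g \<in> carrier (endomorphisms V)" for f g
    unfolding endomorphisms_simps(2) by (intro closedI linear_map_compose[OF lin[OF that(1)] lin[OF that(2)]])
  have ac: "f \<oplus>\<^bsub>endomorphisms V\<^esub> g \<in> carrier (endomorphisms V)"
    if "f \<in> carrier (endomorphisms V)" "g \<in> carrier (endomorphisms V)" for f g
    unfolding endomorphisms_simps(5) by (intro closedI linear_map_plus[OF V] lin that)
  have sc: "c \<odot>\<^bsub>endomorphisms V\<^esub> f \<in> carrier (endomorphisms V)"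
    if "f \<in> carrier (endomorphisms V)" for c f
    unfolding endomorphisms_simps(6) by (intro closedI linear_map_smult[OF V] lin that)
  have oc: "\<one>\<^bsub>endomorphisms V\<^esub> \<in> carrier (endomorphisms V)" "\<zero>\<^bsub>endomorphisms V\<^esub> \<in> carrier (endomorphisms V)"
    unfolding endomorphisms_simps(3,4) by (intro closedI linear_map_id linear_map_const_zero[OF V])+
  have ap: "(f \<otimes>\<^bsub>endomorphisms V\<^esub> g) x = f (g x)" "(f \<oplus>\<^bsub>endomorphisms V\<^esub> g) x = f x \<oplus>\<^bsub>V\<^esub> g x"
    "(c \<odot>\<^bsub>endomorphisms V\<^esub> f) x = c \<odot>\<^bsub>V\<^esub> f x" "\<one>\<^bsub>endomorphisms V\<^esub> x = x" "\<zero>\<^bsub>endomorphisms V\<^esub> x = \<zero>\<^bsub>V\<^esub>"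
    if "x \<in> carrier V" for f g c x
    using that by (simp_all add: endomorphisms_simps)
  note add = linear_mapD(2)[OF lin] and smult = linear_mapD(3)[OF lin]
  have ab: "abelian_group (endomorphisms V)"
  proof (rule abelian_groupI)
    fix f assume f: "f \<in> carrier (endomorphisms V)"
    have "restrict (\<lambda>x. \<ominus>\<^bsub>V\<^esub> f x) (carrier V) \<in> carrier (endomorphisms V)"
      by (intro closedI linear_map_uminus_fun[OF V] lin f)
    then show "\<exists>g\<in>carrier (endomorphisms V). g \<oplus>\<^bsub>endomorphisms V\<^esub> f = \<zero>\<^bsub>endomorphisms V\<^esub>"
      using f by (intro bexI eqI ac oc) (auto simp: ap cl V.M.l_neg)
  qed (auto intro!: ac oc eqI simp: ap cl V.M.a_ac)
  show ?thesis
  proof (rule k_algebraI)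
    show "ring (endomorphisms V)"
    proof (rule ringI[OF ab])
      show "Group.monoid (endomorphisms V)"
        by (rule monoidI) (auto intro!: mc oc eqI simp: ap cl)
    qed (auto intro!: mc ac eqI simp: ap cl add)
    show "vec_space (endomorphisms V)"
      by (rule vec_spaceI[OF ab])
        (auto intro!: sc ac eqI simp: ap cl sm V.smult_r_distr V.smult_l_distr[simplified] V.smult_assoc1[simplified] V.smult_one[simplified])
  qed (auto intro!: mc sc eqI simp: ap cl sm smult)
qed

lemma tensor_hom_eq2:
  assumes A: "vec_space A" and B: "vec_space B" and C: "vec_space C" and D: "vec_space D"
    and F: "bilinear_map (tensor A B) (tensor C D) W F" and G: "bilinear_map (tensor A B) (tensor C D) W G"
    and eq: "\<And>a b c d. a \<in> carrier A \<Longrightarrow> b \<in> carrier B \<Longrightarrow> c \<in> carrier C \<Longrightarrow> d \<in> carrier D \<Longrightarrow>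
      F (tens A B a b) (tens C D c d) = G (tens A B a b) (tens C D c d)"
    and s: "s \<in> carrier (tensor A B)" and t: "t \<in> carrier (tensor C D)"
  shows "F s t = G s t"
proof (rule tensor_hom_eq[OF A B bilinear_map_left[OF F t] bilinear_map_left[OF G t] _ s])
  fix a b assume ab: "a \<in> carrier A" "b \<in> carrier B"
  note cl = tens_closed[OF A B ab]
  show "F (tens A B a b) t = G (tens A B a b) t"
    by (rule tensor_hom_eq[OF C D bilinear_map_right[OF F cl] bilinear_map_right[OF G cl] _ t])
      (rule eq[OF ab])
qed

context poisson
begin

text \<open>The Jacobi identity, solved for the form in which the commutator relation of
  \<open>h\<close> demands it.\<close>

lemma br_derivation:
  assumes x: "x \<in> carrier B" and y: "y \<in> carrier B" and z: "z \<in> carrier B"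
  shows "br x (br y z) = br (br x y) z \<oplus>\<^bsub>B\<^esub> br y (br x z)"
proof -
  define p where "p = br x (br y z)"
  define q where "q = br (br x y) z"
  define r where "r = br y (br x z)"
  have cl: "p \<in> carrier B" "q \<in> carrier B" "r \<in> carrier B" using x y z by (simp_all add: p_def q_def r_def)
  have "br y (br z x) = \<ominus>\<^bsub>B\<^esub> r"
    using x y z linear_map_uminus[OF vec_space_B vec_space_B bilinear_map_right[OF bilinear_br y], of "br x z"]
    by (simp add: r_def br_antisym[of x z])
  moreover have "br z (br x y) = \<ominus>\<^bsub>B\<^esub> q"
    using x y z by (simp add: q_def br_antisym[of "br x y" z])
  ultimately have "p \<oplus>\<^bsub>B\<^esub> \<ominus>\<^bsub>B\<^esub> r \<oplus>\<^bsub>B\<^esub> \<ominus>\<^bsub>B\<^esub> q = \<zero>\<^bsub>B\<^esub>"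
    using br_jacobi[OF x y z] by (simp add: p_def)
  then have "p \<oplus>\<^bsub>B\<^esub> \<ominus>\<^bsub>B\<^esub> (q \<oplus>\<^bsub>B\<^esub> r) = \<zero>\<^bsub>B\<^esub>" using cl by (simp add: B.minus_add B.a_ac)
  then have "p = q \<oplus>\<^bsub>B\<^esub> r"
    using cl minus_eq_zeroD[OF B.is_abelian_group, of p "q \<oplus>\<^bsub>B\<^esub> r"] by (simp add: a_minus_def)
  then show ?thesis by (simp add: p_def q_def r_def)
qed

definition act where
  "act = env_lift (endomorphisms B) (\<lambda>a. restrict (\<lambda>x. a \<otimes>\<^bsub>B\<^esub> x) (carrier B)) (\<lambda>a. restrict (br a) (carrier B))"

lemma mult_endomorphism: "a \<in> carrier B \<Longrightarrow> restrict (\<lambda>x. a \<otimes>\<^bsub>B\<^esub> x) (carrier B) \<in> carrier (endomorphisms B)"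
  using linear_map_mult_left[OF k_algebra_B linear_map_id]
  by (simp add: endomorphisms_simps linear_map_restrict[OF vec_space_B])

lemma br_endomorphism: "a \<in> carrier B \<Longrightarrow> restrict (br a) (carrier B) \<in> carrier (endomorphisms B)"
  using bilinear_map_right[OF bilinear_br]
  by (simp add: endomorphisms_simps linear_map_restrict[OF vec_space_B])

lemma linear_mult_endomorphism:
  "linear_map B (endomorphisms B) (\<lambda>a. restrict (\<lambda>x. a \<otimes>\<^bsub>B\<^esub> x) (carrier B))"
  by (rule linear_mapI, erule mult_endomorphism)
    (auto simp: endomorphisms_simps(5,6) B.l_distr k_algebraD(3)[OF k_algebra_B] fun_eq_iff restrict_def)

lemma linear_br_endomorphism: "linear_map B (endomorphisms B) (\<lambda>a. restrict (br a) (carrier B))"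
  by (rule linear_mapI, erule br_endomorphism) (auto simp: endomorphisms_simps(5,6) br_left fun_eq_iff restrict_def)

text \<open>Each relation is an axiom of Poisson algebras: the rule for h(x y) is the Leibniz rule
  in the first argument, the commutator of two \<open>h\<close> is the Jacobi identity, and the
  commutator of \<open>h\<close> with \<open>m\<close> is the Leibniz rule in the second
  argument.\<close>

lemma
  shows algebra_hom_act: "algebra_hom E (endomorphisms B) act"
    and act_m': "a \<in> carrier B \<Longrightarrow> act (m a) = restrict (\<lambda>x. a \<otimes>\<^bsub>B\<^esub> x) (carrier B)"
    and act_h': "a \<in> carrier B \<Longrightarrow> act (h a) = restrict (br a) (carrier B)"
proof -
  note rel = k_algebra_endomorphisms[OF vec_space_B] linear_mult_endomorphism linear_br_endomorphism
  have one: "restrict (\<lambda>x. \<one>\<^bsub>B\<^esub> \<otimes>\<^bsub>B\<^esub> x) (carrier B) = \<one>\<^bsub>endomorphisms B\<^esub>"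
    by (auto simp: endomorphisms_simps fun_eq_iff restrict_def)
  have mult: "restrict (\<lambda>z. x \<otimes>\<^bsub>B\<^esub> y \<otimes>\<^bsub>B\<^esub> z) (carrier B) =
      restrict (\<lambda>z. x \<otimes>\<^bsub>B\<^esub> z) (carrier B) \<otimes>\<^bsub>endomorphisms B\<^esub> restrict (\<lambda>z. y \<otimes>\<^bsub>B\<^esub> z) (carrier B)"
    if "x \<in> carrier B" "y \<in> carrier B" for x y
    using that by (auto simp: endomorphisms_simps fun_eq_iff restrict_def B.m_assoc)
  have h: "restrict (br (x \<otimes>\<^bsub>B\<^esub> y)) (carrier B) =
      restrict (\<lambda>z. y \<otimes>\<^bsub>B\<^esub> z) (carrier B) \<otimes>\<^bsub>endomorphisms B\<^esub> restrict (br x) (carrier B) \<oplus>\<^bsub>endomorphisms B\<^esub>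
      restrict (\<lambda>z. x \<otimes>\<^bsub>B\<^esub> z) (carrier B) \<otimes>\<^bsub>endomorphisms B\<^esub> restrict (br y) (carrier B)"
    if "x \<in> carrier B" "y \<in> carrier B" for x y
    using that by (auto simp: endomorphisms_simps fun_eq_iff restrict_def br_mult_left B.m_comm)
  have hh: "restrict (br x) (carrier B) \<otimes>\<^bsub>endomorphisms B\<^esub> restrict (br y) (carrier B) =
      restrict (br (br x y)) (carrier B) \<oplus>\<^bsub>endomorphisms B\<^esub>
      restrict (br y) (carrier B) \<otimes>\<^bsub>endomorphisms B\<^esub> restrict (br x) (carrier B)"
    if "x \<in> carrier B" "y \<in> carrier B" for x y
    using that by (auto simp: endomorphisms_simps fun_eq_iff restrict_def br_derivation[of x y])
  have hm: "restrict (br x) (carrier B) \<otimes>\<^bsub>endomorphisms B\<^esub> restrict (\<lambda>z. y \<otimes>\<^bsub>B\<^esub> z) (carrier B) =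
      restrict (\<lambda>z. br x y \<otimes>\<^bsub>B\<^esub> z) (carrier B) \<oplus>\<^bsub>endomorphisms B\<^esub>
      restrict (\<lambda>z. y \<otimes>\<^bsub>B\<^esub> z) (carrier B) \<otimes>\<^bsub>endomorphisms B\<^esub> restrict (br x) (carrier B)"
    if "x \<in> carrier B" "y \<in> carrier B" for x y
    using that by (auto simp: endomorphisms_simps fun_eq_iff restrict_def br_mult_right)
  show "algebra_hom E (endomorphisms B) act"
    unfolding act_def by (rule algebra_hom_env_lift[OF rel one mult h hh hm])
  show "act (m a) = restrict (\<lambda>x. a \<otimes>\<^bsub>B\<^esub> x) (carrier B)" if "a \<in> carrier B"
    unfolding act_def by (rule env_lift_m[OF rel one mult h hh hm that])
  show "act (h a) = restrict (br a) (carrier B)" if "a \<in> carrier B"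
    unfolding act_def by (rule env_lift_h[OF rel one mult h hh hm that])
qed

lemma act_m: "a \<in> carrier B \<Longrightarrow> b \<in> carrier B \<Longrightarrow> act (m a) b = a \<otimes>\<^bsub>B\<^esub> b"
  by (simp add: act_m')

lemma act_h: "a \<in> carrier B \<Longrightarrow> b \<in> carrier B \<Longrightarrow> act (h a) b = br a b"
  by (simp add: act_h')

lemma bilinear_act: "bilinear_map E B B act"
proof (rule bilinear_mapI)
  note hom = linear_mapD[OF algebra_homD(1)[OF algebra_hom_act]]
  fix e assume e: "e \<in> carrier E"
  then show "linear_map B B (act e)" using hom(1)[OF e] by (simp add: endomorphisms_simps)
next
  note hom = linear_mapD[OF algebra_homD(1)[OF algebra_hom_act]]
  fix b assume b: "b \<in> carrier B"
  show "linear_map E B (\<lambda>e. act e b)"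
  proof (rule linear_mapI)
    fix e assume e: "e \<in> carrier E"
    show "act e b \<in> carrier B" using hom(1)[OF e] b by (auto simp: endomorphisms_simps dest: linear_mapD)
    show "act (c \<odot>\<^bsub>E\<^esub> e) b = c \<odot>\<^bsub>B\<^esub> act e b" for c using e b by (simp add: hom(3) endomorphisms_simps)
    show "act (e \<oplus>\<^bsub>E\<^esub> e') b = act e b \<oplus>\<^bsub>B\<^esub> act e' b" if "e' \<in> carrier E" for e'
      using e that b by (simp add: hom(2) endomorphisms_simps)
  qed
qed

lemma act_closed [simp, intro]: "e \<in> carrier E \<Longrightarrow> b \<in> carrier B \<Longrightarrow> act e b \<in> carrier B"
  by (rule bilinear_map_closed[OF bilinear_act])

lemma act_mult: "d \<in> carrier E \<Longrightarrow> e \<in> carrier E \<Longrightarrow> b \<in> carrier B \<Longrightarrow> act (d \<otimes>\<^bsub>E\<^esub> e) b = act d (act e b)"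
  by (simp add: algebra_homD(2)[OF algebra_hom_act] endomorphisms_simps)

lemma act_one: "b \<in> carrier B \<Longrightarrow> act \<one>\<^bsub>E\<^esub> b = b"
  by (simp add: algebra_homD(3)[OF algebra_hom_act] endomorphisms_simps)

abbreviation BB where "BB \<equiv> tensor B B"
abbreviation EE where "EE \<equiv> tensor E E"

lemma vec_space_BB: "vec_space BB" by (rule vec_space_tensor[OF vec_space_B vec_space_B])
lemma k_algebra_EE: "k_algebra EE" by (rule k_algebra_tensor[OF k_algebra_E k_algebra_E])
lemma vec_space_EE: "vec_space EE" by (rule k_algebraD[OF k_algebra_EE])
lemma k_algebra_BB: "k_algebra BB" by (rule k_algebra_tensor[OF k_algebra_B k_algebra_B])

sublocale EE: ring EE by (rule k_algebraD[OF k_algebra_EE])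

lemma tensE_closed [simp]: "d \<in> carrier E \<Longrightarrow> e \<in> carrier E \<Longrightarrow> tens E E d e \<in> carrier EE"
  by (rule tens_closed[OF vec_space_E vec_space_E])

lemma tensB_closed [simp]: "d \<in> carrier B \<Longrightarrow> e \<in> carrier B \<Longrightarrow> tens B B d e \<in> carrier BB"
  by (rule tens_closed[OF vec_space_B vec_space_B])

lemma bilinear_tensor_bracket: "bilinear_map BB BB BB (tensor_bracket B br)"
  unfolding tensor_bracket_def[abs_def]
  by (rule bilinear_map_tensor_lift2[OF vec_space_B vec_space_B vec_space_B vec_space_B vec_space_BB bilinear_bracket_summand])

lemma tensor_bracket_tens:
  assumes "a \<in> carrier B" "b \<in> carrier B" "c \<in> carrier B" "d \<in> carrier B"
  shows "tensor_bracket B br (tens B B a b) (tens B B c d) =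
    tens B B (a \<otimes>\<^bsub>B\<^esub> c) (br b d) \<oplus>\<^bsub>BB\<^esub> tens B B (br a c) (b \<otimes>\<^bsub>B\<^esub> d)"
  unfolding tensor_bracket_def
  by (rule tensor_lift2_tens[OF vec_space_B vec_space_B vec_space_B vec_space_B vec_space_BB bilinear_bracket_summand assms])

text \<open>The maps \<open>m \<otimes> m\<close> and \<open>m \<otimes> h + h \<otimes> m\<close> from \<open>B \<otimes> B\<close> satisfy the defining relations of
  the enveloping algebra of the Poisson algebra \<open>B \<otimes> B\<close>.\<close>

definition mm where "mm = tensor_lift EE (\<lambda>a b. tens E E (m a) (m b))"
definition mh where "mh = tensor_lift EE (\<lambda>a b. tens E E (m a) (h b) \<oplus>\<^bsub>EE\<^esub> tens E E (h a) (m b))"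

lemmas EElin = linear_map_id linear_map_plus[OF vec_space_EE]
  linear_map_tens_left[OF vec_space_E vec_space_E] linear_map_tens_right[OF vec_space_E vec_space_E]
  linear_map_mult_left[OF k_algebra_EE] linear_map_mult_right[OF k_algebra_EE]
  linear_map_mult_left[OF k_algebra_BB] linear_map_mult_right[OF k_algebra_BB]
  linear_map_bilinear_left[OF bilinear_tensor_bracket] linear_map_bilinear_right[OF bilinear_tensor_bracket]
  linear_map_compose[OF linear_m] linear_map_compose[OF linear_h] bilinear_mapI

lemma bilinear_mm: "bilinear_map B B EE (\<lambda>a b. tens E E (m a) (m b))"
  and bilinear_mh: "bilinear_map B B EE (\<lambda>a b. tens E E (m a) (h b) \<oplus>\<^bsub>EE\<^esub> tens E E (h a) (m b))"
  by - (intro EElin m_closed h_closed; assumption?)+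

lemma linear_mm: "linear_map BB EE mm" and linear_mh: "linear_map BB EE mh"
  unfolding mm_def mh_def
  by (rule linear_map_tensor_lift[OF vec_space_B vec_space_B vec_space_EE] bilinear_mm bilinear_mh)+

lemma mm_tens: "a \<in> carrier B \<Longrightarrow> b \<in> carrier B \<Longrightarrow> mm (tens B B a b) = tens E E (m a) (m b)"
  and mh_tens: "a \<in> carrier B \<Longrightarrow> b \<in> carrier B \<Longrightarrow> mh (tens B B a b) = tens E E (m a) (h b) \<oplus>\<^bsub>EE\<^esub> tens E E (h a) (m b)"
  unfolding mm_def mh_def
  by (rule tensor_lift_tens[OF vec_space_B vec_space_B vec_space_EE bilinear_mm]; assumption)
    (rule tensor_lift_tens[OF vec_space_B vec_space_B vec_space_EE bilinear_mh]; assumption)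

lemma mm_closed [simp]: "s \<in> carrier BB \<Longrightarrow> mm s \<in> carrier EE"
  by (rule linear_mapD[OF linear_mm])

lemma mh_closed [simp]: "s \<in> carrier BB \<Longrightarrow> mh s \<in> carrier EE"
  by (rule linear_mapD[OF linear_mh])

lemmas EElin2 = EElin linear_map_compose[OF linear_mm] linear_map_compose[OF linear_mh]
lemmas tensE_left = linear_mapD(2)[OF bilinear_map_left[OF bilinear_map_tens[OF vec_space_E vec_space_E]]]
lemmas tensE_right = linear_mapD(2)[OF bilinear_map_right[OF bilinear_map_tens[OF vec_space_E vec_space_E]]]
lemmas tensE_mult = tens_mult[OF k_algebra_E k_algebra_E]
lemmas tensB_mult = tens_mult[OF k_algebra_B k_algebra_B]

interpretation BBr: ring BB by (rule k_algebraD[OF k_algebra_BB])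

lemma mm_one: "mm \<one>\<^bsub>BB\<^esub> = \<one>\<^bsub>EE\<^esub>"
  by (simp add: mm_tens m_one tens_one[OF k_algebra_E k_algebra_E] flip: tens_one[OF k_algebra_B k_algebra_B])

lemma mm_mult:
  assumes s: "s \<in> carrier BB" and t: "t \<in> carrier BB"
  shows "mm (s \<otimes>\<^bsub>BB\<^esub> t) = mm s \<otimes>\<^bsub>EE\<^esub> mm t"
proof (rule tensor_hom_eq2[OF vec_space_B vec_space_B vec_space_B vec_space_B _ _ _ s t])
  show "bilinear_map BB BB EE (\<lambda>s t. mm (s \<otimes>\<^bsub>BB\<^esub> t))"
    by (intro EElin2)
  show "bilinear_map BB BB EE (\<lambda>s t. mm s \<otimes>\<^bsub>EE\<^esub> mm t)"
    by (intro EElin2 mm_closed)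
qed (simp add: mm_tens tensB_mult tensE_mult m_mult)

text \<open>On pure tensors the product rule for \<open>h\<close> in one factor yields four terms,
  and these are the four of the right side once the elements m(a), m(c) and m(b), m(d) are
  commuted.\<close>

lemma mh_mult:
  assumes s: "s \<in> carrier BB" and t: "t \<in> carrier BB"
  shows "mh (s \<otimes>\<^bsub>BB\<^esub> t) = mm t \<otimes>\<^bsub>EE\<^esub> mh s \<oplus>\<^bsub>EE\<^esub> mm s \<otimes>\<^bsub>EE\<^esub> mh t"
proof (rule tensor_hom_eq2[OF vec_space_B vec_space_B vec_space_B vec_space_B _ _ _ s t])
  show "bilinear_map BB BB EE (\<lambda>s t. mh (s \<otimes>\<^bsub>BB\<^esub> t))"
    by (intro EElin2)
  show "bilinear_map BB BB EE (\<lambda>s t. mm t \<otimes>\<^bsub>EE\<^esub> mh s \<oplus>\<^bsub>EE\<^esub> mm s \<otimes>\<^bsub>EE\<^esub> mh t)"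
    by (intro EElin2 mm_closed mh_closed)
  fix a b c d assume "a \<in> carrier B" "b \<in> carrier B" "c \<in> carrier B" "d \<in> carrier B"
  then show "mh (tens B B a b \<otimes>\<^bsub>BB\<^esub> tens B B c d) =
      mm (tens B B c d) \<otimes>\<^bsub>EE\<^esub> mh (tens B B a b) \<oplus>\<^bsub>EE\<^esub> mm (tens B B a b) \<otimes>\<^bsub>EE\<^esub> mh (tens B B c d)"
    by (simp add: mm_tens mh_tens tensB_mult tensE_mult m_mult h_mult EE.r_distr tensE_left tensE_right
        m_comm[of c a] m_comm[of d b] EE.a_ac)
qed

lemma mh_mm:
  assumes s: "s \<in> carrier BB" and t: "t \<in> carrier BB"
  shows "mh s \<otimes>\<^bsub>EE\<^esub> mm t = mm (tensor_bracket B br s t) \<oplus>\<^bsub>EE\<^esub> mm t \<otimes>\<^bsub>EE\<^esub> mh s"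
proof (rule tensor_hom_eq2[OF vec_space_B vec_space_B vec_space_B vec_space_B _ _ _ s t])
  show "bilinear_map BB BB EE (\<lambda>s t. mh s \<otimes>\<^bsub>EE\<^esub> mm t)"
    by (intro EElin2 mm_closed mh_closed)
  show "bilinear_map BB BB EE (\<lambda>s t. mm (tensor_bracket B br s t) \<oplus>\<^bsub>EE\<^esub> mm t \<otimes>\<^bsub>EE\<^esub> mh s)"
    by (intro EElin2 mm_closed mh_closed)
  fix a b c d assume "a \<in> carrier B" "b \<in> carrier B" "c \<in> carrier B" "d \<in> carrier B"
  then show "mh (tens B B a b) \<otimes>\<^bsub>EE\<^esub> mm (tens B B c d) =
      mm (tensor_bracket B br (tens B B a b) (tens B B c d)) \<oplus>\<^bsub>EE\<^esub> mm (tens B B c d) \<otimes>\<^bsub>EE\<^esub> mh (tens B B a b)"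
    by (simp add: mm_tens mh_tens tensor_bracket_tens linear_mapD(2)[OF linear_mm] tensE_mult m_mult
        EE.r_distr EE.l_distr h_m[of b d] h_m[of a c] tensE_left tensE_right m_comm[of c a] m_comm[of d b] EE.a_ac)
qed

text \<open>On pure tensors there are four products. Those with both \<open>h\<close> in the same
  tensor factor give the summands with h{b, d} and h{a, c}. The corrections of the two mixed ones
  combine, by the product rule for \<open>h\<close>, to h(a c) \<otimes> m{b, d} and m{a, c}
  \<otimes> h(b d).\<close>

lemma mh_mh:
  assumes s: "s \<in> carrier BB" and t: "t \<in> carrier BB"
  shows "mh s \<otimes>\<^bsub>EE\<^esub> mh t = mh (tensor_bracket B br s t) \<oplus>\<^bsub>EE\<^esub> mh t \<otimes>\<^bsub>EE\<^esub> mh s"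
proof (rule tensor_hom_eq2[OF vec_space_B vec_space_B vec_space_B vec_space_B _ _ _ s t])
  show "bilinear_map BB BB EE (\<lambda>s t. mh s \<otimes>\<^bsub>EE\<^esub> mh t)"
    by (intro EElin2 mm_closed mh_closed)
  show "bilinear_map BB BB EE (\<lambda>s t. mh (tensor_bracket B br s t) \<oplus>\<^bsub>EE\<^esub> mh t \<otimes>\<^bsub>EE\<^esub> mh s)"
    by (intro EElin2 mm_closed mh_closed)
  fix a b c d assume abcd: "a \<in> carrier B" "b \<in> carrier B" "c \<in> carrier B" "d \<in> carrier B"
  have 1: "tens E E (m a \<otimes>\<^bsub>E\<^esub> m c) (h b \<otimes>\<^bsub>E\<^esub> h d) =
      tens E E (m (a \<otimes>\<^bsub>B\<^esub> c)) (h (br b d)) \<oplus>\<^bsub>EE\<^esub> tens E E (m c \<otimes>\<^bsub>E\<^esub> m a) (h d \<otimes>\<^bsub>E\<^esub> h b)"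
    using abcd by (simp add: h_h[of b d] tensE_right m_mult m_comm[of c a])
  have 2: "tens E E (h a \<otimes>\<^bsub>E\<^esub> h c) (m b \<otimes>\<^bsub>E\<^esub> m d) =
      tens E E (h (br a c)) (m (b \<otimes>\<^bsub>B\<^esub> d)) \<oplus>\<^bsub>EE\<^esub> tens E E (h c \<otimes>\<^bsub>E\<^esub> h a) (m d \<otimes>\<^bsub>E\<^esub> m b)"
    using abcd by (simp add: h_h[of a c] tensE_left m_mult m_comm[of d b])
  \<comment> \<open>The four reorderings have the correction m{a, c} or m{b, d} on the left with a
    plus sign; where {c, a} or {d, b} would come up, antisymmetry has been used.\<close>
  have hc: "h c \<otimes>\<^bsub>E\<^esub> m a \<oplus>\<^bsub>E\<^esub> m (br a c) = m a \<otimes>\<^bsub>E\<^esub> h c"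
    using abcd by (simp add: h_m[of c a] br_antisym[of a c] linear_map_uminus[OF vec_space_B vec_space_E linear_m]
        E.a_ac E.r_neg1 E.r_neg2)
  have hd: "m d \<otimes>\<^bsub>E\<^esub> h b \<oplus>\<^bsub>E\<^esub> m (br b d) = h b \<otimes>\<^bsub>E\<^esub> m d"
    using abcd by (simp add: h_m[of b d] E.a_comm)
  have hd': "h d \<otimes>\<^bsub>E\<^esub> m b \<oplus>\<^bsub>E\<^esub> m (br b d) = m b \<otimes>\<^bsub>E\<^esub> h d"
    using abcd by (simp add: h_m[of d b] br_antisym[of b d] linear_map_uminus[OF vec_space_B vec_space_E linear_m]
        E.a_ac E.r_neg1 E.r_neg2)
  have ha: "m c \<otimes>\<^bsub>E\<^esub> h a \<oplus>\<^bsub>E\<^esub> m (br a c) = h a \<otimes>\<^bsub>E\<^esub> m c"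
    using abcd by (simp add: h_m[of a c] E.a_comm)
  have 3: "tens E E (m a \<otimes>\<^bsub>E\<^esub> h c) (h b \<otimes>\<^bsub>E\<^esub> m d) =
      tens E E (h c \<otimes>\<^bsub>E\<^esub> m a) (m d \<otimes>\<^bsub>E\<^esub> h b) \<oplus>\<^bsub>EE\<^esub>
      (tens E E (m (br a c)) (m d \<otimes>\<^bsub>E\<^esub> h b) \<oplus>\<^bsub>EE\<^esub> tens E E (m a \<otimes>\<^bsub>E\<^esub> h c) (m (br b d)))"
    using abcd tensE_right[of "m a \<otimes>\<^bsub>E\<^esub> h c" "m d \<otimes>\<^bsub>E\<^esub> h b" "m (br b d)"]
      tensE_left[of "m d \<otimes>\<^bsub>E\<^esub> h b" "h c \<otimes>\<^bsub>E\<^esub> m a" "m (br a c)"]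
    by (simp add: hc hd EE.a_assoc)
  have 4: "tens E E (h a \<otimes>\<^bsub>E\<^esub> m c) (m b \<otimes>\<^bsub>E\<^esub> h d) =
      tens E E (m c \<otimes>\<^bsub>E\<^esub> h a) (h d \<otimes>\<^bsub>E\<^esub> m b) \<oplus>\<^bsub>EE\<^esub>
      (tens E E (m c \<otimes>\<^bsub>E\<^esub> h a) (m (br b d)) \<oplus>\<^bsub>EE\<^esub> tens E E (m (br a c)) (m b \<otimes>\<^bsub>E\<^esub> h d))"
    using abcd tensE_right[of "m c \<otimes>\<^bsub>E\<^esub> h a" "h d \<otimes>\<^bsub>E\<^esub> m b" "m (br b d)"]
      tensE_left[of "m b \<otimes>\<^bsub>E\<^esub> h d" "m c \<otimes>\<^bsub>E\<^esub> h a" "m (br a c)"]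
    by (simp add: ha hd' EE.a_assoc)
  \<comment> \<open>The terms are grouped so that the two inner pairs are the expansions of h(a c)
    and h(b d), matching the corrections collected in 3 and 4.\<close>
  have 5: "mh (tensor_bracket B br (tens B B a b) (tens B B c d)) =
      tens E E (m (a \<otimes>\<^bsub>B\<^esub> c)) (h (br b d)) \<oplus>\<^bsub>EE\<^esub>
      (tens E E (m c \<otimes>\<^bsub>E\<^esub> h a) (m (br b d)) \<oplus>\<^bsub>EE\<^esub> tens E E (m a \<otimes>\<^bsub>E\<^esub> h c) (m (br b d))) \<oplus>\<^bsub>EE\<^esub>
      ((tens E E (m (br a c)) (m d \<otimes>\<^bsub>E\<^esub> h b) \<oplus>\<^bsub>EE\<^esub> tens E E (m (br a c)) (m b \<otimes>\<^bsub>E\<^esub> h d)) \<oplus>\<^bsub>EE\<^esub> tens E E (h (br a c)) (m (b \<otimes>\<^bsub>B\<^esub> d)))"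
    using abcd by (simp add: tensor_bracket_tens linear_mapD(2)[OF linear_mh] mh_tens h_mult tensE_left tensE_right)
  show "mh (tens B B a b) \<otimes>\<^bsub>EE\<^esub> mh (tens B B c d) =
      mh (tensor_bracket B br (tens B B a b) (tens B B c d)) \<oplus>\<^bsub>EE\<^esub> mh (tens B B c d) \<otimes>\<^bsub>EE\<^esub> mh (tens B B a b)"
    unfolding 5 using abcd
    by (simp add: mh_tens EE.l_distr EE.r_distr tensE_mult 1 2 3 4 EE.a_ac)
qed

end

section \<open>The quotient Hopf algebra\<close>

context poisson_hopf
begin

abbreviation env_delta where "env_delta \<equiv> env_comult B br \<Delta>"

text \<open>\<Delta> is an algebra homomorphism and respects brackets, so composing
  \<open>mm\<close> and \<open>mh\<close> with it turns their identities over B \<otimes> B into the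
  defining relations over \<open>B\<close>.\<close>

lemma
  shows algebra_hom_env_comult: "algebra_hom E EE env_delta"
    and env_comult_m: "b \<in> carrier B \<Longrightarrow> env_delta (m b) = mm (\<Delta> b)"
    and env_comult_h: "b \<in> carrier B \<Longrightarrow> env_delta (h b) = mh (\<Delta> b)"
proof -
  have eq: "env_delta = env_lift EE (\<lambda>b. mm (\<Delta> b)) (\<lambda>b. mh (\<Delta> b))"
    by (simp add: env_comult_def Let_def mm_def mh_def)
  note cd = C.comult_closed
  have l1: "linear_map B EE (\<lambda>b. mm (\<Delta> b))" by (rule linear_map_compose[OF linear_mm C.linear_comult])
  have l2: "linear_map B EE (\<lambda>b. mh (\<Delta> b))" by (rule linear_map_compose[OF linear_mh C.linear_comult])
  note hom = algebra_homD[OF algebra_hom_comult]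
  have 1: "mm (\<Delta> \<one>\<^bsub>B\<^esub>) = \<one>\<^bsub>EE\<^esub>" by (simp add: hom(3) mm_one)
  have 2: "mm (\<Delta> (x \<otimes>\<^bsub>B\<^esub> y)) = mm (\<Delta> x) \<otimes>\<^bsub>EE\<^esub> mm (\<Delta> y)" if "x \<in> carrier B" "y \<in> carrier B" for x y
    using that by (simp add: hom(2) mm_mult)
  have 3: "mh (\<Delta> (x \<otimes>\<^bsub>B\<^esub> y)) = mm (\<Delta> y) \<otimes>\<^bsub>EE\<^esub> mh (\<Delta> x) \<oplus>\<^bsub>EE\<^esub> mm (\<Delta> x) \<otimes>\<^bsub>EE\<^esub> mh (\<Delta> y)"
    if "x \<in> carrier B" "y \<in> carrier B" for x y
    using that by (simp add: hom(2) mh_mult)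
  have 4: "mh (\<Delta> x) \<otimes>\<^bsub>EE\<^esub> mh (\<Delta> y) = mh (\<Delta> (br x y)) \<oplus>\<^bsub>EE\<^esub> mh (\<Delta> y) \<otimes>\<^bsub>EE\<^esub> mh (\<Delta> x)"
    if "x \<in> carrier B" "y \<in> carrier B" for x y
    unfolding comult_br[OF that] by (rule mh_mh[OF cd[OF that(1)] cd[OF that(2)]])
  have 5: "mh (\<Delta> x) \<otimes>\<^bsub>EE\<^esub> mm (\<Delta> y) = mm (\<Delta> (br x y)) \<oplus>\<^bsub>EE\<^esub> mm (\<Delta> y) \<otimes>\<^bsub>EE\<^esub> mh (\<Delta> x)"
    if "x \<in> carrier B" "y \<in> carrier B" for x y
    unfolding comult_br[OF that] by (rule mh_mm[OF cd[OF that(1)] cd[OF that(2)]])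
  note rel = k_algebra_EE l1 l2 1 2 3 4 5
  show "algebra_hom E EE env_delta" unfolding eq by (rule algebra_hom_env_lift[OF rel])
  show "env_delta (m b) = mm (\<Delta> b)" if "b \<in> carrier B" unfolding eq by (rule env_lift_m[OF rel that])
  show "env_delta (h b) = mh (\<Delta> b)" if "b \<in> carrier B" unfolding eq by (rule env_lift_h[OF rel that])
qed

lemma env_comult_closed [simp]: "e \<in> carrier E \<Longrightarrow> env_delta e \<in> carrier EE"
  by (rule linear_mapD[OF algebra_homD(1)[OF algebra_hom_env_comult]])

text \<open>With \<eta> = 0, the one relation with content beyond multiplicativity of \<epsilon> is
  that for m{x, y}; it holds because \<epsilon> vanishes on brackets.\<close>

lemma
  shows algebra_hom_env_counit: "algebra_hom E ground (env_counit \<epsilon>)"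
    and env_counit_m: "b \<in> carrier B \<Longrightarrow> env_counit \<epsilon> (m b) = \<epsilon> b"
    and env_counit_h: "b \<in> carrier B \<Longrightarrow> env_counit \<epsilon> (h b) = 0"
proof -
  have l: "linear_map B (ground :: ('k, 'k) module) (\<lambda>_. 0)"
    using linear_map_const_zero[OF vec_space_ground] by simp
  have 1: "\<epsilon> \<one>\<^bsub>B\<^esub> = \<one>\<^bsub>ground\<^esub>" by (simp add: counit_one)
  have 2: "\<epsilon> (x \<otimes>\<^bsub>B\<^esub> y) = \<epsilon> x \<otimes>\<^bsub>ground\<^esub> \<epsilon> y" if "x \<in> carrier B" "y \<in> carrier B" for x y
    using that by (simp add: counit_mult)
  have 3: "0 = \<epsilon> y \<otimes>\<^bsub>ground\<^esub> 0 \<oplus>\<^bsub>ground\<^esub> \<epsilon> x \<otimes>\<^bsub>ground\<^esub> 0" for x y by simp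
  have 4: "0 \<otimes>\<^bsub>ground\<^esub> 0 = 0 \<oplus>\<^bsub>ground\<^esub> 0 \<otimes>\<^bsub>ground\<^esub> (0 :: 'k)" by simp
  have 5: "0 \<otimes>\<^bsub>ground\<^esub> \<epsilon> y = \<epsilon> (br x y) \<oplus>\<^bsub>ground\<^esub> \<epsilon> y \<otimes>\<^bsub>ground\<^esub> 0"
    if "x \<in> carrier B" "y \<in> carrier B" for x y
    using that by (simp add: counit_br)
  note rel = k_algebra_ground C.linear_counit l 1 2 3 4 5
  show "algebra_hom E ground (env_counit \<epsilon>)" unfolding env_counit_def by (rule algebra_hom_env_lift[OF rel])
  show "env_counit \<epsilon> (m b) = \<epsilon> b" if "b \<in> carrier B" unfolding env_counit_def by (rule env_lift_m[OF rel that])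
  show "env_counit \<epsilon> (h b) = 0" if "b \<in> carrier B" unfolding env_counit_def by (rule env_lift_h[OF rel that])
qed

section \<open>The ideal generated by the augmentation ideal, and the quotient algebra\<close>

abbreviation J where "J \<equiv> env_aug_ideal B br \<epsilon>"
abbreviation H where "H \<equiv> env_quot B br \<epsilon>"
abbreviation \<pi> where "\<pi> \<equiv> env_proj B br \<epsilon>"

lemma submodule_J: "submodule J ground E"
  unfolding env_aug_ideal_def by (rule submodule_lin_span[OF vec_space_E]) auto

lemma J_subset: "J \<subseteq> carrier E"
  using EV.submoduleE(1)[OF submodule_J] .

lemma J_generator: "e \<in> carrier E \<Longrightarrow> b \<in> carrier B \<Longrightarrow> \<epsilon> b = 0 \<Longrightarrow> e \<otimes>\<^bsub>E\<^esub> m b \<in> J"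
  unfolding env_aug_ideal_def by (rule subsetD[OF lin_span_superset]) auto

text \<open>Serves two purposes: with \<open>f\<close> a multiplication and \<open>N\<close> the
  ideal itself it shows closure under products, and with \<open>N\<close> the zero space it factors
  maps through the quotient.\<close>

lemma J_induct:
  assumes W: "vec_space W" and f: "linear_map E W f" and N: "submodule N ground W"
    and gen: "\<And>e b. e \<in> carrier E \<Longrightarrow> b \<in> carrier B \<Longrightarrow> \<epsilon> b = 0 \<Longrightarrow> f (e \<otimes>\<^bsub>E\<^esub> m b) \<in> N"
    and x: "x \<in> J"
  shows "f x \<in> N"
proof -
  interpret W: module ground W by (rule W)
  have "submodule {x \<in> carrier E. f x \<in> N} ground E"
  proof (rule EV.submoduleI)
    show "\<zero>\<^bsub>E\<^esub> \<in> {x \<in> carrier E. f x \<in> N}"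
      using submodule.axioms(1)[OF N, THEN subgroup.one_closed] linear_map_zero[OF vec_space_E W f] by simp
    show "\<ominus>\<^bsub>E\<^esub> a \<in> {x \<in> carrier E. f x \<in> N}" if "a \<in> {x \<in> carrier E. f x \<in> N}" for a
      using that W.submoduleE(3)[OF N] linear_map_uminus[OF vec_space_E W f] by simp
    show "a \<oplus>\<^bsub>E\<^esub> b \<in> {x \<in> carrier E. f x \<in> N}" if "a \<in> {x \<in> carrier E. f x \<in> N}" "b \<in> {x \<in> carrier E. f x \<in> N}" for a b
      using that W.submoduleE(5)[OF N] linear_mapD(2)[OF f] by simp
    show "c \<odot>\<^bsub>E\<^esub> a \<in> {x \<in> carrier E. f x \<in> N}" if "a \<in> {x \<in> carrier E. f x \<in> N}" for c a
      using that W.submoduleE(4)[OF N] linear_mapD(3)[OF f] by simp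
  qed auto
  then have "J \<subseteq> {x \<in> carrier E. f x \<in> N}"
    unfolding env_aug_ideal_def by (rule lin_span_minimal) (use gen in auto)
  then show ?thesis using x by blast
qed

lemma J_kernel:
  assumes W: "vec_space W" and f: "linear_map E W f"
    and gen: "\<And>e b. e \<in> carrier E \<Longrightarrow> b \<in> carrier B \<Longrightarrow> \<epsilon> b = 0 \<Longrightarrow> f (e \<otimes>\<^bsub>E\<^esub> m b) = \<zero>\<^bsub>W\<^esub>"
    and x: "x \<in> J"
  shows "f x = \<zero>\<^bsub>W\<^esub>"
proof -
  interpret W: module ground W by (rule W)
  have "submodule {\<zero>\<^bsub>W\<^esub>} ground W"
    using W.smult_r_null by (intro W.submoduleI) (auto simp: W.M.minus_equality)
  from J_induct[OF W f this _ x] gen show ?thesis by simp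
qed

lemma J_left: "d \<in> carrier E \<Longrightarrow> x \<in> J \<Longrightarrow> d \<otimes>\<^bsub>E\<^esub> x \<in> J"
  by (rule J_induct[OF vec_space_E linear_map_mult_left[OF k_algebra_E linear_map_id] submodule_J])
    (auto simp flip: E.m_assoc intro: J_generator)

lemma J_right_m: "c \<in> carrier B \<Longrightarrow> x \<in> J \<Longrightarrow> x \<otimes>\<^bsub>E\<^esub> m c \<in> J"
proof (rule J_induct[OF vec_space_E linear_map_mult_right[OF k_algebra_E linear_map_id m_closed] submodule_J])
  fix e b assume "c \<in> carrier B" "e \<in> carrier E" "b \<in> carrier B" "\<epsilon> b = 0"
  then show "e \<otimes>\<^bsub>E\<^esub> m b \<otimes>\<^bsub>E\<^esub> m c \<in> J"
    using J_generator[of "e \<otimes>\<^bsub>E\<^esub> m c" b] by (simp add: E.m_assoc m_comm[of b c])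
qed

text \<open>The heart of the equality of the left and the right ideal generated by the augmentation
  ideal: m(b) h(c) = h(c) m(b) - m{c, b}, and with \<epsilon>(b) = 0 both terms are generators,
  since \<epsilon>{c, b} = 0.\<close>

lemma J_right_h: "c \<in> carrier B \<Longrightarrow> x \<in> J \<Longrightarrow> x \<otimes>\<^bsub>E\<^esub> h c \<in> J"
proof (rule J_induct[OF vec_space_E linear_map_mult_right[OF k_algebra_E linear_map_id h_closed] submodule_J])
  fix e b assume c: "c \<in> carrier B" and e: "e \<in> carrier E" and b: "b \<in> carrier B" "\<epsilon> b = 0"
  have "e \<otimes>\<^bsub>E\<^esub> m b \<otimes>\<^bsub>E\<^esub> h c \<oplus>\<^bsub>E\<^esub> e \<otimes>\<^bsub>E\<^esub> m (br c b) = e \<otimes>\<^bsub>E\<^esub> h c \<otimes>\<^bsub>E\<^esub> m b"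
    using c e b by (simp add: E.m_assoc h_m[of c b] E.r_distr E.a_comm)
  then have "e \<otimes>\<^bsub>E\<^esub> m b \<otimes>\<^bsub>E\<^esub> h c = e \<otimes>\<^bsub>E\<^esub> h c \<otimes>\<^bsub>E\<^esub> m b \<oplus>\<^bsub>E\<^esub> \<ominus>\<^bsub>E\<^esub> (e \<otimes>\<^bsub>E\<^esub> m (br c b))"
    using c e b by (simp add: E.add.inv_solve_right)
  moreover have "e \<otimes>\<^bsub>E\<^esub> h c \<otimes>\<^bsub>E\<^esub> m b \<in> J" "e \<otimes>\<^bsub>E\<^esub> m (br c b) \<in> J"
    using c e b by (auto intro!: J_generator simp: counit_br)
  ultimately show "e \<otimes>\<^bsub>E\<^esub> m b \<otimes>\<^bsub>E\<^esub> h c \<in> J"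
    using EV.submoduleE(3,5)[OF submodule_J] by simp
qed

lemma J_right:
  assumes "e \<in> carrier E" "x \<in> J"
  shows "x \<otimes>\<^bsub>E\<^esub> e \<in> J"
  using assms
proof (induction arbitrary: x rule: env_induct)
  case one
  then show ?case using J_subset by (simp add: subset_iff)
next
  case (m b e)
  have "x \<otimes>\<^bsub>E\<^esub> (m b \<otimes>\<^bsub>E\<^esub> e) = x \<otimes>\<^bsub>E\<^esub> m b \<otimes>\<^bsub>E\<^esub> e"
    using m J_subset by (subst E.m_assoc) auto
  then show ?case using m J_right_m by simp
next
  case (h b e)
  have "x \<otimes>\<^bsub>E\<^esub> (h b \<otimes>\<^bsub>E\<^esub> e) = x \<otimes>\<^bsub>E\<^esub> h b \<otimes>\<^bsub>E\<^esub> e"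
    using h J_subset by (subst E.m_assoc) auto
  then show ?case using h J_right_h by simp
next
  case (add d e)
  then show ?case using J_subset EV.submoduleE(5)[OF submodule_J] by (simp add: E.r_distr subset_iff)
qed

lemma ideal_J: "ideal J E"
  by (rule idealI)
    (use submodule.axioms(1)[OF submodule_J] E.ring_axioms J_left J_right in auto)

lemma k_algebra_H: "k_algebra H"
  unfolding env_quot_def by (rule k_algebra_quotient[OF k_algebra_E ideal_J])

lemma vec_space_H: "vec_space H"
  by (rule k_algebraD[OF k_algebra_H])

sublocale H: ring H by (rule k_algebraD[OF k_algebra_H])
sublocale HV: module ground H by (rule vec_space_H)

lemma smult_closed_H [simp, intro]: "x \<in> carrier H \<Longrightarrow> c \<odot>\<^bsub>H\<^esub> x \<in> carrier H"
  by (rule HV.smult_closed) simp_all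

lemma algebra_hom_proj: "algebra_hom E H \<pi>"
  unfolding env_quot_def env_proj_def[abs_def]
  by (intro algebra_homI linear_map_coset vec_space_E submodule_J)
    (simp_all add: quotient_mult[OF k_algebra_E ideal_J] quotient_one[OF k_algebra_E ideal_J])

lemmas linear_proj = algebra_homD(1)[OF algebra_hom_proj]
lemmas proj_mult = algebra_homD(2)[OF algebra_hom_proj]
lemmas proj_one = algebra_homD(3)[OF algebra_hom_proj]

lemma proj_closed [simp, intro]: "e \<in> carrier E \<Longrightarrow> \<pi> e \<in> carrier H"
  by (rule linear_mapD[OF linear_proj])

lemma carrier_H: "carrier H = \<pi> ` carrier E"
  unfolding env_quot_def env_proj_def[abs_def] by (rule quotient_carrier[OF vec_space_E submodule_J])

text \<open>Factorization through the quotient; the counit, the comultiplication and the section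
  \<open>\<gamma>\<close> are all evaluated with it.\<close>

lemma the_elem_proj:
  assumes "vec_space W" "linear_map E W f"
    and "\<And>e b. e \<in> carrier E \<Longrightarrow> b \<in> carrier B \<Longrightarrow> \<epsilon> b = 0 \<Longrightarrow> f (e \<otimes>\<^bsub>E\<^esub> m b) = \<zero>\<^bsub>W\<^esub>"
  shows "e \<in> carrier E \<Longrightarrow> the_elem (f ` \<pi> e) = f e"
    and "linear_map H W (\<lambda>X. the_elem (f ` X))"
proof -
  note ker = J_kernel[OF assms(1,2,3)]
  show "the_elem (f ` \<pi> e) = f e" if "e \<in> carrier E"
    unfolding env_proj_def by (rule the_elem_image_coset[OF vec_space_E submodule_J assms(1,2) ker that])
  show "linear_map H W (\<lambda>X. the_elem (f ` X))"
    unfolding env_quot_def by (rule linear_map_the_elem[OF vec_space_E submodule_J assms(1,2) ker])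
qed

lemma proj_m:
  assumes b: "b \<in> carrier B"
  shows "\<pi> (m b) = \<epsilon> b \<odot>\<^bsub>H\<^esub> \<one>\<^bsub>H\<^esub>"
proof -
  \<comment> \<open>The component of b in the augmentation ideal, which \<open>\<pi>\<close> sends
    to zero.\<close>
  let ?b' = "b \<ominus>\<^bsub>B\<^esub> \<epsilon> b \<odot>\<^bsub>B\<^esub> \<one>\<^bsub>B\<^esub>"
  have cl: "?b' \<in> carrier B" using b by simp
  have "\<epsilon> ?b' = \<epsilon> b \<ominus>\<^bsub>ground\<^esub> \<epsilon> (\<epsilon> b \<odot>\<^bsub>B\<^esub> \<one>\<^bsub>B\<^esub>)"
    using b by (simp add: linear_map_minus[OF vec_space_B vec_space_ground C.linear_counit])
  also have "\<epsilon> (\<epsilon> b \<odot>\<^bsub>B\<^esub> \<one>\<^bsub>B\<^esub>) = \<epsilon> b"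
    by (simp add: linear_mapD(3)[OF C.linear_counit] counit_one)
  also have "\<epsilon> b \<ominus>\<^bsub>ground\<^esub> \<epsilon> b = 0"
    using minus_eq_zero_iff[OF vec_space_abelian[OF vec_space_ground], of "\<epsilon> b" "\<epsilon> b"] by simp
  finally have "\<one>\<^bsub>E\<^esub> \<otimes>\<^bsub>E\<^esub> m ?b' \<in> J" using cl by (intro J_generator) auto
  then have J: "m ?b' \<in> J" using cl by simp
  have "\<pi> (m ?b') = \<zero>\<^bsub>H\<^esub>"
    unfolding env_quot_def env_proj_def using coset_eq_zero[OF vec_space_E submodule_J J] .
  also have "m ?b' = m b \<ominus>\<^bsub>E\<^esub> \<epsilon> b \<odot>\<^bsub>E\<^esub> \<one>\<^bsub>E\<^esub>"
    using b by (simp add: linear_map_minus[OF vec_space_B vec_space_E linear_m] m_smult m_one)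
  also have "\<pi> \<dots> = \<pi> (m b) \<ominus>\<^bsub>H\<^esub> \<epsilon> b \<odot>\<^bsub>H\<^esub> \<one>\<^bsub>H\<^esub>"
    using b by (simp add: linear_map_minus[OF vec_space_E vec_space_H linear_proj] linear_mapD(3)[OF linear_proj] proj_one)
  finally show ?thesis
    using b minus_eq_zeroD[OF H.is_abelian_group] by simp
qed

lemma proj_m_mult:
  "b \<in> carrier B \<Longrightarrow> e \<in> carrier E \<Longrightarrow> \<pi> (m b \<otimes>\<^bsub>E\<^esub> e) = \<epsilon> b \<odot>\<^bsub>H\<^esub> \<pi> e"
  "b \<in> carrier B \<Longrightarrow> e \<in> carrier E \<Longrightarrow> \<pi> (e \<otimes>\<^bsub>E\<^esub> m b) = \<epsilon> b \<odot>\<^bsub>H\<^esub> \<pi> e"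
  by (simp_all add: proj_mult proj_m k_algebraD(3,4)[OF k_algebra_H])

definition hbar where "hbar b = \<pi> (h b)"

lemma linear_hbar: "linear_map B H hbar"
  unfolding hbar_def[abs_def] by (rule linear_map_compose[OF linear_proj linear_h])

lemma hbar_closed [simp, intro]: "b \<in> carrier B \<Longrightarrow> hbar b \<in> carrier H"
  by (rule linear_mapD[OF linear_hbar])

lemma proj_h_mult: "b \<in> carrier B \<Longrightarrow> e \<in> carrier E \<Longrightarrow> \<pi> (h b \<otimes>\<^bsub>E\<^esub> e) = hbar b \<otimes>\<^bsub>H\<^esub> \<pi> e"
  by (simp add: hbar_def proj_mult)

text \<open>Under \<open>\<pi>\<close> the generators \<open>m b\<close> become scalars, so the
  elements \<open>hbar b\<close> generate, and left multiplication by \<open>m b\<close> in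
  \<open>env_induct\<close> turns into the scalar case.\<close>

lemma quot_induct [consumes 1, case_names one smult hbar add]:
  assumes z: "z \<in> carrier H"
    and one: "P \<one>\<^bsub>H\<^esub>"
    and smult: "\<And>c z. z \<in> carrier H \<Longrightarrow> P z \<Longrightarrow> P (c \<odot>\<^bsub>H\<^esub> z)"
    and hbar: "\<And>b z. b \<in> carrier B \<Longrightarrow> z \<in> carrier H \<Longrightarrow> P z \<Longrightarrow> P (hbar b \<otimes>\<^bsub>H\<^esub> z)"
    and add: "\<And>y z. y \<in> carrier H \<Longrightarrow> z \<in> carrier H \<Longrightarrow> P y \<Longrightarrow> P z \<Longrightarrow> P (y \<oplus>\<^bsub>H\<^esub> z)"
  shows "P z"
proof -
  have "P (\<pi> e)" if "e \<in> carrier E" for e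
    using that
  proof (induction rule: env_induct)
    case one
    then show ?case by (simp add: proj_one assms(2))
  next
    case (m b e)
    then show ?case by (simp add: proj_m_mult smult)
  next
    case (h b e)
    then show ?case by (simp add: proj_h_mult hbar)
  next
    case (add d e)
    then show ?case by (simp add: linear_mapD(2)[OF linear_proj] assms(5))
  qed
  then show ?thesis using z by (auto simp: carrier_H)
qed

section \<open>Counit and comultiplication of the quotient\<close>

abbreviation \<epsilon>H where "\<epsilon>H \<equiv> env_quot_counit \<epsilon> :: ('k, 'b) env_quot \<Rightarrow> 'k"

lemma env_counit_kernel:
  "e \<in> carrier E \<Longrightarrow> b \<in> carrier B \<Longrightarrow> \<epsilon> b = 0 \<Longrightarrow> env_counit \<epsilon> (e \<otimes>\<^bsub>E\<^esub> m b) = \<zero>\<^bsub>ground\<^esub>"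
  by (simp add: algebra_homD(2)[OF algebra_hom_env_counit] env_counit_m)

lemma linear_quot_counit: "linear_map H ground \<epsilon>H"
  unfolding env_quot_counit_def[abs_def]
  by (rule the_elem_proj(2)[OF vec_space_ground algebra_homD(1)[OF algebra_hom_env_counit] env_counit_kernel])

lemma quot_counit_proj: "e \<in> carrier E \<Longrightarrow> \<epsilon>H (\<pi> e) = env_counit \<epsilon> e"
  unfolding env_quot_counit_def
  by (rule the_elem_proj(1)[OF vec_space_ground algebra_homD(1)[OF algebra_hom_env_counit] env_counit_kernel])

lemma quot_counit_one: "\<epsilon>H \<one>\<^bsub>H\<^esub> = 1"
  using quot_counit_proj[OF E.one_closed] by (simp add: proj_one algebra_homD(3)[OF algebra_hom_env_counit])

lemma quot_counit_hbar: "b \<in> carrier B \<Longrightarrow> z \<in> carrier H \<Longrightarrow> \<epsilon>H (hbar b \<otimes>\<^bsub>H\<^esub> z) = 0"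
  by (auto simp: carrier_H quot_counit_proj env_counit_h algebra_homD(2)[OF algebra_hom_env_counit] simp flip: proj_h_mult)

abbreviation HH where "HH \<equiv> tensor H H"

lemma k_algebra_HH: "k_algebra HH" by (rule k_algebra_tensor[OF k_algebra_H k_algebra_H])
lemma vec_space_HH: "vec_space HH" by (rule k_algebraD[OF k_algebra_HH])

sublocale HHV: module ground HH by (rule vec_space_HH)

lemma tensH_closed [simp]: "y \<in> carrier H \<Longrightarrow> z \<in> carrier H \<Longrightarrow> tens H H y z \<in> carrier HH"
  by (rule tens_closed[OF vec_space_H vec_space_H])

lemma smult_closed_HH [simp, intro]: "t \<in> carrier HH \<Longrightarrow> c \<odot>\<^bsub>HH\<^esub> t \<in> carrier HH"
  by (rule HHV.smult_closed) simp_all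

text \<open>The map \<pi> \<otimes> \<pi>.\<close>

definition pp where "pp = tensor_lift HH (\<lambda>d e. tens H H (\<pi> d) (\<pi> e))"

lemmas Hlin = linear_map_id
  linear_map_plus[OF vec_space_HH] linear_map_smult[OF vec_space_HH] linear_map_scalar[OF vec_space_HH]
  linear_map_plus[OF vec_space_H] linear_map_smult[OF vec_space_H] linear_map_scalar[OF vec_space_H]
  linear_map_tens_left[OF vec_space_H vec_space_H] linear_map_tens_right[OF vec_space_H vec_space_H]
  linear_map_mult_left[OF k_algebra_H] linear_map_mult_right[OF k_algebra_H]
  linear_map_compose[OF linear_hbar] linear_map_compose[OF linear_proj] linear_map_compose[OF linear_quot_counit]
  linear_map_compose[OF C.linear_counit]
  bilinear_mapI

lemma bilinear_pp: "bilinear_map E E HH (\<lambda>d e. tens H H (\<pi> d) (\<pi> e))"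
  by (intro Hlin proj_closed)

lemma linear_pp: "linear_map EE HH pp"
  unfolding pp_def by (rule linear_map_tensor_lift[OF vec_space_E vec_space_E vec_space_HH bilinear_pp])

lemma pp_tens: "d \<in> carrier E \<Longrightarrow> e \<in> carrier E \<Longrightarrow> pp (tens E E d e) = tens H H (\<pi> d) (\<pi> e)"
  unfolding pp_def by (rule tensor_lift_tens[OF vec_space_E vec_space_E vec_space_HH bilinear_pp])

lemma pp_closed [simp]: "t \<in> carrier EE \<Longrightarrow> pp t \<in> carrier HH"
  by (rule linear_mapD[OF linear_pp])

lemma bilinear_counit_counit: "bilinear_map B B ground (\<lambda>a b. \<epsilon> a * \<epsilon> b)"
  by (intro bilinear_mapI linear_map_ground_mult_left linear_map_ground_mult_right C.linear_counit)

lemma counit_counit_comult: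
  assumes x: "x \<in> carrier B" shows "tensor_lift (ground :: ('k, 'k) module) (\<lambda>a b. \<epsilon> a * \<epsilon> b) (\<Delta> x) = \<epsilon> x"
  using C.counit_left_lift[OF vec_space_ground C.linear_counit x] by simp

lemmas tensH_smult_left = linear_mapD(3)[OF bilinear_map_left[OF bilinear_map_tens[OF vec_space_H vec_space_H]]]
lemmas tensH_smult_right = linear_mapD(3)[OF bilinear_map_right[OF bilinear_map_tens[OF vec_space_H vec_space_H]]]

text \<open>Both tensor factors turn \<open>m\<close> into a counit. For u = \<Delta> b the scalar
  is \<epsilon>(b), so the comultiplication sends the generators of the ideal to zero.\<close>

lemma pp_mult_mm:
  assumes t: "t \<in> carrier EE" and u: "u \<in> carrier BB"
  shows "pp (t \<otimes>\<^bsub>EE\<^esub> mm u) = tensor_lift ground (\<lambda>a b. \<epsilon> a * \<epsilon> b) u \<odot>\<^bsub>HH\<^esub> pp t"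
proof (rule tensor_hom_eq2[OF vec_space_E vec_space_E vec_space_B vec_space_B _ _ _ t u])
  show "bilinear_map EE BB HH (\<lambda>t u. pp (t \<otimes>\<^bsub>EE\<^esub> mm u))"
    by (intro bilinear_mapI linear_map_compose[OF linear_pp] EElin2 mm_closed)
  show "bilinear_map EE BB HH (\<lambda>t u. tensor_lift ground (\<lambda>a b. \<epsilon> a * \<epsilon> b) u \<odot>\<^bsub>HH\<^esub> pp t)"
    by (intro Hlin linear_pp pp_closed linear_map_tensor_lift[OF vec_space_B vec_space_B vec_space_ground bilinear_counit_counit])
  fix d e a b assume *: "d \<in> carrier E" "e \<in> carrier E" "a \<in> carrier B" "b \<in> carrier B"
  have "c \<odot>\<^bsub>HH\<^esub> (c' \<odot>\<^bsub>HH\<^esub> t) = (c * c') \<odot>\<^bsub>HH\<^esub> t" if "t \<in> carrier HH" for c c' t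
    using that HHV.smult_assoc1[of c c' t] by simp
  then show "pp (tens E E d e \<otimes>\<^bsub>EE\<^esub> mm (tens B B a b)) =
      tensor_lift ground (\<lambda>a b. \<epsilon> a * \<epsilon> b) (tens B B a b) \<odot>\<^bsub>HH\<^esub> pp (tens E E d e)"
    using * by (simp add: mm_tens tensE_mult pp_tens proj_m_mult tensH_smult_left tensH_smult_right
        tensor_lift_tens[OF vec_space_B vec_space_B vec_space_ground bilinear_counit_counit] mult.commute)
qed

abbreviation \<Delta>H where "\<Delta>H \<equiv> env_quot_comult B br \<Delta> \<epsilon>"

lemma quot_comult_kernel:
  assumes "e \<in> carrier E" "b \<in> carrier B" "\<epsilon> b = 0"
  shows "pp (env_delta (e \<otimes>\<^bsub>E\<^esub> m b)) = \<zero>\<^bsub>HH\<^esub>"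
  using assms HHV.smult_l_null[OF pp_closed[OF env_comult_closed[OF assms(1)]]]
  by (simp add: algebra_homD(2)[OF algebra_hom_env_comult] env_comult_m pp_mult_mm counit_counit_comult)

lemma linear_pp_comult: "linear_map E HH (\<lambda>e. pp (env_delta e))"
  by (rule linear_map_compose[OF linear_pp algebra_homD(1)[OF algebra_hom_env_comult]])

lemma quot_comult_eq: "\<Delta>H X = the_elem ((\<lambda>e. pp (env_delta e)) ` X)"
  unfolding env_quot_comult_def Let_def pp_def by (rule refl)

lemma linear_quot_comult: "linear_map H HH \<Delta>H"
  unfolding quot_comult_eq[abs_def]
  by (rule the_elem_proj(2)[OF vec_space_HH linear_pp_comult quot_comult_kernel])

lemma quot_comult_proj: "e \<in> carrier E \<Longrightarrow> \<Delta>H (\<pi> e) = pp (env_delta e)"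
  unfolding quot_comult_eq by (rule the_elem_proj(1)[OF vec_space_HH linear_pp_comult quot_comult_kernel])

lemma quot_comult_closed [simp]: "z \<in> carrier H \<Longrightarrow> \<Delta>H z \<in> carrier HH"
  by (rule linear_mapD[OF linear_quot_comult])

lemma quot_comult_one: "\<Delta>H \<one>\<^bsub>H\<^esub> = tens H H \<one>\<^bsub>H\<^esub> \<one>\<^bsub>H\<^esub>"
  using quot_comult_proj[OF E.one_closed]
  by (simp add: proj_one algebra_homD(3)[OF algebra_hom_env_comult] pp_tens flip: tens_one[OF k_algebra_E k_algebra_E])

text \<open>\<open>primitive b\<close> is left multiplication by \<open>1 \<otimes> hbar b + hbar b \<otimes> 1\<close>.\<close>

definition primitive where
  "primitive b = tensor_lift HH (\<lambda>y z. tens H H y (hbar b \<otimes>\<^bsub>H\<^esub> z) \<oplus>\<^bsub>HH\<^esub> tens H H (hbar b \<otimes>\<^bsub>H\<^esub> y) z)"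

lemma bilinear_primitive: "b \<in> carrier B \<Longrightarrow>
  bilinear_map H H HH (\<lambda>y z. tens H H y (hbar b \<otimes>\<^bsub>H\<^esub> z) \<oplus>\<^bsub>HH\<^esub> tens H H (hbar b \<otimes>\<^bsub>H\<^esub> y) z)"
  by (intro Hlin hbar_closed H.m_closed)

lemma linear_primitive: "b \<in> carrier B \<Longrightarrow> linear_map HH HH (primitive b)"
  unfolding primitive_def by (rule linear_map_tensor_lift[OF vec_space_H vec_space_H vec_space_HH bilinear_primitive])

lemma primitive_tens: "b \<in> carrier B \<Longrightarrow> y \<in> carrier H \<Longrightarrow> z \<in> carrier H \<Longrightarrow>
    primitive b (tens H H y z) = tens H H y (hbar b \<otimes>\<^bsub>H\<^esub> z) \<oplus>\<^bsub>HH\<^esub> tens H H (hbar b \<otimes>\<^bsub>H\<^esub> y) z"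
  unfolding primitive_def by (rule tensor_lift_tens[OF vec_space_H vec_space_H vec_space_HH bilinear_primitive])

text \<open>In m(x1) \<otimes> h(x2) + h(x1) \<otimes> m(x2) the factors \<open>m\<close> become
  counits under \<open>\<pi>\<close>, and the two counit laws leave 1 \<otimes> hbar(x) + hbar(x)
  \<otimes> 1: the images of the \<open>h\<close> are primitive.\<close>

lemma pp_mh_mult:
  assumes x: "x \<in> carrier B" and t: "t \<in> carrier EE"
  shows "pp (mh (\<Delta> x) \<otimes>\<^bsub>EE\<^esub> t) = primitive x (pp t)"
proof (rule tensor_hom_eq[OF vec_space_E vec_space_E _ linear_map_compose[OF linear_primitive[OF x] linear_pp] _ t])
  show "linear_map EE HH (\<lambda>t. pp (mh (\<Delta> x) \<otimes>\<^bsub>EE\<^esub> t))"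
    by (intro linear_map_compose[OF linear_pp] linear_map_mult_left[OF k_algebra_EE] linear_map_id mh_closed C.comult_closed x)
  fix d e assume de: "d \<in> carrier E" "e \<in> carrier E"
  let ?f = "\<lambda>a b. \<epsilon> a \<odot>\<^bsub>HH\<^esub> tens H H (\<pi> d) (hbar b \<otimes>\<^bsub>H\<^esub> \<pi> e)"
  let ?g = "\<lambda>a b. \<epsilon> b \<odot>\<^bsub>HH\<^esub> tens H H (hbar a \<otimes>\<^bsub>H\<^esub> \<pi> d) (\<pi> e)"
  have f: "bilinear_map B B HH ?f" and g: "bilinear_map B B HH ?g" and fg: "bilinear_map B B HH (\<lambda>a b. ?f a b \<oplus>\<^bsub>HH\<^esub> ?g a b)"
    using de by - (intro Hlin C.linear_counit tensH_closed proj_closed hbar_closed H.m_closed; assumption?)+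
  have f': "linear_map B HH (\<lambda>b. tens H H (\<pi> d) (hbar b \<otimes>\<^bsub>H\<^esub> \<pi> e))"
    and g': "linear_map B HH (\<lambda>b. tens H H (hbar b \<otimes>\<^bsub>H\<^esub> \<pi> d) (\<pi> e))"
    using de by - (intro Hlin proj_closed; assumption?)+
  have "pp (mh u \<otimes>\<^bsub>EE\<^esub> tens E E d e) = tensor_lift HH (\<lambda>a b. ?f a b \<oplus>\<^bsub>HH\<^esub> ?g a b) u" if u: "u \<in> carrier BB" for u
  proof (rule tensor_hom_eq[OF vec_space_B vec_space_B _ linear_map_tensor_lift[OF vec_space_B vec_space_B vec_space_HH fg] _ u])
    show "linear_map BB HH (\<lambda>u. pp (mh u \<otimes>\<^bsub>EE\<^esub> tens E E d e))"
      by (intro linear_map_compose[OF linear_pp] linear_map_mult_right[OF k_algebra_EE] linear_mh tensE_closed de)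
    fix a b assume "a \<in> carrier B" "b \<in> carrier B"
    then show "pp (mh (tens B B a b) \<otimes>\<^bsub>EE\<^esub> tens E E d e) = tensor_lift HH (\<lambda>a b. ?f a b \<oplus>\<^bsub>HH\<^esub> ?g a b) (tens B B a b)"
      using de by (simp add: mh_tens EE.l_distr tensE_mult linear_mapD(2)[OF linear_pp] pp_tens proj_m_mult proj_h_mult
          tensH_smult_left tensH_smult_right tensor_lift_tens[OF vec_space_B vec_space_B vec_space_HH fg])
  qed
  from this[OF C.comult_closed[OF x]]
  have "pp (mh (\<Delta> x) \<otimes>\<^bsub>EE\<^esub> tens E E d e) = tensor_lift HH ?f (\<Delta> x) \<oplus>\<^bsub>HH\<^esub> tensor_lift HH ?g (\<Delta> x)"
    by (simp add: tensor_lift_add_fun[OF vec_space_B vec_space_B vec_space_HH f g C.comult_closed[OF x]])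
  also have "tensor_lift HH ?f (\<Delta> x) = tens H H (\<pi> d) (hbar x \<otimes>\<^bsub>H\<^esub> \<pi> e)"
    by (rule C.counit_left_lift[OF vec_space_HH f' x])
  also have "tensor_lift HH ?g (\<Delta> x) = tens H H (hbar x \<otimes>\<^bsub>H\<^esub> \<pi> d) (\<pi> e)"
    by (rule C.counit_right_lift[OF vec_space_HH g' x])
  finally show "pp (mh (\<Delta> x) \<otimes>\<^bsub>EE\<^esub> tens E E d e) = primitive x (pp (tens E E d e))"
    using de x by (simp add: pp_tens primitive_tens)
qed

lemma quot_comult_hbar: "b \<in> carrier B \<Longrightarrow> z \<in> carrier H \<Longrightarrow> \<Delta>H (hbar b \<otimes>\<^bsub>H\<^esub> z) = primitive b (\<Delta>H z)"
  by (auto simp: carrier_H quot_comult_proj algebra_homD(2)[OF algebra_hom_env_comult] env_comult_h pp_mh_mult simp flip: proj_h_mult)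

text \<open>Carries inductions by \<open>quot_induct\<close> through Sweedler sums over the
  quotient: the new generator enters either the second or the first component.\<close>

lemma quot_comult_hbar_lift:
  assumes W: "vec_space W" and f: "bilinear_map H H W f" and b: "b \<in> carrier B" and z: "z \<in> carrier H"
  shows "tensor_lift W f (\<Delta>H (hbar b \<otimes>\<^bsub>H\<^esub> z)) =
    tensor_lift W (\<lambda>z1 z2. f z1 (hbar b \<otimes>\<^bsub>H\<^esub> z2) \<oplus>\<^bsub>W\<^esub> f (hbar b \<otimes>\<^bsub>H\<^esub> z1) z2) (\<Delta>H z)"
proof -
  note L = linear_map_tensor_lift[OF vec_space_H vec_space_H W f]
  have "tensor_lift W f (\<Delta>H (hbar b \<otimes>\<^bsub>H\<^esub> z)) =
      tensor_lift W (\<lambda>y z. tensor_lift W f (tens H H y (hbar b \<otimes>\<^bsub>H\<^esub> z) \<oplus>\<^bsub>HH\<^esub> tens H H (hbar b \<otimes>\<^bsub>H\<^esub> y) z)) (\<Delta>H z)"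
    unfolding quot_comult_hbar[OF b z] unfolding primitive_def
    by (rule tensor_lift_linear[OF vec_space_H vec_space_H vec_space_HH W bilinear_primitive[OF b] L quot_comult_closed[OF z]])
  also have "\<dots> = tensor_lift W (\<lambda>z1 z2. f z1 (hbar b \<otimes>\<^bsub>H\<^esub> z2) \<oplus>\<^bsub>W\<^esub> f (hbar b \<otimes>\<^bsub>H\<^esub> z1) z2) (\<Delta>H z)"
    by (rule tensor_lift_cong[OF vec_space_H vec_space_H W bilinear_map_compose[OF vec_space_H vec_space_H L bilinear_primitive[OF b]]])
      (use b z in \<open>auto simp: linear_mapD(2)[OF L] tensor_lift_tens[OF vec_space_H vec_space_H W f]\<close>)
  finally show ?thesis .
qed

text \<open>In the step to hbar(x) z, the summand with hbar(x) in the first component is killed by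
  the counit; the other one is hbar(x) times the induction hypothesis. This law later sums away the
  trivial cocycle.\<close>

lemma quot_counit_left:
  assumes "z \<in> carrier H"
  shows "tensor_lift H (\<lambda>z1 z2. \<epsilon>H z1 \<odot>\<^bsub>H\<^esub> z2) (\<Delta>H z) = z"
  using assms
proof (induction rule: quot_induct)
  note V = vec_space_H
  have b: "bilinear_map H H H (\<lambda>z1 z2. \<epsilon>H z1 \<odot>\<^bsub>H\<^esub> z2)" by (intro Hlin linear_quot_counit)
  note lin = linear_mapD[OF linear_map_tensor_lift[OF V V V b]]
  note comult = linear_mapD[OF linear_quot_comult]
  {
    case one
    then show ?case using HV.smult_one[OF H.one_closed]
      by (simp add: quot_comult_one tensor_lift_tens[OF V V V b] quot_counit_one)
  next
    case (smult c z)
    then show ?case by (simp add: lin comult)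
  next
    case (hbar x z)
    have b': "bilinear_map H H H (\<lambda>z1 z2. hbar x \<otimes>\<^bsub>H\<^esub> (\<epsilon>H z1 \<odot>\<^bsub>H\<^esub> z2))"
      using hbar by (intro Hlin linear_quot_counit hbar_closed)
    have "tensor_lift H (\<lambda>z1 z2. \<epsilon>H z1 \<odot>\<^bsub>H\<^esub> z2) (\<Delta>H (hbar x \<otimes>\<^bsub>H\<^esub> z)) =
        tensor_lift H (\<lambda>z1 z2. \<epsilon>H z1 \<odot>\<^bsub>H\<^esub> (hbar x \<otimes>\<^bsub>H\<^esub> z2) \<oplus>\<^bsub>H\<^esub> \<epsilon>H (hbar x \<otimes>\<^bsub>H\<^esub> z1) \<odot>\<^bsub>H\<^esub> z2) (\<Delta>H z)"
      using hbar by (intro quot_comult_hbar_lift[OF V b])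
    also have "\<dots> = tensor_lift H (\<lambda>z1 z2. hbar x \<otimes>\<^bsub>H\<^esub> (\<epsilon>H z1 \<odot>\<^bsub>H\<^esub> z2)) (\<Delta>H z)"
      by (rule sym, rule tensor_lift_cong[OF V V V b'])
        (use hbar HV.smult_l_null in \<open>auto simp: quot_counit_hbar k_algebraD(4)[OF k_algebra_H]\<close>)
    also have "\<dots> = hbar x \<otimes>\<^bsub>H\<^esub> tensor_lift H (\<lambda>z1 z2. \<epsilon>H z1 \<odot>\<^bsub>H\<^esub> z2) (\<Delta>H z)"
      using hbar by (intro tensor_lift_linear[OF V V V V b linear_map_mult_left[OF k_algebra_H linear_map_id], symmetric]) auto
    finally show ?case using hbar by simp
  next
    case (add y z)
    then show ?case by (simp add: lin comult)
  }
qed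

end

section \<open>The crossed product\<close>

text \<open>The crossed product overwrites multiplication and unit of the tensor product, and the
  vector space axioms do not refer to those fields.\<close>

lemma vec_space_update:
  assumes "vec_space V"
  shows "vec_space (V\<lparr>mult := f, one := u\<rparr>)"
proof -
  interpret V: module ground V by fact
  show ?thesis
  proof (rule vec_spaceI)
    show "abelian_group (V\<lparr>mult := f, one := u\<rparr>)"
    proof (rule abelian_groupI)
      fix x assume "x \<in> carrier (V\<lparr>mult := f, one := u\<rparr>)"
      then show "\<exists>y\<in>carrier (V\<lparr>mult := f, one := u\<rparr>). y \<oplus>\<^bsub>V\<lparr>mult := f, one := u\<rparr>\<^esub> x = \<zero>\<^bsub>V\<lparr>mult := f, one := u\<rparr>\<^esub>"
        by (intro bexI[of _ "\<ominus>\<^bsub>V\<^esub> x"]) (auto simp: V.M.l_neg)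
    qed (auto simp: V.M.a_ac)
  qed (auto simp: V.smult_r_distr V.smult_l_distr[simplified] V.smult_assoc1[simplified] V.smult_one[simplified] V.smult_closed[simplified])
qed

text \<open>Every algebra axiom is an equation, so it may be checked after an injective
  multiplicative linear map. For the crossed product this replaces the verification of conditions on
  the action and the cocycle.\<close>

lemma k_algebra_transport:
  assumes A: "k_algebra A" and X: "vec_space X" and f: "linear_map X A f" and inj: "inj_on f (carrier X)"
    and closed: "\<And>x y. x \<in> carrier X \<Longrightarrow> y \<in> carrier X \<Longrightarrow> x \<otimes>\<^bsub>X\<^esub> y \<in> carrier X"
    and mult: "\<And>x y. x \<in> carrier X \<Longrightarrow> y \<in> carrier X \<Longrightarrow> f (x \<otimes>\<^bsub>X\<^esub> y) = f x \<otimes>\<^bsub>A\<^esub> f y"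
    and one: "\<one>\<^bsub>X\<^esub> \<in> carrier X" "f \<one>\<^bsub>X\<^esub> = \<one>\<^bsub>A\<^esub>"
  shows "k_algebra X"
proof -
  interpret A: ring A by (rule k_algebraD[OF A])
  interpret X: module ground X by (rule X)
  note lin = linear_mapD[OF f]
  have sm: "c \<odot>\<^bsub>X\<^esub> x \<in> carrier X" if "x \<in> carrier X" for c x using that X.smult_closed by simp
  note eqI = inj_onD[OF inj]
  show ?thesis
  proof (rule k_algebraI[OF _ X])
    show "ring X"
    proof (rule ringI)
      show "abelian_group X" by (rule vec_space_abelian[OF X])
      show "Group.monoid X"
        by (rule monoidI) (auto intro!: closed one eqI simp: mult closed one lin A.m_assoc)
    qed (auto intro!: closed X.M.a_closed eqI simp: mult lin closed A.l_distr A.r_distr)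
  qed (auto intro!: closed sm eqI simp: mult lin sm closed k_algebraD(3,4)[OF A])
qed

context poisson_hopf
begin

text \<open>The substitution of scalars for \<open>m\<close> and of \<open>\<omega>\<close> for
  \<open>h\<close> respects the relations: the rules for \<open>\<omega>\<close> are
  \<open>\<omega>_mult\<close> and \<open>\<omega>_br\<close>, and the commutator of
  \<open>h\<close> with \<open>m\<close> becomes trivial because scalars are central and
  \<epsilon>{x, y} = 0.\<close>

lemma
  shows algebra_hom_env_gamma: "algebra_hom E E (env_lift E (\<lambda>b. \<epsilon> b \<odot>\<^bsub>E\<^esub> \<one>\<^bsub>E\<^esub>) \<omega>)"
    and env_gamma_m: "b \<in> carrier B \<Longrightarrow> env_lift E (\<lambda>b. \<epsilon> b \<odot>\<^bsub>E\<^esub> \<one>\<^bsub>E\<^esub>) \<omega> (m b) = \<epsilon> b \<odot>\<^bsub>E\<^esub> \<one>\<^bsub>E\<^esub>"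
    and env_gamma_h: "b \<in> carrier B \<Longrightarrow> env_lift E (\<lambda>b. \<epsilon> b \<odot>\<^bsub>E\<^esub> \<one>\<^bsub>E\<^esub>) \<omega> (h b) = \<omega> b"
proof -
  have 1: "\<epsilon> \<one>\<^bsub>B\<^esub> \<odot>\<^bsub>E\<^esub> \<one>\<^bsub>E\<^esub> = \<one>\<^bsub>E\<^esub>"
    using EV.smult_one[OF E.one_closed] by (simp add: counit_one)
  have 2: "\<epsilon> (x \<otimes>\<^bsub>B\<^esub> y) \<odot>\<^bsub>E\<^esub> \<one>\<^bsub>E\<^esub> = (\<epsilon> x \<odot>\<^bsub>E\<^esub> \<one>\<^bsub>E\<^esub>) \<otimes>\<^bsub>E\<^esub> (\<epsilon> y \<odot>\<^bsub>E\<^esub> \<one>\<^bsub>E\<^esub>)"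
    if "x \<in> carrier B" "y \<in> carrier B" for x y
    using that EV.smult_assoc1[of "\<epsilon> y" "\<epsilon> x" "\<one>\<^bsub>E\<^esub>"] by (simp add: mult.commute counit_mult k_algebraD(3,4)[OF k_algebra_E])
  have 3: "\<omega> (x \<otimes>\<^bsub>B\<^esub> y) = (\<epsilon> y \<odot>\<^bsub>E\<^esub> \<one>\<^bsub>E\<^esub>) \<otimes>\<^bsub>E\<^esub> \<omega> x \<oplus>\<^bsub>E\<^esub> (\<epsilon> x \<odot>\<^bsub>E\<^esub> \<one>\<^bsub>E\<^esub>) \<otimes>\<^bsub>E\<^esub> \<omega> y"
    if "x \<in> carrier B" "y \<in> carrier B" for x y
    using that by (simp add: \<omega>_mult k_algebraD(3)[OF k_algebra_E] E.a_comm)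
  have 5: "\<omega> x \<otimes>\<^bsub>E\<^esub> (\<epsilon> y \<odot>\<^bsub>E\<^esub> \<one>\<^bsub>E\<^esub>) = \<epsilon> (br x y) \<odot>\<^bsub>E\<^esub> \<one>\<^bsub>E\<^esub> \<oplus>\<^bsub>E\<^esub> (\<epsilon> y \<odot>\<^bsub>E\<^esub> \<one>\<^bsub>E\<^esub>) \<otimes>\<^bsub>E\<^esub> \<omega> x"
    if "x \<in> carrier B" "y \<in> carrier B" for x y
    using that EV.smult_l_null[OF E.one_closed] by (simp add: counit_br k_algebraD(3,4)[OF k_algebra_E])
  note rel = k_algebra_E linear_counit_one linear_\<omega> 1 2 3 \<omega>_br 5
  show "algebra_hom E E (env_lift E (\<lambda>b. \<epsilon> b \<odot>\<^bsub>E\<^esub> \<one>\<^bsub>E\<^esub>) \<omega>)" by (rule algebra_hom_env_lift[OF rel])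
  show "env_lift E (\<lambda>b. \<epsilon> b \<odot>\<^bsub>E\<^esub> \<one>\<^bsub>E\<^esub>) \<omega> (m b) = \<epsilon> b \<odot>\<^bsub>E\<^esub> \<one>\<^bsub>E\<^esub>" if "b \<in> carrier B" by (rule env_lift_m[OF rel that])
  show "env_lift E (\<lambda>b. \<epsilon> b \<odot>\<^bsub>E\<^esub> \<one>\<^bsub>E\<^esub>) \<omega> (h b) = \<omega> b" if "b \<in> carrier B" by (rule env_lift_h[OF rel that])
qed

definition \<gamma> where
  "\<gamma> X = the_elem (env_lift E (\<lambda>b. \<epsilon> b \<odot>\<^bsub>E\<^esub> \<one>\<^bsub>E\<^esub>) \<omega> ` X)"

lemma env_gamma_kernel:
  assumes "e \<in> carrier E" "b \<in> carrier B" "\<epsilon> b = 0"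
  shows "env_lift E (\<lambda>b. \<epsilon> b \<odot>\<^bsub>E\<^esub> \<one>\<^bsub>E\<^esub>) \<omega> (e \<otimes>\<^bsub>E\<^esub> m b) = \<zero>\<^bsub>E\<^esub>"
  using assms EV.smult_l_null[OF E.one_closed] linear_mapD(1)[OF algebra_homD(1)[OF algebra_hom_env_gamma] assms(1)]
  by (simp add: algebra_homD(2)[OF algebra_hom_env_gamma] env_gamma_m)

lemma linear_gamma: "linear_map H E \<gamma>"
  unfolding \<gamma>_def[abs_def]
  by (rule the_elem_proj(2)[OF vec_space_E algebra_homD(1)[OF algebra_hom_env_gamma] env_gamma_kernel])

lemma gamma_proj: "e \<in> carrier E \<Longrightarrow> \<gamma> (\<pi> e) = env_lift E (\<lambda>b. \<epsilon> b \<odot>\<^bsub>E\<^esub> \<one>\<^bsub>E\<^esub>) \<omega> e"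
  unfolding \<gamma>_def
  by (rule the_elem_proj(1)[OF vec_space_E algebra_homD(1)[OF algebra_hom_env_gamma] env_gamma_kernel])

lemma gamma_closed [simp, intro]: "z \<in> carrier H \<Longrightarrow> \<gamma> z \<in> carrier E"
  by (rule linear_mapD[OF linear_gamma])

lemma gamma_one: "\<gamma> \<one>\<^bsub>H\<^esub> = \<one>\<^bsub>E\<^esub>"
  using gamma_proj[OF E.one_closed] by (simp add: proj_one algebra_homD(3)[OF algebra_hom_env_gamma])

lemma gamma_mult: "y \<in> carrier H \<Longrightarrow> z \<in> carrier H \<Longrightarrow> \<gamma> (y \<otimes>\<^bsub>H\<^esub> z) = \<gamma> y \<otimes>\<^bsub>E\<^esub> \<gamma> z"
  by (auto simp: carrier_H gamma_proj algebra_homD(2)[OF algebra_hom_env_gamma] simp flip: proj_mult)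

lemma gamma_hbar: "b \<in> carrier B \<Longrightarrow> \<gamma> (hbar b) = \<omega> b"
  by (simp add: hbar_def gamma_proj env_gamma_h)

text \<open>\<open>m\<close> acts by multiplication and \<open>h\<close> by the bracket, so S(x1)
  h(x2) acts by dressing. Thus the correction in \<open>\<omega>_m\<close> is itself the action of
  \<omega>(x), the coincidence on which \<open>gamma_m\<close> rests.\<close>

lemma act_\<omega>:
  assumes x: "x \<in> carrier B" and c: "c \<in> carrier B"
  shows "act (\<omega> x) c = dressing x c"
proof -
  have b: "bilinear_map B B E (\<lambda>x1 x2. m (S x1) \<otimes>\<^bsub>E\<^esub> h x2)"
    by (intro lin m_closed S_closed h_closed)
  have "act (\<omega> x) c = tensor_lift B (\<lambda>x1 x2. act (m (S x1) \<otimes>\<^bsub>E\<^esub> h x2) c) (\<Delta> x)"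
    unfolding \<omega>_def convolution_def
    by (rule tensor_lift_linear[OF vec_space_B vec_space_B vec_space_E vec_space_B b bilinear_map_left[OF bilinear_act c] C.comult_closed[OF x]])
  also have "\<dots> = dressing x c"
    unfolding dressing_def
    by (rule tensor_lift_cong[OF vec_space_B vec_space_B vec_space_B
          bilinear_map_compose[OF vec_space_B vec_space_B bilinear_map_left[OF bilinear_act c] b]])
      (use x c in \<open>auto simp: act_mult act_m act_h\<close>)
  finally show ?thesis .
qed

section \<open>The action of the quotient on \<open>B\<close> and its measuring property\<close>

definition dot where "dot z b = act (\<gamma> z) b"

lemma bilinear_dot: "bilinear_map H B B dot"
  unfolding dot_def[abs_def]
  by (intro bilinear_mapI linear_map_bilinear_left[OF bilinear_act] linear_map_bilinear_right[OF bilinear_act]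
      linear_gamma linear_map_id gamma_closed)

lemma dot_closed [simp, intro]: "z \<in> carrier H \<Longrightarrow> b \<in> carrier B \<Longrightarrow> dot z b \<in> carrier B"
  by (rule bilinear_map_closed[OF bilinear_dot])

lemma dot_unit: "b \<in> carrier B \<Longrightarrow> dot \<one>\<^bsub>H\<^esub> b = b"
  by (simp add: dot_def gamma_one act_one)

lemma dot_hbar: "x \<in> carrier B \<Longrightarrow> z \<in> carrier H \<Longrightarrow> b \<in> carrier B \<Longrightarrow> dot (hbar x \<otimes>\<^bsub>H\<^esub> z) b = dressing x (dot z b)"
  by (simp add: dot_def gamma_mult gamma_hbar act_mult act_\<omega>)

abbreviation BH where "BH \<equiv> tensor B H"

lemma vec_space_BH: "vec_space BH" by (rule vec_space_tensor[OF vec_space_B vec_space_H])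

sublocale BHV: module ground BH by (rule vec_space_BH)

lemma tensBH_closed [simp]: "b \<in> carrier B \<Longrightarrow> z \<in> carrier H \<Longrightarrow> tens B H b z \<in> carrier BH"
  by (rule tens_closed[OF vec_space_B vec_space_H])

lemma smult_closed_BH [simp, intro]: "t \<in> carrier BH \<Longrightarrow> c \<odot>\<^bsub>BH\<^esub> t \<in> carrier BH"
  by (rule BHV.smult_closed) simp_all

lemmas BHlin = lin\<omega>
  linear_map_plus[OF vec_space_H] linear_map_smult[OF vec_space_H] linear_map_scalar[OF vec_space_H]
  linear_map_plus[OF vec_space_BH] linear_map_smult[OF vec_space_BH] linear_map_scalar[OF vec_space_BH]
  linear_map_tens_left[OF vec_space_B vec_space_H] linear_map_tens_right[OF vec_space_B vec_space_H]
  linear_map_mult_left[OF k_algebra_H] linear_map_mult_right[OF k_algebra_H]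
  linear_map_compose[OF linear_hbar] linear_map_compose[OF linear_proj] linear_map_compose[OF linear_quot_counit]
  linear_map_compose[OF linear_gamma]
  linear_map_bilinear_left[OF bilinear_dot] linear_map_bilinear_right[OF bilinear_dot]
  linear_map_bilinear_left[OF bilinear_act] linear_map_bilinear_right[OF bilinear_act]

lemmas BHcl = m_closed h_closed S_closed \<omega>_closed br_closed gamma_closed hbar_closed proj_closed dot_closed act_closed
  B.m_closed B.one_closed E.m_closed E.one_closed H.m_closed H.one_closed
  smult_closed_B smult_closed_E smult_closed_H smult_closed_BH tensBH_closed C.comult_closed quot_comult_closed

lemma gamma_m:
  assumes "z \<in> carrier H" and b: "b \<in> carrier B"
  shows "\<gamma> z \<otimes>\<^bsub>E\<^esub> m b = tensor_lift E (\<lambda>z1 z2. m (dot z1 b) \<otimes>\<^bsub>E\<^esub> \<gamma> z2) (\<Delta>H z)"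
  using assms(1)
proof (induction rule: quot_induct)
  note HV = vec_space_H
  have bil: "bilinear_map H H E (\<lambda>z1 z2. m (dot z1 b) \<otimes>\<^bsub>E\<^esub> \<gamma> z2)"
    by (intro BHlin BHcl b)
  note lift = linear_mapD[OF linear_map_tensor_lift[OF HV HV vec_space_E bil]]
  note comult = linear_mapD[OF linear_quot_comult]
  note gam = linear_mapD[OF linear_gamma]
  {
    case one
    then show ?case using b
      by (simp add: quot_comult_one tensor_lift_tens[OF HV HV vec_space_E bil] gamma_one dot_unit)
  next
    case (smult c z)
    then show ?case using b by (simp add: lift comult gam k_algebraD(3)[OF k_algebra_E])
  next
    case (hbar x z)
    have bil': "bilinear_map H H E (\<lambda>z1 z2. \<omega> x \<otimes>\<^bsub>E\<^esub> (m (dot z1 b) \<otimes>\<^bsub>E\<^esub> \<gamma> z2))"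
      using hbar by (intro BHlin BHcl b)
    have "\<gamma> (hbar x \<otimes>\<^bsub>H\<^esub> z) \<otimes>\<^bsub>E\<^esub> m b = \<omega> x \<otimes>\<^bsub>E\<^esub> tensor_lift E (\<lambda>z1 z2. m (dot z1 b) \<otimes>\<^bsub>E\<^esub> \<gamma> z2) (\<Delta>H z)"
      using hbar b by (simp add: gamma_mult gamma_hbar E.m_assoc)
    also have "\<dots> = tensor_lift E (\<lambda>z1 z2. \<omega> x \<otimes>\<^bsub>E\<^esub> (m (dot z1 b) \<otimes>\<^bsub>E\<^esub> \<gamma> z2)) (\<Delta>H z)"
      using hbar by (intro tensor_lift_linear[OF HV HV vec_space_E vec_space_E bil linear_map_mult_left[OF k_algebra_E linear_map_id]]) auto
    \<comment> \<open>Moving \<omega>(x) past m(z1 . b) yields the product in the opposite order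
      plus the dressing of z1 . b. These are the two summands that a primitive generator contributes
      to the coproduct of hbar(x) z.\<close>
    also have "\<dots> = tensor_lift E (\<lambda>z1 z2. m (dot z1 b) \<otimes>\<^bsub>E\<^esub> \<gamma> (hbar x \<otimes>\<^bsub>H\<^esub> z2) \<oplus>\<^bsub>E\<^esub>
        m (dot (hbar x \<otimes>\<^bsub>H\<^esub> z1) b) \<otimes>\<^bsub>E\<^esub> \<gamma> z2) (\<Delta>H z)"
    proof (rule tensor_lift_cong[OF HV HV vec_space_E bil'])
      fix z1 z2 assume zs: "z1 \<in> carrier H" "z2 \<in> carrier H"
      have "m (dressing x (dot z1 b)) \<in> carrier E" using hbar zs b by (simp flip: dot_hbar)
      then show "\<omega> x \<otimes>\<^bsub>E\<^esub> (m (dot z1 b) \<otimes>\<^bsub>E\<^esub> \<gamma> z2) = m (dot z1 b) \<otimes>\<^bsub>E\<^esub> \<gamma> (hbar x \<otimes>\<^bsub>H\<^esub> z2) \<oplus>\<^bsub>E\<^esub>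
        m (dot (hbar x \<otimes>\<^bsub>H\<^esub> z1) b) \<otimes>\<^bsub>E\<^esub> \<gamma> z2"
        using hbar zs b
        by (simp add: gamma_mult gamma_hbar dot_hbar \<omega>_m E.l_distr E.a_comm E.m_assoc[symmetric])
    qed (use hbar in simp)
    also have "\<dots> = tensor_lift E (\<lambda>z1 z2. m (dot z1 b) \<otimes>\<^bsub>E\<^esub> \<gamma> z2) (\<Delta>H (hbar x \<otimes>\<^bsub>H\<^esub> z))"
      by (rule quot_comult_hbar_lift[OF vec_space_E bil hbar(1,2), symmetric])
    finally show ?case .
  next
    case (add y z)
    then show ?case using b by (simp add: lift comult gam E.l_distr)
  }
qed

lemma dressing_scalar:
  assumes x: "x \<in> carrier B"
  shows "dressing x (c \<odot>\<^bsub>B\<^esub> \<one>\<^bsub>B\<^esub>) = \<zero>\<^bsub>B\<^esub>"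
proof -
  have "dressing x \<one>\<^bsub>B\<^esub> = tensor_lift B (\<lambda>x1 x2. S x1 \<otimes>\<^bsub>B\<^esub> br x2 \<one>\<^bsub>B\<^esub>) (\<Delta> x)" by (simp add: dressing_def)
  \<comment> \<open>Each summand vanishes because {x2, 1} = 0. It is rewritten as zero times S(x1)
    x2, so that the scalar 0 can be taken out of the sum.\<close>
  also have "\<dots> = tensor_lift B (\<lambda>x1 x2. 0 \<odot>\<^bsub>B\<^esub> (S x1 \<otimes>\<^bsub>B\<^esub> x2)) (\<Delta> x)"
    by (rule tensor_lift_cong[OF vec_space_B vec_space_B vec_space_B])
      (use x BV.smult_l_null in \<open>auto intro!: lin simp: br_one\<close>)
  also have "\<dots> = 0 \<odot>\<^bsub>B\<^esub> tensor_lift B (\<lambda>x1 x2. S x1 \<otimes>\<^bsub>B\<^esub> x2) (\<Delta> x)"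
    by (rule tensor_lift_linear[OF vec_space_B vec_space_B vec_space_B vec_space_B, symmetric]) (use x in \<open>auto intro!: lin\<close>)
  also have "\<dots> = \<zero>\<^bsub>B\<^esub>" using x BV.smult_l_null by (simp add: S(3))
  finally have 1: "act (\<omega> x) \<one>\<^bsub>B\<^esub> = \<zero>\<^bsub>B\<^esub>" using x by (simp add: act_\<omega>)
  have "act (\<omega> x) (c \<odot>\<^bsub>B\<^esub> \<one>\<^bsub>B\<^esub>) = \<zero>\<^bsub>B\<^esub>"
    using x BV.smult_r_null[of c] by (simp add: linear_mapD(3)[OF bilinear_map_right[OF bilinear_act]] 1)
  then show ?thesis using x by (simp add: act_\<omega>)
qed

text \<open>In the step to hbar(x) z both sides vanish: dressing kills the scalar z . 1, and the
  counit kills hbar(x) z.\<close>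

lemma dot_one:
  assumes "z \<in> carrier H"
  shows "dot z \<one>\<^bsub>B\<^esub> = \<epsilon>H z \<odot>\<^bsub>B\<^esub> \<one>\<^bsub>B\<^esub>"
  using assms
proof (induction rule: quot_induct)
  note d = linear_mapD[OF bilinear_map_left[OF bilinear_dot B.one_closed]]
  note e = linear_mapD[OF linear_quot_counit]
  {
    case one
    then show ?case using BV.smult_one[OF B.one_closed] by (simp add: quot_counit_one dot_def gamma_one act_one)
  next
    case (smult c z)
    then show ?case using BV.smult_assoc1[of c "\<epsilon>H z" "\<one>\<^bsub>B\<^esub>"] by (simp add: d e)
  next
    case (hbar x z)
    then show ?case using BV.smult_l_null[OF B.one_closed] by (simp add: dot_hbar quot_counit_hbar dressing_scalar)
  next
    case (add y z)
    then show ?case using BV.smult_l_distr[of "\<epsilon>H y" "\<epsilon>H z" "\<one>\<^bsub>B\<^esub>"] by (simp add: d e)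
  }
qed

text \<open>The measuring property is the commutation rule \<open>gamma_m\<close> in disguise: apply
  both of its sides, with a in place of b, to the element b.\<close>

lemma dot_mult:
  assumes z: "z \<in> carrier H" and a: "a \<in> carrier B" and b: "b \<in> carrier B"
  shows "dot z (a \<otimes>\<^bsub>B\<^esub> b) = tensor_lift B (\<lambda>z1 z2. dot z1 a \<otimes>\<^bsub>B\<^esub> dot z2 b) (\<Delta>H z)"
proof -
  have bil: "bilinear_map H H E (\<lambda>z1 z2. m (dot z1 a) \<otimes>\<^bsub>E\<^esub> \<gamma> z2)"
    by (intro BHlin BHcl a)
  note L = bilinear_map_left[OF bilinear_act b]
  have "dot z (a \<otimes>\<^bsub>B\<^esub> b) = act (\<gamma> z \<otimes>\<^bsub>E\<^esub> m a) b"
    using z a b by (simp add: dot_def act_mult act_m)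
  also have "\<dots> = tensor_lift B (\<lambda>z1 z2. act (m (dot z1 a) \<otimes>\<^bsub>E\<^esub> \<gamma> z2) b) (\<Delta>H z)"
    unfolding gamma_m[OF z a]
    by (rule tensor_lift_linear[OF vec_space_H vec_space_H vec_space_E vec_space_B bil L quot_comult_closed[OF z]])
  also have "\<dots> = tensor_lift B (\<lambda>z1 z2. dot z1 a \<otimes>\<^bsub>B\<^esub> dot z2 b) (\<Delta>H z)"
  proof (rule tensor_lift_cong[OF vec_space_H vec_space_H vec_space_B bilinear_map_compose[OF vec_space_H vec_space_H L bil] _ quot_comult_closed[OF z]])
    fix z1 z2 assume "z1 \<in> carrier H" "z2 \<in> carrier H"
    then show "act (m (dot z1 a) \<otimes>\<^bsub>E\<^esub> \<gamma> z2) b = dot z1 a \<otimes>\<^bsub>B\<^esub> dot z2 b"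
      using a b by (simp add: act_mult act_m dot_def[of z2])
  qed
  finally show ?thesis .
qed

abbreviation dot_lift where "dot_lift \<equiv> tensor_lift B dot"

lemma dot_lift_tens: "z \<in> carrier H \<Longrightarrow> b \<in> carrier B \<Longrightarrow> dot_lift (tens H B z b) = dot z b"
  by (rule tensor_lift_tens[OF vec_space_H vec_space_B vec_space_B bilinear_dot])

lemma measuring_dot: "measuring H \<Delta>H \<epsilon>H B dot_lift"
proof -
  have "tensor_lift B (\<lambda>z1 z2. dot_lift (tens H B z1 a) \<otimes>\<^bsub>B\<^esub> dot_lift (tens H B z2 b)) (\<Delta>H z) =
      dot z (a \<otimes>\<^bsub>B\<^esub> b)" if "z \<in> carrier H" "a \<in> carrier B" "b \<in> carrier B" for z a b
    unfolding dot_mult[OF that]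
    by (rule sym, rule tensor_lift_cong[OF vec_space_H vec_space_H vec_space_B])
      (use that in \<open>auto intro!: BHlin simp: dot_lift_tens\<close>)
  then show ?thesis
    unfolding measuring_def
    by (auto simp: dot_lift_tens dot_one linear_map_tensor_lift[OF vec_space_H vec_space_B vec_space_B bilinear_dot])
qed

section \<open>The trivial cocycle\<close>

abbreviation cocycle where
  "cocycle \<equiv> tensor_lift B (\<lambda>y z. (\<epsilon>H y * \<epsilon>H z) \<odot>\<^bsub>B\<^esub> \<one>\<^bsub>B\<^esub>)"

lemma bilinear_counits: "bilinear_map H H ground (\<lambda>y z. \<epsilon>H y * \<epsilon>H z)"
  by (intro bilinear_mapI linear_map_ground_mult_left linear_map_ground_mult_right linear_quot_counit)

lemma bilinear_cocycle: "bilinear_map H H B (\<lambda>y z. (\<epsilon>H y * \<epsilon>H z) \<odot>\<^bsub>B\<^esub> \<one>\<^bsub>B\<^esub>)"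
  by (intro bilinear_mapI linear_map_scalar[OF vec_space_B] B.one_closed bilinear_map_left[OF bilinear_counits]
      bilinear_map_right[OF bilinear_counits])

lemma cocycle_tens: "y \<in> carrier H \<Longrightarrow> z \<in> carrier H \<Longrightarrow> cocycle (tens H H y z) = (\<epsilon>H y * \<epsilon>H z) \<odot>\<^bsub>B\<^esub> \<one>\<^bsub>B\<^esub>"
  by (rule tensor_lift_tens[OF vec_space_H vec_space_H vec_space_B bilinear_cocycle])

lemma linear_cocycle: "linear_map HH B cocycle"
  by (rule linear_map_tensor_lift[OF vec_space_H vec_space_H vec_space_B bilinear_cocycle])

lemma quot_counit_left_lift:
  assumes W: "vec_space W" and f: "linear_map H W f" and z: "z \<in> carrier H"
  shows "tensor_lift W (\<lambda>z1 z2. \<epsilon>H z1 \<odot>\<^bsub>W\<^esub> f z2) (\<Delta>H z) = f z"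
proof -
  have b: "bilinear_map H H H (\<lambda>z1 z2. \<epsilon>H z1 \<odot>\<^bsub>H\<^esub> z2)"
    by (intro Hlin linear_quot_counit)
  have "f (tensor_lift H (\<lambda>z1 z2. \<epsilon>H z1 \<odot>\<^bsub>H\<^esub> z2) (\<Delta>H z)) = tensor_lift W (\<lambda>z1 z2. f (\<epsilon>H z1 \<odot>\<^bsub>H\<^esub> z2)) (\<Delta>H z)"
    by (rule tensor_lift_linear[OF vec_space_H vec_space_H vec_space_H W b f quot_comult_closed[OF z]])
  also have "\<dots> = tensor_lift W (\<lambda>z1 z2. \<epsilon>H z1 \<odot>\<^bsub>W\<^esub> f z2) (\<Delta>H z)"
    by (rule tensor_lift_cong[OF vec_space_H vec_space_H W bilinear_map_compose[OF vec_space_H vec_space_H f b]])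
      (simp_all add: linear_mapD(3)[OF f] z)
  finally show ?thesis by (simp add: quot_counit_left z)
qed

text \<open>By the counit law the product of the counits of the two components sums to the counit,
  so the trivial cocycle is its own convolution inverse.\<close>

lemma convolution_invertible_cocycle:
  "convolution_invertible HH (tensor_comult H \<Delta>H H \<Delta>H) (tensor_counit \<epsilon>H \<epsilon>H) B cocycle"
proof -
  let ?T = "tensor HH HH"
  let ?F = "\<lambda>c1 c2 d1 d2. tens HH HH (tens H H c1 d1) (tens H H c2 d2)"
  let ?tk = "tensor_lift (ground :: ('k, 'k) module) (\<lambda>y z. \<epsilon>H y * \<epsilon>H z)"
  note V = vec_space_H and W = vec_space_HH
  note T = vec_space_tensor[OF W W]
  note lin' = linear_map_id linear_map_tens_left[OF V V] linear_map_tens_right[OF V V]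
    linear_map_tens_left[OF W W] linear_map_tens_right[OF W W] bilinear_mapI
  have F1: "bilinear_map H H ?T (?F c1 c2)" if "c1 \<in> carrier H" "c2 \<in> carrier H" for c1 c2
    using that by (intro lin' tensH_closed)
  have F2: "bilinear_map H H ?T (\<lambda>c1 c2. ?F c1 c2 d1 d2)" if "d1 \<in> carrier H" "d2 \<in> carrier H" for d1 d2
    using that by (intro lin' tensH_closed)
  \<comment> \<open>The inner double sum of \<open>tensor_comult\<close>, as a bilinear function of
    two arbitrary tensors. With these in place of the coproducts, identities can be tested on pure
    tensors.\<close>
  define Q where "Q = (\<lambda>s t. tensor_lift ?T (\<lambda>c1 c2. tensor_lift ?T (?F c1 c2) t) s)"
  have Q: "bilinear_map HH HH ?T Q" unfolding Q_def by (rule bilinear_map_tensor_lift2[OF V V V V T F1 F2])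
  have Q_tens: "Q (tens H H c1 c2) (tens H H d1 d2) = ?F c1 c2 d1 d2"
    if "c1 \<in> carrier H" "c2 \<in> carrier H" "d1 \<in> carrier H" "d2 \<in> carrier H" for c1 c2 d1 d2
    unfolding Q_def by (rule tensor_lift2_tens[OF V V V V T F1 F2 that])
  have Q': "bilinear_map H H ?T (\<lambda>c d. Q (\<Delta>H c) (\<Delta>H d))"
    by (intro bilinear_mapI linear_map_bilinear_left[OF Q] linear_map_bilinear_right[OF Q] linear_quot_comult quot_comult_closed)
  have comult: "tensor_comult H \<Delta>H H \<Delta>H = tensor_lift ?T (\<lambda>c d. Q (\<Delta>H c) (\<Delta>H d))"
    by (simp add: tensor_comult_def Let_def Q_def)
  have bc: "bilinear_map HH HH B (\<lambda>s t. cocycle s \<otimes>\<^bsub>B\<^esub> cocycle t)"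
    by (rule bilinear_map_mult[OF k_algebra_B linear_cocycle linear_cocycle])
  define L where "L = tensor_lift B (\<lambda>s t. cocycle s \<otimes>\<^bsub>B\<^esub> cocycle t)"
  have L: "linear_map ?T B L" unfolding L_def by (rule linear_map_tensor_lift[OF W W vec_space_B bc])
  have tk: "linear_map HH ground ?tk" by (rule linear_map_tensor_lift[OF V V vec_space_ground bilinear_counits])
  \<comment> \<open>Reordering the four counits separates the variables; substituting coproducts for
    s and t then collapses each factor to a single counit.\<close>
  have LQ: "L (Q s t) = (?tk s * ?tk t) \<odot>\<^bsub>B\<^esub> \<one>\<^bsub>B\<^esub>" if s: "s \<in> carrier HH" and t: "t \<in> carrier HH" for s t
  proof (rule tensor_hom_eq2[OF V V V V _ _ _ s t])
    show "bilinear_map HH HH B (\<lambda>s t. L (Q s t))"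
      by (rule bilinear_map_compose[OF W W L Q])
    show "bilinear_map HH HH B (\<lambda>s t. (?tk s * ?tk t) \<odot>\<^bsub>B\<^esub> \<one>\<^bsub>B\<^esub>)"
      by (intro bilinear_mapI linear_map_scalar[OF vec_space_B] linear_map_ground_mult_left linear_map_ground_mult_right tk B.one_closed)
    fix a b c d assume *: "a \<in> carrier H" "b \<in> carrier H" "c \<in> carrier H" "d \<in> carrier H"
    have "x \<odot>\<^bsub>B\<^esub> (y \<odot>\<^bsub>B\<^esub> \<one>\<^bsub>B\<^esub>) = (x * y) \<odot>\<^bsub>B\<^esub> \<one>\<^bsub>B\<^esub>" for x y
      using BV.smult_assoc1[of x y "\<one>\<^bsub>B\<^esub>"] by simp
    then show "L (Q (tens H H a b) (tens H H c d)) = (?tk (tens H H a b) * ?tk (tens H H c d)) \<odot>\<^bsub>B\<^esub> \<one>\<^bsub>B\<^esub>"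
      using * by (simp add: Q_tens L_def tensor_lift_tens[OF W W vec_space_B bc] cocycle_tens
          tensor_lift_tens[OF V V vec_space_ground bilinear_counits] k_algebraD(3,4)[OF k_algebra_B] ac_simps)
  qed
  have tk_comult: "?tk (\<Delta>H z) = \<epsilon>H z" if "z \<in> carrier H" for z
    using quot_counit_left_lift[OF vec_space_ground linear_quot_counit that] by simp
  have "convolution (tensor_comult H \<Delta>H H \<Delta>H) B cocycle cocycle c = tensor_counit \<epsilon>H \<epsilon>H c \<odot>\<^bsub>B\<^esub> \<one>\<^bsub>B\<^esub>"
    if c: "c \<in> carrier HH" for c
  proof -
    have "L (tensor_lift ?T (\<lambda>c d. Q (\<Delta>H c) (\<Delta>H d)) c) = ?tk c \<odot>\<^bsub>B\<^esub> \<one>\<^bsub>B\<^esub>"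
    proof (rule tensor_hom_eq[OF V V _ _ _ c])
      show "linear_map HH B (\<lambda>c. L (tensor_lift ?T (\<lambda>c d. Q (\<Delta>H c) (\<Delta>H d)) c))"
        by (rule linear_map_compose[OF L linear_map_tensor_lift[OF V V T Q']])
      show "linear_map HH B (\<lambda>c. ?tk c \<odot>\<^bsub>B\<^esub> \<one>\<^bsub>B\<^esub>)"
        by (rule linear_map_scalar[OF vec_space_B tk B.one_closed])
      fix y z assume "y \<in> carrier H" "z \<in> carrier H"
      then show "L (tensor_lift ?T (\<lambda>c d. Q (\<Delta>H c) (\<Delta>H d)) (tens H H y z)) = ?tk (tens H H y z) \<odot>\<^bsub>B\<^esub> \<one>\<^bsub>B\<^esub>"
        by (simp add: tensor_lift_tens[OF V V T Q'] LQ tk_comult tensor_lift_tens[OF V V vec_space_ground bilinear_counits])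
    qed
    then show ?thesis
      by (simp add: convolution_def comult L_def tensor_counit_def)
  qed
  then show ?thesis
    unfolding convolution_invertible_def using linear_cocycle by blast
qed

section \<open>The mutually inverse maps between \<open>B^e\<close> and the tensor product\<close>

definition lmul where "lmul b = tensor_lift BH (\<lambda>a z. tens B H (b \<otimes>\<^bsub>B\<^esub> a) z)"

text \<open>Left multiplication by h(x), carried over to B \<otimes> H(B). The formula expresses
  h(x) m(a) = m{x, a} + m(a) h(x), with h(x) on the right written as the sum of m(x1)
  \<omega>(x2).\<close>

definition hmul where
  "hmul x = tensor_lift BH (\<lambda>a z. tens B H (br x a) z \<oplus>\<^bsub>BH\<^esub>
     tensor_lift BH (\<lambda>x1 x2. tens B H (x1 \<otimes>\<^bsub>B\<^esub> a) (hbar x2 \<otimes>\<^bsub>H\<^esub> z)) (\<Delta> x))"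

lemma bilinear_lmul: "b \<in> carrier B \<Longrightarrow> bilinear_map B H BH (\<lambda>a z. tens B H (b \<otimes>\<^bsub>B\<^esub> a) z)"
  by (intro BHlin BHcl)

lemma linear_lmul: "b \<in> carrier B \<Longrightarrow> linear_map BH BH (lmul b)"
  unfolding lmul_def by (rule linear_map_tensor_lift[OF vec_space_B vec_space_H vec_space_BH bilinear_lmul])

lemma lmul_tens: "b \<in> carrier B \<Longrightarrow> a \<in> carrier B \<Longrightarrow> z \<in> carrier H \<Longrightarrow> lmul b (tens B H a z) = tens B H (b \<otimes>\<^bsub>B\<^esub> a) z"
  unfolding lmul_def by (rule tensor_lift_tens[OF vec_space_B vec_space_H vec_space_BH bilinear_lmul])

lemma bilinear_hmul_inner:
  "a \<in> carrier B \<Longrightarrow> z \<in> carrier H \<Longrightarrow> bilinear_map B B BH (\<lambda>x1 x2. tens B H (x1 \<otimes>\<^bsub>B\<^esub> a) (hbar x2 \<otimes>\<^bsub>H\<^esub> z))"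
  by (intro BHlin BHcl)

lemma bilinear_hmul:
  assumes x: "x \<in> carrier B"
  shows "bilinear_map B H BH (\<lambda>a z. tens B H (br x a) z \<oplus>\<^bsub>BH\<^esub>
     tensor_lift BH (\<lambda>x1 x2. tens B H (x1 \<otimes>\<^bsub>B\<^esub> a) (hbar x2 \<otimes>\<^bsub>H\<^esub> z)) (\<Delta> x))"
proof -
  have "bilinear_map B H BH (\<lambda>a z. tensor_lift BH (\<lambda>x1 x2. tens B H (x1 \<otimes>\<^bsub>B\<^esub> a) (hbar x2 \<otimes>\<^bsub>H\<^esub> z)) (\<Delta> x))"
    by (rule bilinear_map_tensor_lift_fun[OF vec_space_B vec_space_B vec_space_BH vec_space_B vec_space_H
          C.comult_closed[OF x] bilinear_hmul_inner]) (assumption | intro BHlin BHcl)+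
  from bilinear_map_left[OF this] bilinear_map_right[OF this] x show ?thesis
    by (intro bilinear_mapI linear_map_plus[OF vec_space_BH]) (assumption | intro BHlin BHcl)+
qed

lemma linear_hmul: "x \<in> carrier B \<Longrightarrow> linear_map BH BH (hmul x)"
  unfolding hmul_def by (rule linear_map_tensor_lift[OF vec_space_B vec_space_H vec_space_BH bilinear_hmul])

lemma hmul_tens: "x \<in> carrier B \<Longrightarrow> a \<in> carrier B \<Longrightarrow> z \<in> carrier H \<Longrightarrow>
  hmul x (tens B H a z) = tens B H (br x a) z \<oplus>\<^bsub>BH\<^esub>
     tensor_lift BH (\<lambda>x1 x2. tens B H (x1 \<otimes>\<^bsub>B\<^esub> a) (hbar x2 \<otimes>\<^bsub>H\<^esub> z)) (\<Delta> x)"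
  unfolding hmul_def by (rule tensor_lift_tens[OF vec_space_B vec_space_H vec_space_BH bilinear_hmul])

definition ap where "ap = tensor_lift BH (\<lambda>d e. tens B H (act d \<one>\<^bsub>B\<^esub>) (\<pi> e))"

lemma bilinear_ap: "bilinear_map E E BH (\<lambda>d e. tens B H (act d \<one>\<^bsub>B\<^esub>) (\<pi> e))"
  by (intro BHlin BHcl)

lemma linear_ap: "linear_map EE BH ap"
  unfolding ap_def by (rule linear_map_tensor_lift[OF vec_space_E vec_space_E vec_space_BH bilinear_ap])

lemma ap_tens: "d \<in> carrier E \<Longrightarrow> e \<in> carrier E \<Longrightarrow> ap (tens E E d e) = tens B H (act d \<one>\<^bsub>B\<^esub>) (\<pi> e)"
  unfolding ap_def by (rule tensor_lift_tens[OF vec_space_E vec_space_E vec_space_BH bilinear_ap])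

lemmas tensBH_smult_right = linear_mapD(3)[OF bilinear_map_right[OF bilinear_map_tens[OF vec_space_B vec_space_H]]]
lemmas tensBH_smult_left = linear_mapD(3)[OF bilinear_map_left[OF bilinear_map_tens[OF vec_space_B vec_space_H]]]

text \<open>In the first factor m(b1) acts as multiplication by b1, in the second m(b2) becomes
  \<epsilon>(b2); the counit law restores b.\<close>

lemma ap_mm_mult:
  assumes b: "b \<in> carrier B" and t: "t \<in> carrier EE"
  shows "ap (mm (\<Delta> b) \<otimes>\<^bsub>EE\<^esub> t) = lmul b (ap t)"
proof (rule tensor_hom_eq[OF vec_space_E vec_space_E _ linear_map_compose[OF linear_lmul[OF b] linear_ap] _ t])
  show "linear_map EE BH (\<lambda>t. ap (mm (\<Delta> b) \<otimes>\<^bsub>EE\<^esub> t))"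
    by (intro linear_map_compose[OF linear_ap] linear_map_mult_left[OF k_algebra_EE] linear_map_id mm_closed C.comult_closed b)
  fix d e assume de: "d \<in> carrier E" "e \<in> carrier E"
  let ?f = "\<lambda>a b. \<epsilon> b \<odot>\<^bsub>BH\<^esub> tens B H (a \<otimes>\<^bsub>B\<^esub> act d \<one>\<^bsub>B\<^esub>) (\<pi> e)"
  have f: "bilinear_map B B BH ?f" using de by (intro BHlin C.linear_counit BHcl)
  have f': "linear_map B BH (\<lambda>a. tens B H (a \<otimes>\<^bsub>B\<^esub> act d \<one>\<^bsub>B\<^esub>) (\<pi> e))" using de by (intro BHlin BHcl)
  have "ap (mm u \<otimes>\<^bsub>EE\<^esub> tens E E d e) = tensor_lift BH ?f u" if u: "u \<in> carrier BB" for u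
  proof (rule tensor_hom_eq[OF vec_space_B vec_space_B _ linear_map_tensor_lift[OF vec_space_B vec_space_B vec_space_BH f] _ u])
    show "linear_map BB BH (\<lambda>u. ap (mm u \<otimes>\<^bsub>EE\<^esub> tens E E d e))"
      by (intro linear_map_compose[OF linear_ap] linear_map_mult_right[OF k_algebra_EE] linear_mm tensE_closed de)
    fix a b assume "a \<in> carrier B" "b \<in> carrier B"
    then show "ap (mm (tens B B a b) \<otimes>\<^bsub>EE\<^esub> tens E E d e) = tensor_lift BH ?f (tens B B a b)"
      using de by (simp add: mm_tens tensE_mult ap_tens proj_m_mult act_mult act_m tensBH_smult_right
          tensor_lift_tens[OF vec_space_B vec_space_B vec_space_BH f])
  qed
  then show "ap (mm (\<Delta> b) \<otimes>\<^bsub>EE\<^esub> tens E E d e) = lmul b (ap (tens E E d e))"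
    using de b by (simp add: C.counit_right_lift[OF vec_space_BH f' b] ap_tens lmul_tens)
qed

text \<open>The part h(x1) \<otimes> m(x2) contributes {x1, a} \<epsilon>(x2), which sums to the
  bracket with x, and the part m(x1) \<otimes> h(x2) contributes the Sweedler sum in
  \<open>hmul\<close>.\<close>

lemma ap_mh_mult:
  assumes x: "x \<in> carrier B" and t: "t \<in> carrier EE"
  shows "ap (mh (\<Delta> x) \<otimes>\<^bsub>EE\<^esub> t) = hmul x (ap t)"
proof (rule tensor_hom_eq[OF vec_space_E vec_space_E _ linear_map_compose[OF linear_hmul[OF x] linear_ap] _ t])
  show "linear_map EE BH (\<lambda>t. ap (mh (\<Delta> x) \<otimes>\<^bsub>EE\<^esub> t))"
    by (intro linear_map_compose[OF linear_ap] linear_map_mult_left[OF k_algebra_EE] linear_map_id mh_closed C.comult_closed x)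
  fix d e assume de: "d \<in> carrier E" "e \<in> carrier E"
  let ?f = "\<lambda>a b. \<epsilon> b \<odot>\<^bsub>BH\<^esub> tens B H (br a (act d \<one>\<^bsub>B\<^esub>)) (\<pi> e)"
  let ?g = "\<lambda>a b. tens B H (a \<otimes>\<^bsub>B\<^esub> act d \<one>\<^bsub>B\<^esub>) (hbar b \<otimes>\<^bsub>H\<^esub> \<pi> e)"
  have f: "bilinear_map B B BH ?f" and fg: "bilinear_map B B BH (\<lambda>a b. ?f a b \<oplus>\<^bsub>BH\<^esub> ?g a b)"
    using de by - (intro BHlin C.linear_counit BHcl; assumption?)+
  have g: "bilinear_map B B BH ?g" using de by (intro bilinear_hmul_inner BHcl)
  have f': "linear_map B BH (\<lambda>a. tens B H (br a (act d \<one>\<^bsub>B\<^esub>)) (\<pi> e))" using de by (intro BHlin BHcl)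
  have "ap (mh u \<otimes>\<^bsub>EE\<^esub> tens E E d e) = tensor_lift BH (\<lambda>a b. ?f a b \<oplus>\<^bsub>BH\<^esub> ?g a b) u" if u: "u \<in> carrier BB" for u
  proof (rule tensor_hom_eq[OF vec_space_B vec_space_B _ linear_map_tensor_lift[OF vec_space_B vec_space_B vec_space_BH fg] _ u])
    show "linear_map BB BH (\<lambda>u. ap (mh u \<otimes>\<^bsub>EE\<^esub> tens E E d e))"
      by (intro linear_map_compose[OF linear_ap] linear_map_mult_right[OF k_algebra_EE] linear_mh tensE_closed de)
    fix a b assume "a \<in> carrier B" "b \<in> carrier B"
    then show "ap (mh (tens B B a b) \<otimes>\<^bsub>EE\<^esub> tens E E d e) = tensor_lift BH (\<lambda>a b. ?f a b \<oplus>\<^bsub>BH\<^esub> ?g a b) (tens B B a b)"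
      using de by (simp add: mh_tens EE.l_distr tensE_mult linear_mapD(2)[OF linear_ap] ap_tens proj_m_mult proj_h_mult
          act_mult act_m act_h tensBH_smult_right BHV.M.a_comm tensor_lift_tens[OF vec_space_B vec_space_B vec_space_BH fg])
  qed
  from this[OF C.comult_closed[OF x]]
  have "ap (mh (\<Delta> x) \<otimes>\<^bsub>EE\<^esub> tens E E d e) = tensor_lift BH ?f (\<Delta> x) \<oplus>\<^bsub>BH\<^esub> tensor_lift BH ?g (\<Delta> x)"
    by (simp add: tensor_lift_add_fun[OF vec_space_B vec_space_B vec_space_BH f g C.comult_closed[OF x]])
  then show "ap (mh (\<Delta> x) \<otimes>\<^bsub>EE\<^esub> tens E E d e) = hmul x (ap (tens E E d e))"
    using de x by (simp add: C.counit_right_lift[OF vec_space_BH f' x] ap_tens hmul_tens)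
qed

definition \<Phi> where "\<Phi> e = ap (env_delta e)"
definition \<Psi> where "\<Psi> = tensor_lift E (\<lambda>b z. m b \<otimes>\<^bsub>E\<^esub> \<gamma> z)"

lemma linear_\<Phi>: "linear_map E BH \<Phi>"
  unfolding \<Phi>_def[abs_def] by (rule linear_map_compose[OF linear_ap algebra_homD(1)[OF algebra_hom_env_comult]])

lemma \<Phi>_closed [simp]: "e \<in> carrier E \<Longrightarrow> \<Phi> e \<in> carrier BH"
  by (rule linear_mapD[OF linear_\<Phi>])

lemma \<Phi>_m: "b \<in> carrier B \<Longrightarrow> e \<in> carrier E \<Longrightarrow> \<Phi> (m b \<otimes>\<^bsub>E\<^esub> e) = lmul b (\<Phi> e)"
  by (simp add: \<Phi>_def algebra_homD(2)[OF algebra_hom_env_comult] env_comult_m ap_mm_mult)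

lemma \<Phi>_h: "x \<in> carrier B \<Longrightarrow> e \<in> carrier E \<Longrightarrow> \<Phi> (h x \<otimes>\<^bsub>E\<^esub> e) = hmul x (\<Phi> e)"
  by (simp add: \<Phi>_def algebra_homD(2)[OF algebra_hom_env_comult] env_comult_h ap_mh_mult)

lemma \<Phi>_one: "\<Phi> \<one>\<^bsub>E\<^esub> = tens B H \<one>\<^bsub>B\<^esub> \<one>\<^bsub>H\<^esub>"
  by (simp add: \<Phi>_def algebra_homD(3)[OF algebra_hom_env_comult] ap_tens act_one proj_one flip: tens_one[OF k_algebra_E k_algebra_E])

lemma bilinear_\<Psi>: "bilinear_map B H E (\<lambda>b z. m b \<otimes>\<^bsub>E\<^esub> \<gamma> z)"
  by (intro BHlin BHcl)

lemma linear_\<Psi>: "linear_map BH E \<Psi>"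
  unfolding \<Psi>_def by (rule linear_map_tensor_lift[OF vec_space_B vec_space_H vec_space_E bilinear_\<Psi>])

lemma \<Psi>_tens: "b \<in> carrier B \<Longrightarrow> z \<in> carrier H \<Longrightarrow> \<Psi> (tens B H b z) = m b \<otimes>\<^bsub>E\<^esub> \<gamma> z"
  unfolding \<Psi>_def by (rule tensor_lift_tens[OF vec_space_B vec_space_H vec_space_E bilinear_\<Psi>])

lemma \<Psi>_closed [simp]: "t \<in> carrier BH \<Longrightarrow> \<Psi> t \<in> carrier E"
  by (rule linear_mapD[OF linear_\<Psi>])

lemma \<Psi>_lmul:
  assumes b: "b \<in> carrier B" and t: "t \<in> carrier BH"
  shows "\<Psi> (lmul b t) = m b \<otimes>\<^bsub>E\<^esub> \<Psi> t"
  by (rule tensor_hom_eq[OF vec_space_B vec_space_H linear_map_compose[OF linear_\<Psi> linear_lmul[OF b]]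
        linear_map_mult_left[OF k_algebra_E linear_\<Psi> m_closed[OF b]] _ t])
    (simp add: lmul_tens b \<Psi>_tens m_mult E.m_assoc)

text \<open>On a \<otimes> z the sum of m(x1) \<omega>(x2) reassembles to h(x) behind m(a), and
  together with the bracket term this is h(x) m(a) by the commutator relation.\<close>

lemma \<Psi>_hmul:
  assumes x: "x \<in> carrier B" and t: "t \<in> carrier BH"
  shows "\<Psi> (hmul x t) = h x \<otimes>\<^bsub>E\<^esub> \<Psi> t"
proof (rule tensor_hom_eq[OF vec_space_B vec_space_H linear_map_compose[OF linear_\<Psi> linear_hmul[OF x]]
        linear_map_mult_left[OF k_algebra_E linear_\<Psi> h_closed[OF x]] _ t])
  fix a z assume az: "a \<in> carrier B" "z \<in> carrier H"
  note b = bilinear_hmul_inner[OF az]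
  have cl: "tensor_lift BH (\<lambda>x1 x2. tens B H (x1 \<otimes>\<^bsub>B\<^esub> a) (hbar x2 \<otimes>\<^bsub>H\<^esub> z)) (\<Delta> x) \<in> carrier BH"
    by (rule tensor_lift_closed[OF vec_space_B vec_space_B vec_space_BH b C.comult_closed[OF x]])
  have lz: "linear_map E E (\<lambda>e. m a \<otimes>\<^bsub>E\<^esub> e \<otimes>\<^bsub>E\<^esub> \<gamma> z)"
    using az by (intro BHlin BHcl)
  have "\<Psi> (tensor_lift BH (\<lambda>x1 x2. tens B H (x1 \<otimes>\<^bsub>B\<^esub> a) (hbar x2 \<otimes>\<^bsub>H\<^esub> z)) (\<Delta> x)) =
      tensor_lift E (\<lambda>x1 x2. \<Psi> (tens B H (x1 \<otimes>\<^bsub>B\<^esub> a) (hbar x2 \<otimes>\<^bsub>H\<^esub> z))) (\<Delta> x)"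
    by (rule tensor_lift_linear[OF vec_space_B vec_space_B vec_space_BH vec_space_E b linear_\<Psi> C.comult_closed[OF x]])
  also have "\<dots> = tensor_lift E (\<lambda>x1 x2. m a \<otimes>\<^bsub>E\<^esub> (m x1 \<otimes>\<^bsub>E\<^esub> \<omega> x2) \<otimes>\<^bsub>E\<^esub> \<gamma> z) (\<Delta> x)"
  proof (rule lift_cong_E[OF bilinear_map_compose[OF vec_space_B vec_space_B linear_\<Psi> b] _ C.comult_closed[OF x]])
    fix x1 x2 assume "x1 \<in> carrier B" "x2 \<in> carrier B"
    then show "\<Psi> (tens B H (x1 \<otimes>\<^bsub>B\<^esub> a) (hbar x2 \<otimes>\<^bsub>H\<^esub> z)) = m a \<otimes>\<^bsub>E\<^esub> (m x1 \<otimes>\<^bsub>E\<^esub> \<omega> x2) \<otimes>\<^bsub>E\<^esub> \<gamma> z"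
      using az by (simp add: \<Psi>_tens gamma_mult gamma_hbar B.m_comm[of x1 a] m_mult E.m_assoc)
  qed
  also have "\<dots> = m a \<otimes>\<^bsub>E\<^esub> convolution \<Delta> E m \<omega> x \<otimes>\<^bsub>E\<^esub> \<gamma> z"
    unfolding convolution_def
    by (rule lift_linear_EE[OF bilinear_m_mult[OF linear_\<omega>] lz C.comult_closed[OF x], symmetric])
  also have "\<dots> = m a \<otimes>\<^bsub>E\<^esub> h x \<otimes>\<^bsub>E\<^esub> \<gamma> z" by (simp add: conv_m_\<omega> x)
  finally show "\<Psi> (hmul x (tens B H a z)) = h x \<otimes>\<^bsub>E\<^esub> \<Psi> (tens B H a z)"
    using az x cl
    by (simp add: hmul_tens linear_mapD(2)[OF linear_\<Psi>] \<Psi>_tens h_m[of x a] E.l_distr flip: E.m_assoc)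
qed

text \<open>Both maps intertwine left multiplication by generators with \<open>lmul\<close> and
  \<open>hmul\<close>, so the composite commutes with all left multiplications; it fixes the unit,
  hence everything.\<close>

lemma \<Psi>_\<Phi>:
  assumes "e \<in> carrier E"
  shows "\<Psi> (\<Phi> e) = e"
  using assms
proof (induction rule: env_induct)
  case one
  then show ?case by (simp add: \<Phi>_one \<Psi>_tens m_one gamma_one)
next
  case (m b e)
  then show ?case by (simp add: \<Phi>_m \<Psi>_lmul)
next
  case (h b e)
  then show ?case by (simp add: \<Phi>_h \<Psi>_hmul)
next
  case (add d e)
  then show ?case by (simp add: linear_mapD(2)[OF linear_\<Phi>] linear_mapD(2)[OF linear_\<Psi>])
qed

text \<open>Shaped as the inductive step of \<open>\<Phi>_gamma\<close>, with e = \<gamma> z. For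
  \<omega>(x) = S(x1) h(x2), the factor \<open>h\<close> sends 1 \<otimes> z to the sum of its first
  component tensored with hbar of the second times z, since brackets with 1 vanish. After
  coassociativity the antipode meets the neighbouring component, and S(x1) x2 collapses to a
  counit.\<close>

lemma \<Phi>_\<omega>:
  assumes x: "x \<in> carrier B" and e: "e \<in> carrier E" and z: "z \<in> carrier H" and \<Phi>e: "\<Phi> e = tens B H \<one>\<^bsub>B\<^esub> z"
  shows "\<Phi> (\<omega> x \<otimes>\<^bsub>E\<^esub> e) = tens B H \<one>\<^bsub>B\<^esub> (hbar x \<otimes>\<^bsub>H\<^esub> z)"
proof -
  note V = vec_space_B
  let ?G = "\<lambda>a b c. tens B H (S a \<otimes>\<^bsub>B\<^esub> b) (hbar c \<otimes>\<^bsub>H\<^esub> z)"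
  have b1: "bilinear_map B B E (\<lambda>a b. m (S a) \<otimes>\<^bsub>E\<^esub> h b)" by (intro BHlin BHcl)
  have L: "linear_map E BH (\<lambda>u. \<Phi> (u \<otimes>\<^bsub>E\<^esub> e))"
    by (rule linear_map_compose[OF linear_\<Phi> linear_map_mult_right[OF k_algebra_E linear_map_id e]])
  have G: "linear_map B BH (\<lambda>a. ?G a b c)" "linear_map B BH (\<lambda>b. ?G a b c)" "linear_map B BH (\<lambda>c. ?G a b c)"
    if "a \<in> carrier B" "b \<in> carrier B" "c \<in> carrier B" for a b c
    using that z by - (intro BHlin BHcl; assumption?)+
  have inner: "\<Phi> (m (S a) \<otimes>\<^bsub>E\<^esub> h b \<otimes>\<^bsub>E\<^esub> e) = tensor_lift BH (\<lambda>b1 b2. ?G a b1 b2) (\<Delta> b)"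
    if ab: "a \<in> carrier B" "b \<in> carrier B" for a b
  proof -
    note bi = bilinear_hmul_inner[OF B.one_closed z]
    have "tens B H (br b \<one>\<^bsub>B\<^esub>) z = \<zero>\<^bsub>BH\<^esub>"
      using ab z by (simp add: br_one linear_map_zero[OF V vec_space_BH bilinear_map_left[OF bilinear_map_tens[OF V vec_space_H]]])
    then have "\<Phi> (h b \<otimes>\<^bsub>E\<^esub> e) = tensor_lift BH (\<lambda>x1 x2. tens B H (x1 \<otimes>\<^bsub>B\<^esub> \<one>\<^bsub>B\<^esub>) (hbar x2 \<otimes>\<^bsub>H\<^esub> z)) (\<Delta> b)"
      using ab e z tensor_lift_closed[OF V V vec_space_BH bi C.comult_closed[OF ab(2)]]
      by (simp add: \<Phi>_h \<Phi>e hmul_tens)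
    then have "\<Phi> (m (S a) \<otimes>\<^bsub>E\<^esub> h b \<otimes>\<^bsub>E\<^esub> e) =
        lmul (S a) (tensor_lift BH (\<lambda>x1 x2. tens B H (x1 \<otimes>\<^bsub>B\<^esub> \<one>\<^bsub>B\<^esub>) (hbar x2 \<otimes>\<^bsub>H\<^esub> z)) (\<Delta> b))"
      using ab e by (simp add: E.m_assoc \<Phi>_m)
    also have "\<dots> = tensor_lift BH (\<lambda>x1 x2. lmul (S a) (tens B H (x1 \<otimes>\<^bsub>B\<^esub> \<one>\<^bsub>B\<^esub>) (hbar x2 \<otimes>\<^bsub>H\<^esub> z))) (\<Delta> b)"
      by (rule tensor_lift_linear[OF V V vec_space_BH vec_space_BH bi linear_lmul[OF S_closed[OF ab(1)]] C.comult_closed[OF ab(2)]])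
    also have "\<dots> = tensor_lift BH (\<lambda>b1 b2. ?G a b1 b2) (\<Delta> b)"
      by (rule tensor_lift_cong[OF V V vec_space_BH bilinear_map_compose[OF V V linear_lmul[OF S_closed[OF ab(1)]] bi]])
        (use ab z in \<open>auto simp: lmul_tens\<close>)
    finally show ?thesis .
  qed
  have "\<Phi> (\<omega> x \<otimes>\<^bsub>E\<^esub> e) = tensor_lift BH (\<lambda>a b. \<Phi> (m (S a) \<otimes>\<^bsub>E\<^esub> h b \<otimes>\<^bsub>E\<^esub> e)) (\<Delta> x)"
    unfolding \<omega>_def convolution_def
    by (rule tensor_lift_linear[OF V V vec_space_E vec_space_BH b1 L C.comult_closed[OF x]])
  also have "\<dots> = tensor_lift BH (\<lambda>a b. tensor_lift BH (\<lambda>b1 b2. ?G a b1 b2) (\<Delta> b)) (\<Delta> x)"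
    by (rule tensor_lift_cong[OF V V vec_space_BH bilinear_map_compose[OF V V L b1] _ C.comult_closed[OF x]]) (rule inner)
  also have "\<dots> = tensor_lift BH (\<lambda>b c. tensor_lift BH (\<lambda>b1 b2. ?G b1 b2 c) (\<Delta> b)) (\<Delta> x)"
    by (rule C.coassoc_lift[OF vec_space_BH _ _ _ x, symmetric]) (rule G; assumption?; rule x)+
  also have "\<dots> = tensor_lift BH (\<lambda>b c. \<epsilon> b \<odot>\<^bsub>BH\<^esub> tens B H \<one>\<^bsub>B\<^esub> (hbar c \<otimes>\<^bsub>H\<^esub> z)) (\<Delta> x)"
  proof (rule tensor_lift_cong[OF V V vec_space_BH _ _ C.comult_closed[OF x], symmetric])
    show "bilinear_map B B BH (\<lambda>b c. \<epsilon> b \<odot>\<^bsub>BH\<^esub> tens B H \<one>\<^bsub>B\<^esub> (hbar c \<otimes>\<^bsub>H\<^esub> z))"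
      using z by (intro BHlin BHcl C.linear_counit)
    fix b c assume bc: "b \<in> carrier B" "c \<in> carrier B"
    have bi: "bilinear_map B B B (\<lambda>b1 b2. S b1 \<otimes>\<^bsub>B\<^esub> b2)" by (intro BHlin BHcl)
    have lt: "linear_map B BH (\<lambda>a. tens B H a (hbar c \<otimes>\<^bsub>H\<^esub> z))" using bc z by (intro BHlin BHcl)
    have "tensor_lift BH (\<lambda>b1 b2. ?G b1 b2 c) (\<Delta> b) = tens B H (\<epsilon> b \<odot>\<^bsub>B\<^esub> \<one>\<^bsub>B\<^esub>) (hbar c \<otimes>\<^bsub>H\<^esub> z)"
      unfolding S(3)[OF bc(1), symmetric]
      by (rule tensor_lift_linear[OF V V V vec_space_BH bi lt C.comult_closed[OF bc(1)], symmetric])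
    then show "\<epsilon> b \<odot>\<^bsub>BH\<^esub> tens B H \<one>\<^bsub>B\<^esub> (hbar c \<otimes>\<^bsub>H\<^esub> z) = tensor_lift BH (\<lambda>b1 b2. ?G b1 b2 c) (\<Delta> b)"
      using bc z by (simp add: tensBH_smult_left)
  qed
  also have "\<dots> = tens B H \<one>\<^bsub>B\<^esub> (hbar x \<otimes>\<^bsub>H\<^esub> z)"
    by (rule C.counit_left_lift[OF vec_space_BH _ x]) (use z in \<open>intro BHlin BHcl\<close>)
  finally show ?thesis .
qed

lemma \<Phi>_gamma:
  assumes "z \<in> carrier H"
  shows "\<Phi> (\<gamma> z) = tens B H \<one>\<^bsub>B\<^esub> z"
  using assms
proof (induction rule: quot_induct)
  note t = linear_mapD[OF bilinear_map_right[OF bilinear_map_tens[OF vec_space_B vec_space_H] B.one_closed]]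
  note g = linear_mapD[OF linear_gamma]
  note p = linear_mapD[OF linear_\<Phi>]
  {
    case one
    then show ?case by (simp add: gamma_one \<Phi>_one)
  next
    case (smult c z)
    then show ?case by (simp add: g p t)
  next
    case (hbar x z)
    then show ?case by (simp add: gamma_mult gamma_hbar \<Phi>_\<omega>)
  next
    case (add y z)
    then show ?case by (simp add: g p t)
  }
qed

text \<open>On b \<otimes> z: left multiplication by m(b) corresponds to \<open>lmul\<close>, and
  \<gamma>(z) goes to 1 \<otimes> z.\<close>

lemma \<Phi>_\<Psi>:
  assumes t: "t \<in> carrier BH"
  shows "\<Phi> (\<Psi> t) = t"
  by (rule tensor_hom_eq[OF vec_space_B vec_space_H linear_map_compose[OF linear_\<Phi> linear_\<Psi>] linear_map_id _ t])
    (simp add: \<Psi>_tens \<Phi>_m \<Phi>_gamma lmul_tens)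

section \<open>The multiplication of the crossed product\<close>

abbreviation CP where "CP \<equiv> crossed_product B H \<Delta>H dot_lift cocycle"

lemma CP_simps:
  "carrier CP = carrier BH" "s \<oplus>\<^bsub>CP\<^esub> t = s \<oplus>\<^bsub>BH\<^esub> t" "c \<odot>\<^bsub>CP\<^esub> t = c \<odot>\<^bsub>BH\<^esub> t"
  "\<zero>\<^bsub>CP\<^esub> = \<zero>\<^bsub>BH\<^esub>" "\<one>\<^bsub>CP\<^esub> = tens B H \<one>\<^bsub>B\<^esub> \<one>\<^bsub>H\<^esub>"
  by (simp_all add: crossed_product_def Let_def)

text \<open>The smash product (a # z)(b # y), to which the crossed product reduces once the trivial
  cocycle is summed away.\<close>

definition smash where
  "smash a z b y = tensor_lift BH (\<lambda>z1 z2. tens B H (a \<otimes>\<^bsub>B\<^esub> dot z1 b) (z2 \<otimes>\<^bsub>H\<^esub> y)) (\<Delta>H z)"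

lemma bilinear_smash_inner:
  assumes "a \<in> carrier B" "b \<in> carrier B" "y \<in> carrier H"
  shows "bilinear_map H H BH (\<lambda>z1 z2. tens B H (a \<otimes>\<^bsub>B\<^esub> dot z1 b) (z2 \<otimes>\<^bsub>H\<^esub> y))"
  using assms by (intro BHlin BHcl)

lemma bilinear_smash:
  "a \<in> carrier B \<Longrightarrow> z \<in> carrier H \<Longrightarrow> bilinear_map B H BH (smash a z)"
  "b \<in> carrier B \<Longrightarrow> y \<in> carrier H \<Longrightarrow> bilinear_map B H BH (\<lambda>a z. smash a z b y)"
proof -
  note V = vec_space_H
  show "bilinear_map B H BH (smash a z)" if az: "a \<in> carrier B" "z \<in> carrier H"
    unfolding smash_def[abs_def]
  proof (rule bilinear_map_tensor_lift_fun[OF V V vec_space_BH vec_space_B V quot_comult_closed[OF az(2)]])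
    show "bilinear_map H H BH (\<lambda>z1 z2. tens B H (a \<otimes>\<^bsub>B\<^esub> dot z1 b) (z2 \<otimes>\<^bsub>H\<^esub> y))"
      if "b \<in> carrier B" "y \<in> carrier H" for b y
      by (rule bilinear_smash_inner[OF az(1) that])
    show "bilinear_map B H BH (\<lambda>b y. tens B H (a \<otimes>\<^bsub>B\<^esub> dot z1 b) (z2 \<otimes>\<^bsub>H\<^esub> y))"
      if "z1 \<in> carrier H" "z2 \<in> carrier H" for z1 z2
      using that az by (intro BHlin BHcl)
  qed
  show "bilinear_map B H BH (\<lambda>a z. smash a z b y)" if "b \<in> carrier B" "y \<in> carrier H"
    unfolding smash_def
  proof (rule bilinear_mapI)
    fix a assume a: "a \<in> carrier B"
    show "linear_map H BH (\<lambda>z. tensor_lift BH (\<lambda>z1 z2. tens B H (a \<otimes>\<^bsub>B\<^esub> dot z1 b) (z2 \<otimes>\<^bsub>H\<^esub> y)) (\<Delta>H z))"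
      by (rule linear_map_compose[OF linear_map_tensor_lift[OF V V vec_space_BH bilinear_smash_inner[OF a that]] linear_quot_comult])
  next
    fix z assume z: "z \<in> carrier H"
    show "linear_map B BH (\<lambda>a. tensor_lift BH (\<lambda>z1 z2. tens B H (a \<otimes>\<^bsub>B\<^esub> dot z1 b) (z2 \<otimes>\<^bsub>H\<^esub> y)) (\<Delta>H z))"
      by (rule linear_map_tensor_lift_fun[OF V V vec_space_BH quot_comult_closed[OF z] bilinear_smash_inner[OF _ that] _ vec_space_B])
        (assumption | intro BHlin BHcl that)+
  qed
qed

text \<open>The cocycle contributes the counits of z2 and y1. The counit law for y removes y1, then
  that for z' removes z2, and the fivefold sum becomes a sum over the two components of z.\<close>

lemma smash_mult:
  assumes a: "a \<in> carrier B" and z: "z \<in> carrier H" and b: "b \<in> carrier B" and y: "y \<in> carrier H"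
  shows "tensor_lift BH (\<lambda>z1 z'. tensor_lift BH (\<lambda>z2 z3. tensor_lift BH (\<lambda>y1 y2.
      tens B H (a \<otimes>\<^bsub>B\<^esub> dot_lift (tens H B z1 b) \<otimes>\<^bsub>B\<^esub> cocycle (tens H H z2 y1)) (z3 \<otimes>\<^bsub>H\<^esub> y2))
      (\<Delta>H y)) (\<Delta>H z')) (\<Delta>H z) = smash a z b y"
proof -
  note V = vec_space_H
  let ?G = "\<lambda>z1 z2 z3 y1 y2. tens B H (a \<otimes>\<^bsub>B\<^esub> dot_lift (tens H B z1 b) \<otimes>\<^bsub>B\<^esub> cocycle (tens H H z2 y1)) (z3 \<otimes>\<^bsub>H\<^esub> y2)"
  have 1: "tensor_lift BH (?G z1 z2 z3) (\<Delta>H y) = \<epsilon>H z2 \<odot>\<^bsub>BH\<^esub> tens B H (a \<otimes>\<^bsub>B\<^esub> dot z1 b) (z3 \<otimes>\<^bsub>H\<^esub> y)"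
    if zs: "z1 \<in> carrier H" "z2 \<in> carrier H" "z3 \<in> carrier H" for z1 z2 z3
  proof -
    have f: "linear_map H BH (\<lambda>y2. \<epsilon>H z2 \<odot>\<^bsub>BH\<^esub> tens B H (a \<otimes>\<^bsub>B\<^esub> dot z1 b) (z3 \<otimes>\<^bsub>H\<^esub> y2))"
      using zs a b by (intro BHlin BHcl)
    have "tensor_lift BH (?G z1 z2 z3) (\<Delta>H y) =
        tensor_lift BH (\<lambda>y1 y2. \<epsilon>H y1 \<odot>\<^bsub>BH\<^esub> (\<epsilon>H z2 \<odot>\<^bsub>BH\<^esub> tens B H (a \<otimes>\<^bsub>B\<^esub> dot z1 b) (z3 \<otimes>\<^bsub>H\<^esub> y2))) (\<Delta>H y)"
    proof (rule sym, rule tensor_lift_cong[OF V V vec_space_BH _ _ quot_comult_closed[OF y]])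
      show "bilinear_map H H BH (\<lambda>y1 y2. \<epsilon>H y1 \<odot>\<^bsub>BH\<^esub> (\<epsilon>H z2 \<odot>\<^bsub>BH\<^esub> tens B H (a \<otimes>\<^bsub>B\<^esub> dot z1 b) (z3 \<otimes>\<^bsub>H\<^esub> y2)))"
        using zs a b by (intro BHlin BHcl linear_quot_counit)
      fix y1 y2 assume ys: "y1 \<in> carrier H" "y2 \<in> carrier H"
      have "a \<otimes>\<^bsub>B\<^esub> dot_lift (tens H B z1 b) \<otimes>\<^bsub>B\<^esub> cocycle (tens H H z2 y1) = (\<epsilon>H y1 * \<epsilon>H z2) \<odot>\<^bsub>B\<^esub> (a \<otimes>\<^bsub>B\<^esub> dot z1 b)"
        using zs ys a b by (simp add: dot_lift_tens cocycle_tens k_algebraD(4)[OF k_algebra_B] mult.commute)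
      then show "\<epsilon>H y1 \<odot>\<^bsub>BH\<^esub> (\<epsilon>H z2 \<odot>\<^bsub>BH\<^esub> tens B H (a \<otimes>\<^bsub>B\<^esub> dot z1 b) (z3 \<otimes>\<^bsub>H\<^esub> y2)) = ?G z1 z2 z3 y1 y2"
        using zs ys a b BHV.smult_assoc1[of "\<epsilon>H y1" "\<epsilon>H z2" "tens B H (a \<otimes>\<^bsub>B\<^esub> dot z1 b) (z3 \<otimes>\<^bsub>H\<^esub> y2)"]
        by (simp add: tensBH_smult_left)
    qed
    then show ?thesis by (simp add: quot_counit_left_lift[OF vec_space_BH f y])
  qed
  have 2: "tensor_lift BH (\<lambda>z2 z3. tensor_lift BH (?G z1 z2 z3) (\<Delta>H y)) (\<Delta>H z') = tens B H (a \<otimes>\<^bsub>B\<^esub> dot z1 b) (z' \<otimes>\<^bsub>H\<^esub> y)"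
    if zs: "z1 \<in> carrier H" "z' \<in> carrier H" for z1 z'
  proof -
    have f: "linear_map H BH (\<lambda>z3. tens B H (a \<otimes>\<^bsub>B\<^esub> dot z1 b) (z3 \<otimes>\<^bsub>H\<^esub> y))"
      using zs a b y by (intro BHlin BHcl)
    have g: "bilinear_map H H BH (\<lambda>z2 z3. \<epsilon>H z2 \<odot>\<^bsub>BH\<^esub> tens B H (a \<otimes>\<^bsub>B\<^esub> dot z1 b) (z3 \<otimes>\<^bsub>H\<^esub> y))"
      using zs a b y by (intro BHlin BHcl linear_quot_counit)
    have "tensor_lift BH (\<lambda>z2 z3. tensor_lift BH (?G z1 z2 z3) (\<Delta>H y)) (\<Delta>H z') =
        tensor_lift BH (\<lambda>z2 z3. \<epsilon>H z2 \<odot>\<^bsub>BH\<^esub> tens B H (a \<otimes>\<^bsub>B\<^esub> dot z1 b) (z3 \<otimes>\<^bsub>H\<^esub> y)) (\<Delta>H z')"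
      by (rule sym, rule tensor_lift_cong[OF V V vec_space_BH g _ quot_comult_closed[OF zs(2)]]) (simp only: 1 zs(1))
    then show ?thesis by (simp add: quot_counit_left_lift[OF vec_space_BH f zs(2)])
  qed
  show ?thesis
    unfolding smash_def
    by (rule sym, rule tensor_lift_cong[OF V V vec_space_BH bilinear_smash_inner[OF a b y] _ quot_comult_closed[OF z]])
      (simp only: 2)
qed

lemma CP_mult:
  assumes s: "s \<in> carrier BH" and t: "t \<in> carrier BH"
  shows "s \<otimes>\<^bsub>CP\<^esub> t = tensor_lift BH (\<lambda>a z. tensor_lift BH (smash a z) t) s"
proof -
  note V = vec_space_B vec_space_H
  have b: "bilinear_map B H BH (\<lambda>a z. tensor_lift BH (smash a z) t)"
    by (rule bilinear_map_tensor_lift_fun[OF V vec_space_BH V t bilinear_smash])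
  show ?thesis
    unfolding crossed_product_def Let_def
    by (simp, rule sym, rule tensor_lift_cong[OF V vec_space_BH b _ s],
        rule tensor_lift_cong[OF V vec_space_BH bilinear_smash(1) _ t], assumption, assumption,
        rule smash_mult[symmetric])
qed

lemmas bilinear_CP_mult = bilinear_map_tensor_lift2[OF vec_space_B vec_space_H vec_space_B vec_space_H vec_space_BH bilinear_smash]

lemma CP_mult_closed: "s \<in> carrier BH \<Longrightarrow> t \<in> carrier BH \<Longrightarrow> s \<otimes>\<^bsub>CP\<^esub> t \<in> carrier BH"
  by (simp add: CP_mult bilinear_map_closed[OF bilinear_CP_mult])

text \<open>This is \<open>gamma_m\<close> multiplied by m(a) from the left and by \<gamma>(y) from
  the right.\<close>

lemma \<Psi>_smash:
  assumes a: "a \<in> carrier B" and z: "z \<in> carrier H" and b: "b \<in> carrier B" and y: "y \<in> carrier H"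
  shows "\<Psi> (smash a z b y) = (m a \<otimes>\<^bsub>E\<^esub> \<gamma> z) \<otimes>\<^bsub>E\<^esub> (m b \<otimes>\<^bsub>E\<^esub> \<gamma> y)"
proof -
  note V = vec_space_H
  note bi = bilinear_smash_inner[OF a b y]
  have bg: "bilinear_map H H E (\<lambda>z1 z2. m (dot z1 b) \<otimes>\<^bsub>E\<^esub> \<gamma> z2)" by (intro BHlin BHcl b)
  have L: "linear_map E E (\<lambda>e. m a \<otimes>\<^bsub>E\<^esub> e \<otimes>\<^bsub>E\<^esub> \<gamma> y)" using a y by (intro BHlin BHcl)
  have "\<Psi> (smash a z b y) = tensor_lift E (\<lambda>z1 z2. \<Psi> (tens B H (a \<otimes>\<^bsub>B\<^esub> dot z1 b) (z2 \<otimes>\<^bsub>H\<^esub> y))) (\<Delta>H z)"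
    unfolding smash_def by (rule tensor_lift_linear[OF V V vec_space_BH vec_space_E bi linear_\<Psi> quot_comult_closed[OF z]])
  also have "\<dots> = tensor_lift E (\<lambda>z1 z2. m a \<otimes>\<^bsub>E\<^esub> (m (dot z1 b) \<otimes>\<^bsub>E\<^esub> \<gamma> z2) \<otimes>\<^bsub>E\<^esub> \<gamma> y) (\<Delta>H z)"
    by (rule tensor_lift_cong[OF V V vec_space_E bilinear_map_compose[OF V V linear_\<Psi> bi] _ quot_comult_closed[OF z]])
      (use a b y in \<open>simp add: \<Psi>_tens m_mult gamma_mult E.m_assoc\<close>)
  also have "\<dots> = m a \<otimes>\<^bsub>E\<^esub> (\<gamma> z \<otimes>\<^bsub>E\<^esub> m b) \<otimes>\<^bsub>E\<^esub> \<gamma> y"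
    unfolding gamma_m[OF z b]
    by (rule tensor_lift_linear[OF V V vec_space_E vec_space_E bg L quot_comult_closed[OF z], symmetric])
  finally show ?thesis using a b y z by (simp add: E.m_assoc)
qed

lemma \<Psi>_mult:
  assumes s: "s \<in> carrier BH" and t: "t \<in> carrier BH"
  shows "\<Psi> (s \<otimes>\<^bsub>CP\<^esub> t) = \<Psi> s \<otimes>\<^bsub>E\<^esub> \<Psi> t"
  unfolding CP_mult[OF s t]
proof (rule tensor_hom_eq2[OF vec_space_B vec_space_H vec_space_B vec_space_H _ _ _ s t])
  show "bilinear_map BH BH E (\<lambda>s t. \<Psi> (tensor_lift BH (\<lambda>a z. tensor_lift BH (smash a z) t) s))"
    by (rule bilinear_map_compose[OF vec_space_BH vec_space_BH linear_\<Psi> bilinear_CP_mult])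
  show "bilinear_map BH BH E (\<lambda>s t. \<Psi> s \<otimes>\<^bsub>E\<^esub> \<Psi> t)"
    by (rule bilinear_map_mult[OF k_algebra_E linear_\<Psi> linear_\<Psi>])
  fix a z b y assume "a \<in> carrier B" "z \<in> carrier H" "b \<in> carrier B" "y \<in> carrier H"
  then show "\<Psi> (tensor_lift BH (\<lambda>a z. tensor_lift BH (smash a z) (tens B H b y)) (tens B H a z)) =
      \<Psi> (tens B H a z) \<otimes>\<^bsub>E\<^esub> \<Psi> (tens B H b y)"
    by (simp add: tensor_lift2_tens[OF vec_space_B vec_space_H vec_space_B vec_space_H vec_space_BH bilinear_smash] \<Psi>_smash \<Psi>_tens)
qed

lemma vec_space_CP: "vec_space CP"
  unfolding crossed_product_def Let_def by (rule vec_space_update[OF vec_space_BH])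

lemma linear_\<Psi>_CP: "linear_map CP E \<Psi>"
  using linear_\<Psi> by (simp add: linear_map_def CP_simps)

lemma k_algebra_CP: "k_algebra CP"
proof (rule k_algebra_transport[OF k_algebra_E vec_space_CP linear_\<Psi>_CP])
  show "inj_on \<Psi> (carrier CP)"
    by (rule inj_on_inverseI[of _ \<Phi>]) (simp add: CP_simps \<Phi>_\<Psi>)
qed (simp_all add: CP_simps CP_mult_closed \<Psi>_mult \<Psi>_tens m_one gamma_one)

lemma algebra_isomorphic_CP: "algebra_isomorphic E CP"
proof -
  have lin: "linear_map E CP \<Phi>" using linear_\<Phi> by (simp add: linear_map_def CP_simps)
  have "\<Phi> \<in> ring_hom E CP"
  proof (rule ring_hom_memI)
    fix d e assume de: "d \<in> carrier E" "e \<in> carrier E"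
    \<comment> \<open>Multiplicativity is inherited from the inverse: the argument of the outer
      \<open>\<Phi>\<close> equals the product of d and e by \<open>\<Psi>_mult\<close> and
      \<open>\<Psi>_\<Phi>\<close>.\<close>
    have "\<Phi> (\<Psi> (\<Phi> d \<otimes>\<^bsub>CP\<^esub> \<Phi> e)) = \<Phi> d \<otimes>\<^bsub>CP\<^esub> \<Phi> e"
      using de by (intro \<Phi>_\<Psi> CP_mult_closed) auto
    then show "\<Phi> (d \<otimes>\<^bsub>E\<^esub> e) = \<Phi> d \<otimes>\<^bsub>CP\<^esub> \<Phi> e"
      using de by (simp add: \<Psi>_mult \<Psi>_\<Phi>)
  qed (use lin in \<open>auto simp: linear_mapD CP_simps(5) \<Phi>_one\<close>)
  moreover have "bij_betw \<Phi> (carrier E) (carrier CP)"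
    by (rule bij_betwI[of _ _ _ \<Psi>]) (auto simp: CP_simps \<Psi>_\<Phi> \<Phi>_\<Psi>)
  ultimately show ?thesis
    using lin by (auto simp: algebra_isomorphic_def ring_iso_def)
qed

end

theorem proposition6p24:
  fixes B :: "('k::field, 'b) module"
    and br :: "'b \<Rightarrow> 'b \<Rightarrow> 'b"
    and \<Delta> :: "'b \<Rightarrow> ('k, 'b, 'b) tensors"
    and \<epsilon> :: "'b \<Rightarrow> 'k"
  assumes "poisson_hopf_algebra B br \<Delta> \<epsilon>"
    and "pointed B \<Delta> \<epsilon>"
  shows "let H = env_quot B br \<epsilon>; \<Delta>\<^sub>H = env_quot_comult B br \<Delta> \<epsilon>; \<epsilon>\<^sub>H = env_quot_counit \<epsilon> in
    \<exists>(act :: ('k, ('k, 'b) env_quot, 'b) tensors \<Rightarrow> 'b)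
     (\<sigma> :: ('k, ('k, 'b) env_quot, ('k, 'b) env_quot) tensors \<Rightarrow> 'b).
      measuring H \<Delta>\<^sub>H \<epsilon>\<^sub>H B act \<and>
      convolution_invertible (tensor H H) (tensor_comult H \<Delta>\<^sub>H H \<Delta>\<^sub>H) (tensor_counit \<epsilon>\<^sub>H \<epsilon>\<^sub>H) B \<sigma> \<and>
      k_algebra (crossed_product B H \<Delta>\<^sub>H act \<sigma>) \<and>
      algebra_isomorphic (env B br) (crossed_product B H \<Delta>\<^sub>H act \<sigma>)"
proof -
  interpret poisson_hopf B br \<Delta> \<epsilon>
    using assms(1) by unfold_locales (simp_all add: poisson_hopf_algebra_def)
  show ?thesis
    unfolding Let_def
    using measuring_dot convolution_invertible_cocycle k_algebra_CP algebra_isomorphic_CP by blast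
qed

end
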